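(* Let $a\in\mathbb R$, $p\in(0,1)$, $q>0$, $\lambda\ge0$ and $x\in(-\infty,a]$. Let $U$ be the Lévy process with partial stochastic resetting described in the context. Then $$\mathbb E_x\Bigl(e^{-q\tau^+_{a,U}}\mathbf 1_{\{\tau^+_{a,U}<\infty\}}\Bigr)=e^{-\Phi_{q+\lambda}(a-x)}+\int_{-\infty}^{a\wedge ap^{-1}}\overline{\mathrm V}^{(p)}_\lambda[\overline r^{(q+\lambda)}](x,y)\,e^{-\Phi_{q+\lambda}(a-py)}\,\mathrm dy+\mathbf 1_{\{a\in\mathbb R_-\}}\int_{ap^{-1}}^{a}\overline{\mathrm V}^{(p)}_\lambda[\overline r^{(q+\lambda)}](x,y)\,\mathrm dy .$$
   Context: $X$ is a spectrally negative Lévy process (no positive jumps, non-monotone paths) with Laplace exponent $\psi(\vartheta)=\log\mathbb E[e^{\vartheta X_1}]$, $\vartheta\ge0$, and $\Phi_q=\sup\{\vartheta\ge0:\psi(\vartheta)=q\}$. The scale function $W^{(q)}:\mathbb R\to[0,\infty)$ vanishes on $(-\infty,0)$, is right-continuous on $[0,\infty)$ and satisfies $\int_0^\infty e^{-\vartheta x}W^{(q)}(x)\,\mathrm dx=1/(\psi(\vartheta)-q)$ for $\vartheta>\Phi_q$. $N$ is a Poisson process of intensity $\lambda$ independent of $X$, and $U$ is the unique strong solution of $\mathrm dU_t=\mathrm dX_t-(1-p)U_{t^-}\,\mathrm dN_t$; $\mathbb E_x$ denotes expectation when $U_0=X_0=x$. Further $\tau^+_{a,U}=\inf\{t>0:U_t>a\}$.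 For $x,y\in(-\infty,a]$ let $\overline r^{(q)}(x,y)=e^{-\Phi_q(a-x)}W^{(q)}(a-y)-W^{(q)}(x-y)$. Set $u_1=-\infty$ and $u_2=a\wedge ap^{-1}$ (minimum). For $x,y\in(-\infty,a]$, $\overline{\mathrm V}^{(p)}_\lambda[\overline r^{(q+\lambda)}](x,y)=\sum_{k=1}^\infty\lambda^k\,\mathrm V^{(p)}_k[\overline r^{(q+\lambda)}](x,y)$, where $\mathrm V^{(p)}_1[\overline r^{(q+\lambda)}]=\overline r^{(q+\lambda)}$ and $\mathrm V^{(p)}_n[\overline r^{(q+\lambda)}](x,y)=\int_{u_1}^{u_2}\overline r^{(q+\lambda)}(x,z)\,\mathrm V^{(p)}_{n-1}[\overline r^{(q+\lambda)}](pz,y)\,\mathrm dz$ for $n\ge2$. $\mathbb R_-$ denotes the negative half-line (whether $0$ is included does not affect the formula). *)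

theory Defs
  imports "HOL-Probability.Probability"
begin

section \<open>Paths\<close>

text \<open>All processes are indexed by \<^typ>\<open>real\<close>; only times \<open>t \<ge> 0\<close> are meaningful.\<close>

definition left_lim :: "(real \<Rightarrow> real) \<Rightarrow> real \<Rightarrow> real" where
  "left_lim f t = Lim (at_left t) f"

definition cadlag :: "(real \<Rightarrow> real) \<Rightarrow> bool" where
  "cadlag f \<longleftrightarrow>
     (\<forall>t\<ge>0. continuous (at_right t) f) \<and> (\<forall>t>0. \<exists>l. (f \<longlongrightarrow> l) (at_left t))"

text \<open>The infimum is taken in \<^typ>\<open>ereal\<close>, so it is \<open>\<infinity>\<close> if the level is never exceeded.\<close>

definition first_passage :: "real \<Rightarrow> (real \<Rightarrow> real) \<Rightarrow> ereal" where
  "first_passage a f = Inf (ereal ` {t. t > 0 \<and> f t > a})"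

section \<open>Levy processes and Poisson processes\<close>

text \<open>Levy processes are started at 0; the process started at \<open>x\<close> is \<open>x + X\<close>.\<close>

locale levy_process = prob_space M for M :: "'a measure" +
  fixes X :: "real \<Rightarrow> 'a \<Rightarrow> real"
  assumes measurable_process: "\<And>t. t \<ge> 0 \<Longrightarrow> random_variable borel (X t)"
    and start: "AE \<omega> in M. X 0 \<omega> = 0"
    and cadlag_paths: "AE \<omega> in M. cadlag (\<lambda>t. X t \<omega>)"
    and stationary_increments:
      "\<And>s t. s \<ge> 0 \<Longrightarrow> t \<ge> 0 \<Longrightarrow>
        distr M borel (\<lambda>\<omega>. X (s + t) \<omega> - X s \<omega>) = distr M borel (X t)"
    and independent_increments:
      "\<And>(n :: nat) t. mono t \<Longrightarrow> t 0 \<ge> 0 \<Longrightarrow>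
        indep_vars (\<lambda>_. borel) (\<lambda>i \<omega>. X (t (Suc i)) \<omega> - X (t i) \<omega>) {..<n}"

locale spectrally_negative_levy_process = levy_process +
  assumes no_positive_jumps: "AE \<omega> in M. \<forall>t>0. X t \<omega> \<le> left_lim (\<lambda>s. X s \<omega>) t"
    and non_monotone:
      "AE \<omega> in M. \<not> mono_on {0..} (\<lambda>t. X t \<omega>) \<and> \<not> antimono_on {0..} (\<lambda>t. X t \<omega>)"

text \<open>Intensity 0 is allowed: since \<open>0 ^ 0 = 1\<close>, the process is then almost surely 0.\<close>

locale poisson_process = levy_process M N
  for M :: "'a measure" and lam :: real and N :: "real \<Rightarrow> 'a \<Rightarrow> real" +
  assumes intensity_nonneg: "lam \<ge> 0"
    and poisson_marginals:
      "\<And>t (k :: nat). t \<ge> 0 \<Longrightarrow>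
        prob {\<omega> \<in> space M. N t \<omega> = real k} = (lam * t) ^ k / fact k * exp (- (lam * t))"

definition independent_processes ::
    "'a measure \<Rightarrow> (real \<Rightarrow> 'a \<Rightarrow> real) \<Rightarrow> (real \<Rightarrow> 'a \<Rightarrow> real) \<Rightarrow> bool" where
  "independent_processes M X Y \<longleftrightarrow>
     prob_space.indep_var M
       (Pi\<^sub>M {0..} (\<lambda>_. borel)) (\<lambda>\<omega>. \<lambda>t\<in>{0..}. X t \<omega>)
       (Pi\<^sub>M {0..} (\<lambda>_. borel)) (\<lambda>\<omega>. \<lambda>t\<in>{0..}. Y t \<omega>)"

section \<open>Partial stochastic resetting\<close>

text \<open>
  The completed natural filtration of the pair \<open>(X, N)\<close>. Processes adapted to it are
  measurable only with respect to \<open>completion M\<close>, which is therefore the measure to use for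
  expectations of their functionals.
\<close>

definition completed_filtration ::
    "'a measure \<Rightarrow> (real \<Rightarrow> 'a \<Rightarrow> real) \<Rightarrow> (real \<Rightarrow> 'a \<Rightarrow> real) \<Rightarrow> real \<Rightarrow> 'a measure" where
  "completed_filtration M X N t = sigma (space M)
     ({X s -` A \<inter> space M |s A. 0 \<le> s \<and> s \<le> t \<and> A \<in> sets borel} \<union>
      {N s -` A \<inter> space M |s A. 0 \<le> s \<and> s \<le> t \<and> A \<in> sets borel} \<union>
      null_sets (completion M))"

text \<open>
  The pathwise Lebesgue--Stieltjes integral of \<open>u\<^bsub>s-\<^esub>\<close> against \<open>dn\<^sub>s\<close> over \<open>(0, t]\<close>.
  The path \<open>n\<close> is extended to negative times by its value at 0, so that
  \<^const>\<open>interval_measure\<close> applies.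
\<close>

definition predictable_integral :: "(real \<Rightarrow> real) \<Rightarrow> (real \<Rightarrow> real) \<Rightarrow> real \<Rightarrow> real" where
  "predictable_integral u n t =
     (LINT s:{0<..t}|interval_measure (\<lambda>s. n (max 0 s)). left_lim u s)"

text \<open>
  Strong solutions of \<open>dU\<^sub>t = dX\<^sub>t - (1 - p) U\<^bsub>t-\<^esub> dN\<^sub>t\<close> with \<open>U\<^sub>0 = x\<close>. As \<open>X\<close> starts
  at 0, this is the process \<open>U\<close> under the law for which the Levy process starts at \<open>x\<close>.
\<close>

definition resetting_solution ::
    "'a measure \<Rightarrow> (real \<Rightarrow> 'a \<Rightarrow> real) \<Rightarrow> (real \<Rightarrow> 'a \<Rightarrow> real) \<Rightarrow> real \<Rightarrow> real \<Rightarrow>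
      (real \<Rightarrow> 'a \<Rightarrow> real) \<Rightarrow> bool" where
  "resetting_solution M X N p x U \<longleftrightarrow>
     (\<forall>t\<ge>0. U t \<in> borel_measurable (completed_filtration M X N t)) \<and>
     (AE \<omega> in M. cadlag (\<lambda>t. U t \<omega>)) \<and>
     (AE \<omega> in M. \<forall>t\<ge>0.
        U t \<omega> = x + X t \<omega> -
          (1 - p) * predictable_integral (\<lambda>s. U s \<omega>) (\<lambda>s. N s \<omega>) t)"

section \<open>Laplace exponent and scale functions\<close>

definition laplace_exponent :: "'a measure \<Rightarrow> (real \<Rightarrow> 'a \<Rightarrow> real) \<Rightarrow> real \<Rightarrow> real" where
  "laplace_exponent M X \<theta> = ln (LINT \<omega>|M. exp (\<theta> * X 1 \<omega>))"

definition right_inverse :: "(real \<Rightarrow> real) \<Rightarrow> real \<Rightarrow> real" where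
  "right_inverse \<psi> q = Sup {\<theta>. \<theta> \<ge> 0 \<and> \<psi> \<theta> = q}"

definition is_scale_function :: "(real \<Rightarrow> real) \<Rightarrow> real \<Rightarrow> (real \<Rightarrow> real) \<Rightarrow> bool" where
  "is_scale_function \<psi> q W \<longleftrightarrow>
     (\<forall>x. W x \<ge> 0) \<and> (\<forall>x<0. W x = 0) \<and> (\<forall>x\<ge>0. continuous (at_right x) W) \<and>
     (\<forall>\<theta>>right_inverse \<psi> q.
        set_integrable lborel {0..} (\<lambda>x. exp (- \<theta> * x) * W x) \<and>
        (LBINT x:{0..}. exp (- \<theta> * x) * W x) = 1 / (\<psi> \<theta> - q))"

section \<open>The resolvent series\<close>

text \<open>Here \<open>\<Phi>\<close> and \<open>W\<close> are the values of \<open>\<Phi>\<^sub>q\<close> and \<open>W\<^sup>q\<close> for one fixed index \<open>q\<close>.\<close>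

definition r_bar :: "real \<Rightarrow> (real \<Rightarrow> real) \<Rightarrow> real \<Rightarrow> real \<Rightarrow> real \<Rightarrow> real" where
  "r_bar \<Phi> W a x y = exp (- \<Phi> * (a - x)) * W (a - y) - W (x - y)"

text \<open>The operators are indexed from 1; the value at index 0 is never used.\<close>

fun V_iter ::
    "real \<Rightarrow> real \<Rightarrow> nat \<Rightarrow> (real \<Rightarrow> real \<Rightarrow> real) \<Rightarrow> real \<Rightarrow> real \<Rightarrow> real" where
  "V_iter p a 0 r x y = 0"
| "V_iter p a (Suc 0) r x y = r x y"
| "V_iter p a (Suc (Suc n)) r x y =
     (LBINT z:{..min a (a / p)}. r x z * V_iter p a (Suc n) r (p * z) y)"

definition V_bar ::
    "real \<Rightarrow> real \<Rightarrow> real \<Rightarrow> (real \<Rightarrow> real \<Rightarrow> real) \<Rightarrow> real \<Rightarrow> real \<Rightarrow> real" where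
  "V_bar p a lam r x y = (\<Sum>k. lam ^ Suc k * V_iter p a (Suc k) r x y)"

end

theory Submission
  imports Defs
begin

text \<open>
  Kill at first passage above \<open>a\<close> and let \<open>L\<close> be the discounted occupation measure of \<open>U\<close>. Dynkin's
  formula for exponentials, obtained by discretising time, gives
  \<open>c e\<^sup>\<theta>\<^sup>a = e\<^sup>\<theta>\<^sup>x + (\<psi>(\<theta>) - q - \<lambda>) \<integral> e\<^sup>\<theta>\<^sup>y L(dy) + \<lambda> \<integral> 1{py \<le> a} e\<^sup>\<theta>\<^sup>p\<^sup>y L(dy)\<close> for all \<open>\<theta> > 0\<close>,
  where \<open>c\<close> is the discounted probability of passing \<open>a\<close> by creeping; the remaining passages are by
  a reset and contribute \<open>\<lambda> L{y. py > a}\<close>. Taking \<open>\<theta> = \<Phi>\<close> determines \<open>c\<close>. The same identity without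
  resetting, with discount \<open>q + \<lambda>\<close>, shows by uniqueness of Laplace transforms that the process killed
  above \<open>a\<close> has occupation density \<open>r(z, y)\<close>. A second use of uniqueness gives
  \<open>L(dy) = r(x, y) dy + \<lambda> \<integral> 1{pz \<le> a} L(dz) r(pz, y) dy\<close>, and iterating this equation,
  which is a contraction since \<open>r(z, \<cdot>)\<close> has mass at most \<open>1 / (q + \<lambda>)\<close>, identifies \<open>\<lambda> L\<close> with the
  measure of density \<open>V_bar\<close>.
\<close>

section \<open>Cadlag paths\<close>

text \<open>Time discretisation stands in for stochastic calculus and the strong Markov property:
  the argument rests on the independence of the past from the increments over one grid step, so each
  one-step error has to be \<open>o(h)\<close> in the mesh \<open>h\<close>, uniformly over the
  past. The delicate term is the mean of \<open>exp (\<theta> * X h)\<close> over the event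
  \<open>X h > \<delta>\<close>; it is \<open>o(h)\<close> because there are no positive jumps.
  Finite exponential moments are not part of the definition of the process and have to be extracted
  from the paths, since \<open>laplace_exponent\<close> is the logarithm of a Bochner integral,
  which is 0 when it diverges. The scale function is given through its Laplace transform only, so
  even the sign of \<open>r_bar\<close> is read off from an occupation measure. The equation for
  \<open>L\<close> comes from comparing transforms instead of conditioning at a reset time; its
  contraction constant is \<open>lam / (q + lam)\<close>, below 1 because \<open>q > 0\<close>. The
  last term of the formula reflects that a reset moves the process towards 0, hence upwards only
  from negative positions, and so can pass \<open>a\<close> from below only if
  \<open>a < 0\<close>.\<close>

lemma tendsto_left_lim:
  assumes "cadlag f" "t > 0"
  shows "(f \<longlongrightarrow> left_lim f t) (at_left t)"
proof -
  obtain l where l: "(f \<longlongrightarrow> l) (at_left t)"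
    using assms by (auto simp: cadlag_def)
  then have "Lim (at_left t) f = l"
    by (intro tendsto_Lim) auto
  with l show ?thesis by (simp add: left_lim_def)
qed

lemma cadlag_tendsto_right:
  assumes "cadlag f" "t \<ge> 0"
  shows "(f \<longlongrightarrow> f t) (at_right t)"
  using assms by (auto simp: cadlag_def continuous_within)

lemma cadlag_seq_right:
  assumes "cadlag f" "t \<ge> 0" "s \<longlonglongrightarrow> t" "\<And>n. s n \<ge> t"
  shows "(\<lambda>n. f (s n)) \<longlonglongrightarrow> f t"
proof -
  have "continuous (at t within {t..}) f"
    using assms by (simp add: cadlag_def at_within_Ici_at_right)
  then show ?thesis
    using assms(3,4) by (auto simp: continuous_within_sequentially o_def)
qed

lemma cadlag_local_osc:
  assumes "cadlag f" "t > 0" "e > 0"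
  shows "\<exists>d>0. \<forall>s. t - d < s \<and> s < t \<longrightarrow> \<bar>f s - left_lim f t\<bar> < e"
proof -
  have "\<forall>\<^sub>F s in at_left t. dist (f s) (left_lim f t) < e"
    using tendsto_left_lim[OF assms(1,2)] assms(3) by (auto simp: tendsto_iff)
  then obtain b where "b < t" "\<forall>y>b. y < t \<longrightarrow> dist (f y) (left_lim f t) < e"
    by (auto simp: eventually_at_left_field)
  then show ?thesis
    by (intro exI[of _ "t - b"]) (auto simp: dist_real_def)
qed

lemma cadlag_local_right:
  assumes "cadlag f" "t \<ge> 0" "e > 0"
  shows "\<exists>d>0. \<forall>s. t \<le> s \<and> s < t + d \<longrightarrow> \<bar>f s - f t\<bar> < e"
proof -
  have "\<forall>\<^sub>F s in at_right t. dist (f s) (f t) < e"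
    using cadlag_tendsto_right[OF assms(1,2)] assms(3) by (auto simp: tendsto_iff)
  then obtain b where b: "b > t" "\<forall>y>t. y < b \<longrightarrow> dist (f y) (f t) < e"
    by (auto simp: eventually_at_right_field)
  have "\<bar>f s - f t\<bar> < e" if "t \<le> s" "s < b" for s
    using b(2) that assms(3) by (cases "s = t") (auto simp: dist_real_def)
  then show ?thesis
    using b(1) by (intro exI[of _ "b - t"]) auto
qed

lemma cadlag_local:
  assumes "cadlag f" "t \<ge> 0" "e > 0"
  shows "\<exists>d>0. (\<forall>s. 0 \<le> s \<and> t - d < s \<and> s < t \<longrightarrow> \<bar>f s - left_lim f t\<bar> < e) \<and>
                (\<forall>s. t \<le> s \<and> s < t + d \<longrightarrow> \<bar>f s - f t\<bar> < e)"
proof -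
  obtain d1 where d1: "d1 > 0" "\<And>s. t \<le> s \<Longrightarrow> s < t + d1 \<Longrightarrow> \<bar>f s - f t\<bar> < e"
    using cadlag_local_right[OF assms] by auto
  obtain d2 where d2: "d2 > 0" "\<And>s. 0 \<le> s \<Longrightarrow> t - d2 < s \<Longrightarrow> s < t \<Longrightarrow> \<bar>f s - left_lim f t\<bar> < e"
  proof (cases "t = 0")
    case True
    then show ?thesis by (intro that[of 1]) auto
  next
    case False
    then show ?thesis using cadlag_local_osc[of f t e] assms that by auto
  qed
  show ?thesis
    using d1 d2 by (intro exI[of _ "min d1 d2"]) auto
qed

text \<open>One-sided limits make the path bounded near every time, and bounds on two adjacent
  intervals combine; a bisection argument does the rest.\<close>

lemma cadlag_bounded:
  assumes "cadlag f"
  shows "\<exists>B. \<forall>s\<in>{0..T}. \<bar>f s\<bar> \<le> B"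
proof (cases "0 \<le> T")
  case True
  then show ?thesis
  \<comment> \<open>The intervals \<open>{a..b}\<close> of the bisection principle may reach below
    0, where nothing is known about \<open>f\<close>; hence the restriction to
    \<open>s \<ge> 0\<close>.\<close>
  proof (rule Bolzano[where P = "\<lambda>a b. \<exists>B. \<forall>s\<ge>0. s \<in> {a..b} \<longrightarrow> \<bar>f s\<bar> \<le> B",
      where a = 0 and b = T, THEN ex_forward])
    fix a b c :: real
    assume "\<exists>B. \<forall>s\<ge>0. s \<in> {a..b} \<longrightarrow> \<bar>f s\<bar> \<le> B" "\<exists>B. \<forall>s\<ge>0. s \<in> {b..c} \<longrightarrow> \<bar>f s\<bar> \<le> B"
    then obtain B1 B2 where B: "\<forall>s\<ge>0. s \<in> {a..b} \<longrightarrow> \<bar>f s\<bar> \<le> B1" "\<forall>s\<ge>0. s \<in> {b..c} \<longrightarrow> \<bar>f s\<bar> \<le> B2"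
      by auto
    have "\<bar>f s\<bar> \<le> max B1 B2" if "s \<ge> 0" "s \<in> {a..c}" for s
      using B that by (cases "s \<le> b") fastforce+
    then show "\<exists>B. \<forall>s\<ge>0. s \<in> {a..c} \<longrightarrow> \<bar>f s\<bar> \<le> B" by blast
  next
    fix x assume x: "0 \<le> x" "x \<le> T"
    obtain d where d: "d > 0" "\<And>s. 0 \<le> s \<Longrightarrow> x - d < s \<Longrightarrow> s < x \<Longrightarrow> \<bar>f s - left_lim f x\<bar> < 1"
       "\<And>s. x \<le> s \<Longrightarrow> s < x + d \<Longrightarrow> \<bar>f s - f x\<bar> < 1"
      using cadlag_local[OF assms x(1), of 1] by auto
    have "\<bar>f s\<bar> \<le> \<bar>f x\<bar> + \<bar>left_lim f x\<bar> + 1" if "0 \<le> s" "s \<in> {a..b}" "a \<le> x" "x \<le> b" "b - a < d" for a b s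
      using d(2)[of s] d(3)[of s] that by (cases "s < x") auto
    then show "\<exists>d>0. \<forall>a b. a \<le> x \<and> x \<le> b \<and> b - a < d \<longrightarrow>
       (\<exists>B. \<forall>s\<ge>0. s \<in> {a..b} \<longrightarrow> \<bar>f s\<bar> \<le> B)"
      using d(1) by blast
  qed auto
qed auto

text \<open>Near any time \<open>t\<close> the path is almost constant on each side, and across
  \<open>t\<close> it can only jump down, so it rises by at most \<open>e\<close> there. Compactness
  of \<open>{0..T}\<close>, through a Lebesgue number, makes the neighbourhoods uniform. This is the
  pathwise form in which the absence of positive jumps is used.\<close>

lemma cadlag_no_positive_jumps_increment:
  assumes f: "cadlag f" "\<And>t. t > 0 \<Longrightarrow> f t \<le> left_lim f t" and "e > 0"
  shows "\<exists>d>0. \<forall>s s'. 0 \<le> s \<and> s \<le> s' \<and> s' \<le> T \<and> s' - s < d \<longrightarrow> f s' - f s \<le> e"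
proof -
  define good where "good B \<longleftrightarrow> (\<forall>s s'. 0 \<le> s \<and> s \<le> s' \<and> s \<in> B \<and> s' \<in> B \<longrightarrow> f s' - f s \<le> e)" for B
  have loc: "\<exists>d>0. good {t - d<..<t + d}" if "t \<in> {0..T}" for t
  proof -
    have "0 \<le> t" "0 < e / 2" using that \<open>e > 0\<close> by auto
    from cadlag_local[OF f(1) this]
    obtain d where d: "d > 0" "\<And>s. 0 \<le> s \<Longrightarrow> t - d < s \<Longrightarrow> s < t \<Longrightarrow> \<bar>f s - left_lim f t\<bar> < e / 2"
       "\<And>s. t \<le> s \<Longrightarrow> s < t + d \<Longrightarrow> \<bar>f s - f t\<bar> < e / 2"
      by blast
    have "f s' - f s \<le> e" if "0 \<le> s" "s \<le> s'" "t - d < s" "s' < t + d" for s s'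
    proof -
      consider "s' < t" | "s < t" "t \<le> s'" | "t \<le> s" using that by linarith
      then show ?thesis
      proof cases
        case 1
        then show ?thesis using d(2)[of s] d(2)[of s'] that by arith
      next
        \<comment> \<open>The pair straddles \<open>t\<close>: \<open>f s'\<close> is close to
          \<open>f t\<close>, which lies below \<open>left_lim f t\<close>, which is close to
          \<open>f s\<close>.\<close>
        case 2
        then show ?thesis using d(2)[of s] d(3)[of s'] that f(2)[of t] by arith
      next
        case 3
        then show ?thesis using d(3)[of s] d(3)[of s'] that by arith
      qed
    qed
    then have "good {t - d<..<t + d}" unfolding good_def by auto
    with d(1) show ?thesis by auto
  qed
  show ?thesis
  proof (cases "0 \<le> T")
    case True
    \<comment> \<open>A Lebesgue number of the cover by good open sets serves as the common modulus;
      it is applied to the two-point sets \<open>{s, s'}\<close>.\<close>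
    obtain d where d: "d > 0" "\<And>A. A \<subseteq> {0..T} \<Longrightarrow> diameter A < d \<Longrightarrow> \<exists>B\<in>{B. open B \<and> good B}. A \<subseteq> B"
    proof (rule Lebesgue_number_lemma[of "{0..T}" "{B. open B \<and> good B}"])
      show "{B. open B \<and> good B} \<noteq> {}"
        using loc[of 0] True by (auto intro!: exI[of _ "{}"] simp: good_def)
      show "{0..T} \<subseteq> \<Union> {B. open B \<and> good B}"
      proof
        fix t assume "t \<in> {0..T}"
        then obtain d where "d > 0" "good {t - d<..<t + d}" using loc by blast
        then show "t \<in> \<Union> {B. open B \<and> good B}"
          by (intro UnionI[of "{t - d<..<t + d}"]) auto
      qed
    qed auto
    have "f s' - f s \<le> e" if "0 \<le> s" "s \<le> s'" "s' \<le> T" "s' - s < d" for s s'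
    proof -
      have "diameter {s, s'} \<le> s' - s"
        using that by (intro diameter_le) (auto simp: dist_real_def)
      then have "diameter {s, s'} < d" using that by linarith
      moreover have "{s, s'} \<subseteq> {0..T}" using that by auto
      ultimately obtain B where "good B" "{s, s'} \<subseteq> B"
        using d(2) by blast
      then show ?thesis using that by (auto simp: good_def)
    qed
    with d(1) show ?thesis by blast
  qed (auto intro!: exI[of _ 1])
qed

text \<open>This grid point of mesh \<open>1 / Suc n\<close> is the first one strictly to the right
  of \<open>s\<close>. Approaching from the right is essential because the paths are
  right-continuous.\<close>

lemma floor_grid_gt: "s < (of_int \<lfloor>real (Suc n) * s\<rfloor> + 1) / real (Suc n)"
proof -
  have "real (Suc n) * s < of_int \<lfloor>real (Suc n) * s\<rfloor> + 1" by linarith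
  then show ?thesis by (subst pos_less_divide_eq) (auto simp: mult.commute)
qed

lemma floor_grid_le: "(of_int \<lfloor>real (Suc n) * s\<rfloor> + 1) / real (Suc n) \<le> s + 1 / real (Suc n)"
proof -
  have "of_int \<lfloor>real (Suc n) * s\<rfloor> + 1 \<le> real (Suc n) * s + 1" by linarith
  then have "(of_int \<lfloor>real (Suc n) * s\<rfloor> + 1) / real (Suc n) \<le> (real (Suc n) * s + 1) / real (Suc n)"
    by (intro divide_right_mono) auto
  also have "\<dots> = s + 1 / real (Suc n)" by (simp add: field_simps)
  finally show ?thesis .
qed

lemma floor_grid_tendsto_right:
  "(\<lambda>n. (of_int \<lfloor>real (Suc n) * s\<rfloor> + 1) / real (Suc n)) \<longlonglongrightarrow> s"
proof (rule tendsto_sandwich)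
  show "\<forall>\<^sub>F n in sequentially. s \<le> (of_int \<lfloor>real (Suc n) * s\<rfloor> + 1) / real (Suc n)"
    by (rule always_eventually, rule allI, rule less_imp_le, rule floor_grid_gt)
  show "\<forall>\<^sub>F n in sequentially. (of_int \<lfloor>real (Suc n) * s\<rfloor> + 1) / real (Suc n) \<le> s + 1 / real (Suc n)"
    by (rule always_eventually, rule allI, rule floor_grid_le)
  have "(\<lambda>n. s + 1 / real (Suc n)) \<longlonglongrightarrow> s + 0"
    by (intro tendsto_add tendsto_const LIMSEQ_Suc[OF lim_1_over_n])
  then show "(\<lambda>n. s + 1 / real (Suc n)) \<longlonglongrightarrow> s" by (simp only: add_0_right)
qed simp

text \<open>Sampling at the next grid point gives functions of an integer variable, and
  right-continuity makes them converge. Negative times are cut off since no continuity is known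
  there.\<close>

lemma right_continuous_borel_measurable:
  fixes f :: "real \<Rightarrow> real"
  assumes "\<And>t. t \<ge> 0 \<Longrightarrow> continuous (at_right t) f"
  shows "(\<lambda>s. indicator {0..} s * f s) \<in> borel_measurable borel"
proof (rule borel_measurable_LIMSEQ_real)
  let ?g = "\<lambda>n s. (of_int \<lfloor>real (Suc n) * s\<rfloor> + 1) / real (Suc n)"
  fix n :: nat
  have "(\<lambda>s. f ((of_int \<lfloor>real (Suc n) * s\<rfloor> + 1) / real (Suc n))) \<in> borel_measurable borel"
    by (rule measurable_compose[where g = "\<lambda>i::int. f ((of_int i + 1) / real (Suc n))" and N = "count_space UNIV"])
       auto
  then show "(\<lambda>s. indicator {0..} s * f (?g n s)) \<in> borel_measurable borel"
    by measurable
next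
  fix s :: real
  let ?g = "\<lambda>n. (of_int \<lfloor>real (Suc n) * s\<rfloor> + 1) / real (Suc n)"
  show "(\<lambda>n. indicator {0..} s * f (?g n)) \<longlonglongrightarrow> indicator {0..} s * f s"
  proof (cases "s \<ge> 0")
    case True
    have "continuous (at s within {s..}) f"
      using assms True by (simp add: at_within_Ici_at_right)
    then have "(\<lambda>n. f (?g n)) \<longlonglongrightarrow> f s"
      using floor_grid_tendsto_right[of s] less_imp_le[OF floor_grid_gt[of s]]
      by (auto simp: continuous_within_sequentially o_def)
    then show ?thesis by (intro tendsto_mult) auto
  qed simp
qed

text \<open>The left limit at \<open>s > 0\<close> is the limit of the values at
  \<open>s - 1 / Suc n\<close>. These times are eventually positive, so the path may be replaced by
  its version \<open>g\<close> that vanishes at negative times.\<close>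

lemma cadlag_left_lim_measurable:
  assumes "cadlag f"
  shows "(\<lambda>s. indicator {0<..} s * left_lim f s) \<in> borel_measurable borel"
proof (rule borel_measurable_LIMSEQ_real)
  define g where "g s = indicator {0..} s * f s" for s
  have [measurable]: "g \<in> borel_measurable borel"
    unfolding g_def using assms by (intro right_continuous_borel_measurable) (auto simp: cadlag_def)
  show "(\<lambda>s. indicator {0<..} s * g (s - 1 / Suc n)) \<in> borel_measurable borel" for n
    by measurable
  fix s :: real
  show "(\<lambda>n. indicator {0<..} s * g (s - 1 / Suc n)) \<longlonglongrightarrow> indicator {0<..} s * left_lim f s"
  proof (cases "s > 0")
    case True
    have lim: "(\<lambda>n. s - 1 / real (Suc n)) \<longlonglongrightarrow> s - 0"
      by (intro tendsto_diff tendsto_const LIMSEQ_Suc[OF lim_1_over_n])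
    have "filterlim (\<lambda>n. s - 1 / real (Suc n)) (at_left s) sequentially"
      using lim unfolding filterlim_at by simp
    then have "(\<lambda>n. f (s - 1 / real (Suc n))) \<longlonglongrightarrow> left_lim f s"
      by (rule filterlim_compose[OF tendsto_left_lim[OF assms True]])
    moreover have "\<forall>\<^sub>F n in sequentially. s - 1 / real (Suc n) > 0"
      using order_tendstoD(1)[OF lim, of 0] True by simp
    then have "\<forall>\<^sub>F n in sequentially. f (s - 1 / real (Suc n)) = g (s - 1 / real (Suc n))"
      by eventually_elim (simp add: g_def)
    ultimately have "(\<lambda>n. g (s - 1 / real (Suc n))) \<longlonglongrightarrow> left_lim f s"
      by (rule Lim_transform_eventually)
    then show ?thesis by (intro tendsto_mult) auto
  qed simp
qed


section \<open>Counting paths and the integral against them\<close>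

locale counting_path =
  fixes n :: "real \<Rightarrow> real"
  assumes mono: "\<And>s s'. 0 \<le> s \<Longrightarrow> s \<le> s' \<Longrightarrow> n s \<le> n s'"
    and right_cont: "\<And>t. 0 \<le> t \<Longrightarrow> continuous (at_right t) n"
    and integral: "\<And>t. 0 \<le> t \<Longrightarrow> n t \<in> \<int>"
begin

lemma mono_ext: "s \<le> s' \<Longrightarrow> n (max 0 s) \<le> n (max 0 s')"
  by (intro mono) auto

lemma right_cont_ext: "continuous (at_right t) (\<lambda>s. n (max 0 s))"
proof (cases "0 \<le> t")
  case True
  have "\<forall>\<^sub>F s in at_right t. n s = n (max 0 s)"
    using True by (auto simp: eventually_at_right_field intro!: exI[of _ "t + 1"])
  then have "((\<lambda>s. n (max 0 s)) \<longlongrightarrow> n t) (at_right t)"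
    using right_cont[OF True] unfolding continuous_within by (rule Lim_transform_eventually[rotated])
  then show ?thesis using True by (simp add: continuous_within max_def)
next
  case False
  have "\<forall>\<^sub>F s in at_right t. n (max 0 s) = n 0"
    using False by (auto simp: eventually_at_right_field intro!: exI[of _ 0])
  then have "((\<lambda>s. n (max 0 s)) \<longlongrightarrow> n 0) (at_right t)"
    by (rule tendsto_eventually)
  then show ?thesis using False by (simp add: continuous_within max_def)
qed

abbreviation "dn \<equiv> interval_measure (\<lambda>s. n (max 0 s))"

lemma emeasure_Ioc: "0 \<le> s \<Longrightarrow> s \<le> t \<Longrightarrow> emeasure dn {s<..t} = ennreal (n t - n s)"
  by (subst emeasure_interval_measure_Ioc) (use mono_ext right_cont_ext in \<open>auto simp: max_def\<close>)

text \<open>At times up to 0 the value of \<open>left_lim u\<close> is arbitrary; since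
  \<open>0 \<le> s\<close>, an extra indicator of the positive half-line can be inserted to exclude
  them.\<close>

lemma measurable_integrand:
  assumes "cadlag u" "0 \<le> s"
  shows "(\<lambda>r. indicator {s<..t} r *\<^sub>R left_lim u r) \<in> borel_measurable dn"
proof -
  have "(\<lambda>r. indicator {s<..t} r * (indicator {0<..} r * left_lim u r)) \<in> borel_measurable borel"
    using cadlag_left_lim_measurable[OF assms(1)] by measurable
  also have "(\<lambda>r. indicator {s<..t} r * (indicator {0<..} r * left_lim u r)) = (\<lambda>r. indicator {s<..t} r *\<^sub>R left_lim u r)"
    using assms(2) by (auto simp: indicator_def fun_eq_iff)
  finally show ?thesis by (simp cong: measurable_cong_sets)
qed

lemma predictable_integral_no_jump:
  assumes u: "cadlag u" and t: "0 \<le> t" "t \<le> t'" and "n t' = n t"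
  shows "predictable_integral u n t' = predictable_integral u n t"
  unfolding predictable_integral_def set_lebesgue_integral_def
proof (rule integral_cong_AE)
  have "{t<..t'} \<in> null_sets dn"
    using emeasure_Ioc[OF t] assms(4) by (auto simp: null_sets_def)
  then have "AE s in dn. s \<notin> {t<..t'}" by (rule AE_not_in)
  then show "AE s in dn. indicator {0<..t'} s *\<^sub>R left_lim u s = indicator {0<..t} s *\<^sub>R left_lim u s"
    by eventually_elim (use t in \<open>auto simp: indicator_def\<close>)
qed (simp_all only: measurable_integrand[OF u] order_refl)

lemma left_lim_bounded:
  assumes "cadlag u" "0 < t" "\<And>s. 0 \<le> s \<Longrightarrow> s < t \<Longrightarrow> t - d < s \<Longrightarrow> \<bar>u s - c\<bar> \<le> B" "d > 0"
  shows "\<bar>left_lim u t - c\<bar> \<le> B"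
proof (rule tendsto_upperbound)
  show "((\<lambda>s. \<bar>u s - c\<bar>) \<longlongrightarrow> \<bar>left_lim u t - c\<bar>) (at_left t)"
    by (intro tendsto_intros tendsto_left_lim assms)
  show "\<forall>\<^sub>F s in at_left t. \<bar>u s - c\<bar> \<le> B"
    using assms(2,4) by (auto simp: eventually_at_left_field intro!: exI[of _ "max 0 (t - d)"] assms(3))
qed simp

lemma set_integrable_integrand:
  assumes u: "cadlag u" and "0 \<le> s"
  shows "set_integrable dn {s<..t} (left_lim u)"
proof -
  obtain B where B: "\<And>r. r \<in> {0..t} \<Longrightarrow> \<bar>u r\<bar> \<le> B" using cadlag_bounded[OF u] by blast
  have fin: "emeasure dn {s<..t} < \<infinity>"
    by (cases "s \<le> t") (use emeasure_Ioc[of s t] assms in \<open>auto simp: less_top\<close>)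
  show ?thesis unfolding set_integrable_def
  proof (rule Bochner_Integration.integrable_bound)
    show "integrable dn (\<lambda>r. indicator {s<..t} r * B)"
      using fin by (intro integrable_mult_left integrable_real_indicator) auto
    have "\<bar>left_lim u r - 0\<bar> \<le> B" if "r \<in> {s<..t}" for r
      using assms B that by (intro left_lim_bounded[where d = 1]) auto
    then have "norm (indicator {s<..t} r *\<^sub>R left_lim u r) \<le> norm (indicator {s<..t} r * B)" for r
      by (cases "r \<in> {s<..t}") force+
    then show "AE r in dn. norm (indicator {s<..t} r *\<^sub>R left_lim u r) \<le> norm (indicator {s<..t} r * B)"
      by auto
  qed (rule measurable_integrand[OF assms])
qed

text \<open>A monotone integer-valued path that grows by 1 does so at a single time
  \<open>T\<close>, so on \<open>{t<..t'}\<close> the measure \<open>dn\<close> is a unit mass at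
  \<open>T\<close> and the integral picks up the left limit there. Constancy before \<open>T\<close>
  is recorded because it lets the solution be followed up to the jump.\<close>

lemma predictable_integral_one_jump:
  assumes u: "cadlag u" and t: "0 \<le> t" "t \<le> t'" and jump: "n t' = n t + 1"
  shows "\<exists>T. t < T \<and> T \<le> t' \<and> (\<forall>s. t \<le> s \<and> s < T \<longrightarrow> n s = n t) \<and>
    predictable_integral u n t' = predictable_integral u n t + left_lim u T"
proof -
  define S where "S = {s. t \<le> s \<and> n s \<ge> n t + 1}"
  define T where "T = Inf S"
  have S: "t' \<in> S" "bdd_below S" using t jump by (auto simp: S_def intro: bdd_belowI[of _ t])
  have T: "t \<le> T" "T \<le> t'"
    using S unfolding T_def by (auto intro!: cInf_lower cInf_greatest simp: S_def)
  \<comment> \<open>Below the infimum the path is still less than \<open>n t + 1\<close>;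
    monotonicity and integrality leave only the value \<open>n t\<close>.\<close>
  have before: "n s = n t" if "t \<le> s" "s < T" for s
  proof -
    have "s \<notin> S" using that cInf_lower[OF _ S(2), of s] by (auto simp: T_def)
    then have "n s < n t + 1" using that by (auto simp: S_def)
    moreover have "n s \<ge> n t" using that t by (intro mono) auto
    moreover have "n s \<in> \<int>" "n t \<in> \<int>" using that t by (auto intro!: integral)
    ultimately show ?thesis by (auto elim!: Ints_cases)
  qed
  have after: "n s \<ge> n t + 1" if "T < s" for s
  proof -
    have "S \<noteq> {}" "Inf S < s" using that S by (auto simp: T_def)
    then obtain r where "r \<in> S" "r < s" using cInf_lessD by blast
    then show ?thesis using mono[of r s] t unfolding S_def by fastforce
  qed
  \<comment> \<open>Right-continuity puts the jump at \<open>T\<close> itself and not after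
    it.\<close>
  have "n T \<ge> n t + 1"
  proof (rule tendsto_lowerbound)
    show "(n \<longlongrightarrow> n T) (at_right T)"
      using right_cont[of T] t T by (auto simp: continuous_within)
    show "\<forall>\<^sub>F s in at_right T. n t + 1 \<le> n s"
      using after by (auto simp: eventually_at_right_field intro!: exI[of _ "T + 1"])
  qed simp
  then have nT: "n T = n t'" "t < T"
    using mono[of T t'] T t jump by (auto simp: less_le)
  have null: "{t<..<T} \<in> null_sets dn" "{T<..t'} \<in> null_sets dn"
  proof -
    \<comment> \<open>\<open>dn\<close> is computed on half-open intervals only, so the open
      interval is exhausted by half-open ones that end before \<open>T\<close>.\<close>
    have "{t<..<T} = (\<Union>k. {t<..T - 1 / Suc k})"
    proof (intro equalityI subsetI)
      fix s assume s: "s \<in> {t<..<T}"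
      then obtain k where "1 / Suc k < T - s" using nat_approx_posE[of "T - s"] by auto
      then show "s \<in> (\<Union>k. {t<..T - 1 / Suc k})" using s by (auto intro!: exI[of _ k])
    next
      fix s assume "s \<in> (\<Union>k. {t<..T - 1 / Suc k})"
      then obtain k where "t < s" "s \<le> T - 1 / Suc k" by auto
      moreover have "1 / real (Suc k) > 0" by simp
      ultimately show "s \<in> {t<..<T}" unfolding greaterThanLessThan_iff by linarith
    qed
    moreover have null_k: "{t<..T - 1 / Suc k} \<in> null_sets dn" for k
    proof (cases "t \<le> T - 1 / Suc k")
      case True
      then have "n (T - 1 / Suc k) = n t" by (intro before) auto
      then show ?thesis using emeasure_Ioc[OF t(1) True] by (auto simp: null_sets_def)
    qed auto
    ultimately show "{t<..<T} \<in> null_sets dn"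
      by (simp only: null_sets_UN)
    show "{T<..t'} \<in> null_sets dn"
      using emeasure_Ioc[of T t'] t T nT by (auto simp: null_sets_def)
  qed
  have "{0<..t'} = {0<..t} \<union> {t<..t'}" using t by auto
  then have "predictable_integral u n t' = (LINT s:{0<..t} \<union> {t<..t'}|dn. left_lim u s)"
    by (simp only: predictable_integral_def)
  also have "\<dots> = predictable_integral u n t + (LINT s:{t<..t'}|dn. left_lim u s)"
    unfolding predictable_integral_def
    by (rule set_integral_Un) (use t in \<open>auto intro!: set_integrable_integrand u\<close>)
  also have "(LINT s:{t<..t'}|dn. left_lim u s) = (LINT s:{t<..t'}|dn. left_lim u T)"
    unfolding set_lebesgue_integral_def
  proof (rule integral_cong_AE)
    show "AE s in dn. indicator {t<..t'} s *\<^sub>R left_lim u s = indicator {t<..t'} s *\<^sub>R left_lim u T"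
      using null[THEN AE_not_in]
    proof eventually_elim
      case (elim s)
      then have "s \<in> {t<..t'} \<Longrightarrow> s = T" by (cases s T rule: linorder_cases) auto
      then show ?case by (cases "s \<in> {t<..t'}") auto
    qed
  qed (rule measurable_integrand[OF u t(1)], measurable)
  also have "\<dots> = left_lim u T"
    using emeasure_Ioc[OF t] jump by (simp add: set_lebesgue_integral_def measure_def)
  finally have "predictable_integral u n t' = predictable_integral u n t + left_lim u T" .
  moreover have "\<forall>s. t \<le> s \<and> s < T \<longrightarrow> n s = n t" using before by blast
  ultimately show ?thesis using nT(2) T(2) by (intro exI[of _ T] conjI)
qed

end

section \<open>Increments of Levy processes\<close>

text \<open>Finite-dimensional events generate the past and are closed under intersection, so
  independence proved for them extends to the generated sigma-algebra. The total function
  \<open>A\<close> is relevant on \<open>J\<close> only.\<close>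

definition cylinders :: "'a measure \<Rightarrow> (real \<Rightarrow> 'a \<Rightarrow> real) \<Rightarrow> real \<Rightarrow> 'a set set" where
  "cylinders M X t = {E. \<exists>J A. finite J \<and> J \<subseteq> {0..t} \<and> (\<forall>s. A s \<in> sets borel) \<and>
     E = {\<omega> \<in> space M. \<forall>s\<in>J. X s \<omega> \<in> A s}}"

lemma cylinders_iff:
  "E \<in> cylinders M X t \<longleftrightarrow> (\<exists>J A. finite J \<and> J \<subseteq> {0..t} \<and> (\<forall>s. A s \<in> sets borel) \<and>
     E = {\<omega> \<in> space M. \<forall>s\<in>J. X s \<omega> \<in> A s})"
  unfolding cylinders_def mem_Collect_eq ..

lemma cylindersI:
  assumes "finite J" "J \<subseteq> {0..t}" "\<And>s. A s \<in> sets borel"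
  shows "{\<omega> \<in> space M. \<forall>s\<in>J. X s \<omega> \<in> A s} \<in> cylinders M X t"
  unfolding cylinders_iff using assms by (intro exI[of _ J] exI[of _ A]) simp

lemma Int_stable_vimage_sets: "Int_stable {f -` B \<inter> S |B. B \<in> sets N}"
proof (rule Int_stableI)
  fix E F assume "E \<in> {f -` B \<inter> S |B. B \<in> sets N}" "F \<in> {f -` B \<inter> S |B. B \<in> sets N}"
  then obtain A B where "A \<in> sets N" "B \<in> sets N" "E = f -` A \<inter> S" "F = f -` B \<inter> S" by auto
  then have "A \<inter> B \<in> sets N" "E \<inter> F = f -` (A \<inter> B) \<inter> S" by auto
  then show "E \<inter> F \<in> {f -` B \<inter> S |B. B \<in> sets N}" by blast
qed

lemma Int_stable_cylinders: "Int_stable (cylinders M X t)"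
proof (rule Int_stableI)
  fix E F assume EF: "E \<in> cylinders M X t" "F \<in> cylinders M X t"
  from EF(1) obtain J A where J: "finite J" "J \<subseteq> {0..t}" "\<forall>s. A s \<in> sets borel"
    "E = {\<omega> \<in> space M. \<forall>s\<in>J. X s \<omega> \<in> A s}" unfolding cylinders_iff by (elim exE conjE)
  from EF(2) obtain K B where K: "finite K" "K \<subseteq> {0..t}" "\<forall>s. B s \<in> sets borel"
    "F = {\<omega> \<in> space M. \<forall>s\<in>K. X s \<omega> \<in> B s}" unfolding cylinders_iff by (elim exE conjE)
  define C where "C s = (if s \<in> J then A s else UNIV) \<inter> (if s \<in> K then B s else UNIV)" for s
  have "E \<inter> F = {\<omega> \<in> space M. \<forall>s\<in>J \<union> K. X s \<omega> \<in> C s}"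
    unfolding J(4) K(4) C_def by auto
  moreover have "\<dots> \<in> cylinders M X t"
    using J K by (intro cylindersI) (auto simp: C_def)
  ultimately show "E \<inter> F \<in> cylinders M X t" by simp
qed

lemma single_cylinder:
  assumes "0 \<le> s" "s \<le> t" "A \<in> sets borel"
  shows "X s -` A \<inter> space M \<in> cylinders M X t"
proof -
  have "{\<omega> \<in> space M. \<forall>r\<in>{s}. X r \<omega> \<in> A} \<in> cylinders M X t"
    using assms by (intro cylindersI) auto
  also have "{\<omega> \<in> space M. \<forall>r\<in>{s}. X r \<omega> \<in> A} = X s -` A \<inter> space M" by auto
  finally show ?thesis .
qed

context levy_process
begin

lemma cylinders_events: "cylinders M X t \<subseteq> events"
proof
  fix E assume "E \<in> cylinders M X t"
  then obtain J A where *: "finite J" "J \<subseteq> {0..t}" "\<forall>s. A s \<in> sets borel"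
    "E = {\<omega> \<in> space M. \<forall>s\<in>J. X s \<omega> \<in> A s}" unfolding cylinders_iff by (elim exE conjE)
  have "{\<omega> \<in> space M. X s \<omega> \<in> A s} \<in> events" if "s \<in> J" for s
    using that * measurable_sets[OF measurable_process[of s], of "A s"]
    by (auto simp: vimage_def Int_def conj_commute)
  then show "E \<in> events"
    unfolding *(4) using *(1) by (intro sets.sets_Collect_finite_All) auto
qed

lemma measurable_increment [measurable]:
  assumes "0 \<le> s" "0 \<le> t"
  shows "(\<lambda>\<omega>. X s \<omega> - X t \<omega>) \<in> borel_measurable M"
  using measurable_process[OF assms(1)] measurable_process[OF assms(2)] by simp

text \<open>The values at the times of \<open>J\<close> are partial sums of increments along a
  sorted grid ending at \<open>t\<close>, and the increment over \<open>[t, t + h]\<close> is one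
  further increment. Grouping the independent increments into these two blocks gives the
  product.\<close>

lemma cylinder_indep_increment:
  assumes t: "0 \<le> t" "0 \<le> h" and E: "E \<in> cylinders M X t" and B: "B \<in> sets borel"
  shows "prob (E \<inter> {\<omega> \<in> space M. X (t + h) \<omega> - X t \<omega> \<in> B}) =
         prob E * prob {\<omega> \<in> space M. X (t + h) \<omega> - X t \<omega> \<in> B}"
proof -
  obtain J A where J: "finite J" "J \<subseteq> {0..t}" "\<forall>s. A s \<in> sets borel"
    "E = {\<omega> \<in> space M. \<forall>s\<in>J. X s \<omega> \<in> A s}" using E unfolding cylinders_iff by (elim exE conjE)
  \<comment> \<open>Including 0 and \<open>t\<close> makes the partial sums start at
    \<open>X 0\<close> and lets the grid end at \<open>t\<close>, so that the next increment is the
    one in question.\<close>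
  define us where "us = sorted_list_of_set (insert 0 (insert t J))"
  define k where "k = length us - 1"
  have "finite (insert 0 (insert t J))" using J(1) by simp
  then have set_us: "set us = insert 0 (insert t J)"
    unfolding us_def by (rule set_sorted_list_of_set)
  have sorted: "sorted us" unfolding us_def by (rule sorted_sorted_list_of_set)
  have ne: "us \<noteq> []" using set_us by auto
  then have k_less: "k < length us" by (cases us) (auto simp: k_def)
  \<comment> \<open>Staying at \<open>t + h\<close> after index \<open>k\<close> extends the grid to
    a monotone sequence on all of \<open>nat\<close>, as the assumption on increments
    demands.\<close>
  define \<tau> where "\<tau> i = (if i \<le> k then us ! i else t + h)" for i
  have us_mem: "us ! i \<in> {0..t}" if "i \<le> k" for i
  proof -
    have "us ! i \<in> set us" using that k_less by (intro nth_mem) auto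
    then show ?thesis using set_us J(2) t by auto
  qed
  have mono_us: "us ! i \<le> us ! j" if "i \<le> j" "j \<le> k" for i j
    using that k_less by (intro sorted_nth_mono[OF sorted]) auto
  have idx: "\<exists>i\<le>k. us ! i = s" if "s \<in> insert 0 (insert t J)" for s
  proof -
    have "s \<in> set us" using that set_us by simp
    then obtain i where "i < length us" "us ! i = s" by (auto simp: in_set_conv_nth)
    then show ?thesis by (intro exI[of _ i]) (auto simp: k_def)
  qed
  have us0: "us ! 0 = 0"
  proof -
    obtain i where "i \<le> k" "us ! i = 0" using idx[of 0] by auto
    then show ?thesis using mono_us[of 0 i] us_mem[of 0] by auto
  qed
  have usk: "us ! k = t"
  proof -
    obtain i where "i \<le> k" "us ! i = t" using idx[of t] by auto
    then show ?thesis using mono_us[of i k] us_mem[of k] by auto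
  qed
  have "mono \<tau>"
  proof (rule monoI)
    fix i j :: nat assume "i \<le> j"
    then show "\<tau> i \<le> \<tau> j"
      using mono_us[of i j] us_mem[of i] t by (auto simp: \<tau>_def)
  qed
  moreover have "\<tau> 0 \<ge> 0" using us0 by (simp add: \<tau>_def)
  ultimately have ind: "indep_vars (\<lambda>_. borel) (\<lambda>i \<omega>. X (\<tau> (Suc i)) \<omega> - X (\<tau> i) \<omega>) {..<Suc k}"
    by (rule independent_increments)
  define D where "D i \<omega> = X (\<tau> (Suc i)) \<omega> - X (\<tau> i) \<omega>" for i \<omega>
  have Dk: "D k \<omega> = X (t + h) \<omega> - X t \<omega>" for \<omega>
    by (simp add: D_def \<tau>_def usk)
  have sumD: "(\<Sum>j<i. D j \<omega>) = X (us ! i) \<omega> - X 0 \<omega>" if "i \<le> k" for i \<omega>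
  proof -
    have "(\<Sum>j<i. D j \<omega>) = X (\<tau> i) \<omega> - X (\<tau> 0) \<omega>"
      unfolding D_def by (rule sum_lessThan_telescope)
    then show ?thesis using that us0 by (simp add: \<tau>_def)
  qed
  have "\<exists>ix. \<forall>s\<in>J. ix s \<le> k \<and> us ! (ix s) = s"
    using idx by (intro bchoice) auto
  then obtain ix where ix: "\<And>s. s \<in> J \<Longrightarrow> ix s \<le> k" "\<And>s. s \<in> J \<Longrightarrow> us ! (ix s) = s" by blast
  define F where "F = {v \<in> space (PiM {..<k} (\<lambda>_. borel :: real measure)). \<forall>s\<in>J. (\<Sum>j<ix s. v j) \<in> A s}"
  define F2 where "F2 = {v \<in> space (PiM {k} (\<lambda>_. borel :: real measure)). v k \<in> B}"
  have F: "F \<in> sets (PiM {..<k} (\<lambda>_. borel))"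
    unfolding F_def
  proof (intro sets.sets_Collect_finite_All)
    fix s assume s: "s \<in> J"
    have "(\<lambda>v. \<Sum>j<ix s. v j) \<in> borel_measurable (PiM {..<k} (\<lambda>_. borel :: real measure))"
      using ix(1)[OF s] by (intro borel_measurable_sum measurable_component_singleton) auto
    then show "{v \<in> space (PiM {..<k} (\<lambda>_. borel)). (\<Sum>j<ix s. v j) \<in> A s} \<in> sets (PiM {..<k} (\<lambda>_. borel))"
      using J(3)[rule_format, of s] by measurable
  qed fact
  have F2: "F2 \<in> sets (PiM {k} (\<lambda>_. borel))"
  proof -
    have "(\<lambda>v. v k) \<in> borel_measurable (PiM {k} (\<lambda>_. borel :: real measure))"
      by (intro measurable_component_singleton) auto
    then show ?thesis using B unfolding F2_def by measurable
  qed
  have "indep_var (PiM {..<k} (\<lambda>_. borel)) (\<lambda>\<omega>. restrict (\<lambda>i. D i \<omega>) {..<k})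
                  (PiM {k} (\<lambda>_. borel)) (\<lambda>\<omega>. restrict (\<lambda>i. D i \<omega>) {k})"
    using ind unfolding D_def by (rule indep_var_restrict) auto
  from indep_varD[OF this F F2]
  have eq: "prob ((\<lambda>x. (restrict (\<lambda>i. D i x) {..<k}, restrict (\<lambda>i. D i x) {k})) -` (F \<times> F2) \<inter> space M) =
     prob ((\<lambda>\<omega>. restrict (\<lambda>i. D i \<omega>) {..<k}) -` F \<inter> space M) * prob ((\<lambda>\<omega>. restrict (\<lambda>i. D i \<omega>) {k}) -` F2 \<inter> space M)" .
  have inF: "restrict (\<lambda>i. D i \<omega>) {..<k} \<in> F \<longleftrightarrow> (\<forall>s\<in>J. X s \<omega> - X 0 \<omega> \<in> A s)" for \<omega>
  proof -
    have "(\<Sum>j<ix s. restrict (\<lambda>i. D i \<omega>) {..<k} j) = X s \<omega> - X 0 \<omega>" if "s \<in> J" for s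
    proof -
      have "(\<Sum>j<ix s. restrict (\<lambda>i. D i \<omega>) {..<k} j) = (\<Sum>j<ix s. D j \<omega>)"
        using ix(1)[OF that] by (intro sum.cong) auto
      then show ?thesis using sumD ix that by simp
    qed
    then show ?thesis by (auto simp: F_def space_PiM)
  qed
  have inF2: "restrict (\<lambda>i. D i \<omega>) {k} \<in> F2 \<longleftrightarrow> X (t + h) \<omega> - X t \<omega> \<in> B" for \<omega>
    by (simp add: F2_def space_PiM Dk)
  define E' where "E' = {\<omega> \<in> space M. \<forall>s\<in>J. X s \<omega> - X 0 \<omega> \<in> A s}"
  define H where "H = {\<omega> \<in> space M. X (t + h) \<omega> - X t \<omega> \<in> B}"
  have [measurable]: "(\<lambda>\<omega>. X (t + h) \<omega> - X t \<omega>) \<in> borel_measurable M" using t by (intro measurable_increment) auto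
  have H: "H \<in> events" using B unfolding H_def by measurable
  have E': "E' \<in> events" unfolding E'_def
  proof (intro sets.sets_Collect_finite_All)
    fix s assume s: "s \<in> J"
    have "(\<lambda>\<omega>. X s \<omega> - X 0 \<omega>) \<in> borel_measurable M" using J(2) s by (intro measurable_increment) auto
    then show "{\<omega> \<in> space M. X s \<omega> - X 0 \<omega> \<in> A s} \<in> events" using J(3)[rule_format, of s] by measurable
  qed fact
  have "E \<in> events" using E cylinders_events by auto
  have eq': "prob (E' \<inter> H) = prob E' * prob H"
  proof -
    have "(\<lambda>x. (restrict (\<lambda>i. D i x) {..<k}, restrict (\<lambda>i. D i x) {k})) -` (F \<times> F2) \<inter> space M = E' \<inter> H"
      "(\<lambda>\<omega>. restrict (\<lambda>i. D i \<omega>) {..<k}) -` F \<inter> space M = E'"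
      "(\<lambda>\<omega>. restrict (\<lambda>i. D i \<omega>) {k}) -` F2 \<inter> space M = H"
      using inF inF2 by (auto simp: E'_def H_def simp del: restrict_apply)
    with eq show ?thesis by simp
  qed
  \<comment> \<open>Increments determine only \<open>X s - X 0\<close>. The start at 0 holds almost
    surely, so \<open>E\<close> and \<open>E'\<close> differ by a null set.\<close>
  have AE: "AE \<omega> in M. \<omega> \<in> E \<longleftrightarrow> \<omega> \<in> E'"
    using start by eventually_elim (simp add: J(4) E'_def)
  have "prob E = prob E'" "prob (E \<inter> H) = prob (E' \<inter> H)"
    using AE E' H \<open>E \<in> events\<close> by (auto intro!: measure_eq_AE)
  with eq' show ?thesis by (simp add: H_def)
qed

definition inc :: "real \<Rightarrow> nat \<Rightarrow> 'a \<Rightarrow> real" where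
  "inc h i \<omega> = X (real (Suc i) * h) \<omega> - X (real i * h) \<omega>"

lemma inc_measurable [measurable]: "0 \<le> h \<Longrightarrow> inc h i \<in> borel_measurable M"
  unfolding inc_def by (intro measurable_increment) auto

lemma indep_inc:
  assumes "0 \<le> h"
  shows "indep_vars (\<lambda>_. borel) (inc h) {..<n}"
proof -
  have "mono (\<lambda>i. real i * h)" using assms by (intro monoI mult_right_mono) auto
  from independent_increments[OF this, of n] show ?thesis
    by (simp add: inc_def[abs_def] eta_contract_eq)
qed

lemma distr_increment:
  assumes "0 \<le> s" "s \<le> t"
  shows "distr M borel (\<lambda>\<omega>. X t \<omega> - X s \<omega>) = distr M borel (X (t - s))"
  using stationary_increments[of s "t - s"] assms by simp

lemma distr_inc: "0 \<le> h \<Longrightarrow> distr M borel (inc h i) = distr M borel (X h)"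
  unfolding inc_def[abs_def] by (subst distr_increment) (auto intro: mult_right_mono simp: algebra_simps)

lemma AE_sum_inc:
  "AE \<omega> in M. \<forall>h n. (\<Sum>i<n. inc h i \<omega>) = X (real n * h) \<omega>"
  using start
proof eventually_elim
  case (elim \<omega>)
  have "(\<Sum>i<n. inc h i \<omega>) = X (real n * h) \<omega> - X (real 0 * h) \<omega>" for h n
    unfolding inc_def by (rule sum_lessThan_telescope)
  then show ?case using elim by simp
qed

text \<open>Increments over equal steps are independent and identically distributed. Nonnegative
  integrals are used so that the formula is available before integrability is known.\<close>

lemma nn_integral_prod_inc:
  assumes h: "0 \<le> h" and [measurable]: "g \<in> borel_measurable borel" and "\<And>x. 0 \<le> g x"
  shows "(\<integral>\<^sup>+\<omega>. ennreal (\<Prod>i<n. g (inc h i \<omega>)) \<partial>M) = (\<integral>\<^sup>+\<omega>. ennreal (g (X h \<omega>)) \<partial>M) ^ n"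
proof -
  have "indep_vars (\<lambda>_. borel) (\<lambda>i \<omega>. ennreal (g (inc h i \<omega>))) {..<n}"
    by (rule indep_vars_compose2[OF indep_inc[OF h], where Y = "\<lambda>_ x. ennreal (g x)"]) simp
  have eq: "(\<integral>\<^sup>+\<omega>. ennreal (g (inc h i \<omega>)) \<partial>M) = (\<integral>\<^sup>+\<omega>. ennreal (g (X h \<omega>)) \<partial>M)" for i
  proof -
    have "(\<integral>\<^sup>+\<omega>. ennreal (g (inc h i \<omega>)) \<partial>M) = (\<integral>\<^sup>+x. ennreal (g x) \<partial>distr M borel (inc h i))"
      using h by (subst nn_integral_distr) auto
    also have "\<dots> = (\<integral>\<^sup>+x. ennreal (g x) \<partial>distr M borel (X h))" using h by (simp add: distr_inc)
    also have "\<dots> = (\<integral>\<^sup>+\<omega>. ennreal (g (X h \<omega>)) \<partial>M)"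
      using measurable_process[OF h] by (subst nn_integral_distr) auto
    finally show ?thesis .
  qed
  have "(\<integral>\<^sup>+\<omega>. ennreal (\<Prod>i<n. g (inc h i \<omega>)) \<partial>M) = (\<integral>\<^sup>+\<omega>. (\<Prod>i<n. ennreal (g (inc h i \<omega>))) \<partial>M)"
    using assms(3) by (simp add: prod_ennreal)
  also have "\<dots> = (\<Prod>i<n. \<integral>\<^sup>+\<omega>. ennreal (g (inc h i \<omega>)) \<partial>M)"
    by (rule indep_vars_nn_integral) (auto intro!: indep_vars_compose2[OF indep_inc[OF h], where Y = "\<lambda>_ x. ennreal (g x)"])
  finally show ?thesis by (simp add: eq)
qed

text \<open>Independence on the intersection-stable generators extends to the sigma-algebra of the
  past, with which \<open>Z\<close> is measurable; stationarity replaces the increment by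
  \<open>X h\<close>.\<close>

lemma integral_past_times_increment:
  fixes Z :: "'a \<Rightarrow> real" and g :: "real \<Rightarrow> real"
  assumes t: "0 \<le> t" "0 \<le> h"
    and Z: "Z \<in> borel_measurable (sigma (space M) (cylinders M X t))" "integrable M Z"
    and g: "g \<in> borel_measurable borel" "integrable M (\<lambda>\<omega>. g (X h \<omega>))"
  shows "(LINT \<omega>|M. Z \<omega> * g (X (t + h) \<omega> - X t \<omega>)) = (LINT \<omega>|M. Z \<omega>) * (LINT \<omega>|M. g (X h \<omega>))"
proof -
  let ?D = "\<lambda>\<omega>. X (t + h) \<omega> - X t \<omega>"
  have D: "?D \<in> borel_measurable M" using t by (intro measurable_increment) auto
  have distr: "distr M borel ?D = distr M borel (X h)" using t by (subst distr_increment) auto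
  have int: "integrable M (\<lambda>\<omega>. g (?D \<omega>))" and eq: "(LINT \<omega>|M. g (?D \<omega>)) = (LINT \<omega>|M. g (X h \<omega>))"
    using integrable_distr_eq[OF D g(1)] integrable_distr_eq[OF measurable_process[OF t(2)] g(1)] g(2)
      integral_distr[OF D g(1)] integral_distr[OF measurable_process[OF t(2)] g(1)] by (simp_all add: distr)
  have "indep_set (cylinders M X t) {?D -` B \<inter> space M |B. B \<in> sets borel}"
    unfolding indep_sets2_eq
  proof (intro conjI ballI)
    show "{?D -` B \<inter> space M |B. B \<in> sets borel} \<subseteq> events" using D by auto
    fix E F assume "E \<in> cylinders M X t" "F \<in> {?D -` B \<inter> space M |B. B \<in> sets borel}"
    then show "prob (E \<inter> F) = prob E * prob F"
      using cylinder_indep_increment[OF t, of E]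
      by (auto simp: vimage_def Int_def conj_commute)
  qed (rule cylinders_events)
  then have "indep_set (sigma_sets (space M) (cylinders M X t)) (sigma_sets (space M) {?D -` B \<inter> space M |B. B \<in> sets borel})"
    by (rule indep_set_sigma_sets) (auto intro: Int_stable_cylinders Int_stable_vimage_sets)
  moreover have cyl: "cylinders M X t \<subseteq> Pow (space M)" using cylinders_events sets.sets_into_space by blast
  moreover have "sigma_sets (space M) {Z -` A \<inter> space M |A. A \<in> sets borel} \<subseteq> sigma_sets (space M) (cylinders M X t)"
  proof (rule sigma_sets_mono, rule subsetI)
    fix E assume "E \<in> {Z -` A \<inter> space M |A. A \<in> sets borel}"
    then show "E \<in> sigma_sets (space M) (cylinders M X t)"
      using measurable_sets[OF Z(1)] cyl by (auto simp: space_measure_of sets_measure_of)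
  qed
  ultimately have ind: "indep_var borel Z borel ?D"
    using Z(2) D unfolding indep_var_eq indep_sets2_eq by auto
  have "indep_var borel Z borel (\<lambda>\<omega>. g (?D \<omega>))"
    using indep_var_compose[OF ind, of "\<lambda>x. x" borel g borel] g(1) by (simp add: comp_def)
  from indep_var_lebesgue_integral[OF this Z(2) int] eq show ?thesis by simp
qed

definition dyadic_exit :: "real \<Rightarrow> real \<Rightarrow> real \<Rightarrow> nat \<Rightarrow> 'a set" where
  "dyadic_exit t h c m = {\<omega> \<in> space M. \<exists>k\<in>{..2^m}. \<bar>X (t + real k * (h / 2^m)) \<omega> - X t \<omega>\<bar> > c}"

text \<open>The event that \<open>X\<close> moves by more than \<open>c\<close> away from
  \<open>X t\<close> during \<open>[t, t + h]\<close>. Testing dyadic times makes it a countable,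
  increasing union of events; \<open>not_exits_bound\<close> recovers all times from
  right-continuity.\<close>

definition exits :: "real \<Rightarrow> real \<Rightarrow> real \<Rightarrow> 'a set" where
  "exits t h c = (\<Union>m. dyadic_exit t h c m)"

lemma dyadic_exit_events:
  assumes "0 \<le> t" "0 \<le> h"
  shows "dyadic_exit t h c m \<in> events"
  unfolding dyadic_exit_def
proof -
  have "{\<omega> \<in> space M. \<bar>X (t + real k * (h / 2^m)) \<omega> - X t \<omega>\<bar> > c} \<in> events" for k
  proof -
    have "(\<lambda>\<omega>. X (t + real k * (h / 2^m)) \<omega> - X t \<omega>) \<in> borel_measurable M"
      using assms by (intro measurable_increment) auto
    then show ?thesis by measurable
  qed
  then show "{\<omega> \<in> space M. \<exists>k\<in>{..2^m}. \<bar>X (t + real k * (h / 2^m)) \<omega> - X t \<omega>\<bar> > c} \<in> events"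
    by (intro sets.sets_Collect_finite_Ex) auto
qed

lemma exits_events [measurable]: "0 \<le> t \<Longrightarrow> 0 \<le> h \<Longrightarrow> exits t h c \<in> events"
  unfolding exits_def by (intro sets.countable_UN) (auto intro: dyadic_exit_events)

text \<open>For either starting time the event is the preimage of the same set \<open>F\<close> of
  increment vectors, and the vectors have the same product law.\<close>

lemma prob_dyadic_exit:
  assumes t: "0 \<le> t" "0 \<le> h"
  shows "prob (dyadic_exit t h c m) = prob (dyadic_exit 0 h c m)"
proof -
  define n :: nat where "n = 2^m"
  define d where "d = h / 2^m"
  have d: "0 \<le> d" using t by (simp add: d_def)
  have "n > 0" by (simp add: n_def)
  define P where "P = PiM {..<n} (\<lambda>_. borel :: real measure)"
  define F where "F = {v \<in> space P. \<exists>k\<in>{..n}. \<bar>\<Sum>i<k. v i\<bar> > c}"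
  have F: "F \<in> sets P" unfolding F_def
  proof (intro sets.sets_Collect_finite_Ex)
    fix k assume "k \<in> {..n}"
    then have "(\<lambda>v. \<Sum>i<k. v i) \<in> borel_measurable P"
      unfolding P_def by (intro borel_measurable_sum measurable_component_singleton) auto
    then show "{v \<in> space P. \<bar>\<Sum>i<k. v i\<bar> > c} \<in> sets P" by measurable
  qed simp
  have key: "prob (dyadic_exit s h c m) = measure (PiM {..<n} (\<lambda>_. distr M borel (X d))) F"
    if s: "0 \<le> s" for s
  proof -
    define D where "D i \<omega> = X (s + real (Suc i) * d) \<omega> - X (s + real i * d) \<omega>" for i \<omega>
    have D: "random_variable borel (D i)" for i
      unfolding D_def[abs_def] using s d by (intro measurable_increment) auto
    have "mono (\<lambda>i. s + real i * d)" using d by (intro monoI add_left_mono mult_right_mono) auto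
    from independent_increments[OF this, of n] have "indep_vars (\<lambda>_. borel) D {..<n}"
      using s by (simp add: D_def[abs_def])
    then have eq: "distr M P (\<lambda>x. \<lambda>i\<in>{..<n}. D i x) = (\<Pi>\<^sub>M i\<in>{..<n}. distr M borel (D i))"
      unfolding P_def using \<open>n > 0\<close> D by (subst (asm) indep_vars_iff_distr_eq_PiM) auto
    have "distr M borel (D i) = distr M borel (X d)" for i
      unfolding D_def[abs_def] using s d
      by (subst distr_increment) (auto intro: mult_right_mono simp: algebra_simps)
    then have eq2: "distr M P (\<lambda>x. \<lambda>i\<in>{..<n}. D i x) = (\<Pi>\<^sub>M i\<in>{..<n}. distr M borel (X d))"
      using eq by simp
    have meas: "(\<lambda>x. \<lambda>i\<in>{..<n}. D i x) \<in> M \<rightarrow>\<^sub>M P"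
      unfolding P_def by (intro measurable_restrict D)
    have "(\<Sum>i<k. (\<lambda>i\<in>{..<n}. D i \<omega>) i) = X (s + real k * d) \<omega> - X s \<omega>" if "k \<le> n" for k \<omega>
    proof -
      have "(\<Sum>i<k. (\<lambda>i\<in>{..<n}. D i \<omega>) i) = (\<Sum>i<k. D i \<omega>)"
        using that by (intro sum.cong) auto
      also have "\<dots> = X (s + real k * d) \<omega> - X (s + real 0 * d) \<omega>"
        unfolding D_def by (rule sum_lessThan_telescope)
      finally show ?thesis by simp
    qed
    then have "(\<lambda>x. \<lambda>i\<in>{..<n}. D i x) -` F \<inter> space M = dyadic_exit s h c m"
      using measurable_space[OF meas]
      by (auto simp: F_def dyadic_exit_def n_def[symmetric] d_def[symmetric] simp del: restrict_apply)
    then show ?thesis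
      using measure_distr[OF meas F] by (simp add: eq2)
  qed
  from key[OF t(1)] key[of 0] show ?thesis by simp
qed

lemma prob_exits:
  assumes t: "0 \<le> t" "0 \<le> h"
  shows "prob (exits t h c) = prob (exits 0 h c)"
proof -
  have lim: "(\<lambda>m. prob (dyadic_exit s h c m)) \<longlonglongrightarrow> prob (exits s h c)" if "0 \<le> s" for s
    unfolding exits_def
  proof (rule finite_Lim_measure_incseq)
    show "range (dyadic_exit s h c) \<subseteq> events" using dyadic_exit_events[OF that t(2)] by auto
    show "incseq (dyadic_exit s h c)"
    proof (rule incseq_SucI, rule subsetI)
      fix m \<omega> assume "\<omega> \<in> dyadic_exit s h c m"
      then obtain k where k: "\<omega> \<in> space M" "k \<le> 2^m" "\<bar>X (s + real k * (h / 2^m)) \<omega> - X s \<omega>\<bar> > c"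
        unfolding dyadic_exit_def by blast
      \<comment> \<open>Refining the dyadic grid doubles the index of a given time.\<close>
      have "real (2 * k) * (h / 2 ^ Suc m) = real k * (h / 2^m)" by simp
      then show "\<omega> \<in> dyadic_exit s h c (Suc m)"
        unfolding dyadic_exit_def using k by (intro CollectI conjI bexI[of _ "2 * k"]) simp_all
    qed
  qed
  have "(\<lambda>m. prob (dyadic_exit t h c m)) \<longlonglongrightarrow> prob (exits 0 h c)"
    using lim[of 0] by (simp add: prob_dyadic_exit[OF t])
  with lim[OF t(1)] show ?thesis by (rule LIMSEQ_unique)
qed

text \<open>Every \<open>s < t + h\<close> is a limit from the right of dyadic points of the
  interval, at which the bound holds. The endpoint has no such points to its right, but it is itself
  a grid point.\<close>

lemma not_exits_bound:
  assumes "cadlag (\<lambda>t. X t \<omega>)" "\<omega> \<in> space M" "\<omega> \<notin> exits t h c" "0 \<le> t" "0 < h" "t \<le> s" "s \<le> t + h"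
  shows "\<bar>X s \<omega> - X t \<omega>\<bar> \<le> c"
proof -
  have grid: "\<bar>X (t + real k * (h / 2^m)) \<omega> - X t \<omega>\<bar> \<le> c" if "k \<le> 2^m" for k m
  proof (rule ccontr)
    assume "\<not> \<bar>X (t + real k * (h / 2^m)) \<omega> - X t \<omega>\<bar> \<le> c"
    then have "\<omega> \<in> dyadic_exit t h c m"
      unfolding dyadic_exit_def using that assms(2) by (intro CollectI conjI bexI[of _ k]) auto
    then show False using assms(3) by (auto simp: exits_def)
  qed
  show ?thesis
  proof (cases "s = t + h")
    case True
    then show ?thesis using grid[of 1 0] by simp
  next
    case False
    define u where "u = (s - t) / h"
    have u: "0 \<le> u" "u < 1" using assms False by (auto simp: u_def)
    \<comment> \<open>The dyadic index just above the relative position \<open>u\<close> of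
      \<open>s\<close>; it stays at most \<open>2^m\<close> because \<open>u < 1\<close>.\<close>
    define k where "k m = nat (\<lfloor>2^m * u\<rfloor> + 1)" for m :: nat
    have k1: "2^m * u < real (k m)" "real (k m) \<le> 2^m * u + 1" for m
    proof -
      have "real (k m) = of_int (\<lfloor>2^m * u\<rfloor> + 1)" unfolding k_def using u by (intro of_nat_nat) auto
      then show "2^m * u < real (k m)" "real (k m) \<le> 2^m * u + 1" by linarith+
    qed
    have k2: "k m \<le> 2^m" for m
    proof -
      have "\<lfloor>2^m * u\<rfloor> < 2^m" using u by (simp add: floor_less_iff)
      then show ?thesis unfolding k_def by (simp add: nat_le_iff)
    qed
    define r where "r m = t + real (k m) * (h / 2^m)" for m
    have s_eq: "s = t + (2^m * u) * (h / 2^m)" for m :: nat using assms by (simp add: u_def)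
    have r1: "s \<le> r m" for m
      unfolding r_def by (subst s_eq[of m]) (use k1(1)[of m] assms(5) in \<open>intro add_left_mono mult_right_mono; simp\<close>)
    have r2: "r m \<le> s + h * (1/2)^m" for m
    proof -
      have "r m \<le> t + (2^m * u + 1) * (h / 2^m)"
        unfolding r_def using k1(2)[of m] assms(5) by (intro add_left_mono mult_right_mono) auto
      also have "\<dots> = s + h * (1/2)^m" by (subst s_eq[of m]) (simp add: field_simps power_one_over)
      finally show ?thesis .
    qed
    have "(\<lambda>m. s + h * (1/2)^m) \<longlonglongrightarrow> s + h * 0"
      by (intro tendsto_intros LIMSEQ_realpow_zero) auto
    then have up: "(\<lambda>m. s + h * (1/2)^m) \<longlonglongrightarrow> s" by simp
    have "r \<longlonglongrightarrow> s"
      by (rule tendsto_sandwich[OF always_eventually[OF allI[OF r1]] always_eventually[OF allI[OF r2]] tendsto_const up])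
    then have "(\<lambda>m. X (r m) \<omega>) \<longlonglongrightarrow> X s \<omega>"
      using assms r1 by (intro cadlag_seq_right[of "\<lambda>t. X t \<omega>"]) auto
    then have "(\<lambda>m. \<bar>X (r m) \<omega> - X t \<omega>\<bar>) \<longlonglongrightarrow> \<bar>X s \<omega> - X t \<omega>\<bar>"
      by (intro tendsto_intros)
    moreover have "\<bar>X (r m) \<omega> - X t \<omega>\<bar> \<le> c" for m
      unfolding r_def by (rule grid[OF k2])
    ultimately show ?thesis by (intro LIMSEQ_le_const2) auto
  qed
qed

text \<open>Right-continuity at time 0 keeps each path within \<open>c\<close> on a short enough
  interval, so the indicators vanish eventually; dominated convergence follows.\<close>

lemma prob_exits_tendsto_0:
  assumes "0 < c"
  shows "(\<lambda>n. prob (exits 0 (1 / real (Suc n)) c)) \<longlonglongrightarrow> 0"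
proof -
  have "(\<lambda>n. LINT \<omega>|M. indicat_real (exits 0 (1 / real (Suc n)) c) \<omega>) \<longlonglongrightarrow> (LINT \<omega>|M. 0)"
  proof (rule integral_dominated_convergence[where w = "\<lambda>_. 1"])
    show "AE \<omega> in M. (\<lambda>n. indicat_real (exits 0 (1 / real (Suc n)) c) \<omega>) \<longlonglongrightarrow> 0"
      using cadlag_paths
    proof eventually_elim
      case (elim \<omega>)
      have "\<exists>d>0. \<forall>s. 0 \<le> s \<and> s < 0 + d \<longrightarrow> \<bar>X s \<omega> - X 0 \<omega>\<bar> < c"
        by (rule cadlag_local_right[OF elim order_refl assms])
      then obtain d where d0: "d > 0" "\<forall>s. 0 \<le> s \<and> s < 0 + d \<longrightarrow> \<bar>X s \<omega> - X 0 \<omega>\<bar> < c"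
        by (elim exE conjE)
      have d: "0 < d" "\<bar>X s \<omega> - X 0 \<omega>\<bar> < c" if "0 \<le> s" "s < d" for s
        using d0 that by simp_all
      have "\<forall>\<^sub>F n in sequentially. 1 / real (Suc n) < d"
        by (rule order_tendstoD(2)[OF _ d0(1)]) (rule LIMSEQ_Suc[OF lim_1_over_n])
      then have "\<forall>\<^sub>F n in sequentially. indicat_real (exits 0 (1 / real (Suc n)) c) \<omega> = 0"
      proof eventually_elim
        case (elim n)
        have bound: "\<bar>X (0 + real k * (1 / real (Suc n) / 2^m)) \<omega> - X 0 \<omega>\<bar> < c" if "k \<le> 2^m" for k m
        proof -
          have "real k \<le> 2^m" using of_nat_mono[OF that, where 'a = real] by simp
          then have "real k * (1 / real (Suc n) / 2^m) \<le> 2^m * (1 / real (Suc n) / 2^m)"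
            by (intro mult_right_mono) auto
          also have "\<dots> < d" using elim by simp
          finally have lt: "0 + real k * (1 / real (Suc n) / 2^m) < d" by (simp only: add_0)
          have "0 \<le> 0 + real k * (1 / real (Suc n) / 2^m)" by simp
          then show ?thesis using lt by (rule d(2))
        qed
        have "\<omega> \<notin> exits 0 (1 / real (Suc n)) c"
        proof
          assume "\<omega> \<in> exits 0 (1 / real (Suc n)) c"
          then obtain m where "\<omega> \<in> dyadic_exit 0 (1 / real (Suc n)) c m" unfolding exits_def by blast
          then obtain k where "k \<le> 2^m" "\<bar>X (0 + real k * (1 / real (Suc n) / 2^m)) \<omega> - X 0 \<omega>\<bar> > c"
            unfolding dyadic_exit_def mem_Collect_eq by (elim conjE bexE) (simp only: atMost_iff)
          with bound[of k m] show False by linarith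
        qed
        then show ?case by simp
      qed
      then show ?case by (rule tendsto_eventually)
    qed
  qed (auto simp: indicator_def)
  then show ?thesis by (simp del: of_nat_Suc)
qed

section \<open>Finiteness of exponential moments\<close>

lemma past_measurable:
  assumes "0 \<le> s" "s \<le> t"
  shows "X s \<in> borel_measurable (sigma (space M) (cylinders M X t))"
proof -
  have sub: "cylinders M X t \<subseteq> Pow (space M)"
    using cylinders_events sets.sets_into_space by blast
  show ?thesis
  proof (rule measurableI)
    fix A :: "real set" assume "A \<in> sets borel"
    then have "X s -` A \<inter> space M \<in> sigma_sets (space M) (cylinders M X t)"
      using assms by (intro sigma_sets.Basic single_cylinder)
    then show "X s -` A \<inter> space (sigma (space M) (cylinders M X t)) \<in> sets (sigma (space M) (cylinders M X t))"
      using sub by (simp add: space_measure_of sets_measure_of)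
  qed auto
qed

text \<open>A Chernoff-type bound uniform in the mesh \<open>h\<close>: the partial sums of truncated increments are stopped
  when they first exceed 1, which is unlikely within time \<open>\<delta>\<close>. Since \<open>X\<close> has no positive jumps, the
  truncation disappears as the mesh tends to 0, and exponential moments turn out to be finite.\<close>

lemma truncated_moment_power_bound:
  fixes \<theta> \<delta> :: real and N :: nat
  assumes \<theta>: "0 \<le> \<theta>" and \<delta>: "0 < \<delta>" and small: "prob (exits 0 \<delta> 1) \<le> exp (- (2 * \<theta>)) / 2"
  defines "h \<equiv> \<delta> / 2^N"
  shows "(LINT \<omega>|M. exp (\<theta> * min (X h \<omega>) 1)) ^ (2^N) \<le> 2 * exp \<theta>"
proof -
  define n :: nat where "n = 2^N"
  have h: "0 \<le> h" using \<delta> by (simp add: h_def)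
  have meas_h: "X h \<in> borel_measurable M" using h by (rule measurable_process)
  define S where "S k \<omega> = (\<Sum>i<k. min (inc h i \<omega>) 1)" for k \<omega>
  \<comment> \<open>The truncated partial sums have not yet exceeded 1 up to step \<open>k\<close>;
    \<open>B k\<close> depends on the past only.\<close>
  define B where "B k = {\<omega> \<in> space M. \<forall>j\<in>{..k}. S j \<omega> \<le> 1}" for k
  define c where "c = (LINT \<omega>|M. exp (\<theta> * min (X h \<omega>) 1))"
  define a where "a k = (LINT \<omega>|M. indicator (B k) \<omega> * exp (\<theta> * S k \<omega>))" for k
  define F where "F k = sigma (space M) (cylinders M X (real k * h))" for k
  have space_F: "space (F k) = space M" for k unfolding F_def by (rule space_measure_of_conv)
  have S_meas: "S k \<in> borel_measurable M" for k unfolding S_def using h by measurable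
  have S_F: "S j \<in> borel_measurable (F k)" if "j \<le> k" for j k
    unfolding S_def inc_def F_def
  proof (intro borel_measurable_sum borel_measurable_min borel_measurable_diff borel_measurable_const past_measurable)
    fix i assume "i \<in> {..<j}"
    then have "real (Suc i) \<le> real k" "real i \<le> real k" using that by auto
    then show "real (Suc i) * h \<le> real k * h" "real i * h \<le> real k * h"
      using h by (auto intro!: mult_right_mono simp del: of_nat_Suc)
  qed (use h in auto)
  have B_events: "B k \<in> events" for k
    unfolding B_def using S_meas by (intro sets.sets_Collect_finite_All) auto
  have B_F: "B k \<in> sets (F k)" for k
  proof -
    have "{\<omega> \<in> space (F k). \<forall>j\<in>{..k}. S j \<omega> \<le> 1} \<in> sets (F k)"
      using S_F by (intro sets.sets_Collect_finite_All) auto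
    then show ?thesis by (simp add: space_F B_def)
  qed
  have B_Suc: "B (Suc k) \<subseteq> B k" for k unfolding B_def by auto
  have int_a: "integrable M (\<lambda>\<omega>. indicator (B k) \<omega> * exp (\<theta> * S k \<omega>))" for k
  proof (rule integrable_const_bound[where B = "exp \<theta>"])
    have "indicator (B k) \<omega> * exp (\<theta> * S k \<omega>) \<le> exp \<theta>" for \<omega>
      using \<theta> by (auto simp: indicator_def B_def mult_left_le)
    then show "AE \<omega> in M. norm (indicator (B k) \<omega> * exp (\<theta> * S k \<omega>)) \<le> exp \<theta>"
      by (auto simp: abs_mult)
    show "(\<lambda>\<omega>. indicator (B k) \<omega> * exp (\<theta> * S k \<omega>)) \<in> borel_measurable M"
      using B_events S_meas by measurable
  qed
  have a_le: "a k \<le> exp \<theta>" for k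
  proof -
    have "a k \<le> (LINT \<omega>|M. exp \<theta>)"
      unfolding a_def
    proof (rule integral_mono[OF int_a])
      show "indicator (B k) \<omega> * exp (\<theta> * S k \<omega>) \<le> exp \<theta>" for \<omega>
        using \<theta> by (auto simp: indicator_def B_def mult_left_le)
    qed simp
    then show ?thesis by (simp add: prob_space)
  qed
  have int_c: "integrable M (\<lambda>\<omega>. exp (\<theta> * min (X h \<omega>) 1))"
  proof (rule integrable_const_bound[where B = "exp \<theta>"])
    have "\<theta> * min (X h \<omega>) 1 \<le> \<theta>" for \<omega> using \<theta> by (auto intro: mult_left_le)
    then show "AE \<omega> in M. norm (exp (\<theta> * min (X h \<omega>) 1)) \<le> exp \<theta>" by auto
  qed (use meas_h in measurable)
  \<comment> \<open>The independent next increment contributes the factor \<open>c\<close>. A sum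
    that was at most 1 is at most 2 after a truncated increment, so the paths leaving
    \<open>B\<close> at this step cost at most \<open>exp (2 * \<theta>)\<close> times their
    probability.\<close>
  have step: "a k * c \<le> a (Suc k) + exp (2 * \<theta>) * (prob (B k) - prob (B (Suc k)))" for k
  proof -
    have "a k * c = (LINT \<omega>|M. (indicator (B k) \<omega> * exp (\<theta> * S k \<omega>)) *
        exp (\<theta> * min (X (real k * h + h) \<omega> - X (real k * h) \<omega>) 1))"
      unfolding a_def c_def
    proof (rule integral_past_times_increment[symmetric, where g = "\<lambda>x. exp (\<theta> * min x 1)"])
      show "(\<lambda>\<omega>. indicator (B k) \<omega> * exp (\<theta> * S k \<omega>)) \<in> borel_measurable (sigma (space M) (cylinders M X (real k * h)))"
        using B_F[of k] S_F[of k k] unfolding F_def[symmetric] by measurable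
    qed (use h int_a int_c in auto)
    also have "\<dots> = (LINT \<omega>|M. indicator (B k) \<omega> * exp (\<theta> * S (Suc k) \<omega>))"
    proof (rule Bochner_Integration.integral_cong[OF refl])
      fix \<omega>
      have "real k * h + h = real (Suc k) * h" by (simp add: algebra_simps)
      then have m: "min (X (real k * h + h) \<omega> - X (real k * h) \<omega>) 1 = S (Suc k) \<omega> - S k \<omega>"
        by (simp add: S_def inc_def del: of_nat_Suc)
      show "(indicator (B k) \<omega> * exp (\<theta> * S k \<omega>)) *
        exp (\<theta> * min (X (real k * h + h) \<omega> - X (real k * h) \<omega>) 1) = indicator (B k) \<omega> * exp (\<theta> * S (Suc k) \<omega>)"
        by (simp only: m mult.assoc exp_add[symmetric]) (simp add: algebra_simps)
    qed
    also have "\<dots> \<le> (LINT \<omega>|M. indicator (B (Suc k)) \<omega> * exp (\<theta> * S (Suc k) \<omega>) +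
        exp (2 * \<theta>) * (indicator (B k) \<omega> - indicator (B (Suc k)) \<omega>))"
    proof (rule integral_mono')
      show "integrable M (\<lambda>\<omega>. indicator (B (Suc k)) \<omega> * exp (\<theta> * S (Suc k) \<omega>) +
        exp (2 * \<theta>) * (indicator (B k) \<omega> - indicator (B (Suc k)) \<omega>))"
        using int_a[of "Suc k"] B_events[of k] B_events[of "Suc k"]
        by (intro Bochner_Integration.integrable_add integrable_mult_right Bochner_Integration.integrable_diff integrable_real_indicator)
           (auto simp: less_top[symmetric])
      fix \<omega> assume "\<omega> \<in> space M"
      show "indicator (B k) \<omega> * exp (\<theta> * S (Suc k) \<omega>) \<le> indicator (B (Suc k)) \<omega> * exp (\<theta> * S (Suc k) \<omega>) +
        exp (2 * \<theta>) * (indicator (B k) \<omega> - indicator (B (Suc k)) \<omega>)"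
      proof (cases "\<omega> \<in> B k")
        case True
        then have "S k \<omega> \<le> 1" by (auto simp: B_def)
        moreover have "S (Suc k) \<omega> = S k \<omega> + min (inc h k \<omega>) 1" by (simp add: S_def)
        ultimately have "S (Suc k) \<omega> \<le> 2" by linarith
        then have "\<theta> * S (Suc k) \<omega> \<le> 2 * \<theta>" using mult_left_mono[of "S (Suc k) \<omega>" 2 \<theta>] \<theta> by (simp add: mult.commute)
        then show ?thesis using True by (auto simp: indicator_def)
      next
        case False
        then show ?thesis using B_Suc[of k] by (auto simp: indicator_def)
      qed
      show "0 \<le> indicator (B (Suc k)) \<omega> * exp (\<theta> * S (Suc k) \<omega>) +
        exp (2 * \<theta>) * (indicator (B k) \<omega> - indicator (B (Suc k)) \<omega>)"
        using B_Suc[of k] by (auto simp: indicator_def)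
    qed
    also have "\<dots> = a (Suc k) + exp (2 * \<theta>) * (prob (B k) - prob (B (Suc k)))"
      unfolding a_def using int_a[of "Suc k"] B_events[of k] B_events[of "Suc k"]
      by (simp add: less_top[symmetric])
    finally show ?thesis .
  qed
  have probBn: "prob (B n) \<ge> 1 - exp (- (2 * \<theta>)) / 2"
  proof -
    have "space M - exits 0 \<delta> 1 \<subseteq> B n"
    proof
      fix \<omega> assume \<omega>: "\<omega> \<in> space M - exits 0 \<delta> 1"
      have "S j \<omega> \<le> 1" if "j \<le> n" for j
      proof -
        have "S j \<omega> \<le> (\<Sum>i<j. inc h i \<omega>)" unfolding S_def by (intro sum_mono) auto
        also have "\<dots> = X (real j * h) \<omega> - X (real 0 * h) \<omega>"
          unfolding inc_def by (rule sum_lessThan_telescope)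
        also have "\<dots> \<le> 1"
        proof (rule ccontr)
          assume "\<not> X (real j * h) \<omega> - X (real 0 * h) \<omega> \<le> 1"
          then have "\<omega> \<in> dyadic_exit 0 \<delta> 1 N"
            using \<omega> that unfolding dyadic_exit_def by (intro CollectI conjI bexI[of _ j]) (auto simp: h_def n_def)
          then show False using \<omega> by (auto simp: exits_def)
        qed
        finally show ?thesis .
      qed
      then show "\<omega> \<in> B n" using \<omega> by (auto simp: B_def)
    qed
    then have "prob (space M - exits 0 \<delta> 1) \<le> prob (B n)"
      using B_events by (intro finite_measure_mono) auto
    moreover have "prob (space M - exits 0 \<delta> 1) = 1 - prob (exits 0 \<delta> 1)"
      using \<delta> by (intro prob_compl exits_events) auto
    ultimately show ?thesis using small by simp
  qed
  have "c ^ n \<le> 2 * exp \<theta>"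
  proof (cases "c \<ge> 1")
    case True
    \<comment> \<open>Dividing by \<open>c ^ k\<close> with \<open>c \<ge> 1\<close> only shrinks
      the error terms, which then telescope to the probability of having left
      \<open>B\<close>.\<close>
    have lower: "a k / c ^ k \<ge> 1 - exp (2 * \<theta>) * (1 - prob (B k))" for k
    proof (induction k)
      case 0
      have "B 0 = space M" by (auto simp: B_def S_def)
      then show ?case by (simp add: a_def S_def prob_space)
    next
      case (Suc k)
      define d where "d = exp (2 * \<theta>) * (prob (B k) - prob (B (Suc k)))"
      have d: "d \<ge> 0" unfolding d_def using B_Suc B_events by (intro mult_nonneg_nonneg) (auto intro: finite_measure_mono)
      have "a k / c ^ k = a k * c / c ^ Suc k" using True by simp
      also have "\<dots> \<le> (a (Suc k) + d) / c ^ Suc k"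
        using step[of k] True unfolding d_def by (intro divide_right_mono) auto
      also have "\<dots> = a (Suc k) / c ^ Suc k + d / c ^ Suc k" by (rule add_divide_distrib)
      also have "d / c ^ Suc k \<le> d / 1"
        using d True by (intro divide_left_mono one_le_power) auto
      finally have "a k / c ^ k \<le> a (Suc k) / c ^ Suc k + d" by simp
      then show ?case using Suc.IH by (simp add: d_def algebra_simps)
    qed
    \<comment> \<open>The bound assumed in \<open>small\<close> is the one that turns the total loss
      into one half.\<close>
    have "exp (2 * \<theta>) * (1 - prob (B n)) \<le> exp (2 * \<theta>) * (exp (- (2 * \<theta>)) / 2)"
      using probBn by (intro mult_left_mono) auto
    also have "\<dots> = 1 / 2" by (simp add: exp_add[symmetric])
    finally have "1 / 2 \<le> a n / c ^ n" using lower[of n] by linarith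
    also have "\<dots> \<le> exp \<theta> / c ^ n" using a_le[of n] True by (intro divide_right_mono) auto
    finally show ?thesis using True by (simp add: field_simps)
  next
    case False
    have "0 \<le> c" unfolding c_def by (intro integral_nonneg_AE) auto
    then have "c ^ n \<le> 1" using False by (intro power_le_one) auto
    also have "1 \<le> 2 * exp \<theta>" using exp_ge_add_one_self[of \<theta>] \<theta> by linarith
    finally show ?thesis .
  qed
  then show ?thesis unfolding c_def n_def .
qed

end

context spectrally_negative_levy_process
begin

text \<open>One exceptional null set serves all horizons, thresholds and meshes at once: outside it
  the statement follows path by path from \<open>cadlag_no_positive_jumps_increment\<close>.\<close>

lemma AE_small_increments:
  "AE \<omega> in M. \<forall>T c. c > 0 \<longrightarrow> (\<exists>d>0. \<forall>h k. 0 \<le> h \<and> h < d \<and> real (Suc k) * h \<le> T \<longrightarrow> inc h k \<omega> \<le> c)"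
  using cadlag_paths no_positive_jumps
proof eventually_elim
  case (elim \<omega>)
  show ?case
  proof (intro allI impI)
    fix T c :: real assume "c > 0"
    have "\<exists>d>0. \<forall>s s'. 0 \<le> s \<and> s \<le> s' \<and> s' \<le> T \<and> s' - s < d \<longrightarrow> X s' \<omega> - X s \<omega> \<le> c"
      by (rule cadlag_no_positive_jumps_increment[OF elim(1) elim(2)[rule_format] \<open>c > 0\<close>])
    then obtain d where d: "d > 0" "\<forall>s s'. 0 \<le> s \<and> s \<le> s' \<and> s' \<le> T \<and> s' - s < d \<longrightarrow> X s' \<omega> - X s \<omega> \<le> c"
      by (elim exE conjE)
    have "inc h k \<omega> \<le> c" if "0 \<le> h" "h < d" "real (Suc k) * h \<le> T" for h k
      unfolding inc_def using that by (intro d(2)[rule_format]) (auto simp: algebra_simps)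
    then show "\<exists>d>0. \<forall>h k. 0 \<le> h \<and> h < d \<and> real (Suc k) * h \<le> T \<longrightarrow> inc h k \<omega> \<le> c"
      using d(1) by (intro exI[of _ d]) simp
  qed
qed

text \<open>For a path without positive jumps the truncation of increments at 1 has no effect once
  the mesh is fine. Fatou's lemma therefore carries the uniform bound
  \<open>2 * exp \<theta>\<close> over to \<open>X \<delta>\<close>, for a small
  \<open>\<delta>\<close> with \<open>1 / \<delta>\<close> an integer, and \<open>X 1\<close> is a
  sum of independent copies of \<open>X \<delta>\<close>.\<close>

lemma exp_moment_finite:
  assumes \<theta>: "0 \<le> \<theta>"
  shows "integrable M (\<lambda>\<omega>. exp (\<theta> * X 1 \<omega>))"
proof -
  have "\<forall>\<^sub>F n in sequentially. prob (exits 0 (1 / real (Suc n)) 1) < exp (- (2 * \<theta>)) / 2"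
    using prob_exits_tendsto_0[of 1] by (rule order_tendstoD(2)) auto
  then obtain m where m: "prob (exits 0 (1 / real (Suc m)) 1) < exp (- (2 * \<theta>)) / 2"
    by (auto simp: eventually_sequentially)
  define \<delta> where "\<delta> = 1 / real (Suc m)"
  have \<delta>: "0 < \<delta>" by (simp add: \<delta>_def)
  have meas [measurable]: "X t \<in> borel_measurable M" if "0 \<le> t" for t using that by (rule measurable_process)
  define G where "G N \<omega> = (\<Prod>i<2^N. exp (\<theta> * min (inc (\<delta> / 2^N) i \<omega>) 1))" for N :: nat and \<omega>
  have G_meas: "(\<lambda>\<omega>. ennreal (G N \<omega>)) \<in> borel_measurable M" for N
  proof -
    have [measurable]: "inc (\<delta> / 2^N) i \<in> borel_measurable M" for i
      using \<delta> by (intro inc_measurable) simp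
    show ?thesis unfolding G_def by measurable
  qed
  have G_bound: "(\<integral>\<^sup>+\<omega>. ennreal (G N \<omega>) \<partial>M) \<le> ennreal (2 * exp \<theta>)" for N
  proof -
    define h where "h = \<delta> / 2^N"
    have h: "0 \<le> h" using \<delta> by (simp add: h_def)
    have "(\<integral>\<^sup>+\<omega>. ennreal (G N \<omega>) \<partial>M) = (\<integral>\<^sup>+\<omega>. ennreal (exp (\<theta> * min (X h \<omega>) 1)) \<partial>M) ^ (2^N)"
      unfolding G_def h_def[symmetric] using h by (intro nn_integral_prod_inc) auto
    also have "(\<integral>\<^sup>+\<omega>. ennreal (exp (\<theta> * min (X h \<omega>) 1)) \<partial>M) = ennreal (LINT \<omega>|M. exp (\<theta> * min (X h \<omega>) 1))"
    proof (rule nn_integral_eq_integral)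
      show "integrable M (\<lambda>\<omega>. exp (\<theta> * min (X h \<omega>) 1))"
      proof (rule integrable_const_bound[where B = "exp \<theta>"])
        have "\<theta> * min (X h \<omega>) 1 \<le> \<theta>" for \<omega> using \<theta> by (auto intro: mult_left_le)
        then show "AE \<omega> in M. norm (exp (\<theta> * min (X h \<omega>) 1)) \<le> exp \<theta>" by auto
      qed (use meas[OF h] in measurable)
    qed auto
    also have "ennreal (LINT \<omega>|M. exp (\<theta> * min (X h \<omega>) 1)) ^ (2^N) = ennreal ((LINT \<omega>|M. exp (\<theta> * min (X h \<omega>) 1)) ^ (2^N))"
      by (intro ennreal_power integral_nonneg_AE) auto
    also have "\<dots> \<le> ennreal (2 * exp \<theta>)"
      unfolding h_def using truncated_moment_power_bound[OF \<theta> \<delta>] m by (intro ennreal_leI) (auto simp: \<delta>_def)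
    finally show ?thesis .
  qed
  \<comment> \<open>The products are eventually constant in \<open>N\<close>, so their lower limit
    is their actual limit.\<close>
  have lim: "AE \<omega> in M. ennreal (exp (\<theta> * X \<delta> \<omega>)) = liminf (\<lambda>N. ennreal (G N \<omega>))"
    using AE_small_increments AE_sum_inc
  proof eventually_elim
    case (elim \<omega>)
    obtain d where d: "d > 0" "\<forall>h k. 0 \<le> h \<and> h < d \<and> real (Suc k) * h \<le> \<delta> \<longrightarrow> inc h k \<omega> \<le> 1"
      using elim(1)[rule_format, of 1 \<delta>] by auto
    have "(\<lambda>N. \<delta> * (1/2)^N) \<longlonglongrightarrow> \<delta> * 0"
      by (intro tendsto_intros LIMSEQ_realpow_zero) auto
    then have "\<forall>\<^sub>F N in sequentially. \<delta> * (1/2)^N < d"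
      by (rule order_tendstoD(2)) (use d(1) in simp)
    then have "\<forall>\<^sub>F N in sequentially. ennreal (G N \<omega>) = ennreal (exp (\<theta> * X \<delta> \<omega>))"
    proof eventually_elim
      case (elim N)
      define h where "h = \<delta> / 2^N"
      have h: "0 \<le> h" "h < d" using \<delta> elim by (auto simp: h_def power_one_over field_simps)
      have "inc h i \<omega> \<le> 1" if "i < 2^N" for i
      proof (rule d(2)[rule_format], intro conjI)
        have "real (Suc i) \<le> 2^N"
          using that of_nat_mono[of "Suc i" "2^N", where 'a = real] by (simp del: of_nat_Suc)
        then have "real (Suc i) * h \<le> 2^N * h" using h by (intro mult_right_mono) auto
        also have "\<dots> = \<delta>" by (simp add: h_def)
        finally show "real (Suc i) * h \<le> \<delta>" .
      qed (use h in auto)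
      then have "G N \<omega> = (\<Prod>i<2^N. exp (\<theta> * inc h i \<omega>))"
        unfolding G_def h_def[symmetric] by (intro prod.cong) (auto simp: min_absorb1)
      also have "\<dots> = exp (\<theta> * (\<Sum>i<2^N. inc h i \<omega>))"
        by (simp add: exp_sum sum_distrib_left)
      also have "(\<Sum>i<2^N. inc h i \<omega>) = X (real (2^N) * h) \<omega>" using \<open>\<forall>h n. (\<Sum>i<n. inc h i \<omega>) = X (real n * h) \<omega>\<close> by blast
      also have "real (2^N) * h = \<delta>" by (simp add: h_def)
      finally show ?case by simp
    qed
    then have "(\<lambda>N. ennreal (G N \<omega>)) \<longlonglongrightarrow> ennreal (exp (\<theta> * X \<delta> \<omega>))"
      by (rule tendsto_eventually)
    then show ?case by (intro lim_imp_Liminf[symmetric]) auto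
  qed
  have "(\<integral>\<^sup>+\<omega>. ennreal (exp (\<theta> * X \<delta> \<omega>)) \<partial>M) = (\<integral>\<^sup>+\<omega>. liminf (\<lambda>N. ennreal (G N \<omega>)) \<partial>M)"
    by (rule nn_integral_cong_AE[OF lim])
  also have "\<dots> \<le> liminf (\<lambda>N. \<integral>\<^sup>+\<omega>. ennreal (G N \<omega>) \<partial>M)"
    by (rule nn_integral_liminf[OF G_meas])
  also have "\<dots> \<le> liminf (\<lambda>N::nat. ennreal (2 * exp \<theta>))"
    by (intro Liminf_mono always_eventually allI G_bound)
  also have "\<dots> < \<infinity>" by (simp add: Liminf_const)
  finally have fin: "(\<integral>\<^sup>+\<omega>. ennreal (exp (\<theta> * X \<delta> \<omega>)) \<partial>M) < \<infinity>" .
  have "(\<integral>\<^sup>+\<omega>. ennreal (exp (\<theta> * X 1 \<omega>)) \<partial>M) = (\<integral>\<^sup>+\<omega>. ennreal (\<Prod>i<Suc m. exp (\<theta> * inc \<delta> i \<omega>)) \<partial>M)"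
  proof (rule nn_integral_cong_AE)
    show "AE \<omega> in M. ennreal (exp (\<theta> * X 1 \<omega>)) = ennreal (\<Prod>i<Suc m. exp (\<theta> * inc \<delta> i \<omega>))"
      using AE_sum_inc
    proof eventually_elim
      case (elim \<omega>)
      have "real (Suc m) * \<delta> = 1" by (simp add: \<delta>_def)
      then have "(\<Sum>i<Suc m. inc \<delta> i \<omega>) = X 1 \<omega>" using elim by metis
      moreover have "(\<Prod>i<Suc m. exp (\<theta> * inc \<delta> i \<omega>)) = exp (\<theta> * (\<Sum>i<Suc m. inc \<delta> i \<omega>))"
        by (simp only: exp_sum[OF finite_lessThan] sum_distrib_left)
      ultimately show ?case by simp
    qed
  qed
  also have "\<dots> = (\<integral>\<^sup>+\<omega>. ennreal (exp (\<theta> * X \<delta> \<omega>)) \<partial>M) ^ Suc m"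
    using \<delta> by (intro nn_integral_prod_inc) auto
  also have "\<dots> < \<infinity>" using fin by (simp add: power_less_top_ennreal del: power_Suc)
  finally show ?thesis by (intro integrableI_nonneg) auto
qed

section \<open>The Laplace exponent and its right inverse\<close>

abbreviation "\<psi> \<equiv> laplace_exponent M X"

text \<open>Inverting the logarithm requires a positive mean; it is positive since an integrable,
  everywhere positive function cannot have integral 0.\<close>

lemma exp_laplace_exponent:
  assumes "0 \<le> \<theta>"
  shows "exp (\<psi> \<theta>) = (LINT \<omega>|M. exp (\<theta> * X 1 \<omega>))"
proof -
  have "(LINT \<omega>|M. exp (\<theta> * X 1 \<omega>)) \<noteq> 0"
  proof
    assume "(LINT \<omega>|M. exp (\<theta> * X 1 \<omega>)) = 0"
    then have "AE \<omega> in M. exp (\<theta> * X 1 \<omega>) = 0"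
      by (subst (asm) integral_nonneg_eq_0_iff_AE[OF exp_moment_finite[OF assms]]) auto
    then show False by simp
  qed
  moreover have "0 \<le> (LINT \<omega>|M. exp (\<theta> * X 1 \<omega>))" by (intro integral_nonneg_AE) auto
  ultimately have "0 < (LINT \<omega>|M. exp (\<theta> * X 1 \<omega>))" by (metis less_le)
  then show ?thesis unfolding laplace_exponent_def by (rule exp_ln)
qed

lemma laplace_exponent_0: "\<psi> 0 = 0"
  unfolding laplace_exponent_def by (simp add: prob_space)

lemma prod_exp_inc: "(\<Prod>i<n. exp (\<theta> * inc h i \<omega>)) = exp (\<theta> * (\<Sum>i<n. inc h i \<omega>))"
  by (simp add: exp_sum sum_distrib_left)

lemma AE_sum_inc_unit:
  "AE \<omega> in M. \<forall>n>0. (\<Sum>i<n. inc (1 / real n) i \<omega>) = X 1 \<omega>"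
  using AE_sum_inc
proof eventually_elim
  case (elim \<omega>)
  show ?case
  proof (intro allI impI)
    fix n :: nat assume "n > 0"
    then have "real n * (1 / real n) = 1" by simp
    then show "(\<Sum>i<n. inc (1 / real n) i \<omega>) = X 1 \<omega>"
      using elim[rule_format, of "1 / real n" n] by (simp only:)
  qed
qed

text \<open>The mean for \<open>X 1\<close> is the \<open>n\<close>-th power of the mean for
  \<open>X (1 / n)\<close>, so finiteness passes to the factor and its value is the nonnegative
  root. Times \<open>1 / n\<close> are exactly the grid steps used later.\<close>

lemma
  assumes \<theta>: "0 \<le> \<theta>" and n: "n > 0"
  shows exp_moment_grid: "integrable M (\<lambda>\<omega>. exp (\<theta> * X (1 / real n) \<omega>))"
    and mgf_grid: "(LINT \<omega>|M. exp (\<theta> * X (1 / real n) \<omega>)) = exp (\<psi> \<theta> / real n)"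
proof -
  define h where "h = 1 / real n"
  have h: "0 \<le> h" by (simp add: h_def)
  have meas [measurable]: "X h \<in> borel_measurable M" using h by (rule measurable_process)
  have "(\<integral>\<^sup>+\<omega>. ennreal (exp (\<theta> * X h \<omega>)) \<partial>M) ^ n = (\<integral>\<^sup>+\<omega>. ennreal (\<Prod>i<n. exp (\<theta> * inc h i \<omega>)) \<partial>M)"
    using h by (intro nn_integral_prod_inc[symmetric]) auto
  also have "\<dots> = (\<integral>\<^sup>+\<omega>. ennreal (exp (\<theta> * X 1 \<omega>)) \<partial>M)"
    unfolding prod_exp_inc h_def
  proof (rule nn_integral_cong_AE)
    show "AE \<omega> in M. ennreal (exp (\<theta> * (\<Sum>i<n. inc (1 / real n) i \<omega>))) = ennreal (exp (\<theta> * X 1 \<omega>))"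
      using AE_sum_inc_unit by eventually_elim (use n in simp)
  qed
  also have "\<dots> = ennreal (exp (\<psi> \<theta>))"
    using exp_laplace_exponent[OF \<theta>] by (subst nn_integral_eq_integral[OF exp_moment_finite[OF \<theta>]]) auto
  finally have pow: "(\<integral>\<^sup>+\<omega>. ennreal (exp (\<theta> * X h \<omega>)) \<partial>M) ^ n = ennreal (exp (\<psi> \<theta>))" .
  have "(\<integral>\<^sup>+\<omega>. ennreal (exp (\<theta> * X h \<omega>)) \<partial>M) < \<infinity>"
  proof (rule ccontr)
    assume "\<not> (\<integral>\<^sup>+\<omega>. ennreal (exp (\<theta> * X h \<omega>)) \<partial>M) < \<infinity>"
    then have "(\<integral>\<^sup>+\<omega>. ennreal (exp (\<theta> * X h \<omega>)) \<partial>M) = \<top>" by (simp add: not_less top_unique)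
    then show False using pow n by (simp add: power_top_ennreal)
  qed
  then have int: "integrable M (\<lambda>\<omega>. exp (\<theta> * X h \<omega>))"
    by (intro integrableI_nonneg) auto
  then show "integrable M (\<lambda>\<omega>. exp (\<theta> * X (1 / real n) \<omega>))" by (simp add: h_def)
  let ?E = "LINT \<omega>|M. exp (\<theta> * X h \<omega>)"
  have E0: "0 \<le> ?E" by (intro integral_nonneg_AE) auto
  have "ennreal (?E ^ n) = ennreal (exp (\<psi> \<theta>))"
    using pow nn_integral_eq_integral[OF int] E0 by (simp add: ennreal_power)
  then have "?E ^ n = exp (\<psi> \<theta>)" using E0 by simp
  also have "\<dots> = exp (\<psi> \<theta> / real n) ^ n" using n by (simp add: exp_of_nat_mult[symmetric])
  finally have "?E = exp (\<psi> \<theta> / real n)"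
    using E0 n by (intro power_eq_imp_eq_base[of ?E n]) auto
  then show "(LINT \<omega>|M. exp (\<theta> * X (1 / real n) \<omega>)) = exp (\<psi> \<theta> / real n)" by (simp add: h_def)
qed

text \<open>The infinitesimal form of the absence of positive jumps: large upward moves in time
  \<open>h\<close> carry exponential mass \<open>o(h)\<close>. Split the one-step mean
  \<open>\<kappa>\<close> into the part \<open>u\<close> with increment at most \<open>c\<close> and
  the rest \<open>b\<close>. Both \<open>u ^ Suc n\<close> and \<open>\<kappa> ^ Suc n\<close> tend
  to \<open>exp (\<psi> \<theta>)\<close>, and the powers can agree in the limit only if
  \<open>b\<close> is \<open>o(1 / n)\<close>.\<close>

lemma exp_moment_exceed_tendsto_0:
  assumes \<theta>: "0 \<le> \<theta>" and c: "0 < c"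
  shows "(\<lambda>n. real (Suc n) * (LINT \<omega>|M. exp (\<theta> * X (1 / real (Suc n)) \<omega>) * indicator {c<..} (X (1 / real (Suc n)) \<omega>)))
     \<longlonglongrightarrow> 0"
proof -
  define h where "h n = 1 / real (Suc n)" for n
  have h: "0 \<le> h n" for n by (simp add: h_def)
  have meas [measurable]: "X t \<in> borel_measurable M" if "0 \<le> t" for t using that by (rule measurable_process)
  have meas_h [measurable]: "X (h n) \<in> borel_measurable M" for n using h by (rule measurable_process)
  define g where "g x = exp (\<theta> * x) * indicator {..c} x" for x :: real
  have g0: "0 \<le> g x" for x by (simp add: g_def)
  have [measurable]: "g \<in> borel_measurable borel" unfolding g_def by measurable
  define u where "u n = (LINT \<omega>|M. g (X (h n) \<omega>))" for n
  define b where "b n = (LINT \<omega>|M. exp (\<theta> * X (h n) \<omega>) * indicator {c<..} (X (h n) \<omega>))" for n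
  define \<kappa> where "\<kappa> n = exp (\<psi> \<theta> * h n)" for n
  have int_exp: "integrable M (\<lambda>\<omega>. exp (\<theta> * X (h n) \<omega>))" for n
    unfolding h_def by (rule exp_moment_grid[OF \<theta>]) simp
  have int_g: "integrable M (\<lambda>\<omega>. g (X (h n) \<omega>))" for n
    by (rule Bochner_Integration.integrable_bound[OF int_exp[of n]]) (auto simp: g_def indicator_def)
  have int_b: "integrable M (\<lambda>\<omega>. exp (\<theta> * X (h n) \<omega>) * indicator {c<..} (X (h n) \<omega>))" for n
    by (rule Bochner_Integration.integrable_bound[OF int_exp[of n]]) (auto simp: indicator_def)
  have ub: "u n + b n = \<kappa> n" for n
  proof -
    have "u n + b n = (LINT \<omega>|M. g (X (h n) \<omega>) + exp (\<theta> * X (h n) \<omega>) * indicator {c<..} (X (h n) \<omega>))"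
      unfolding u_def b_def by (rule Bochner_Integration.integral_add[symmetric, OF int_g int_b])
    also have "\<dots> = (LINT \<omega>|M. exp (\<theta> * X (h n) \<omega>))"
      by (rule Bochner_Integration.integral_cong[OF refl]) (auto simp: g_def indicator_def)
    also have "\<dots> = \<kappa> n" unfolding h_def \<kappa>_def using mgf_grid[OF \<theta>, of "Suc n"] by (simp del: of_nat_Suc)
    finally show ?thesis .
  qed
  have b0: "0 \<le> b n" for n unfolding b_def by (intro integral_nonneg_AE) auto
  have u0: "0 \<le> u n" for n unfolding u_def by (intro integral_nonneg_AE) (auto simp: g0)
  have pow: "u n ^ Suc n = (LINT \<omega>|M. (\<Prod>i<Suc n. g (inc (h n) i \<omega>)))" for n
  proof -
    have P0: "0 \<le> (\<Prod>i<Suc n. g (inc (h n) i \<omega>))" for \<omega> by (intro prod_nonneg ballI g0)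
    have eq: "(\<integral>\<^sup>+\<omega>. ennreal (\<Prod>i<Suc n. g (inc (h n) i \<omega>)) \<partial>M) = ennreal (u n ^ Suc n)"
    proof -
      have "(\<integral>\<^sup>+\<omega>. ennreal (\<Prod>i<Suc n. g (inc (h n) i \<omega>)) \<partial>M) = (\<integral>\<^sup>+\<omega>. ennreal (g (X (h n) \<omega>)) \<partial>M) ^ Suc n"
        by (rule nn_integral_prod_inc[OF h _ g0]) measurable
      also have "(\<integral>\<^sup>+\<omega>. ennreal (g (X (h n) \<omega>)) \<partial>M) = ennreal (u n)"
        unfolding u_def by (rule nn_integral_eq_integral[OF int_g]) (simp add: g0)
      finally show ?thesis using u0[of n] by (simp only: ennreal_power)
    qed
    have "(LINT \<omega>|M. (\<Prod>i<Suc n. g (inc (h n) i \<omega>))) = enn2real (\<integral>\<^sup>+\<omega>. ennreal (\<Prod>i<Suc n. g (inc (h n) i \<omega>)) \<partial>M)"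
    proof (rule integral_eq_nn_integral)
      have [measurable]: "inc (h n) i \<in> borel_measurable M" for i by (rule inc_measurable[OF h])
      show "(\<lambda>\<omega>. \<Prod>i<Suc n. g (inc (h n) i \<omega>)) \<in> borel_measurable M" by measurable
    qed (use P0 in simp)
    then show ?thesis unfolding eq using u0[of n] by (simp only: enn2real_ennreal zero_le_power)
  qed
  have "(\<lambda>n. LINT \<omega>|M. (\<Prod>i<Suc n. g (inc (h n) i \<omega>))) \<longlonglongrightarrow> (LINT \<omega>|M. exp (\<theta> * X 1 \<omega>))"
  proof (rule integral_dominated_convergence[where w = "\<lambda>\<omega>. exp (\<theta> * X 1 \<omega>)"])
    have [measurable]: "inc (h n) i \<in> borel_measurable M" for i n by (rule inc_measurable[OF h])
    show "(\<lambda>\<omega>. \<Prod>i<Suc n. g (inc (h n) i \<omega>)) \<in> borel_measurable M" for n by measurable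
    show "AE \<omega> in M. norm (\<Prod>i<Suc n. g (inc (h n) i \<omega>)) \<le> exp (\<theta> * X 1 \<omega>)" for n
      using AE_sum_inc_unit
    proof eventually_elim
      case (elim \<omega>)
      have "norm (\<Prod>i<Suc n. g (inc (h n) i \<omega>)) = (\<Prod>i<Suc n. g (inc (h n) i \<omega>))"
        using prod_nonneg[of "{..<Suc n}" "\<lambda>i. g (inc (h n) i \<omega>)"] g0 by simp
      also have "\<dots> \<le> (\<Prod>i<Suc n. exp (\<theta> * inc (h n) i \<omega>))"
        using g0 by (intro prod_mono) (auto simp: g_def indicator_def)
      also have "\<dots> = exp (\<theta> * X 1 \<omega>)"
        unfolding prod_exp_inc h_def using elim[rule_format, of "Suc n"] by (simp only: zero_less_Suc)
      finally show ?case .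
    qed
    \<comment> \<open>For a fixed path all grid increments are eventually at most \<open>c\<close>,
      so no factor is cut and the product equals the full exponential.\<close>
    show "AE \<omega> in M. (\<lambda>n. \<Prod>i<Suc n. g (inc (h n) i \<omega>)) \<longlonglongrightarrow> exp (\<theta> * X 1 \<omega>)"
      using AE_small_increments AE_sum_inc_unit
    proof eventually_elim
      case (elim \<omega>)
      obtain d where d: "d > 0" "\<forall>h k. 0 \<le> h \<and> h < d \<and> real (Suc k) * h \<le> 1 \<longrightarrow> inc h k \<omega> \<le> c"
        using elim(1) c by meson
      have "h \<longlonglongrightarrow> 0" unfolding h_def by (rule LIMSEQ_Suc[OF lim_1_over_n])
      then have "\<forall>\<^sub>F n in sequentially. h n < d"
        by (rule order_tendstoD(2)) (rule d(1))
      then have "\<forall>\<^sub>F n in sequentially. (\<Prod>i<Suc n. g (inc (h n) i \<omega>)) = exp (\<theta> * X 1 \<omega>)"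
      proof eventually_elim
        case less: (elim n)
        have "inc (h n) i \<omega> \<le> c" if "i < Suc n" for i
        proof (rule d(2)[rule_format], intro conjI h less)
          have "real (Suc i) * h n \<le> real (Suc n) * h n" using that h by (intro mult_right_mono) auto
          then show "real (Suc i) * h n \<le> 1" by (simp add: h_def)
        qed
        then have "(\<Prod>i<Suc n. g (inc (h n) i \<omega>)) = (\<Prod>i<Suc n. exp (\<theta> * inc (h n) i \<omega>))"
          by (intro prod.cong) (auto simp: g_def)
        then show ?case
          unfolding prod_exp_inc h_def using elim(2)[rule_format, of "Suc n"] by (simp only: zero_less_Suc)
      qed
      then show ?case by (rule tendsto_eventually)
    qed
  qed (use exp_moment_finite[OF \<theta>] in auto)
  then have lim_pow: "(\<lambda>n. u n ^ Suc n) \<longlonglongrightarrow> exp (\<psi> \<theta>)"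
    by (simp only: pow exp_laplace_exponent[OF \<theta>])
  \<comment> \<open>The relative share of the large moves; \<open>1 - v\<close> is
    \<open>u / \<kappa>\<close>.\<close>
  define v where "v n = b n / \<kappa> n" for n
  have \<kappa>: "\<kappa> n > 0" "\<kappa> n ^ Suc n = exp (\<psi> \<theta>)" for n
  proof -
    show "\<kappa> n > 0" by (simp add: \<kappa>_def)
    have "real (Suc n) * (\<psi> \<theta> * h n) = \<psi> \<theta>" by (simp add: h_def)
    then show "\<kappa> n ^ Suc n = exp (\<psi> \<theta>)" unfolding \<kappa>_def exp_of_nat_mult[symmetric] by (simp only:)
  qed
  have v: "0 \<le> v n" "1 - v n = u n / \<kappa> n" for n
    using b0[of n] \<kappa>(1)[of n] ub[of n] by (auto simp: v_def field_simps)
  have "(\<lambda>n. u n ^ Suc n / exp (\<psi> \<theta>)) \<longlonglongrightarrow> exp (\<psi> \<theta>) / exp (\<psi> \<theta>)"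
    by (intro tendsto_intros lim_pow) auto
  moreover have "u n ^ Suc n / exp (\<psi> \<theta>) = (1 - v n) ^ Suc n" for n
    by (simp only: v(2) power_divide \<kappa>(2))
  ultimately have one: "(\<lambda>n. (1 - v n) ^ Suc n) \<longlonglongrightarrow> 1" by simp
  \<comment> \<open>From \<open>ln (1 - v) \<le> - v\<close> one gets
    \<open>n * v \<le> - ln ((1 - v) ^ n)\<close>, and the right side tends to
    \<open>- ln 1\<close>.\<close>
  have nv: "(\<lambda>n. real (Suc n) * v n) \<longlonglongrightarrow> 0"
  proof (rule tendsto_sandwich)
    show "\<forall>\<^sub>F n in sequentially. 0 \<le> real (Suc n) * v n"
      by (intro always_eventually allI mult_nonneg_nonneg v) simp
    have "\<forall>\<^sub>F n in sequentially. (1 - v n) ^ Suc n > 0"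
      using one by (rule order_tendstoD(1)) simp
    then show "\<forall>\<^sub>F n in sequentially. real (Suc n) * v n \<le> - ln ((1 - v n) ^ Suc n)"
    proof eventually_elim
      case (elim n)
      have "0 \<le> 1 - v n" using v(2)[of n] u0[of n] \<kappa>(1)[of n] by simp
      moreover have "1 - v n \<noteq> 0" using elim by (intro notI) simp
      ultimately have pos: "0 < 1 - v n" by linarith
      have "ln ((1 - v n) ^ Suc n) = real (Suc n) * ln (1 - v n)" by (subst ln_realpow) (use pos in auto)
      moreover have "real (Suc n) * ln (1 - v n) \<le> real (Suc n) * (- v n)"
        using ln_le_minus_one[OF pos] by (intro mult_left_mono) auto
      ultimately show ?case by linarith
    qed
    show "(\<lambda>n. - ln ((1 - v n) ^ Suc n)) \<longlonglongrightarrow> 0"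
      using tendsto_minus[OF tendsto_ln[OF one]] by simp
  qed simp
  have "\<kappa> \<longlonglongrightarrow> exp (\<psi> \<theta> * 0)"
    unfolding \<kappa>_def h_def by (intro tendsto_intros LIMSEQ_Suc[OF lim_1_over_n])
  then have "(\<lambda>n. (real (Suc n) * v n) * \<kappa> n) \<longlonglongrightarrow> 0 * exp (\<psi> \<theta> * 0)"
    by (intro tendsto_mult nv)
  moreover have "(real (Suc n) * v n) * \<kappa> n = real (Suc n) * b n" for n
    using \<kappa>(1)[of n] by (simp add: v_def)
  ultimately show ?thesis by (simp add: b_def h_def del: of_nat_Suc)
qed

text \<open>If all \<open>n\<close> increments are positive so is their sum; by independence the
  \<open>n\<close>-th power of the probability in question is bounded by the probability that
  \<open>X 1\<close> is positive.\<close>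

lemma prob_grid_positive_eq_0:
  assumes "prob {\<omega> \<in> space M. X 1 \<omega> > 0} = 0" and n: "n > 0"
  shows "prob {\<omega> \<in> space M. X (1 / real n) \<omega> > 0} = 0"
proof -
  define h where "h = 1 / real n"
  have h: "0 \<le> h" by (simp add: h_def)
  have [measurable]: "X h \<in> borel_measurable M" "X 1 \<in> borel_measurable M" using h by (auto intro: measurable_process)
  have "(\<integral>\<^sup>+\<omega>. ennreal (indicat_real {0<..} (X h \<omega>)) \<partial>M) ^ n = (\<integral>\<^sup>+\<omega>. ennreal (\<Prod>i<n. indicat_real {0<..} (inc h i \<omega>)) \<partial>M)"
    using h by (intro nn_integral_prod_inc[symmetric]) auto
  also have "\<dots> \<le> (\<integral>\<^sup>+\<omega>. indicator {\<omega> \<in> space M. X 1 \<omega> > 0} \<omega> \<partial>M)"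
  proof (rule nn_integral_mono_AE)
    show "AE \<omega> in M. ennreal (\<Prod>i<n. indicat_real {0<..} (inc h i \<omega>)) \<le> indicator {\<omega> \<in> space M. X 1 \<omega> > 0} \<omega>"
      using AE_sum_inc_unit AE_space
    proof eventually_elim
      case (elim \<omega>)
      show ?case
      proof (cases "\<forall>i<n. inc h i \<omega> > 0")
        case True
        then have "(\<Sum>i<n. inc h i \<omega>) > 0" using n by (intro sum_pos) auto
        then have "X 1 \<omega> > 0" using elim(1) n unfolding h_def by auto
        then have "indicator {\<omega> \<in> space M. X 1 \<omega> > 0} \<omega> = (1::ennreal)" using elim by simp
        moreover have "(\<Prod>i<n. indicat_real {0<..} (inc h i \<omega>)) = 1" using True by (intro prod.neutral) auto
        ultimately show ?thesis by simp
      next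
        case False
        then obtain i where "i < n" "\<not> inc h i \<omega> > 0" by blast
        then have "(\<Prod>i<n. indicat_real {0<..} (inc h i \<omega>)) = 0" by (intro prod_zero bexI[of _ i]) auto
        then have "ennreal (\<Prod>i<n. indicat_real {0<..} (inc h i \<omega>)) = 0" by (simp only: ennreal_0)
        then show ?thesis by (simp only: zero_le)
      qed
    qed
  qed
  also have "\<dots> = 0" using assms(1) by (simp add: emeasure_eq_measure)
  finally have "(\<integral>\<^sup>+\<omega>. ennreal (indicat_real {0<..} (X h \<omega>)) \<partial>M) = 0"
    using n by (simp add: le_zero_eq)
  moreover have "(\<integral>\<^sup>+\<omega>. ennreal (indicat_real {0<..} (X h \<omega>)) \<partial>M) = emeasure M {\<omega> \<in> space M. X h \<omega> > 0}"
  proof -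
    have "(\<integral>\<^sup>+\<omega>. ennreal (indicat_real {0<..} (X h \<omega>)) \<partial>M) = (\<integral>\<^sup>+\<omega>. indicator {\<omega> \<in> space M. X h \<omega> > 0} \<omega> \<partial>M)"
      by (rule nn_integral_cong) (simp split: split_indicator)
    then show ?thesis by (simp add: nn_integral_indicator)
  qed
  ultimately show ?thesis by (simp add: measure_def h_def)
qed

text \<open>Otherwise all increments on all grids are nonpositive almost surely, and
  right-continuity makes the whole path nonincreasing, against \<open>non_monotone\<close>.\<close>

lemma prob_positive: "prob {\<omega> \<in> space M. X 1 \<omega> > 0} > 0"
proof (rule ccontr)
  assume "\<not> prob {\<omega> \<in> space M. X 1 \<omega> > 0} > 0"
  then have 0: "prob {\<omega> \<in> space M. X 1 \<omega> > 0} = 0"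
    using measure_nonneg[of M "{\<omega> \<in> space M. X 1 \<omega> > 0}"] by linarith
  have "AE \<omega> in M. inc (1 / real (Suc n)) k \<omega> \<le> 0" for n k
  proof -
    define h where "h = 1 / real (Suc n)"
    have h: "0 \<le> h" by (simp add: h_def)
    have [measurable]: "X h \<in> borel_measurable M" "inc h k \<in> borel_measurable M"
      using h by (auto intro: measurable_process)
    have "AE \<omega> in M. X h \<omega> \<le> 0"
      using prob_grid_positive_eq_0[OF 0, of "Suc n"]
      by (subst AE_iff_measurable[where N = "{\<omega> \<in> space M. X h \<omega> > 0}"])
         (auto simp: h_def[symmetric] not_le emeasure_eq_measure simp del: of_nat_Suc)
    then have "AE x in distr M borel (X h). x \<le> 0" by (subst AE_distr_iff) auto
    then have "AE x in distr M borel (inc h k). x \<le> 0" unfolding distr_inc[OF h] .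
    then show ?thesis by (subst (asm) AE_distr_iff) (auto simp: h_def)
  qed
  then have "AE \<omega> in M. \<forall>n k. inc (1 / real (Suc n)) k \<omega> \<le> 0" by (simp add: AE_all_countable del: of_nat_Suc)
  then have "AE \<omega> in M. False" using cadlag_paths non_monotone
  proof eventually_elim
    case (elim \<omega>)
    have "antimono_on {0..} (\<lambda>t. X t \<omega>)"
    proof (rule monotone_onI)
      fix s t :: real assume st: "s \<in> {0..}" "t \<in> {0..}" "s \<le> t"
      define g where "g r n = (of_int \<lfloor>real (Suc n) * r\<rfloor> + 1) / real (Suc n)" for r and n :: nat
      have lim: "(\<lambda>n. X (g r n) \<omega>) \<longlonglongrightarrow> X r \<omega>" if "r \<ge> 0" for r
        unfolding g_def
        by (rule cadlag_seq_right[OF elim(2) that floor_grid_tendsto_right less_imp_le[OF floor_grid_gt]])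
      have "X (g t n) \<omega> \<le> X (g s n) \<omega>" for n
      proof -
        define N where "N r = nat (\<lfloor>real (Suc n) * r\<rfloor> + 1)" for r
        have g_eq: "g r n = real (N r) * (1 / real (Suc n))" if "r \<ge> 0" for r
        proof -
          have "\<lfloor>real (Suc n) * r\<rfloor> \<ge> 0" using that by simp
          then show ?thesis by (simp add: g_def N_def del: of_nat_Suc)
        qed
        have "N s \<le> N t" unfolding N_def using st by (intro nat_mono add_mono floor_mono mult_left_mono) auto
        moreover have "decseq (\<lambda>k. X (real k * (1 / real (Suc n))) \<omega>)"
          using elim(1)[rule_format, of n] unfolding inc_def by (intro decseq_SucI) (simp del: of_nat_Suc)
        ultimately have "X (real (N t) * (1 / real (Suc n))) \<omega> \<le> X (real (N s) * (1 / real (Suc n))) \<omega>"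
          by (rule decseqD[rotated])
        then show ?thesis using st g_eq by simp
      qed
      then show "X t \<omega> \<le> X s \<omega>"
        using st by (intro LIMSEQ_le[OF lim lim]) auto
    qed
    with elim(3) show False by simp
  qed
  then show False by simp
qed

text \<open>Restricting the mean to an event \<open>X 1 > c\<close> of positive probability bounds
  it below by \<open>exp (\<theta> * c)\<close> times that probability. Linear growth makes
  \<open>\<psi>\<close> reach the level \<open>q\<close> and confines the solutions of
  \<open>\<psi> \<theta> = q\<close> to a bounded set.\<close>

lemma laplace_exponent_lower_bound:
  obtains c p where "c > 0" "\<And>\<theta>. 0 \<le> \<theta> \<Longrightarrow> \<psi> \<theta> \<ge> c * \<theta> + p"
proof -
  have [measurable]: "X 1 \<in> borel_measurable M" by (rule measurable_process) simp
  have "(\<lambda>n. prob {\<omega> \<in> space M. X 1 \<omega> > 1 / real (Suc n)}) \<longlonglongrightarrow> prob (\<Union>n. {\<omega> \<in> space M. X 1 \<omega> > 1 / real (Suc n)})"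
  proof (rule finite_Lim_measure_incseq)
    show "incseq (\<lambda>n. {\<omega> \<in> space M. X 1 \<omega> > 1 / real (Suc n)})"
    proof (rule incseq_SucI, rule subsetI)
      fix n \<omega> assume "\<omega> \<in> {\<omega> \<in> space M. X 1 \<omega> > 1 / real (Suc n)}"
      moreover have "1 / real (Suc (Suc n)) \<le> 1 / real (Suc n)" by (intro divide_left_mono) auto
      ultimately show "\<omega> \<in> {\<omega> \<in> space M. X 1 \<omega> > 1 / real (Suc (Suc n))}" by (auto simp del: of_nat_Suc)
    qed
  qed auto
  moreover have "(\<Union>n. {\<omega> \<in> space M. X 1 \<omega> > 1 / real (Suc n)}) = {\<omega> \<in> space M. X 1 \<omega> > 0}"
  proof (intro equalityI subsetI)
    fix \<omega> assume \<omega>: "\<omega> \<in> {\<omega> \<in> space M. X 1 \<omega> > 0}"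
    then obtain n where "1 / real (Suc n) < X 1 \<omega>" using nat_approx_posE[of "X 1 \<omega>"] by auto
    then show "\<omega> \<in> (\<Union>n. {\<omega> \<in> space M. X 1 \<omega> > 1 / real (Suc n)})" using \<omega> by (intro UN_I[of n]) auto
  next
    fix \<omega> assume "\<omega> \<in> (\<Union>n. {\<omega> \<in> space M. X 1 \<omega> > 1 / real (Suc n)})"
    then obtain n where "\<omega> \<in> space M" "1 / real (Suc n) < X 1 \<omega>" by blast
    moreover have "0 < 1 / real (Suc n)" by simp
    ultimately show "\<omega> \<in> {\<omega> \<in> space M. X 1 \<omega> > 0}" unfolding mem_Collect_eq by linarith
  qed
  ultimately have "\<forall>\<^sub>F n in sequentially. prob {\<omega> \<in> space M. X 1 \<omega> > 1 / real (Suc n)} > 0"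
    using order_tendstoD(1)[OF _ prob_positive] by simp
  then obtain n where n: "prob {\<omega> \<in> space M. X 1 \<omega> > 1 / real (Suc n)} > 0"
    by (auto simp: eventually_sequentially)
  define c where "c = 1 / real (Suc n)"
  define P where "P = prob {\<omega> \<in> space M. X 1 \<omega> > c}"
  have P: "P > 0" using n by (simp only: P_def c_def)
  have "\<psi> \<theta> \<ge> c * \<theta> + ln P" if \<theta>: "0 \<le> \<theta>" for \<theta>
  proof -
    have "(LINT \<omega>|M. exp (\<theta> * c) * indicator {\<omega> \<in> space M. X 1 \<omega> > c} \<omega>) \<le> (LINT \<omega>|M. exp (\<theta> * X 1 \<omega>))"
      using \<theta> by (intro integral_mono exp_moment_finite integrable_mult_right integrable_real_indicator)
         (auto simp: indicator_def less_top[symmetric] intro: mult_left_mono)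
    then have "exp (\<theta> * c) * P \<le> exp (\<psi> \<theta>)"
      using exp_laplace_exponent[OF \<theta>] by (simp add: P_def)
    then have "exp (\<theta> * c + ln P) \<le> exp (\<psi> \<theta>)" using P by (simp add: exp_add)
    then show ?thesis by (simp add: mult.commute)
  qed
  then show thesis by (intro that[of c "ln P"]) (auto simp: c_def)
qed

text \<open>Along a convergent sequence of exponents bounded by \<open>K\<close> the integrands are
  dominated by \<open>1 + exp (K * X 1)\<close>, the 1 covering negative values of
  \<open>X 1\<close>.\<close>

lemma continuous_laplace_exponent: "continuous_on {0..} \<psi>"
proof -
  have [measurable]: "X 1 \<in> borel_measurable M" by (rule measurable_process) simp
  have "continuous_on {0..} (\<lambda>\<theta>. LINT \<omega>|M. exp (\<theta> * X 1 \<omega>))"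
    unfolding continuous_on_sequentially
  proof (intro allI ballI impI, elim conjE)
    fix u :: "nat \<Rightarrow> real" and \<theta> assume u: "\<forall>n. u n \<in> {0..}" "u \<longlonglongrightarrow> \<theta>" and \<theta>: "\<theta> \<in> {0..}"
    obtain K where K: "K > 0" "\<And>n. norm (u n) \<le> K"
      using convergent_imp_Bseq[OF convergentI[OF u(2)]] by (auto simp: Bseq_def)
    have "(\<lambda>n. LINT \<omega>|M. exp (u n * X 1 \<omega>)) \<longlonglongrightarrow> (LINT \<omega>|M. exp (\<theta> * X 1 \<omega>))"
    proof (rule integral_dominated_convergence[where w = "\<lambda>\<omega>. 1 + exp (K * X 1 \<omega>)"])
      show "integrable M (\<lambda>\<omega>. 1 + exp (K * X 1 \<omega>))" using exp_moment_finite[of K] K by auto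
      show "AE \<omega> in M. (\<lambda>n. exp (u n * X 1 \<omega>)) \<longlonglongrightarrow> exp (\<theta> * X 1 \<omega>)"
        using u(2) by (intro AE_I2 tendsto_intros)
      show "AE \<omega> in M. norm (exp (u n * X 1 \<omega>)) \<le> 1 + exp (K * X 1 \<omega>)" for n
      proof (intro AE_I2)
        fix \<omega>
        have un: "0 \<le> u n" "u n \<le> K" using u(1) K(2)[of n] by auto
        show "norm (exp (u n * X 1 \<omega>)) \<le> 1 + exp (K * X 1 \<omega>)"
        proof (cases "X 1 \<omega> \<ge> 0")
          case True
          then have "u n * X 1 \<omega> \<le> K * X 1 \<omega>" using un by (intro mult_right_mono)
          then have "exp (u n * X 1 \<omega>) \<le> exp (K * X 1 \<omega>)" by simp
          then show ?thesis unfolding real_norm_def abs_exp_cancel by linarith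
        next
          case False
          then have "exp (u n * X 1 \<omega>) \<le> 1" using un by (simp add: mult_nonneg_nonpos)
          then show ?thesis using exp_gt_zero[of "K * X 1 \<omega>"] unfolding real_norm_def abs_exp_cancel by linarith
        qed
      qed
    qed auto
    then show "((\<lambda>\<theta>. LINT \<omega>|M. exp (\<theta> * X 1 \<omega>)) \<circ> u) \<longlonglongrightarrow> (LINT \<omega>|M. exp (\<theta> * X 1 \<omega>))"
      by (simp add: comp_def)
  qed
  moreover have "(LINT \<omega>|M. exp (\<theta> * X 1 \<omega>)) \<noteq> 0" if "\<theta> \<in> {0..}" for \<theta>
    using exp_laplace_exponent[of \<theta>] that exp_not_eq_zero[of "\<psi> \<theta>"] by simp
  ultimately show ?thesis
    unfolding laplace_exponent_def by (intro continuous_on_ln) auto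
qed

text \<open>The solution set is nonempty by the intermediate value theorem between
  \<open>\<psi> 0 = 0\<close> and linear growth, bounded by that growth, and closed by continuity,
  so its supremum is attained.\<close>

lemma right_inverse_laplace_exponent:
  assumes q: "0 < q"
  shows "\<psi> (right_inverse \<psi> q) = q" "0 < right_inverse \<psi> q"
    "\<And>\<theta>. right_inverse \<psi> q < \<theta> \<Longrightarrow> \<psi> \<theta> \<noteq> q"
proof -
  define S where "S = {\<theta>. \<theta> \<ge> 0 \<and> \<psi> \<theta> = q}"
  obtain c p where c: "c > 0" "\<And>\<theta>. 0 \<le> \<theta> \<Longrightarrow> \<psi> \<theta> \<ge> c * \<theta> + p"
    using laplace_exponent_lower_bound by blast
  \<comment> \<open>The lower bound \<open>c * \<theta> + p\<close> reaches \<open>q\<close> at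
    \<open>(q - p) / c\<close>; the absolute value keeps the argument in the domain of
    \<open>\<psi>\<close>.\<close>
  define K where "K = \<bar>(q - p) / c\<bar>"
  have K: "\<psi> K \<ge> q"
  proof -
    have le: "(q - p) / c \<le> K" unfolding K_def by (rule abs_ge_self)
    have "q = c * ((q - p) / c) + p" using c(1) by simp
    also have "\<dots> \<le> c * K + p" using c(1) by (intro add_right_mono mult_left_mono le) auto
    also have "\<dots> \<le> \<psi> K" by (rule c(2)) (simp add: K_def)
    finally show ?thesis .
  qed
  have "\<exists>\<theta>\<ge>0. \<theta> \<le> K \<and> \<psi> \<theta> = q"
    using K q continuous_on_subset[OF continuous_laplace_exponent, of "{0..K}"]
    by (intro IVT') (auto simp: laplace_exponent_0 K_def)
  then have ne: "S \<noteq> {}" by (auto simp: S_def)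
  have bdd: "bdd_above S"
  proof (rule bdd_aboveI)
    fix \<theta> assume "\<theta> \<in> S"
    then have "c * \<theta> + p \<le> q" "\<theta> \<ge> 0" using c(2)[of \<theta>] by (auto simp: S_def)
    then show "\<theta> \<le> (q - p) / c" using c(1) by (simp add: field_simps)
  qed
  have "closed S"
  proof -
    have "S = {0..} \<inter> \<psi> -` {q}" by (auto simp: S_def)
    then show ?thesis using continuous_closed_preimage[OF continuous_laplace_exponent, of "{q}"] by simp
  qed
  then have "Sup S \<in> S" using ne bdd by (intro closed_contains_Sup)
  moreover have eq: "right_inverse \<psi> q = Sup S" by (simp add: right_inverse_def S_def)
  ultimately have in_S: "right_inverse \<psi> q \<in> S" by simp
  then show *: "\<psi> (right_inverse \<psi> q) = q" by (simp add: S_def)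
  have "right_inverse \<psi> q \<noteq> 0" using * laplace_exponent_0 q by auto
  then show "0 < right_inverse \<psi> q" using in_S by (simp add: S_def)
  show "\<psi> \<theta> \<noteq> q" if "right_inverse \<psi> q < \<theta>" for \<theta>
  proof
    assume "\<psi> \<theta> = q"
    then have "\<theta> \<in> S" using that in_S by (simp add: S_def)
    then have "\<theta> \<le> Sup S" using bdd by (intro cSup_upper)
    with that eq show False by simp
  qed
qed

end

section \<open>Passage to the completion\<close>

lemma prob_space_completion':
  assumes "prob_space M"
  shows "prob_space (completion M)"
  using prob_space.emeasure_space_1[OF assms] by (intro prob_spaceI) simp

text \<open>All sets concerned belong to \<open>M\<close>, where the completion has the same
  values.\<close>

lemma indep_sets_completion:
  assumes "prob_space M" "prob_space.indep_sets M F I"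
  shows "prob_space.indep_sets (completion M) F I"
proof -
  interpret M: prob_space M by fact
  interpret C: prob_space "completion M" by (rule prob_space_completion') fact
  have F: "F i \<subseteq> sets M" if "i \<in> I" for i using assms(2) that unfolding M.indep_sets_def by auto
  show ?thesis unfolding C.indep_sets_def
  proof (intro conjI ballI allI impI)
    show "F i \<subseteq> sets (completion M)" if "i \<in> I" for i using F[OF that] by auto
    fix J A assume J: "J \<subseteq> I" "J \<noteq> {}" "finite J" and A: "A \<in> Pi J F"
    have A_sets: "A j \<in> sets M" if "j \<in> J" for j using A F J(1) that by auto
    then have "(\<Inter>j\<in>J. A j) \<in> sets M" using J by (intro sets.finite_INT) auto
    then have "measure (completion M) (\<Inter>j\<in>J. A j) = measure M (\<Inter>j\<in>J. A j)" by simp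
    also have "\<dots> = (\<Prod>j\<in>J. measure M (A j))" using assms(2) J A unfolding M.indep_sets_def by blast
    also have "\<dots> = (\<Prod>j\<in>J. measure (completion M) (A j))" using A_sets by (intro prod.cong) auto
    finally show "measure (completion M) (\<Inter>j\<in>J. A j) = (\<Prod>j\<in>J. measure (completion M) (A j))" .
  qed
qed

lemma indep_vars_completion:
  assumes "prob_space M" "prob_space.indep_vars M M' Y I"
  shows "prob_space.indep_vars (completion M) M' Y I"
proof -
  interpret M: prob_space M by fact
  interpret C: prob_space "completion M" by (rule prob_space_completion') fact
  have "\<forall>i\<in>I. Y i \<in> measurable M (M' i)"
    and ind: "M.indep_sets (\<lambda>i. {Y i -` A \<inter> space M |A. A \<in> sets (M' i)}) I"
    using assms(2) unfolding M.indep_vars_def2 by auto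
  then show ?thesis using indep_sets_completion[OF assms(1) ind]
    unfolding C.indep_vars_def2 space_completion by (blast intro: measurable_completion)
qed

lemma levy_process_completion:
  assumes "levy_process M X"
  shows "levy_process (completion M) X"
proof -
  interpret levy_process M X by fact
  show ?thesis
    unfolding levy_process_def levy_process_axioms_def
  proof (intro conjI allI impI)
    show "prob_space (completion M)" by (rule prob_space_completion') unfold_locales
    show "X t \<in> borel_measurable (completion M)" if "0 \<le> t" for t
      using measurable_process[OF that] by (rule measurable_completion)
    show "AE \<omega> in completion M. X 0 \<omega> = 0" using start by (rule AE_completion)
    show "AE \<omega> in completion M. cadlag (\<lambda>t. X t \<omega>)" using cadlag_paths by (rule AE_completion)
    show "distr (completion M) borel (\<lambda>\<omega>. X (s + t) \<omega> - X s \<omega>) = distr (completion M) borel (X t)" if "0 \<le> s" "0 \<le> t" for s t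
      using stationary_increments[OF that] measurable_process[OF that(2)] measurable_increment[of "s + t" s] that
      by (simp add: distr_completion)
    show "prob_space.indep_vars (completion M) (\<lambda>_. borel) (\<lambda>i \<omega>. X (t (Suc i)) \<omega> - X (t i) \<omega>) {..<n}"
      if "mono t" "0 \<le> t 0" for n :: nat and t
      by (rule indep_vars_completion[OF prob_space_axioms independent_increments[OF that]])
  qed
qed

lemma spectrally_negative_levy_process_completion:
  assumes "spectrally_negative_levy_process M X"
  shows "spectrally_negative_levy_process (completion M) X"
proof -
  interpret spectrally_negative_levy_process M X by fact
  show ?thesis
    unfolding spectrally_negative_levy_process_def spectrally_negative_levy_process_axioms_def
    by (intro conjI levy_process_completion levy_process_axioms AE_completion no_positive_jumps non_monotone)
qed

lemma poisson_process_completion: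
  assumes "poisson_process M lam N"
  shows "poisson_process (completion M) lam N"
proof -
  interpret poisson_process M lam N by fact
  have meas: "{\<omega> \<in> space M. N t \<omega> = real k} \<in> sets M" if "0 \<le> t" for t k
  proof -
    have [measurable]: "N t \<in> borel_measurable M" using that by (rule measurable_process)
    show ?thesis by measurable
  qed
  show ?thesis
    unfolding poisson_process_def poisson_process_axioms_def
  proof (intro conjI allI impI levy_process_completion levy_process_axioms intensity_nonneg)
    fix t :: real and k :: nat assume t: "0 \<le> t"
    show "measure (completion M) {\<omega> \<in> space (completion M). N t \<omega> = real k} = (lam * t) ^ k / fact k * exp (- (lam * t))"
      using poisson_marginals[OF t, of k] measure_completion[OF meas[OF t]] by (simp only: space_completion)
  qed
qed

lemma independent_processes_completion:
  assumes "prob_space M" "independent_processes M X Y"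
  shows "independent_processes (completion M) X Y"
proof -
  interpret M: prob_space M by fact
  interpret C: prob_space "completion M" by (rule prob_space_completion') fact
  show ?thesis
    using assms(2) unfolding independent_processes_def M.indep_var_def C.indep_var_def
    by (rule indep_vars_completion[OF assms(1)])
qed

lemma laplace_exponent_completion:
  assumes "levy_process M X"
  shows "laplace_exponent (completion M) X = laplace_exponent M X"
proof -
  interpret levy_process M X by fact
  have [measurable]: "X 1 \<in> borel_measurable M" by (rule measurable_process) simp
  show ?thesis unfolding laplace_exponent_def by (subst integral_completion) auto
qed

text \<open>The bridge from events to integrals: independence of two intersection-stable generators
  becomes independence of functions measurable for the sigma-algebras they generate.\<close>

lemma (in prob_space) indep_var_sigmaI:
  fixes Z W :: "'a \<Rightarrow> real"
  assumes ind: "indep_set A B" and "Int_stable A" "Int_stable B"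
    and Z: "Z \<in> borel_measurable (sigma (space M) A)" and W: "W \<in> borel_measurable (sigma (space M) B)"
  shows "indep_var borel Z borel W"
proof -
  have AB: "A \<subseteq> events" "B \<subseteq> events" using ind by (auto simp: indep_sets2_eq)
  then have sub: "A \<subseteq> Pow (space M)" "B \<subseteq> Pow (space M)" using sets.sets_into_space by blast+
  have sets: "sigma_sets (space M) A \<subseteq> events" "sigma_sets (space M) B \<subseteq> events"
    using AB by (simp_all add: sets.sigma_sets_subset)
  have pre: "V -` E \<inter> space M \<in> sigma_sets (space M) C"
    if V: "V \<in> borel_measurable (sigma (space M) C)" and C: "C \<subseteq> Pow (space M)" and E: "E \<in> sets borel"
    for V :: "'a \<Rightarrow> real" and C E
    using measurable_sets[OF V E] C by (simp add: space_measure_of sets_measure_of)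
  have le: "sigma_sets (space M) {V -` E \<inter> space M |E. E \<in> sets borel} \<subseteq> sigma_sets (space M) C"
    if "V \<in> borel_measurable (sigma (space M) C)" and "C \<subseteq> Pow (space M)" for V :: "'a \<Rightarrow> real" and C
    by (rule sigma_sets_mono) (use pre[OF that] in blast)
  have meas: "V \<in> borel_measurable M"
    if "V \<in> borel_measurable (sigma (space M) C)" "C \<subseteq> Pow (space M)" "sigma_sets (space M) C \<subseteq> events"
    for V :: "'a \<Rightarrow> real" and C
  proof (rule measurableI)
    fix E :: "real set" assume "E \<in> sets borel"
    then show "V -` E \<inter> space M \<in> events" using pre[OF that(1,2)] that(3) by blast
  qed simp
  have "indep_set (sigma_sets (space M) A) (sigma_sets (space M) B)"
    by (rule indep_set_sigma_sets) fact+
  then show ?thesis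
    using le[OF Z sub(1)] le[OF W sub(2)] meas[OF Z sub(1) sets(1)] meas[OF W sub(2) sets(2)]
    unfolding indep_var_eq indep_sets2_eq by blast
qed

section \<open>Paths and increments of the Poisson process\<close>

context poisson_process
begin

lemma prob_increment_eq:
  assumes "0 \<le> t" "0 \<le> h"
  shows "prob {\<omega> \<in> space M. N (t + h) \<omega> - N t \<omega> = real k} = (lam * h) ^ k / fact k * exp (- (lam * h))"
proof -
  have D: "(\<lambda>\<omega>. N (t + h) \<omega> - N t \<omega>) \<in> borel_measurable M" using assms by (intro measurable_increment) auto
  have H: "N h \<in> borel_measurable M" using assms by (intro measurable_process)
  have "measure (distr M borel (\<lambda>\<omega>. N (t + h) \<omega> - N t \<omega>)) {real k} = measure (distr M borel (N h)) {real k}"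
    by (simp add: stationary_increments[OF assms])
  then have "prob ((\<lambda>\<omega>. N (t + h) \<omega> - N t \<omega>) -` {real k} \<inter> space M) = prob (N h -` {real k} \<inter> space M)"
    by (simp add: measure_distr[OF D] measure_distr[OF H])
  moreover have "f -` {real k} \<inter> space M = {\<omega> \<in> space M. f \<omega> = real k}" for f :: "'a \<Rightarrow> real" by auto
  ultimately show ?thesis
    using poisson_marginals[OF assms(2), of k] by simp
qed

text \<open>The Poisson weights of the naturals already add up to 1, so no probability is left for
  other values.\<close>

lemma AE_increment_nat:
  assumes "0 \<le> h"
  shows "AE \<omega> in M. inc h i \<omega> \<in> \<nat>"
proof -
  define A where "A k = {\<omega> \<in> space M. inc h i \<omega> = real k}" for k
  have [measurable]: "inc h i \<in> borel_measurable M" using assms by (rule inc_measurable)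
  have A: "A k \<in> events" for k unfolding A_def by measurable
  have prob_A: "prob (A k) = (lam * h) ^ k / fact k * exp (- (lam * h))" for k
  proof -
    have "real i * h + h = real (Suc i) * h" by (simp add: algebra_simps)
    then show ?thesis
      using prob_increment_eq[of "real i * h" h k] assms by (simp add: A_def inc_def del: of_nat_Suc)
  qed
  have "(\<lambda>k. prob (A k)) sums prob (\<Union>k. A k)"
    using A by (intro finite_measure_UNION) (auto simp: disjoint_family_on_def A_def)
  moreover have "(\<lambda>k. prob (A k)) sums (exp (lam * h) * exp (- (lam * h)))"
    unfolding prob_A using sums_mult2[OF exp_converges[of "lam * h"], of "exp (- (lam * h))"]
    by (simp add: divide_inverse mult_ac)
  ultimately have "prob (\<Union>k. A k) = exp (lam * h) * exp (- (lam * h))" by (rule sums_unique2)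
  then have "prob (\<Union>k. A k) = 1" by (simp add: exp_minus)
  then have "AE \<omega> in M. \<omega> \<in> (\<Union>k. A k)" using A by (subst (asm) prob_eq_1) auto
  then show ?thesis by eventually_elim (auto simp: A_def)
qed

text \<open>Outside one null set all increments on all grids are naturals, so the path is monotone
  and integer-valued along grids; right limits along grids transfer both properties to all
  times.\<close>

lemma AE_counting_path: "AE \<omega> in M. counting_path (\<lambda>t. N t \<omega>)"
proof -
  have "AE \<omega> in M. \<forall>n k. inc (1 / real (Suc n)) k \<omega> \<in> \<nat>"
    unfolding AE_all_countable by (intro allI AE_increment_nat) simp
  then show ?thesis using cadlag_paths AE_sum_inc
  proof eventually_elim
    case (elim \<omega>)
    define g where "g r n = (of_int \<lfloor>real (Suc n) * r\<rfloor> + 1) / real (Suc n)" for r and n :: nat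
    define G where "G r n = nat (\<lfloor>real (Suc n) * r\<rfloor> + 1)" for r and n :: nat
    have lim: "(\<lambda>n. N (g r n) \<omega>) \<longlonglongrightarrow> N r \<omega>" if "r \<ge> 0" for r
      unfolding g_def
      by (rule cadlag_seq_right[OF elim(2) that floor_grid_tendsto_right less_imp_le[OF floor_grid_gt]])
    have g_eq: "g r n = real (G r n) * (1 / real (Suc n))" if "r \<ge> 0" for r n
    proof -
      have "\<lfloor>real (Suc n) * r\<rfloor> \<ge> 0" using that by simp
      then show ?thesis by (simp add: g_def G_def del: of_nat_Suc)
    qed
    have inc_nat: "inc (1 / real (Suc n)) k \<omega> \<in> \<nat>" for n k using elim(1) by blast
    show ?case
    proof
      fix s t :: real assume st: "0 \<le> s" "s \<le> t"
      have "N (g s n) \<omega> \<le> N (g t n) \<omega>" for n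
      proof -
        have "G s n \<le> G t n" unfolding G_def using st by (intro nat_mono add_mono floor_mono mult_left_mono) auto
        moreover have "incseq (\<lambda>k. N (real k * (1 / real (Suc n))) \<omega>)"
        proof (rule incseq_SucI)
          fix k
          have "0 \<le> inc (1 / real (Suc n)) k \<omega>" using inc_nat[of n k] by (auto elim: Nats_cases)
          then show "N (real k * (1 / real (Suc n))) \<omega> \<le> N (real (Suc k) * (1 / real (Suc n))) \<omega>"
            unfolding inc_def by linarith
        qed
        ultimately have "N (real (G s n) * (1 / real (Suc n))) \<omega> \<le> N (real (G t n) * (1 / real (Suc n))) \<omega>"
          by (rule incseqD[rotated])
        then show ?thesis using st g_eq by simp
      qed
      then show "N s \<omega> \<le> N t \<omega>"
        using st by (intro LIMSEQ_le[OF lim lim]) auto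
    next
      fix t :: real assume t: "0 \<le> t"
      show "continuous (at_right t) (\<lambda>t. N t \<omega>)" using elim(2) t by (simp add: cadlag_def)
      have "N (g t n) \<omega> \<in> \<int>" for n
      proof -
        have "N (g t n) \<omega> = (\<Sum>i<G t n. inc (1 / real (Suc n)) i \<omega>)"
          unfolding g_eq[OF t] using elim(3) by metis
        also have "\<dots> \<in> \<int>" using inc_nat Nats_subset_Ints by (intro Ints_sum) blast
        finally show ?thesis .
      qed
      \<comment> \<open>The integers are closed, so a limit of integer values is an integer.\<close>
      then show "N t \<omega> \<in> \<int>"
        by (intro closed_sequentially[OF closed_Ints _ lim[OF t]])
    qed
  qed
qed

text \<open>With \<open>x = lam * h\<close> this is \<open>1 - (1 + x) * exp (- x)\<close>, and
  \<open>exp (- x) \<ge> 1 - x\<close>. The quadratic order makes several resets in one step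
  negligible.\<close>

lemma prob_several_jumps:
  assumes t: "0 \<le> t" "0 \<le> h"
  shows "prob {\<omega> \<in> space M. N (t + h) \<omega> - N t \<omega> \<notin> {0, 1}} \<le> (lam * h)\<^sup>2"
proof -
  let ?D = "\<lambda>\<omega>. N (t + h) \<omega> - N t \<omega>"
  have [measurable]: "?D \<in> borel_measurable M" using t by (intro measurable_increment) auto
  have sets: "{\<omega> \<in> space M. ?D \<omega> = real k} \<in> events" for k by measurable
  define x where "x = lam * h"
  have x: "0 \<le> x" using intensity_nonneg t by (simp add: x_def)
  have "prob {\<omega> \<in> space M. ?D \<omega> \<in> {0, 1}} = prob ({\<omega> \<in> space M. ?D \<omega> = real 0} \<union> {\<omega> \<in> space M. ?D \<omega> = real 1})"
    by (intro arg_cong[where f = prob]) auto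
  also have "\<dots> = prob {\<omega> \<in> space M. ?D \<omega> = real 0} + prob {\<omega> \<in> space M. ?D \<omega> = real 1}"
    by (intro finite_measure_Union sets) auto
  also have "\<dots> = exp (- x) * (1 + x)"
    unfolding prob_increment_eq[OF t] by (simp add: x_def algebra_simps)
  finally have eq: "prob {\<omega> \<in> space M. ?D \<omega> \<in> {0, 1}} = exp (- x) * (1 + x)" .
  have "{\<omega> \<in> space M. ?D \<omega> \<notin> {0, 1}} = space M - {\<omega> \<in> space M. ?D \<omega> \<in> {0, 1}}" by blast
  then have "prob {\<omega> \<in> space M. ?D \<omega> \<notin> {0, 1}} = 1 - exp (- x) * (1 + x)"
    unfolding eq[symmetric] by (simp only:) (rule prob_compl, measurable)
  also have "\<dots> \<le> 1 - (1 - x) * (1 + x)"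
    using exp_ge_add_one_self[of "- x"] x by (intro diff_left_mono mult_right_mono) auto
  also have "\<dots> = (lam * h)\<^sup>2" by (simp add: x_def power2_eq_square algebra_simps)
  finally show ?thesis .
qed

end

lemma space_cylinders: "space M \<in> cylinders M X t"
  using cylindersI[of "{}" t "\<lambda>_. UNIV" M X] by simp

section \<open>One step of the resetting process\<close>

locale independent_levy_poisson =
  X: spectrally_negative_levy_process P X + N: poisson_process P lam N
  for P :: "'a measure" and X :: "real \<Rightarrow> 'a \<Rightarrow> real" and lam :: real and N :: "real \<Rightarrow> 'a \<Rightarrow> real" +
  assumes indep: "independent_processes P X N"
begin

abbreviation "prob \<equiv> measure P"

text \<open>An intersection-stable family large enough to contain the generators of
  \<open>filt t\<close>: independence can be checked on the rectangles and is trivial on null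
  sets.\<close>

definition past_gen :: "real \<Rightarrow> 'a set set" where
  "past_gen t = {E \<inter> F |E F. E \<in> cylinders P X t \<and> F \<in> cylinders P N t} \<union> null_sets P"

definition future_gen :: "real \<Rightarrow> real \<Rightarrow> 'a set set" where
  "future_gen t h = {{\<omega> \<in> space P. X (t + h) \<omega> - X t \<omega> \<in> B \<and> N (t + h) \<omega> - N t \<omega> \<in> C} |B C.
      B \<in> sets borel \<and> C \<in> sets borel}"

lemma future_genI:
  assumes "B \<in> sets borel" "C \<in> sets borel"
  shows "{\<omega> \<in> space P. X (t + h) \<omega> - X t \<omega> \<in> B \<and> N (t + h) \<omega> - N t \<omega> \<in> C} \<in> future_gen t h"
  unfolding future_gen_def mem_Collect_eq using assms by (intro exI[of _ B] exI[of _ C] conjI refl)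

text \<open>For \<open>P = completion M\<close> this is \<open>completed_filtration M X N t\<close>;
  here \<open>P\<close> itself supplies the null sets.\<close>

definition filt :: "real \<Rightarrow> 'a measure" where
  "filt t = sigma (space P)
     ({X s -` A \<inter> space P |s A. 0 \<le> s \<and> s \<le> t \<and> A \<in> sets borel} \<union>
      {N s -` A \<inter> space P |s A. 0 \<le> s \<and> s \<le> t \<and> A \<in> sets borel} \<union>
      null_sets P)"

lemma past_gen_events: "past_gen t \<subseteq> sets P"
proof
  fix G assume "G \<in> past_gen t"
  then show "G \<in> sets P"
    unfolding past_gen_def
  proof (elim UnE)
    assume "G \<in> {E \<inter> F |E F. E \<in> cylinders P X t \<and> F \<in> cylinders P N t}"
    then obtain E F where G: "G = E \<inter> F" and "E \<in> cylinders P X t" "F \<in> cylinders P N t"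
      unfolding mem_Collect_eq by (elim exE conjE)
    then have "E \<in> sets P" "F \<in> sets P"
      using X.cylinders_events[THEN subsetD] N.cylinders_events[THEN subsetD] by auto
    then show "G \<in> sets P" unfolding G by (rule sets.Int)
  next
    assume "G \<in> null_sets P"
    then show "G \<in> sets P" by (rule null_setsD2)
  qed
qed

lemma filt_gen_space:
  "{X s -` A \<inter> space P |s A. 0 \<le> s \<and> s \<le> t \<and> A \<in> sets borel} \<union>
   {N s -` A \<inter> space P |s A. 0 \<le> s \<and> s \<le> t \<and> A \<in> sets borel} \<union> null_sets P \<subseteq> Pow (space P)"
proof (intro Un_least)
  show "null_sets P \<subseteq> Pow (space P)"
    using sets.sets_into_space[OF null_setsD2] by auto
qed auto

lemma space_filt [simp]: "space (filt t) = space P"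
  unfolding filt_def by (rule space_measure_of_conv)

lemma sets_filt_le_past: "sets (filt t) \<subseteq> sigma_sets (space P) (past_gen t)"
proof -
  let ?G = "{X s -` A \<inter> space P |s A. 0 \<le> s \<and> s \<le> t \<and> A \<in> sets borel} \<union>
      {N s -` A \<inter> space P |s A. 0 \<le> s \<and> s \<le> t \<and> A \<in> sets borel} \<union> null_sets P"
  have "?G \<subseteq> Pow (space P)" by (rule filt_gen_space)
  then have "sets (filt t) = sigma_sets (space P) ?G" unfolding filt_def by (rule sets_measure_of)
  also have "\<dots> \<subseteq> sigma_sets (space P) (past_gen t)"
  proof (rule sigma_sets_mono, rule subsetI)
    fix E assume E: "E \<in> ?G"
    have sp: "space P \<in> cylinders P Y t" for Y :: "real \<Rightarrow> 'a \<Rightarrow> real"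
      using cylindersI[of "{}" t "\<lambda>_. UNIV" P Y] by simp
    have basic: "C \<inter> D \<in> past_gen t" if "C \<in> cylinders P X t" "D \<in> cylinders P N t" for C D
      unfolding past_gen_def by (rule UnI1, rule CollectI, intro exI[of _ C] exI[of _ D] conjI refl that)
    from E have "E \<in> past_gen t"
    proof (elim UnE)
      assume "E \<in> {X s -` A \<inter> space P |s A. 0 \<le> s \<and> s \<le> t \<and> A \<in> sets borel}"
      then obtain s A where E: "E = X s -` A \<inter> space P" and *: "0 \<le> s" "s \<le> t" "A \<in> sets borel"
        unfolding mem_Collect_eq by (elim exE conjE)
      have "E \<inter> space P \<in> past_gen t" unfolding E by (rule basic[OF single_cylinder[OF *] sp])
      moreover have "E \<inter> space P = E" unfolding E by auto
      ultimately show ?thesis by simp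
    next
      assume "E \<in> {N s -` A \<inter> space P |s A. 0 \<le> s \<and> s \<le> t \<and> A \<in> sets borel}"
      then obtain s A where E: "E = N s -` A \<inter> space P" and *: "0 \<le> s" "s \<le> t" "A \<in> sets borel"
        unfolding mem_Collect_eq by (elim exE conjE)
      have "space P \<inter> E \<in> past_gen t" unfolding E by (rule basic[OF sp single_cylinder[OF *]])
      moreover have "space P \<inter> E = E" unfolding E by auto
      ultimately show ?thesis by simp
    next
      assume "E \<in> null_sets P"
      then show ?thesis unfolding past_gen_def by (rule UnI2)
    qed
    then show "E \<in> sigma_sets (space P) (past_gen t)" by (rule sigma_sets.Basic)
  qed
  finally show ?thesis .
qed

lemma measurable_filt_past:
  fixes Z :: "'a \<Rightarrow> real"
  assumes "Z \<in> borel_measurable (filt t)"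
  shows "Z \<in> borel_measurable (sigma (space P) (past_gen t))"
proof (rule measurableI)
  have sub: "past_gen t \<subseteq> Pow (space P)" using past_gen_events sets.sets_into_space by blast
  fix A :: "real set" assume "A \<in> sets borel"
  then have "Z -` A \<inter> space P \<in> sets (filt t)" using measurable_sets[OF assms, of A] by simp
  then show "Z -` A \<inter> space (sigma (space P) (past_gen t)) \<in> sets (sigma (space P) (past_gen t))"
    using sets_filt_le_past sub by (auto simp: space_measure_of sets_measure_of)
qed simp

lemma sets_filt_events: "sets (filt t) \<subseteq> sets P"
  using sets_filt_le_past[of t] sets.sigma_sets_subset[OF past_gen_events[of t]] by (rule order_trans)

lemma measurable_filt:
  fixes Z :: "'a \<Rightarrow> real"
  assumes "Z \<in> borel_measurable (filt t)"
  shows "Z \<in> borel_measurable P"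
proof (rule measurableI)
  fix A :: "real set" assume "A \<in> sets borel"
  then show "Z -` A \<inter> space P \<in> sets P" using measurable_sets[OF assms, of A] sets_filt_events by auto
qed simp

lemma sets_filt_mono:
  assumes "s \<le> t"
  shows "sets (filt s) \<subseteq> sets (filt t)"
proof -
  let ?G = "\<lambda>t. {X s -` A \<inter> space P |s A. 0 \<le> s \<and> s \<le> t \<and> A \<in> sets borel} \<union>
      {N s -` A \<inter> space P |s A. 0 \<le> s \<and> s \<le> t \<and> A \<in> sets borel} \<union> null_sets P"
  have "?G t \<subseteq> Pow (space P)" for t by (rule filt_gen_space)
  then have eq: "sets (filt t) = sigma_sets (space P) (?G t)" for t unfolding filt_def by (rule sets_measure_of)
  have mono: "{Y r -` A \<inter> space P |r A. 0 \<le> r \<and> r \<le> s \<and> A \<in> sets borel} \<subseteq>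
      {Y r -` A \<inter> space P |r A. 0 \<le> r \<and> r \<le> t \<and> A \<in> sets borel}" for Y :: "real \<Rightarrow> 'a \<Rightarrow> real"
  proof
    fix E assume "E \<in> {Y r -` A \<inter> space P |r A. 0 \<le> r \<and> r \<le> s \<and> A \<in> sets borel}"
    then obtain r A where "E = Y r -` A \<inter> space P" "0 \<le> r" "r \<le> s" "A \<in> sets borel"
      unfolding mem_Collect_eq by (elim exE conjE)
    then show "E \<in> {Y r -` A \<inter> space P |r A. 0 \<le> r \<and> r \<le> t \<and> A \<in> sets borel}"
      unfolding mem_Collect_eq using assms by (intro exI[of _ r] exI[of _ A]) simp
  qed
  show ?thesis unfolding eq
    by (rule sigma_sets_mono') (intro Un_mono mono order_refl)
qed

lemma measurable_filt_mono:
  fixes Z :: "'a \<Rightarrow> real"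
  assumes "Z \<in> borel_measurable (filt s)" "s \<le> t"
  shows "Z \<in> borel_measurable (filt t)"
proof (rule measurableI)
  fix A :: "real set" assume "A \<in> sets borel"
  then show "Z -` A \<inter> space (filt t) \<in> sets (filt t)"
    using measurable_sets[OF assms(1), of A] sets_filt_mono[OF assms(2)] by auto
qed simp

lemma prob_paths_indep:
  assumes A: "A \<in> sets (Pi\<^sub>M {0..} (\<lambda>_. borel))" and B: "B \<in> sets (Pi\<^sub>M {0..} (\<lambda>_. borel))"
    and E: "\<And>\<omega>. \<omega> \<in> space P \<Longrightarrow> \<omega> \<in> E \<longleftrightarrow> (\<lambda>t\<in>{0..}. X t \<omega>) \<in> A" "E \<subseteq> space P"
    and F: "\<And>\<omega>. \<omega> \<in> space P \<Longrightarrow> \<omega> \<in> F \<longleftrightarrow> (\<lambda>t\<in>{0..}. N t \<omega>) \<in> B" "F \<subseteq> space P"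
  shows "prob (E \<inter> F) = prob E * prob F"
proof -
  have "(\<lambda>\<omega>. \<lambda>t\<in>{0..}. X t \<omega>) -` A \<inter> space P = E" using E by auto
  moreover have "(\<lambda>\<omega>. \<lambda>t\<in>{0..}. N t \<omega>) -` B \<inter> space P = F" using F by auto
  moreover have "(\<lambda>\<omega>. (\<lambda>t\<in>{0..}. X t \<omega>, \<lambda>t\<in>{0..}. N t \<omega>)) -` (A \<times> B) \<inter> space P = E \<inter> F" using E F by auto
  ultimately show ?thesis
    using X.indep_varD[OF indep[unfolded independent_processes_def] A B] by simp
qed

lemma component_measurable:
  "0 \<le> s \<Longrightarrow> (\<lambda>w. w s) \<in> borel_measurable (Pi\<^sub>M {0..} (\<lambda>_. borel :: real measure))"
  by (intro measurable_component_singleton) auto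

lemma UNIV_borel: "UNIV \<in> sets (borel :: real measure)"
  by simp

text \<open>\<open>independent_processes\<close> concerns entire paths, so events have to be
  exhibited as preimages of measurable sets of paths.\<close>

lemma cylinder_increment_path:
  fixes Y :: "real \<Rightarrow> 'a \<Rightarrow> real"
  assumes "E \<in> cylinders P Y t" "0 \<le> t" "0 \<le> h" "B \<in> sets borel"
  shows "\<exists>A\<in>sets (Pi\<^sub>M {0..} (\<lambda>_. borel)). \<forall>\<omega>\<in>space P.
    (\<omega> \<in> E \<inter> {\<omega> \<in> space P. Y (t + h) \<omega> - Y t \<omega> \<in> B}) = ((\<lambda>t\<in>{0..}. Y t \<omega>) \<in> A)"
proof -
  obtain J C where J: "finite J" "J \<subseteq> {0..t}" "\<forall>s. C s \<in> sets borel"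
    "E = {\<omega> \<in> space P. \<forall>s\<in>J. Y s \<omega> \<in> C s}" using assms(1) unfolding cylinders_iff by (elim exE conjE)
  let ?M = "Pi\<^sub>M {0..} (\<lambda>_. borel :: real measure)"
  define A where "A = {w \<in> space ?M. (\<forall>s\<in>J. w s \<in> C s) \<and> w (t + h) - w t \<in> B}"
  have "{w \<in> space ?M. \<forall>s\<in>J. w s \<in> C s} \<in> sets ?M"
  proof (intro sets.sets_Collect_finite_All J(1))
    fix s assume "s \<in> J"
    then have "0 \<le> s" using J(2) by auto
    note [measurable] = component_measurable[OF this]
    show "{w \<in> space ?M. w s \<in> C s} \<in> sets ?M"
      using J(3)[rule_format, of s] by measurable
  qed
  moreover have "{w \<in> space ?M. w (t + h) - w t \<in> B} \<in> sets ?M"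
  proof -
    have "(\<lambda>w. w (t + h) - w t) \<in> borel_measurable ?M"
      using assms(2,3) by (intro borel_measurable_diff component_measurable) auto
    then show ?thesis using assms(4) by measurable
  qed
  moreover have "A = {w \<in> space ?M. \<forall>s\<in>J. w s \<in> C s} \<inter> {w \<in> space ?M. w (t + h) - w t \<in> B}"
    unfolding A_def by blast
  ultimately have A_sets: "A \<in> sets ?M" by simp
  have "\<omega> \<in> E \<inter> {\<omega> \<in> space P. Y (t + h) \<omega> - Y t \<omega> \<in> B} \<longleftrightarrow> (\<lambda>t\<in>{0..}. Y t \<omega>) \<in> A" if "\<omega> \<in> space P" for \<omega>
  proof -
    have "(\<lambda>t\<in>{0..}. Y t \<omega>) \<in> space ?M" by (simp add: space_PiM)
    moreover have "(\<lambda>t\<in>{0..}. Y t \<omega>) s = Y s \<omega>" if "s \<in> J \<or> s = t + h \<or> s = t" for s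
      using that J(2) assms(2,3) by auto
    ultimately show ?thesis using that unfolding A_def J(4) by simp
  qed
  then show ?thesis by (intro bexI[of _ A] ballI A_sets)
qed

text \<open>Two independences are combined: \<open>X\<close> and \<open>N\<close> are independent as
  paths, and within each process the past is independent of the next increment. A rectangle thus
  splits into four factors that can be regrouped into past and future.\<close>

lemma indep_past_future:
  assumes t: "0 \<le> t" "0 \<le> h"
  shows "X.indep_set (past_gen t) (future_gen t h)"
  unfolding X.indep_sets2_eq
proof (intro conjI ballI)
  show "past_gen t \<subseteq> sets P" by (rule past_gen_events)
  have [measurable]: "(\<lambda>\<omega>. X (t + h) \<omega> - X t \<omega>) \<in> borel_measurable P" "(\<lambda>\<omega>. N (t + h) \<omega> - N t \<omega>) \<in> borel_measurable P"
    using t by (auto intro: X.measurable_increment N.measurable_increment)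
  have rect: "{\<omega> \<in> space P. X (t + h) \<omega> - X t \<omega> \<in> B \<and> N (t + h) \<omega> - N t \<omega> \<in> C} \<in> sets P"
    if "B \<in> sets borel" "C \<in> sets borel" for B C using that by measurable
  then show "future_gen t h \<subseteq> sets P" unfolding future_gen_def by auto
  fix G H assume G: "G \<in> past_gen t" and "H \<in> future_gen t h"
  from this(2) obtain B C where
    H: "H = {\<omega> \<in> space P. X (t + h) \<omega> - X t \<omega> \<in> B \<and> N (t + h) \<omega> - N t \<omega> \<in> C}"
    and BC: "B \<in> sets borel" "C \<in> sets borel"
    unfolding future_gen_def mem_Collect_eq by (elim exE conjE)
  define HX where "HX = {\<omega> \<in> space P. X (t + h) \<omega> - X t \<omega> \<in> B}"
  define HN where "HN = {\<omega> \<in> space P. N (t + h) \<omega> - N t \<omega> \<in> C}"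
  have H_eq: "H = HX \<inter> HN" unfolding H HX_def HN_def by auto
  have prod: "prob ((E \<inter> HX) \<inter> (F \<inter> HN)) = prob E * prob HX * (prob F * prob HN)"
    if E: "E \<in> cylinders P X t" and F: "F \<in> cylinders P N t" for E F
  proof -
    obtain A1 where A1: "A1 \<in> sets (Pi\<^sub>M {0..} (\<lambda>_. borel))"
      "\<forall>\<omega>\<in>space P. (\<omega> \<in> E \<inter> {\<omega> \<in> space P. X (t + h) \<omega> - X t \<omega> \<in> B}) = ((\<lambda>t\<in>{0..}. X t \<omega>) \<in> A1)"
      using cylinder_increment_path[OF E t BC(1)] by (elim bexE)
    obtain A2 where A2: "A2 \<in> sets (Pi\<^sub>M {0..} (\<lambda>_. borel))"
      "\<forall>\<omega>\<in>space P. (\<omega> \<in> F \<inter> {\<omega> \<in> space P. N (t + h) \<omega> - N t \<omega> \<in> C}) = ((\<lambda>t\<in>{0..}. N t \<omega>) \<in> A2)"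
      using cylinder_increment_path[OF F t BC(2)] by (elim bexE)
    have "prob ((E \<inter> HX) \<inter> (F \<inter> HN)) = prob (E \<inter> HX) * prob (F \<inter> HN)"
      unfolding HX_def HN_def
      by (rule prob_paths_indep[OF A1(1) A2(1) A1(2)[rule_format] _ A2(2)[rule_format]]) blast+
    then show ?thesis
      using X.cylinder_indep_increment[OF t E BC(1)] N.cylinder_indep_increment[OF t F BC(2)]
      by (simp add: HX_def HN_def)
  qed
  have sp: "space P \<in> cylinders P Y t" for Y :: "real \<Rightarrow> 'a \<Rightarrow> real"
    by (rule space_cylinders)
  have sub: "HX \<subseteq> space P" "HN \<subseteq> space P" by (auto simp: HX_def HN_def)
  have sp1: "prob (space P) = 1" by (rule X.prob_space)
  have H_prob: "prob H = prob HX * prob HN"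
    using prod[OF sp sp] sub by (simp add: H_eq sp1 Int_absorb1)
  from G show "prob (G \<inter> H) = prob G * prob H"
    unfolding past_gen_def
  proof (elim UnE)
    assume "G \<in> {E \<inter> F |E F. E \<in> cylinders P X t \<and> F \<in> cylinders P N t}"
    then obtain E F where EF: "G = E \<inter> F" "E \<in> cylinders P X t" "F \<in> cylinders P N t"
      unfolding mem_Collect_eq by (elim exE conjE)
    have Esub: "E \<subseteq> space P" "F \<subseteq> space P"
      using sets.sets_into_space[OF X.cylinders_events[THEN subsetD, OF EF(2)]]
        sets.sets_into_space[OF N.cylinders_events[THEN subsetD, OF EF(3)]] .
    have "G \<inter> H = (E \<inter> HX) \<inter> (F \<inter> HN)" unfolding EF H_eq by auto
    then have "prob (G \<inter> H) = prob E * prob HX * (prob F * prob HN)" using prod[OF EF(2,3)] by simp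
    moreover have "prob G = prob E * prob F"
    proof -
      \<comment> \<open>With \<open>UNIV\<close> as increment set the path lemma yields the cylinder
        alone, which gives the product formula for the past event by itself.\<close>
      obtain A1 where A1: "A1 \<in> sets (Pi\<^sub>M {0..} (\<lambda>_. borel))"
        "\<forall>\<omega>\<in>space P. (\<omega> \<in> E \<inter> {\<omega> \<in> space P. X (t + h) \<omega> - X t \<omega> \<in> UNIV}) = ((\<lambda>t\<in>{0..}. X t \<omega>) \<in> A1)"
        using cylinder_increment_path[OF EF(2) t, of UNIV, OF UNIV_borel] by (elim bexE)
      obtain A2 where A2: "A2 \<in> sets (Pi\<^sub>M {0..} (\<lambda>_. borel))"
        "\<forall>\<omega>\<in>space P. (\<omega> \<in> F \<inter> {\<omega> \<in> space P. N (t + h) \<omega> - N t \<omega> \<in> UNIV}) = ((\<lambda>t\<in>{0..}. N t \<omega>) \<in> A2)"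
        using cylinder_increment_path[OF EF(3) t, of UNIV, OF UNIV_borel] by (elim bexE)
      have "prob ((E \<inter> {\<omega> \<in> space P. X (t + h) \<omega> - X t \<omega> \<in> UNIV}) \<inter> (F \<inter> {\<omega> \<in> space P. N (t + h) \<omega> - N t \<omega> \<in> UNIV})) =
        prob (E \<inter> {\<omega> \<in> space P. X (t + h) \<omega> - X t \<omega> \<in> UNIV}) * prob (F \<inter> {\<omega> \<in> space P. N (t + h) \<omega> - N t \<omega> \<in> UNIV})"
        by (rule prob_paths_indep[OF A1(1) A2(1) A1(2)[rule_format] _ A2(2)[rule_format]]) blast+
      then show ?thesis unfolding EF(1) using Esub by (simp add: Int_absorb2)
    qed
    ultimately show ?thesis by (simp add: H_prob)
  next
    assume "G \<in> null_sets P"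
    moreover have "H \<in> sets P" unfolding H using BC by (rule rect)
    ultimately have "G \<inter> H \<in> null_sets P" by (rule null_set_Int2)
    then show ?thesis using \<open>G \<in> null_sets P\<close> by (simp add: measure_eq_0_null_sets)
  qed
qed

lemma Int_stable_past_gen: "Int_stable (past_gen t)"
proof (rule Int_stableI)
  fix G H assume GH: "G \<in> past_gen t" "H \<in> past_gen t"
  show "G \<inter> H \<in> past_gen t"
  proof (cases "G \<in> null_sets P \<or> H \<in> null_sets P")
    case True
    moreover have "G \<in> sets P" "H \<in> sets P" using GH past_gen_events by auto
    ultimately have "G \<inter> H \<in> null_sets P" by (auto intro: null_set_Int1 null_set_Int2)
    then show ?thesis unfolding past_gen_def by (rule UnI2)
  next
    case False
    have "\<exists>E F. K = E \<inter> F \<and> E \<in> cylinders P X t \<and> F \<in> cylinders P N t"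
      if "K \<in> past_gen t" "K \<notin> null_sets P" for K
      using that unfolding past_gen_def Un_iff mem_Collect_eq by (elim disjE) simp_all
    note ex = this
    have "\<exists>E F. G = E \<inter> F \<and> E \<in> cylinders P X t \<and> F \<in> cylinders P N t" using False GH by (intro ex) simp_all
    then obtain E F where EF: "G = E \<inter> F" "E \<in> cylinders P X t" "F \<in> cylinders P N t" by (elim exE conjE)
    have "\<exists>E F. H = E \<inter> F \<and> E \<in> cylinders P X t \<and> F \<in> cylinders P N t" using False GH by (intro ex) simp_all
    then obtain E' F' where EF': "H = E' \<inter> F'" "E' \<in> cylinders P X t" "F' \<in> cylinders P N t" by (elim exE conjE)
    have cyl: "E \<inter> E' \<in> cylinders P X t" "F \<inter> F' \<in> cylinders P N t"
      by (rule Int_stable_cylinders[THEN Int_stableD, OF EF(2) EF'(2)])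
        (rule Int_stable_cylinders[THEN Int_stableD, OF EF(3) EF'(3)])
    have GH_eq: "G \<inter> H = (E \<inter> E') \<inter> (F \<inter> F')" unfolding EF(1) EF'(1) by auto
    show ?thesis unfolding GH_eq past_gen_def
      by (rule UnI1, rule CollectI, intro exI[of _ "E \<inter> E'"] exI[of _ "F \<inter> F'"] conjI refl cyl)
  qed
qed

lemma Int_stable_future_gen: "Int_stable (future_gen t h)"
proof (rule Int_stableI)
  fix G H assume "G \<in> future_gen t h" "H \<in> future_gen t h"
  then obtain B C B' C' where *: "G = {\<omega> \<in> space P. X (t + h) \<omega> - X t \<omega> \<in> B \<and> N (t + h) \<omega> - N t \<omega> \<in> C}"
    "B \<in> sets borel" "C \<in> sets borel"
    "H = {\<omega> \<in> space P. X (t + h) \<omega> - X t \<omega> \<in> B' \<and> N (t + h) \<omega> - N t \<omega> \<in> C'}"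
    "B' \<in> sets borel" "C' \<in> sets borel"
    unfolding future_gen_def mem_Collect_eq by (elim exE conjE)
  have GH: "G \<inter> H = {\<omega> \<in> space P. X (t + h) \<omega> - X t \<omega> \<in> B \<inter> B' \<and> N (t + h) \<omega> - N t \<omega> \<in> C \<inter> C'}"
    unfolding *(1,4) by auto
  show "G \<inter> H \<in> future_gen t h"
    unfolding GH by (rule future_genI) (use *(2,3,5,6) in auto)
qed

lemma prob_increments_indep:
  assumes t: "0 \<le> t" "0 \<le> h" and BC: "B \<in> sets borel" "C \<in> sets borel"
  shows "prob ({\<omega> \<in> space P. X (t + h) \<omega> - X t \<omega> \<in> B} \<inter> {\<omega> \<in> space P. N (t + h) \<omega> - N t \<omega> \<in> C}) =
    prob {\<omega> \<in> space P. X (t + h) \<omega> - X t \<omega> \<in> B} * prob {\<omega> \<in> space P. N (t + h) \<omega> - N t \<omega> \<in> C}"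
proof -
  have sp: "space P \<in> cylinders P Y t" for Y :: "real \<Rightarrow> 'a \<Rightarrow> real"
    by (rule space_cylinders)
  obtain A1 where A1: "A1 \<in> sets (Pi\<^sub>M {0..} (\<lambda>_. borel))"
    "\<forall>\<omega>\<in>space P. (\<omega> \<in> space P \<inter> {\<omega> \<in> space P. X (t + h) \<omega> - X t \<omega> \<in> B}) = ((\<lambda>t\<in>{0..}. X t \<omega>) \<in> A1)"
    using cylinder_increment_path[OF sp[of X] t BC(1)] by (elim bexE)
  obtain A2 where A2: "A2 \<in> sets (Pi\<^sub>M {0..} (\<lambda>_. borel))"
    "\<forall>\<omega>\<in>space P. (\<omega> \<in> space P \<inter> {\<omega> \<in> space P. N (t + h) \<omega> - N t \<omega> \<in> C}) = ((\<lambda>t\<in>{0..}. N t \<omega>) \<in> A2)"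
    using cylinder_increment_path[OF sp[of N] t BC(2)] by (elim bexE)
  have "prob ((space P \<inter> {\<omega> \<in> space P. X (t + h) \<omega> - X t \<omega> \<in> B}) \<inter> (space P \<inter> {\<omega> \<in> space P. N (t + h) \<omega> - N t \<omega> \<in> C})) =
    prob (space P \<inter> {\<omega> \<in> space P. X (t + h) \<omega> - X t \<omega> \<in> B}) * prob (space P \<inter> {\<omega> \<in> space P. N (t + h) \<omega> - N t \<omega> \<in> C})"
    by (rule prob_paths_indep[OF A1(1) A2(1) A1(2)[rule_format] _ A2(2)[rule_format]]) blast+
  moreover have "space P \<inter> {\<omega> \<in> space P. Q \<omega>} = {\<omega> \<in> space P. Q \<omega>}" for Q by blast
  ultimately show ?thesis by (simp only:)
qed

text \<open>\<open>Z\<close> is independent of the pair of increments, and inside the pair the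
  increment of \<open>X\<close> is independent of that of \<open>N\<close>; the expectation factors
  twice.\<close>

lemma integral_past_times_increments:
  fixes Z :: "'a \<Rightarrow> real" and g :: "real \<Rightarrow> real"
  assumes t: "0 \<le> t" "0 \<le> h"
    and Z: "Z \<in> borel_measurable (filt t)" "integrable P Z"
    and g: "g \<in> borel_measurable borel" "integrable P (\<lambda>\<omega>. g (X h \<omega>))" and C: "C \<in> sets borel"
  shows "integrable P (\<lambda>\<omega>. Z \<omega> * (g (X (t + h) \<omega> - X t \<omega>) * indicator C (N (t + h) \<omega> - N t \<omega>)))"
    and "(LINT \<omega>|P. Z \<omega> * (g (X (t + h) \<omega> - X t \<omega>) * indicator C (N (t + h) \<omega> - N t \<omega>))) =
    (LINT \<omega>|P. Z \<omega>) * ((LINT \<omega>|P. g (X h \<omega>)) * prob {\<omega> \<in> space P. N (t + h) \<omega> - N t \<omega> \<in> C})"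
proof -
  let ?D = "\<lambda>\<omega>. X (t + h) \<omega> - X t \<omega>" and ?K = "\<lambda>\<omega>. N (t + h) \<omega> - N t \<omega>"
  have D: "?D \<in> borel_measurable P" and K: "?K \<in> borel_measurable P"
    using t by (auto intro: X.measurable_increment N.measurable_increment)
  have Xh: "X h \<in> borel_measurable P" using t(2) by (rule X.measurable_process)
  have distr: "distr P borel ?D = distr P borel (X h)" using t by (subst X.distr_increment) auto
  have int_D: "integrable P (\<lambda>\<omega>. g (?D \<omega>))" and eq_D: "(LINT \<omega>|P. g (?D \<omega>)) = (LINT \<omega>|P. g (X h \<omega>))"
    using integrable_distr_eq[OF D g(1)] integrable_distr_eq[OF Xh g(1)] g(2)
      integral_distr[OF D g(1)] integral_distr[OF Xh g(1)] by (simp_all add: distr)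
  have int_K: "integrable P (\<lambda>\<omega>. indicator C (?K \<omega>) :: real)"
    by (rule X.integrable_const_bound[where B = 1]) (use K C in \<open>auto simp: indicator_def\<close>)
  have eq_K: "(LINT \<omega>|P. indicator C (?K \<omega>)) = prob {\<omega> \<in> space P. ?K \<omega> \<in> C}"
  proof -
    have "(LINT \<omega>|P. indicator C (?K \<omega>)) = (LINT \<omega>|P. indicat_real {\<omega> \<in> space P. ?K \<omega> \<in> C} \<omega>)"
      by (rule Bochner_Integration.integral_cong[OF refl]) (auto simp: indicator_def)
    also have "\<dots> = prob {\<omega> \<in> space P. ?K \<omega> \<in> C}"
    proof -
      have "{\<omega> \<in> space P. ?K \<omega> \<in> C} \<in> sets P" using K C by measurable
      then show ?thesis by simp
    qed
    finally show ?thesis .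
  qed
  let ?S = "sigma (space P) (future_gen t h)"
  have fg: "future_gen t h \<subseteq> Pow (space P)" unfolding future_gen_def by auto
  have sets_S: "sets ?S = sigma_sets (space P) (future_gen t h)" by (rule sets_measure_of[OF fg])
  have space_S: "space ?S = space P" by (rule space_measure_of_conv)
  have D_S: "?D \<in> borel_measurable ?S"
  proof (rule measurableI)
    fix B :: "real set" assume B: "B \<in> sets borel"
    have eq: "?D -` B \<inter> space P = {\<omega> \<in> space P. ?D \<omega> \<in> B \<and> ?K \<omega> \<in> UNIV}" by auto
    show "?D -` B \<inter> space ?S \<in> sets ?S"
      unfolding sets_S space_S eq by (rule sigma_sets.Basic, rule future_genI[OF B UNIV_borel])
  qed simp
  have K_S: "?K \<in> borel_measurable ?S"
  proof (rule measurableI)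
    fix B :: "real set" assume B: "B \<in> sets borel"
    have eq: "?K -` B \<inter> space P = {\<omega> \<in> space P. ?D \<omega> \<in> UNIV \<and> ?K \<omega> \<in> B}" by auto
    show "?K -` B \<inter> space ?S \<in> sets ?S"
      unfolding sets_S space_S eq by (rule sigma_sets.Basic, rule future_genI[OF UNIV_borel B])
  qed simp
  have W: "(\<lambda>\<omega>. g (?D \<omega>) * indicator C (?K \<omega>)) \<in> borel_measurable ?S"
    using D_S K_S g(1) C by measurable
  have ind: "X.indep_var borel Z borel (\<lambda>\<omega>. g (?D \<omega>) * indicator C (?K \<omega>))"
    by (rule X.indep_var_sigmaI[OF indep_past_future[OF t] Int_stable_past_gen Int_stable_future_gen
        measurable_filt_past[OF Z(1)] W])
  have "X.indep_set {?D -` B \<inter> space P |B. B \<in> sets borel} {?K -` B \<inter> space P |B. B \<in> sets borel}"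
    unfolding X.indep_sets2_eq
  proof (intro conjI ballI)
    show "{?D -` B \<inter> space P |B. B \<in> sets borel} \<subseteq> sets P" "{?K -` B \<inter> space P |B. B \<in> sets borel} \<subseteq> sets P"
      by (auto intro: measurable_sets[OF D] measurable_sets[OF K])
    fix E F assume EF: "E \<in> {?D -` B \<inter> space P |B. B \<in> sets borel}" "F \<in> {?K -` B \<inter> space P |B. B \<in> sets borel}"
    from EF(1) obtain B where B: "E = ?D -` B \<inter> space P" "B \<in> sets borel"
      unfolding mem_Collect_eq by (elim exE conjE)
    from EF(2) obtain C where C: "F = ?K -` C \<inter> space P" "C \<in> sets borel"
      unfolding mem_Collect_eq by (elim exE conjE)
    have "E = {\<omega> \<in> space P. ?D \<omega> \<in> B}" "F = {\<omega> \<in> space P. ?K \<omega> \<in> C}" unfolding B C by auto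
    then show "prob (E \<inter> F) = prob E * prob F" using prob_increments_indep[OF t B(2) C(2)] by simp
  qed
  then have "X.indep_set (sigma_sets (space P) {?D -` B \<inter> space P |B. B \<in> sets borel}) (sigma_sets (space P) {?K -` B \<inter> space P |B. B \<in> sets borel})"
    by (rule X.indep_set_sigma_sets) (rule Int_stable_vimage_sets)+
  then have "X.indep_var borel ?D borel ?K" using D K unfolding X.indep_var_eq by blast
  from X.indep_var_compose[OF this, of g borel "indicator C" borel] g(1) C
  have ind2: "X.indep_var borel (\<lambda>\<omega>. g (?D \<omega>)) borel (\<lambda>\<omega>. indicator C (?K \<omega>) :: real)"
    by (simp add: comp_def)
  note int_W = X.indep_var_integrable[OF ind2 int_D int_K]
  show "integrable P (\<lambda>\<omega>. Z \<omega> * (g (?D \<omega>) * indicator C (?K \<omega>)))"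
    by (rule X.indep_var_integrable[OF ind Z(2) int_W])
  show "(LINT \<omega>|P. Z \<omega> * (g (?D \<omega>) * indicator C (?K \<omega>))) =
    (LINT \<omega>|P. Z \<omega>) * ((LINT \<omega>|P. g (X h \<omega>)) * prob {\<omega> \<in> space P. ?K \<omega> \<in> C})"
    using X.indep_var_lebesgue_integral[OF ind Z(2) int_W] X.indep_var_lebesgue_integral[OF ind2 int_D int_K]
    by (simp only: eq_D eq_K)
qed

text \<open>A reset and a large oscillation of \<open>X\<close> in the same step are independent,
  which turns an error of order \<open>h\<close> into \<open>o(h)\<close>. The dyadic form of
  \<open>exits\<close> makes the oscillation an event about countably many path values.\<close>

lemma prob_exits_jump:
  assumes t: "0 \<le> t" "0 \<le> h" and C: "C \<in> sets borel"
  shows "prob (X.exits t h c \<inter> {\<omega> \<in> space P. N (t + h) \<omega> - N t \<omega> \<in> C}) =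
    prob (X.exits 0 h c) * prob {\<omega> \<in> space P. N (t + h) \<omega> - N t \<omega> \<in> C}"
proof -
  let ?M = "Pi\<^sub>M {0..} (\<lambda>_. borel :: real measure)"
  have sp: "space P \<in> cylinders P N t" by (rule space_cylinders)
  obtain A2 where A2: "A2 \<in> sets ?M"
    "\<forall>\<omega>\<in>space P. (\<omega> \<in> space P \<inter> {\<omega> \<in> space P. N (t + h) \<omega> - N t \<omega> \<in> C}) = ((\<lambda>t\<in>{0..}. N t \<omega>) \<in> A2)"
    using cylinder_increment_path[OF sp t C] by (elim bexE)
  define A1 where "A1 = (\<Union>m. {w \<in> space ?M. \<exists>k\<in>{..2^m}. \<bar>w (t + real k * (h / 2^m)) - w t\<bar> > c})"
  have A1: "A1 \<in> sets ?M" unfolding A1_def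
  proof (intro sets.countable_UN image_subsetI sets.sets_Collect_finite_Ex)
    fix m :: nat and k :: nat
    have "(\<lambda>w. w (t + real k * (h / 2^m)) - w t) \<in> borel_measurable ?M"
      using t by (intro borel_measurable_diff component_measurable) auto
    then show "{w \<in> space ?M. \<bar>w (t + real k * (h / 2^m)) - w t\<bar> > c} \<in> sets ?M" by measurable
  qed auto
  have "\<omega> \<in> X.exits t h c \<longleftrightarrow> (\<lambda>t\<in>{0..}. X t \<omega>) \<in> A1" if "\<omega> \<in> space P" for \<omega>
  proof -
    have "(\<lambda>t\<in>{0..}. X t \<omega>) \<in> space ?M" by (simp add: space_PiM)
    moreover have "0 \<le> t + real k * (h / 2^m)" for k m using t by simp
    ultimately show ?thesis using that t unfolding A1_def X.exits_def X.dyadic_exit_def by simp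
  qed
  then have "prob (X.exits t h c \<inter> (space P \<inter> {\<omega> \<in> space P. N (t + h) \<omega> - N t \<omega> \<in> C})) =
    prob (X.exits t h c) * prob (space P \<inter> {\<omega> \<in> space P. N (t + h) \<omega> - N t \<omega> \<in> C})"
    by (rule prob_paths_indep[OF A1 A2(1) _ _ A2(2)[rule_format]])
      (use sets.sets_into_space[OF X.exits_events[OF t]] in blast)+
  moreover have "space P \<inter> {\<omega> \<in> space P. Q \<omega>} = {\<omega> \<in> space P. Q \<omega>}" for Q by blast
  ultimately show ?thesis using X.prob_exits[OF t] by (simp only:)
qed

end

text \<open>The theorem allows paths to misbehave on a null set; this locale asks for a version without exceptional
  paths. With \<open>lam = 0\<close> and \<open>N = 0\<close> it covers the process that is never reset.\<close>

locale resetting = independent_levy_poisson P X lam N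
  for P :: "'a measure" and X :: "real \<Rightarrow> 'a \<Rightarrow> real" and lam :: real and N :: "real \<Rightarrow> 'a \<Rightarrow> real" +
  fixes U :: "real \<Rightarrow> 'a \<Rightarrow> real" and p q x a :: real
  assumes adapted: "\<And>t. 0 \<le> t \<Longrightarrow> U t \<in> borel_measurable (filt t)"
    and cadlag_U: "\<And>\<omega>. \<omega> \<in> space P \<Longrightarrow> cadlag (\<lambda>t. U t \<omega>)"
    and sde: "AE \<omega> in P. \<forall>t\<ge>0. U t \<omega> = x + X t \<omega> -
          (1 - p) * predictable_integral (\<lambda>s. U s \<omega>) (\<lambda>s. N s \<omega>) t"
    and start: "\<And>\<omega>. \<omega> \<in> space P \<Longrightarrow> U 0 \<omega> = x"
    and p: "0 < p" "p < 1" and q: "0 < q" and x_le_a: "x \<le> a"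
begin

lemma U_measurable: "0 \<le> t \<Longrightarrow> U t \<in> borel_measurable P"
  by (rule measurable_filt[OF adapted])

lemma AE_no_jump:
  "AE \<omega> in P. \<forall>t t'. 0 \<le> t \<and> t \<le> t' \<and> N t' \<omega> = N t \<omega> \<longrightarrow> U t' \<omega> = U t \<omega> + (X t' \<omega> - X t \<omega>)"
  using sde N.AE_counting_path AE_space
proof eventually_elim
  case (elim \<omega>)
  interpret counting_path "\<lambda>t. N t \<omega>" by fact
  show ?case
  proof (intro allI impI, elim conjE)
    fix t t' assume t: "0 \<le> t" "t \<le> t'" "N t' \<omega> = N t \<omega>"
    have "U t' \<omega> = x + X t' \<omega> - (1 - p) * predictable_integral (\<lambda>s. U s \<omega>) (\<lambda>s. N s \<omega>) t'"
      "U t \<omega> = x + X t \<omega> - (1 - p) * predictable_integral (\<lambda>s. U s \<omega>) (\<lambda>s. N s \<omega>) t"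
      using elim(1) t by auto
    moreover have "predictable_integral (\<lambda>s. U s \<omega>) (\<lambda>s. N s \<omega>) t' = predictable_integral (\<lambda>s. U s \<omega>) (\<lambda>s. N s \<omega>) t"
      by (rule predictable_integral_no_jump[OF cadlag_U[OF elim(3)] t])
    ultimately show "U t' \<omega> = U t \<omega> + (X t' \<omega> - X t \<omega>)" by simp
  qed
qed

text \<open>Up to the jump time \<open>T\<close> the solution moves with \<open>X\<close>, at
  \<open>T\<close> it loses the fraction \<open>1 - p\<close> of its left limit, and afterwards it
  moves with \<open>X\<close> again. An oscillation of at most \<open>c\<close> perturbs the value
  before the jump and the total increment by at most \<open>c\<close> each.\<close>

lemma AE_one_jump:
  "AE \<omega> in P. \<forall>t h c. 0 \<le> t \<and> 0 < h \<and> N (t + h) \<omega> = N t \<omega> + 1 \<and> \<omega> \<notin> X.exits t h c \<longrightarrow>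
     \<bar>U (t + h) \<omega> - p * U t \<omega>\<bar> \<le> 2 * c"
  using sde N.AE_counting_path AE_no_jump X.cadlag_paths AE_space
proof eventually_elim
  case (elim \<omega>)
  interpret counting_path "\<lambda>t. N t \<omega>" by fact
  note cU = cadlag_U[OF elim(5)]
  show ?case
  proof (intro allI impI, elim conjE)
    fix t h c :: real
    assume t: "0 \<le> t" "0 < h" "N (t + h) \<omega> = N t \<omega> + 1" "\<omega> \<notin> X.exits t h c"
    have le: "t \<le> t + h" using t by simp
    from predictable_integral_one_jump[OF cU t(1) le t(3)]
    obtain T where T: "t < T" "T \<le> t + h" "\<forall>s. t \<le> s \<and> s < T \<longrightarrow> N s \<omega> = N t \<omega>"
      "predictable_integral (\<lambda>s. U s \<omega>) (\<lambda>s. N s \<omega>) (t + h) =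
       predictable_integral (\<lambda>s. U s \<omega>) (\<lambda>s. N s \<omega>) t + left_lim (\<lambda>s. U s \<omega>) T"
      by (elim exE conjE)
    have X_bound: "\<bar>X s \<omega> - X t \<omega>\<bar> \<le> c" if "t \<le> s" "s \<le> t + h" for s
      by (rule X.not_exits_bound[OF elim(4,5) t(4,1,2) that])
    have "\<bar>U s \<omega> - U t \<omega>\<bar> \<le> c" if s: "t \<le> s" "s < T" for s
    proof -
      have "U s \<omega> = U t \<omega> + (X s \<omega> - X t \<omega>)" using elim(3)[rule_format, of t s] t(1) s T(3)[rule_format, of s] by simp
      then show ?thesis using X_bound[of s] s T(2) by simp
    qed
    then have L: "\<bar>left_lim (\<lambda>s. U s \<omega>) T - U t \<omega>\<bar> \<le> c"
      using T(1) t(1) by (intro left_lim_bounded[OF cU, where d = "T - t"]) auto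
    define L where "L = left_lim (\<lambda>s. U s \<omega>) T"
    define I where "I = predictable_integral (\<lambda>s. U s \<omega>) (\<lambda>s. N s \<omega>) t"
    have "U (t + h) \<omega> = x + X (t + h) \<omega> - (1 - p) * (I + L)" "U t \<omega> = x + X t \<omega> - (1 - p) * I"
      using elim(1) t le T(4) by (auto simp: I_def L_def)
    \<comment> \<open>The equation at the two endpoints, with the integral growing by
      \<open>L\<close>, rearranged so that both deviations are visible.\<close>
    then have "U (t + h) \<omega> - p * U t \<omega> = (X (t + h) \<omega> - X t \<omega>) - (1 - p) * (L - U t \<omega>)"
      by (simp add: algebra_simps)
    also have "\<bar>\<dots>\<bar> \<le> \<bar>X (t + h) \<omega> - X t \<omega>\<bar> + \<bar>(1 - p) * (L - U t \<omega>)\<bar>" by (rule abs_triangle_ineq4)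
    also have "\<bar>(1 - p) * (L - U t \<omega>)\<bar> = (1 - p) * \<bar>L - U t \<omega>\<bar>" using p by (simp add: abs_mult)
    also have "\<dots> \<le> 1 * \<bar>L - U t \<omega>\<bar>" using p by (intro mult_right_mono) auto
    finally show "\<bar>U (t + h) \<omega> - p * U t \<omega>\<bar> \<le> 2 * c"
      using X_bound[of "t + h"] L t le by (simp add: L_def)
  qed
qed

text \<open>Over one step there is no reset (then \<open>f\<close> is exponential at the endpoint unless \<open>X\<close> has moved up by
  more than \<open>\<delta>\<close>), one reset (then the endpoint is close to \<open>p U\<close> unless \<open>X\<close> has oscillated by
  more than \<open>c\<close>), or several.\<close>

lemma one_step_bound:
  fixes f :: "real \<Rightarrow> real" and \<alpha> \<theta> \<delta> B K c h :: real and k n :: nat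
  assumes h_def: "h = 1 / real (Suc n)" and \<theta>: "0 \<le> \<theta>" and \<delta>: "0 < \<delta>" and [measurable]: "f \<in> borel_measurable borel"
    and K: "\<And>u. \<bar>f u\<bar> \<le> K" and B: "\<And>u v. \<bar>f u - f v\<bar> \<le> B * \<bar>u - v\<bar>"
    and f_exp: "\<And>u. u \<le> a + \<delta> \<Longrightarrow> f u = \<alpha> * exp (\<theta> * u)"
    and A: "A \<in> sets (filt (real k * h))" "\<And>\<omega>. \<omega> \<in> A \<Longrightarrow> U (real k * h) \<omega> \<le> a"
    and c: "0 < c"
  shows "\<bar>(LINT \<omega>|P. indicator A \<omega> * f (U (real (Suc k) * h) \<omega>)) -
      (\<alpha> * exp ((X.\<psi> \<theta> - lam) * h) * (LINT \<omega>|P. indicator A \<omega> * exp (\<theta> * U (real k * h) \<omega>)) +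
       lam * h * exp (- lam * h) * (LINT \<omega>|P. indicator A \<omega> * f (p * U (real k * h) \<omega>)))\<bar>
    \<le> (K + \<bar>\<alpha>\<bar> * exp (\<theta> * a)) * (LINT \<omega>|P. exp (\<theta> * X h \<omega>) * indicator {\<delta><..} (X h \<omega>)) +
      (2 * B * c + 2 * K * prob (X.exits 0 h c)) * (lam * h) + K * (lam * h)\<^sup>2"
proof -
  define t where "t = real k * h"
  have h: "0 < h" "0 \<le> h" by (simp_all add: h_def)
  have t: "0 \<le> t" using h by (simp add: t_def)
  have t_Suc: "real (Suc k) * h = t + h" by (simp add: t_def algebra_simps)
  have lam: "0 \<le> lam" by (rule N.intensity_nonneg)
  have K0: "0 \<le> K" using K[of 0] by linarith
  have B0: "0 \<le> B" using B[of 0 1] by simp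
  let ?D = "\<lambda>\<omega>. X (t + h) \<omega> - X t \<omega>" and ?J = "\<lambda>\<omega>. N (t + h) \<omega> - N t \<omega>"
  have [measurable]: "?D \<in> borel_measurable P" "?J \<in> borel_measurable P"
    using t h by (auto intro: X.measurable_increment N.measurable_increment)
  have Xh [measurable]: "X h \<in> borel_measurable P" using h(2) by (rule X.measurable_process)
  have [measurable]: "U t \<in> borel_measurable P" "U (t + h) \<in> borel_measurable P"
    using t h by (auto intro: U_measurable)
  have Ut: "U t \<in> borel_measurable (filt t)" by (rule adapted[OF t])
  have A_filt: "A \<in> sets (filt t)" using A(1) by (simp add: t_def)
  have A_P [measurable]: "A \<in> sets P" using A_filt sets_filt_events by auto
  have A_le: "\<omega> \<in> A \<Longrightarrow> U t \<omega> \<le> a" for \<omega> using A(2) by (simp add: t_def)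
  have A_exp: "\<omega> \<in> A \<Longrightarrow> exp (\<theta> * U t \<omega>) \<le> exp (\<theta> * a)" for \<omega> using A_le \<theta> by (simp add: mult_left_mono)
  have exits_P [measurable]: "X.exits t h c \<in> sets P" using t h by (intro X.exits_events) auto
  have \<beta>_int: "integrable P (\<lambda>\<omega>. exp (\<theta> * X h \<omega>))"
    unfolding h_def by (rule X.exp_moment_grid[OF \<theta>]) simp
  have mgf: "(LINT \<omega>|P. exp (\<theta> * X h \<omega>)) = exp (X.\<psi> \<theta> * h)"
    using X.mgf_grid[OF \<theta>, of "Suc n"] by (simp add: h_def)
  \<comment> \<open>The part of the exponential moment belonging to upward moves beyond
    \<open>\<delta>\<close>; its mean \<open>\<beta>\<close> is what
    \<open>exp_moment_exceed_tendsto_0\<close> makes small.\<close>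
  define g where "g y = exp (\<theta> * y) * indicator {\<delta><..} y" for y
  have [measurable]: "g \<in> borel_measurable borel" unfolding g_def by measurable
  have g_int: "integrable P (\<lambda>\<omega>. g (X h \<omega>))"
    by (rule Bochner_Integration.integrable_bound[OF \<beta>_int]) (auto simp: g_def indicator_def)
  define \<beta> where "\<beta> = (LINT \<omega>|P. g (X h \<omega>))"
  define Z0 where "Z0 \<omega> = indicator A \<omega> * exp (\<theta> * U t \<omega>)" for \<omega>
  define Z1 where "Z1 \<omega> = indicator A \<omega> * f (p * U t \<omega>)" for \<omega>
  have Z_filt: "Z0 \<in> borel_measurable (filt t)" "Z1 \<in> borel_measurable (filt t)"
    unfolding Z0_def Z1_def using Ut A_filt by measurable
  have Z0_int: "integrable P Z0"
    by (rule X.integrable_const_bound[where B = "exp (\<theta> * a)"])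
       (use A_exp measurable_filt[OF Z_filt(1)] in \<open>auto simp: Z0_def indicator_def\<close>)
  have Z1_int: "integrable P Z1"
    by (rule X.integrable_const_bound[where B = K])
       (use K K0 measurable_filt[OF Z_filt(2)] in \<open>auto simp: Z1_def indicator_def\<close>)
  have J0: "prob {\<omega> \<in> space P. ?J \<omega> \<in> {0}} = exp (- lam * h)"
    using N.prob_increment_eq[OF t h(2), of 0] by simp
  have J1: "prob {\<omega> \<in> space P. ?J \<omega> \<in> {1}} = lam * h * exp (- lam * h)"
    using N.prob_increment_eq[OF t h(2), of 1] by simp
  \<comment> \<open>The idealised outcomes of a step: \<open>T0\<close> continues the exponential
    without reset, \<open>T1\<close> places the process exactly at \<open>p * U t\<close> after one
    reset. Their means are computable by independence.\<close>
  define T0 where "T0 \<omega> = Z0 \<omega> * (exp (\<theta> * ?D \<omega>) * indicator {0} (?J \<omega>))" for \<omega>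
  define T1 where "T1 \<omega> = Z1 \<omega> * (1 * indicator {1} (?J \<omega>))" for \<omega>
  note I0 = integral_past_times_increments[OF t h(2) Z_filt(1) Z0_int, of "\<lambda>y. exp (\<theta> * y)" "{0}"]
  have T0: "integrable P T0" "(LINT \<omega>|P. T0 \<omega>) = (LINT \<omega>|P. Z0 \<omega>) * (exp (X.\<psi> \<theta> * h) * exp (- lam * h))"
    unfolding T0_def J0[symmetric] mgf[symmetric] by (rule I0; use \<beta>_int in simp)+
  note I1 = integral_past_times_increments[OF t h(2) Z_filt(2) Z1_int, of "\<lambda>y. 1" "{1}"]
  have T1_int: "integrable P T1" and T1': "(LINT \<omega>|P. T1 \<omega>) = (LINT \<omega>|P. Z1 \<omega>) * ((LINT \<omega>|P. 1) * prob {\<omega> \<in> space P. ?J \<omega> \<in> {1}})"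
    unfolding T1_def by (rule I1; simp)+
  have T1: "integrable P T1" "(LINT \<omega>|P. T1 \<omega>) = (LINT \<omega>|P. Z1 \<omega>) * (lam * h * exp (- lam * h))"
    using T1_int T1' unfolding J1 by (simp_all add: X.prob_space)
  define F where "F \<omega> = indicator A \<omega> * f (U (t + h) \<omega>)" for \<omega>
  have F_meas: "F \<in> borel_measurable P" unfolding F_def by measurable
  have F_int: "integrable P F"
    by (rule X.integrable_const_bound[where B = K]) (use K K0 F_meas in \<open>auto simp: F_def indicator_def\<close>)
  define E1 where "E1 = {\<omega> \<in> space P. ?J \<omega> \<in> {1}}"
  define E2 where "E2 = {\<omega> \<in> space P. ?J \<omega> \<notin> {0, 1}}"
  have [measurable]: "E1 \<in> sets P" "E2 \<in> sets P" unfolding E1_def E2_def by measurable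
  define C where "C = K + \<bar>\<alpha>\<bar> * exp (\<theta> * a)"
  have C0: "0 \<le> C" using K0 by (simp add: C_def)
  \<comment> \<open>One summand for each way the idealisation fails: an upward move beyond
    \<open>\<delta>\<close> without reset, a deviation of at most \<open>2 * c\<close> at a reset, a
    reset with large oscillation, and several resets.\<close>
  define W where "W \<omega> = C * g (?D \<omega>) + 2 * B * c * indicator E1 \<omega> + 2 * K * indicator (X.exits t h c \<inter> E1) \<omega> + K * indicator E2 \<omega>" for \<omega>
  have distr: "distr P borel ?D = distr P borel (X h)" using t h by (subst X.distr_increment) auto
  have gD: "integrable P (\<lambda>\<omega>. g (?D \<omega>))" "(LINT \<omega>|P. g (?D \<omega>)) = \<beta>"
    using integrable_distr_eq[of ?D P borel g] integrable_distr_eq[of "X h" P borel g] g_int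
      integral_distr[of ?D P borel g] integral_distr[of "X h" P borel g] by (simp_all add: distr \<beta>_def)
  have ind_int: "integrable P (\<lambda>\<omega>. indicat_real S \<omega>)" if "S \<in> sets P" for S
    using that by (intro integrable_real_indicator) (auto simp: less_top[symmetric])
  have W_int: "integrable P W" unfolding W_def
    by (intro Bochner_Integration.integrable_add integrable_mult_right gD ind_int) measurable
  have W_eq: "(LINT \<omega>|P. W \<omega>) = C * \<beta> + 2 * B * c * prob E1 + 2 * K * prob (X.exits t h c \<inter> E1) + K * prob E2"
    unfolding W_def using gD ind_int by (simp add: integral_add)
  have bound: "AE \<omega> in P. \<bar>F \<omega> - (\<alpha> * T0 \<omega> + T1 \<omega>)\<bar> \<le> W \<omega>"
    using AE_no_jump AE_one_jump AE_space
  proof eventually_elim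
    case (elim \<omega>)
    have g0: "0 \<le> g (?D \<omega>)" by (simp add: g_def)
    have W0: "C * g (?D \<omega>) \<le> W \<omega>" "2 * B * c * indicator E1 \<omega> + 2 * K * indicator (X.exits t h c \<inter> E1) \<omega> \<le> W \<omega>"
      "K * indicator E2 \<omega> \<le> W \<omega>"
      using g0 C0 K0 B0 c unfolding W_def by simp_all
    show ?case
    proof (cases "\<omega> \<in> A")
      case False
      then have "F \<omega> - (\<alpha> * T0 \<omega> + T1 \<omega>) = 0" by (simp add: F_def T0_def T1_def Z0_def Z1_def)
      moreover have "0 \<le> C * g (?D \<omega>)" using C0 g0 by simp
      ultimately show ?thesis using W0(1) by simp
    next
      case True
      consider "?J \<omega> = 0" | "?J \<omega> = 1" | "?J \<omega> \<notin> {0, 1}" by blast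
      then show ?thesis
      proof cases
        case 1
        then have "N (t + h) \<omega> = N t \<omega>" by simp
        then have U': "U (t + h) \<omega> = U t \<omega> + ?D \<omega>" using elim(1) t h by auto
        have eq: "F \<omega> - (\<alpha> * T0 \<omega> + T1 \<omega>) = f (U t \<omega> + ?D \<omega>) - \<alpha> * exp (\<theta> * (U t \<omega> + ?D \<omega>))"
          using True 1 U' by (simp add: F_def T0_def T1_def Z0_def Z1_def exp_add[symmetric] distrib_left)
        show ?thesis
        \<comment> \<open>Starting below \<open>a\<close>, a move of at most \<open>\<delta>\<close>
          ends where \<open>f\<close> is still the exponential, so there is no error at all; the
          margin above \<open>a\<close> exists for this purpose.\<close>
        proof (cases "?D \<omega> \<le> \<delta>")
          case True
          then have "f (U t \<omega> + ?D \<omega>) = \<alpha> * exp (\<theta> * (U t \<omega> + ?D \<omega>))"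
            using A_le[OF \<open>\<omega> \<in> A\<close>] by (intro f_exp) linarith
          then have "F \<omega> - (\<alpha> * T0 \<omega> + T1 \<omega>) = 0" unfolding eq by simp
          moreover have "0 \<le> C * g (?D \<omega>)" using C0 g0 by simp
          ultimately show ?thesis using W0(1) by simp
        next
          case False
          then have g_eq: "g (?D \<omega>) = exp (\<theta> * ?D \<omega>)" by (simp add: g_def)
          have ge1: "1 \<le> exp (\<theta> * ?D \<omega>)" using False \<delta> \<theta> by simp
          have "\<bar>\<alpha> * exp (\<theta> * (U t \<omega> + ?D \<omega>))\<bar> = \<bar>\<alpha>\<bar> * (exp (\<theta> * U t \<omega>) * exp (\<theta> * ?D \<omega>))"
            by (simp add: abs_mult exp_add[symmetric] distrib_left)
          also have "\<dots> \<le> \<bar>\<alpha>\<bar> * (exp (\<theta> * a) * exp (\<theta> * ?D \<omega>))"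
            using A_exp[OF \<open>\<omega> \<in> A\<close>] by (intro mult_left_mono mult_right_mono) auto
          finally have 2: "\<bar>\<alpha> * exp (\<theta> * (U t \<omega> + ?D \<omega>))\<bar> \<le> \<bar>\<alpha>\<bar> * (exp (\<theta> * a) * exp (\<theta> * ?D \<omega>))" .
          have "K * 1 \<le> K * exp (\<theta> * ?D \<omega>)" using ge1 K0 by (rule mult_left_mono)
          then have 3: "\<bar>f (U t \<omega> + ?D \<omega>)\<bar> \<le> K * exp (\<theta> * ?D \<omega>)" using K[of "U t \<omega> + ?D \<omega>"] by simp
          have "\<bar>F \<omega> - (\<alpha> * T0 \<omega> + T1 \<omega>)\<bar> \<le> \<bar>f (U t \<omega> + ?D \<omega>)\<bar> + \<bar>\<alpha> * exp (\<theta> * (U t \<omega> + ?D \<omega>))\<bar>"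
            unfolding eq by (rule abs_triangle_ineq4)
          also have "\<dots> \<le> K * exp (\<theta> * ?D \<omega>) + \<bar>\<alpha>\<bar> * (exp (\<theta> * a) * exp (\<theta> * ?D \<omega>))"
            using 2 3 by (rule add_mono[rotated])
          also have "\<dots> = C * g (?D \<omega>)" unfolding g_eq C_def by (simp add: algebra_simps)
          finally show ?thesis using W0(1) by linarith
        qed
      next
        case 2
        then have J: "N (t + h) \<omega> = N t \<omega> + 1" by simp
        have E1: "\<omega> \<in> E1" using 2 elim(3) by (simp add: E1_def)
        have eq: "F \<omega> - (\<alpha> * T0 \<omega> + T1 \<omega>) = f (U (t + h) \<omega>) - f (p * U t \<omega>)"
          using True 2 by (simp add: F_def T0_def T1_def Z0_def Z1_def)
        have "\<bar>f (U (t + h) \<omega>) - f (p * U t \<omega>)\<bar> \<le> 2 * B * c + 2 * K * indicator (X.exits t h c) \<omega>"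
        proof (cases "\<omega> \<in> X.exits t h c")
          case True
          have "\<bar>f (U (t + h) \<omega>) - f (p * U t \<omega>)\<bar> \<le> K + K"
            using K[of "U (t + h) \<omega>"] K[of "p * U t \<omega>"] by linarith
          moreover have "0 \<le> 2 * B * c" using B0 c by simp
          ultimately show ?thesis using True by simp
        next
          case False
          then have "\<bar>U (t + h) \<omega> - p * U t \<omega>\<bar> \<le> 2 * c" using elim(2) t h(1) J by blast
          then have "B * \<bar>U (t + h) \<omega> - p * U t \<omega>\<bar> \<le> B * (2 * c)" using B0 by (rule mult_left_mono)
          then show ?thesis using B[of "U (t + h) \<omega>" "p * U t \<omega>"] False by simp
        qed
        then show ?thesis unfolding eq using W0(2) E1 by (simp add: indicator_def)
      next
        case 3
        have E2: "\<omega> \<in> E2" using 3 elim(3) by (simp add: E2_def)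
        have "F \<omega> - (\<alpha> * T0 \<omega> + T1 \<omega>) = f (U (t + h) \<omega>)"
          using True 3 by (simp add: F_def T0_def T1_def)
        then show ?thesis using W0(3) E2 K[of "U (t + h) \<omega>"] by simp
      qed
    qed
  qed
  have int_diff: "integrable P (\<lambda>\<omega>. F \<omega> - (\<alpha> * T0 \<omega> + T1 \<omega>))"
    using F_int T0(1) T1(1) by auto
  have "(LINT \<omega>|P. F \<omega> - (\<alpha> * T0 \<omega> + T1 \<omega>)) = (LINT \<omega>|P. F \<omega>) - (\<alpha> * (LINT \<omega>|P. T0 \<omega>) + (LINT \<omega>|P. T1 \<omega>))"
    using F_int T0(1) T1(1) by simp
  moreover have "\<bar>LINT \<omega>|P. F \<omega> - (\<alpha> * T0 \<omega> + T1 \<omega>)\<bar> \<le> (LINT \<omega>|P. \<bar>F \<omega> - (\<alpha> * T0 \<omega> + T1 \<omega>)\<bar>)"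
    by (rule integral_abs_bound)
  moreover have "\<dots> \<le> (LINT \<omega>|P. W \<omega>)"
    by (rule integral_mono_AE) (use int_diff W_int bound in auto)
  ultimately have main: "\<bar>(LINT \<omega>|P. F \<omega>) - (\<alpha> * (LINT \<omega>|P. T0 \<omega>) + (LINT \<omega>|P. T1 \<omega>))\<bar> \<le> (LINT \<omega>|P. W \<omega>)"
    by linarith
  have lh: "0 \<le> lam * h" using lam h by simp
  have "lam * h * exp (- lam * h) \<le> lam * h * 1" using lh by (intro mult_left_mono) auto
  then have E1_le: "prob E1 \<le> lam * h" unfolding E1_def J1 by simp
  have E2_le: "prob E2 \<le> (lam * h)\<^sup>2" unfolding E2_def by (rule N.prob_several_jumps[OF t h(2)])
  have "prob (X.exits t h c \<inter> E1) = prob (X.exits 0 h c) * prob E1"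
    unfolding E1_def by (rule prob_exits_jump[OF t h(2)]) simp
  also have "\<dots> \<le> prob (X.exits 0 h c) * (lam * h)" using E1_le by (rule mult_left_mono) simp
  finally have E12_le: "prob (X.exits t h c \<inter> E1) \<le> prob (X.exits 0 h c) * (lam * h)" .
  have "(LINT \<omega>|P. W \<omega>) \<le> C * \<beta> + 2 * B * c * (lam * h) + 2 * K * (prob (X.exits 0 h c) * (lam * h)) + K * (lam * h)\<^sup>2"
    unfolding W_eq using E1_le E2_le E12_le B0 K0 c by (intro add_mono mult_left_mono order_refl) auto
  also have "\<dots> = C * \<beta> + (2 * B * c + 2 * K * prob (X.exits 0 h c)) * (lam * h) + K * (lam * h)\<^sup>2"
    by (simp add: algebra_simps)
  finally have W_le: "(LINT \<omega>|P. W \<omega>) \<le> \<dots>" .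
  have "exp ((X.\<psi> \<theta> - lam) * h) = exp (X.\<psi> \<theta> * h) * exp (- lam * h)"
    by (simp add: exp_add[symmetric] algebra_simps)
  then have "\<alpha> * (LINT \<omega>|P. T0 \<omega>) + (LINT \<omega>|P. T1 \<omega>) =
    \<alpha> * exp ((X.\<psi> \<theta> - lam) * h) * (LINT \<omega>|P. Z0 \<omega>) + lam * h * exp (- lam * h) * (LINT \<omega>|P. Z1 \<omega>)"
    unfolding T0 T1 by (simp only: mult_ac)
  with main W_le show ?thesis
    unfolding t_Suc t_def[symmetric] by (simp only: F_def Z0_def Z1_def C_def \<beta>_def g_def)
qed

text \<open>The error is \<open>o(h)\<close> with a threshold in \<open>n\<close> that works for all
  steps \<open>k\<close> and all past events \<open>A\<close>; this uniformity allows the errors to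
  be summed over the grid.\<close>

lemma one_step:
  fixes f :: "real \<Rightarrow> real" and \<alpha> \<theta> \<delta> B K e :: real
  assumes \<theta>: "0 \<le> \<theta>" and \<delta>: "0 < \<delta>" and f: "f \<in> borel_measurable borel"
    and K: "\<And>u. \<bar>f u\<bar> \<le> K" and B: "\<And>u v. \<bar>f u - f v\<bar> \<le> B * \<bar>u - v\<bar>"
    and f_exp: "\<forall>u. u \<le> a + \<delta> \<longrightarrow> f u = \<alpha> * exp (\<theta> * u)"
    and e: "0 < e"
  shows "\<forall>\<^sub>F n in sequentially. \<forall>k A. A \<in> sets (filt (real k * (1 / real (Suc n)))) \<longrightarrow>
     (\<forall>\<omega>\<in>A. U (real k * (1 / real (Suc n))) \<omega> \<le> a) \<longrightarrow>
     \<bar>(LINT \<omega>|P. indicator A \<omega> * f (U (real (Suc k) * (1 / real (Suc n))) \<omega>)) -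
      (\<alpha> * exp ((X.\<psi> \<theta> - lam) * (1 / real (Suc n))) * (LINT \<omega>|P. indicator A \<omega> * exp (\<theta> * U (real k * (1 / real (Suc n))) \<omega>)) +
       lam * (1 / real (Suc n)) * exp (- lam * (1 / real (Suc n))) * (LINT \<omega>|P. indicator A \<omega> * f (p * U (real k * (1 / real (Suc n))) \<omega>)))\<bar>
    \<le> e * (1 / real (Suc n))"
proof -
  have lam: "0 \<le> lam" by (rule N.intensity_nonneg)
  have B0: "0 \<le> B" using B[of 0 1] by simp
  define C where "C = K + \<bar>\<alpha>\<bar> * exp (\<theta> * a)"
  \<comment> \<open>Chosen so that \<open>2 * B * c * lam\<close> is at most \<open>e / 2\<close>;
    the added 1 keeps the denominator positive.\<close>
  define c where "c = e / (4 * (B * lam + 1))"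
  have Bl: "0 \<le> B * lam" using B0 lam by simp
  have c: "0 < c" using e Bl by (simp add: c_def)
  have cB: "2 * B * c * lam \<le> e / 2"
  proof -
    have "2 * B * c * lam = (e / 2) * (B * lam / (B * lam + 1))" using Bl by (simp add: c_def field_simps)
    also have "\<dots> \<le> (e / 2) * 1" using e Bl by (intro mult_left_mono) auto
    finally show ?thesis by simp
  qed
  \<comment> \<open>The remaining error terms divided by \<open>h\<close>, each of which tends to 0
    for this fixed \<open>c\<close>.\<close>
  define R where "R n = C * (real (Suc n) * (LINT \<omega>|P. exp (\<theta> * X (1 / real (Suc n)) \<omega>) * indicator {\<delta><..} (X (1 / real (Suc n)) \<omega>))) +
      2 * K * prob (X.exits 0 (1 / real (Suc n)) c) * lam + K * lam\<^sup>2 * (1 / real (Suc n))" for n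
  have "R \<longlonglongrightarrow> C * 0 + 2 * K * 0 * lam + K * lam\<^sup>2 * 0"
    unfolding R_def
    by (intro tendsto_intros X.exp_moment_exceed_tendsto_0[OF \<theta> \<delta>] X.prob_exits_tendsto_0[OF c] LIMSEQ_Suc[OF lim_1_over_n])
  then have "\<forall>\<^sub>F n in sequentially. R n < e / 2"
    by (rule order_tendstoD(2)) (use e in simp)
  then show ?thesis
  proof eventually_elim
    case (elim n)
    define h where "h = 1 / real (Suc n)"
    have h: "0 < h" "real (Suc n) * h = 1" by (simp_all add: h_def)
    show ?case
    proof (intro allI impI)
      fix k :: nat and A
      assume A: "A \<in> sets (filt (real k * (1 / real (Suc n))))" "\<forall>\<omega>\<in>A. U (real k * (1 / real (Suc n))) \<omega> \<le> a"
      define \<beta> where "\<beta> = (LINT \<omega>|P. exp (\<theta> * X h \<omega>) * indicator {\<delta><..} (X h \<omega>))"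
      define \<pi> where "\<pi> = prob (X.exits 0 h c)"
      have "C * \<beta> + (2 * B * c + 2 * K * \<pi>) * (lam * h) + K * (lam * h)\<^sup>2 = (R n + 2 * B * c * lam) * h"
      proof -
        have "R n = C * (real (Suc n) * \<beta>) + 2 * K * \<pi> * lam + K * lam\<^sup>2 * h"
          by (simp only: R_def \<beta>_def \<pi>_def h_def)
        then have "(R n + 2 * B * c * lam) * h = C * \<beta> * (real (Suc n) * h) + 2 * K * \<pi> * lam * h + K * lam\<^sup>2 * h * h + 2 * B * c * lam * h"
          by (simp add: algebra_simps del: of_nat_Suc)
        then show ?thesis unfolding h(2) by (simp add: algebra_simps power2_eq_square)
      qed
      also have "\<dots> \<le> (e / 2 + e / 2) * h" using elim cB h by (intro mult_right_mono add_mono) auto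
      finally have le: "C * \<beta> + (2 * B * c + 2 * K * \<pi>) * (lam * h) + K * (lam * h)\<^sup>2 \<le> e * h" by simp
      show "\<bar>(LINT \<omega>|P. indicator A \<omega> * f (U (real (Suc k) * (1 / real (Suc n))) \<omega>)) -
        (\<alpha> * exp ((X.\<psi> \<theta> - lam) * (1 / real (Suc n))) * (LINT \<omega>|P. indicator A \<omega> * exp (\<theta> * U (real k * (1 / real (Suc n))) \<omega>)) +
         lam * (1 / real (Suc n)) * exp (- lam * (1 / real (Suc n))) * (LINT \<omega>|P. indicator A \<omega> * f (p * U (real k * (1 / real (Suc n))) \<omega>)))\<bar>
        \<le> e * (1 / real (Suc n))"
        using one_step_bound[OF refl \<theta> \<delta> f K B f_exp[rule_format] A(1) A(2)[rule_format] c] le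
        unfolding C_def \<beta>_def \<pi>_def h_def by (rule order_trans)
    qed
  qed
qed

end

section \<open>First passage on a grid\<close>

text \<open>The real-valued form of \<open>first_passage\<close>; it carries information only when
  the level is exceeded, since the infimum of the empty set is unspecified.\<close>

definition crossing_time :: "real \<Rightarrow> (real \<Rightarrow> real) \<Rightarrow> real" where
  "crossing_time a u = Inf {t. 0 < t \<and> a < u t}"

definition grid_alive :: "real \<Rightarrow> (real \<Rightarrow> real) \<Rightarrow> real \<Rightarrow> nat \<Rightarrow> bool" where
  "grid_alive a u h k \<longleftrightarrow> (\<forall>j\<in>{..k}. u (real j * h) \<le> a)"

lemma exponential_integral:
  fixes q :: real
  assumes q: "0 < q"
  shows "integrable lborel (\<lambda>s. indicat_real {0..} s * exp (- q * s))"
    "(LINT s|lborel. indicat_real {0..} s * exp (- q * s)) = 1 / q"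
proof -
  interpret E: prob_space "density lborel (exponential_density q)"
    by (rule prob_space_exponential_density[OF q])
  have "(\<integral>\<^sup>+s. ennreal (exponential_density q s) \<partial>lborel) = 1"
    using E.emeasure_space_1 by (simp add: emeasure_density)
  moreover have "exponential_density q s = q * (indicat_real {0..} s * exp (- q * s))" for s
    by (simp add: exponential_density_def indicator_def mult_ac)
  ultimately have nn: "(\<integral>\<^sup>+s. ennreal (q * (indicat_real {0..} s * exp (- q * s))) \<partial>lborel) = 1" by simp
  have int: "integrable lborel (\<lambda>s. q * (indicat_real {0..} s * exp (- q * s)))"
    by (rule integrableI_nonneg) (use q nn in auto)
  then show "integrable lborel (\<lambda>s. indicat_real {0..} s * exp (- q * s))"
    using q by simp
  have "(LINT s|lborel. q * (indicat_real {0..} s * exp (- q * s))) = 1"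
    using integral_eq_nn_integral[of "\<lambda>s. q * (indicat_real {0..} s * exp (- q * s))" lborel] q nn by simp
  then show "(LINT s|lborel. indicat_real {0..} s * exp (- q * s)) = 1 / q"
    using q by (simp add: field_simps)
qed

locale cadlag_path =
  fixes u :: "real \<Rightarrow> real" and a :: real
  assumes cadlag: "cadlag u" and start: "u 0 \<le> a"
begin

abbreviation "h n \<equiv> 1 / real (Suc n)"

abbreviation "crosses \<equiv> {t. 0 < t \<and> a < u t} \<noteq> {}"

abbreviation "\<tau> \<equiv> crossing_time a u"

lemma bdd: "bdd_below {t. 0 < t \<and> a < u t}"
  by (rule bdd_belowI[of _ 0]) auto

lemma crossing_nonneg: "crosses \<Longrightarrow> 0 \<le> \<tau>"
  unfolding crossing_time_def by (rule cInf_greatest) auto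

lemma crossing_le: "0 < t \<Longrightarrow> a < u t \<Longrightarrow> \<tau> \<le> t"
  unfolding crossing_time_def by (rule cInf_lower[OF _ bdd]) auto

text \<open>If the path were below \<open>a\<close> at \<open>\<tau>\<close>, right-continuity would
  keep it below \<open>a\<close> for a while, and \<open>\<tau>\<close> would not be the
  infimum.\<close>

lemma crossing_value_ge:
  assumes crosses
  shows "a \<le> u \<tau>"
proof (rule ccontr)
  assume less: "\<not> a \<le> u \<tau>"
  have "0 < a - u \<tau>" using less by simp
  from cadlag_local_right[OF cadlag crossing_nonneg[OF assms] this]
  obtain d where d: "d > 0" "\<forall>s. \<tau> \<le> s \<and> s < \<tau> + d \<longrightarrow> \<bar>u s - u \<tau>\<bar> < a - u \<tau>"
    by (elim exE conjE)
  have "Inf {t. 0 < t \<and> a < u t} < \<tau> + d" using d(1) by (simp add: crossing_time_def)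
  then obtain t where t: "0 < t" "a < u t" "t < \<tau> + d" using cInf_lessD[OF assms] by blast
  have "\<bar>u t - u \<tau>\<bar> < a - u \<tau>" using crossing_le[OF t(1,2)] t(3) d(2) by simp
  then show False using t(2) by linarith
qed

lemma above_right:
  assumes "0 \<le> t" "a < u t"
  shows "\<exists>d>0. \<forall>s. t \<le> s \<and> s < t + d \<longrightarrow> a < u s"
proof -
  obtain d where d: "d > 0" "\<forall>s. t \<le> s \<and> s < t + d \<longrightarrow> \<bar>u s - u t\<bar> < u t - a"
    using cadlag_local_right[OF cadlag assms(1), of "u t - a"] assms(2) by auto
  have "a < u s" if "t \<le> s" "s < t + d" for s
    using d(2)[rule_format, of s] that by linarith
  then show ?thesis using d(1) by blast
qed

lemma grid_point_between:
  assumes "0 \<le> t" "h n < d"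
  obtains j :: nat where "t \<le> real j * h n" "real j * h n < t + d"
proof -
  define j where "j = nat \<lceil>real (Suc n) * t\<rceil>"
  have "0 \<le> real (Suc n) * t" using assms(1) by simp
  then have "real j = of_int \<lceil>real (Suc n) * t\<rceil>" unfolding j_def by (intro of_nat_nat) simp
  then have j: "real (Suc n) * t \<le> real j" "real j < real (Suc n) * t + 1" by linarith+
  have h: "0 < h n" by simp
  have t_eq: "t = real (Suc n) * t * h n" by simp
  have "real (Suc n) * t * h n \<le> real j * h n" using j(1) h by (intro mult_right_mono) auto
  then have 1: "t \<le> real j * h n" by simp
  have "real j * h n < (real (Suc n) * t + 1) * h n" using j(2) h by (rule mult_strict_right_mono)
  also have "\<dots> = t + h n" by (simp add: field_simps)
  finally have "real j * h n < t + d" using assms(2) by linarith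
  with 1 show thesis by (rule that)
qed

lemma eventually_h_less: "0 < d \<Longrightarrow> \<forall>\<^sub>F n in sequentially. h n < d"
  by (rule order_tendstoD(2)[OF _ ]) (rule LIMSEQ_Suc[OF lim_1_over_n])

lemma eventually_less_Suc: "\<forall>\<^sub>F n in sequentially. (c::real) < real (Suc n)"
proof -
  obtain N where "c < real N" using reals_Archimedean2 by blast
  then have "c < real (Suc n)" if "N \<le> n" for n using that by simp
  then show ?thesis unfolding eventually_sequentially by blast
qed

text \<open>Once above \<open>a\<close>, a right-continuous path stays there for some time
  \<open>d\<close>, so every grid finer than \<open>d\<close> sees the crossing.\<close>

lemma crosses_grid:
  assumes crosses "0 < e"
  shows "\<forall>\<^sub>F n in sequentially. \<exists>j. a < u (real j * h n) \<and> real j * h n < \<tau> + e"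
proof -
  have "Inf {t. 0 < t \<and> a < u t} < \<tau> + e" using assms(2) by (simp add: crossing_time_def)
  then obtain t where t: "0 < t" "a < u t" "t < \<tau> + e" using cInf_lessD[OF assms(1)] by blast
  obtain d where d: "d > 0" "\<forall>s. t \<le> s \<and> s < t + d \<longrightarrow> a < u s" using above_right[of t] t by auto
  have "\<forall>\<^sub>F n in sequentially. h n < min d (\<tau> + e - t)"
    by (rule eventually_h_less) (use t d in auto)
  then show ?thesis
  proof eventually_elim
    case (elim n)
    obtain j where j: "t \<le> real j * h n" "real j * h n < t + min d (\<tau> + e - t)"
      by (rule grid_point_between[OF _ elim, of t]) (use t in auto)
    then have "a < u (real j * h n)" using d(2) by simp
    then show ?case using j(2) by (intro exI[of _ j]) auto
  qed
qed

definition first_exceed :: "nat \<Rightarrow> nat" where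
  "first_exceed n = (LEAST j. a < u (real j * h n))"

lemma first_exceed:
  assumes "a < u (real j * h n)"
  shows "a < u (real (first_exceed n) * h n)" "first_exceed n \<le> j" "0 < first_exceed n"
    "\<tau> \<le> real (first_exceed n) * h n"
proof -
  show 1: "a < u (real (first_exceed n) * h n)" unfolding first_exceed_def by (rule LeastI) fact
  show "first_exceed n \<le> j" unfolding first_exceed_def by (rule Least_le) fact
  show 2: "0 < first_exceed n" using 1 start by (cases "first_exceed n") auto
  show "\<tau> \<le> real (first_exceed n) * h n" by (rule crossing_le[OF _ 1]) (use 2 in simp)
qed

lemma first_exceed_tendsto:
  assumes crosses
  shows "(\<lambda>n. real (first_exceed n) * h n) \<longlonglongrightarrow> \<tau>"
proof (rule order_tendstoI)
  fix b assume "b < \<tau>"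
  have "\<forall>\<^sub>F n in sequentially. \<exists>j. a < u (real j * h n) \<and> real j * h n < \<tau> + 1"
    by (rule crosses_grid[OF assms]) simp
  then show "\<forall>\<^sub>F n in sequentially. b < real (first_exceed n) * h n"
    by eventually_elim (use \<open>b < \<tau>\<close> first_exceed(4) less_le_trans in blast)
next
  fix b assume b: "\<tau> < b"
  have "\<forall>\<^sub>F n in sequentially. \<exists>j. a < u (real j * h n) \<and> real j * h n < \<tau> + (b - \<tau>)"
    by (rule crosses_grid[OF assms]) (use b in simp)
  then show "\<forall>\<^sub>F n in sequentially. real (first_exceed n) * h n < b"
  proof eventually_elim
    case (elim n)
    then obtain j where j: "a < u (real j * h n)" "real j * h n < b" by auto
    have "real (first_exceed n) * h n \<le> real j * h n"
      using first_exceed(2)[OF j(1)] by (intro mult_right_mono) auto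
    with j(2) show ?case by linarith
  qed
qed

definition exit_term :: "real \<Rightarrow> (real \<Rightarrow> real) \<Rightarrow> nat \<Rightarrow> nat \<Rightarrow> real" where
  "exit_term q f n k = exp (- q * (real (Suc k) * h n)) *
     (of_bool (grid_alive a u (h n) k \<and> \<not> grid_alive a u (h n) (Suc k)) * f (u (real (Suc k) * h n)))"

lemma exit_term_cond:
  "grid_alive a u (h n) k \<and> \<not> grid_alive a u (h n) (Suc k) \<longleftrightarrow>
    (\<exists>j. a < u (real j * h n)) \<and> Suc k = first_exceed n"
proof
  assume *: "grid_alive a u (h n) k \<and> \<not> grid_alive a u (h n) (Suc k)"
  then have le: "\<And>j. j \<le> k \<Longrightarrow> u (real j * h n) \<le> a" unfolding grid_alive_def by (simp only: atMost_iff Ball_def)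
  have "\<exists>j\<le>Suc k. a < u (real j * h n)" using * unfolding grid_alive_def by (auto simp: not_le)
  then obtain j where j: "j \<le> Suc k" "a < u (real j * h n)" by blast
  then have "\<not> j \<le> k" using le[of j] by auto
  then have "j = Suc k" using j(1) by simp
  have "first_exceed n \<le> Suc k" using first_exceed(2)[OF j(2)] \<open>j = Suc k\<close> by simp
  moreover have "\<not> first_exceed n \<le> k" using le first_exceed(1)[OF j(2)] by force
  ultimately show "(\<exists>j. a < u (real j * h n)) \<and> Suc k = first_exceed n" using j(2) by auto
next
  assume *: "(\<exists>j. a < u (real j * h n)) \<and> Suc k = first_exceed n"
  then obtain j where j: "a < u (real j * h n)" by blast
  have "u (real i * h n) \<le> a" if "i \<le> k" for i
  proof (rule ccontr)
    assume "\<not> u (real i * h n) \<le> a"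
    then have "first_exceed n \<le> i" by (intro first_exceed(2)) simp
    then show False using * that by simp
  qed
  moreover have "a < u (real (Suc k) * h n)" using first_exceed(1)[OF j] * by metis
  ultimately show "grid_alive a u (h n) k \<and> \<not> grid_alive a u (h n) (Suc k)"
    unfolding grid_alive_def by (auto simp: not_le simp del: of_nat_Suc)
qed

text \<open>At most one term is nonzero, the one at the first grid time above \<open>a\<close>, and
  these times decrease to \<open>\<tau>\<close> closely enough for right-continuity to give the
  value at \<open>\<tau>\<close>, including any jump. With step \<open>1 / Suc n\<close> the
  \<open>Suc n * Suc n\<close> steps cover the time span \<open>Suc n\<close>, which eventually
  contains \<open>\<tau>\<close>.\<close>

lemma exit_sum_tendsto:
  assumes f: "continuous_on UNIV f" and q: "0 < q"
  shows "(\<lambda>n. \<Sum>k<Suc n * Suc n. exit_term q f n k) \<longlonglongrightarrow>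
    of_bool crosses * (exp (- q * \<tau>) * f (u \<tau>))"
proof (cases crosses)
  case False
  have none: "\<not> a < u (real j * h n)" for j n
    using False start by (cases j) (auto simp del: of_nat_Suc)
  have "exit_term q f n k = 0" for n k
    unfolding exit_term_def exit_term_cond using none by (simp only: simp_thms of_bool_eq; simp)
  then show ?thesis using False by simp
next
  case True
  let ?s = "\<lambda>n. real (first_exceed n) * h n"
  note lim = first_exceed_tendsto[OF True]
  have ex: "\<forall>\<^sub>F n in sequentially. \<exists>j. a < u (real j * h n) \<and> real j * h n < \<tau> + 1"
    by (rule crosses_grid[OF True]) simp
  have large: "\<forall>\<^sub>F n in sequentially. \<tau> + 1 < real (Suc n)"
    by (rule eventually_less_Suc)
  have "\<forall>\<^sub>F n in sequentially. ?s n < \<tau> + 1" by (rule order_tendstoD(2)[OF lim]) simp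
  with ex large have ev: "\<forall>\<^sub>F n in sequentially. (\<Sum>k<Suc n * Suc n. exit_term q f n k) = exp (- q * ?s n) * f (u (?s n))"
  proof eventually_elim
    case (elim n)
    then obtain j where j: "a < u (real j * h n)" by blast
    obtain k0 where k0: "first_exceed n = Suc k0" using first_exceed(3)[OF j] by (cases "first_exceed n") auto
    have "real (first_exceed n) = ?s n * real (Suc n)" by simp
    also have "\<dots> < real (Suc n) * real (Suc n)" using elim by (intro mult_strict_right_mono) auto
    finally have "real (first_exceed n) < real (Suc n * Suc n)" by (simp only: of_nat_mult)
    then have "k0 < Suc n * Suc n" using k0 by (simp only: of_nat_less_iff)
    have "exit_term q f n k = (if k = k0 then exp (- q * ?s n) * f (u (?s n)) else 0)" for k
    proof (cases "k = k0")
      case True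
      then have "grid_alive a u (h n) k \<and> \<not> grid_alive a u (h n) (Suc k)" unfolding exit_term_cond using j k0 by (intro conjI exI[of _ j]) simp_all
      then show ?thesis using True unfolding exit_term_def k0 by (simp del: of_nat_Suc)
    next
      case False
      then have "\<not> (grid_alive a u (h n) k \<and> \<not> grid_alive a u (h n) (Suc k))" unfolding exit_term_cond k0 by simp
      then show ?thesis using False unfolding exit_term_def by (simp only: of_bool_eq; simp)
    qed
    then show ?case using \<open>k0 < Suc n * Suc n\<close> by (simp add: sum.delta)
  qed
  \<comment> \<open>While no grid point exceeds \<open>a\<close>, the least index is arbitrary; the
    maximum forces all terms to lie to the right of \<open>\<tau>\<close>, and it changes nothing
    eventually.\<close>
  define s where "s n = max \<tau> (?s n)" for n
  have "s \<longlonglongrightarrow> max \<tau> \<tau>" unfolding s_def by (intro tendsto_max tendsto_const lim)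
  then have s: "s \<longlonglongrightarrow> \<tau>" by simp
  have "(\<lambda>n. u (s n)) \<longlonglongrightarrow> u \<tau>"
    by (rule cadlag_seq_right[OF cadlag crossing_nonneg[OF True] s]) (simp add: s_def)
  then have "(\<lambda>n. f (u (s n))) \<longlonglongrightarrow> f (u \<tau>)"
    using continuous_on_tendsto_compose[OF f] by simp
  then have "(\<lambda>n. exp (- q * s n) * f (u (s n))) \<longlonglongrightarrow> exp (- q * \<tau>) * f (u \<tau>)"
    by (intro tendsto_intros s)
  moreover have "\<forall>\<^sub>F n in sequentially. exp (- q * s n) * f (u (s n)) = (\<Sum>k<Suc n * Suc n. exit_term q f n k)"
    using ev ex
  proof eventually_elim
    case (elim n)
    then obtain j where "a < u (real j * h n)" by blast
    then have "s n = ?s n" unfolding s_def using first_exceed(4) by (simp add: max_def)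
    then show ?case using elim(1) by simp
  qed
  ultimately have "(\<lambda>n. \<Sum>k<Suc n * Suc n. exit_term q f n k) \<longlonglongrightarrow> exp (- q * \<tau>) * f (u \<tau>)"
    by (rule Lim_transform_eventually)
  then show ?thesis using True by simp
qed

lemma exit_sum_bounded:
  assumes f: "\<And>y. \<bar>f y\<bar> \<le> K" and q: "0 < q"
  shows "\<bar>\<Sum>k<m. exit_term q f n k\<bar> \<le> K"
proof -
  have K0: "0 \<le> K" using f[of 0] by linarith
  have bnd: "\<bar>exit_term q f n k\<bar> \<le> of_bool (Suc k = first_exceed n) * K" for k
  proof (cases "grid_alive a u (h n) k \<and> \<not> grid_alive a u (h n) (Suc k)")
    case True
    then have "Suc k = first_exceed n" unfolding exit_term_cond by simp
    moreover have "\<bar>exit_term q f n k\<bar> \<le> 1 * K"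
      unfolding exit_term_def abs_mult using f K0 q True
      by (intro mult_mono) (auto simp: mult_nonneg_nonneg)
    ultimately show ?thesis by simp
  next
    case False
    then have "exit_term q f n k = 0" unfolding exit_term_def by (simp only: of_bool_eq; simp)
    then show ?thesis using K0 by simp
  qed
  have "\<bar>\<Sum>k<m. exit_term q f n k\<bar> \<le> (\<Sum>k<m. of_bool (Suc k = first_exceed n) * K)"
    by (rule order_trans[OF sum_abs]) (rule sum_mono[OF bnd])
  also have "\<dots> = (\<Sum>k<m. if k = first_exceed n - 1 \<and> 0 < first_exceed n then K else 0)"
    by (intro sum.cong) auto
  also have "\<dots> \<le> K"
  proof (cases "0 < first_exceed n")
    case True
    then show ?thesis using K0 by (simp add: sum.delta)
  qed (use K0 in simp)
  finally show ?thesis .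
qed

definition live :: "real \<Rightarrow> bool" where
  "live s \<longleftrightarrow> u s \<le> a \<and> (\<forall>r\<in>\<rat>. 0 < r \<and> r < s \<longrightarrow> u r \<le> a)"

lemma live_before: "0 \<le> s \<Longrightarrow> \<not> crosses \<or> s < \<tau> \<Longrightarrow> live s"
proof -
  assume s: "0 \<le> s" and *: "\<not> crosses \<or> s < \<tau>"
  have "u r \<le> a" if "0 \<le> r" "r \<le> s" for r
  proof (cases "r = 0")
    case False
    show ?thesis
    proof (rule ccontr)
      assume "\<not> u r \<le> a"
      then have "0 < r" "a < u r" using that False by auto
      then show False using crossing_le[of r] * that by force
    qed
  qed (use start in simp)
  then show "live s" using s unfolding live_def by simp
qed

lemma not_live_after: "crosses \<Longrightarrow> \<tau> < s \<Longrightarrow> \<not> live s"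
proof -
  assume "crosses" "\<tau> < s"
  then have "Inf {t. 0 < t \<and> a < u t} < s" by (simp add: crossing_time_def)
  then obtain t where t: "0 < t" "a < u t" "t < s" using cInf_lessD[OF \<open>crosses\<close>] by blast
  obtain d where d: "d > 0" "\<forall>s. t \<le> s \<and> s < t + d \<longrightarrow> a < u s" using above_right[of t] t by auto
  obtain r where r: "r \<in> \<rat>" "t < r" "r < min s (t + d)" using Rats_dense_in_real[of t "min s (t + d)"] t d by auto
  have "a < u r" using d(2) r by simp
  then show "\<not> live s" using r t unfolding live_def by force
qed

definition occ_step :: "real \<Rightarrow> (real \<Rightarrow> real) \<Rightarrow> nat \<Rightarrow> nat \<Rightarrow> real" where
  "occ_step q g n k = exp (- q * (real k * h n)) * (of_bool (grid_alive a u (h n) k) * g (u (real k * h n)))"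

text \<open>A step function in time whose value on a cell is sampled at the right endpoint of the
  cell, in accordance with right-continuity; its integral is the Riemann sum. Index 0 is absent and
  is accounted for by \<open>expectation_occ_sum\<close>.\<close>

definition occ_fun :: "real \<Rightarrow> (real \<Rightarrow> real) \<Rightarrow> nat \<Rightarrow> real \<Rightarrow> real" where
  "occ_fun q g n s = (\<Sum>k\<in>{1..<Suc n * Suc n}. indicator {(real k - 1) * h n..<real k * h n} s * occ_step q g n k)"

lemma occ_fun_eq:
  assumes "0 \<le> s"
  shows "occ_fun q g n s = of_bool (nat \<lfloor>real (Suc n) * s\<rfloor> + 1 < Suc n * Suc n) * occ_step q g n (nat \<lfloor>real (Suc n) * s\<rfloor> + 1)"
proof -
  define k0 where "k0 = nat \<lfloor>real (Suc n) * s\<rfloor> + 1"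
  have h: "0 < h n" by simp
  have ind: "indicat_real {(real k - 1) * h n..<real k * h n} s = of_bool (k = k0)" if "1 \<le> k" for k
  proof -
    have "s \<in> {(real k - 1) * h n..<real k * h n} \<longleftrightarrow> real k - 1 \<le> real (Suc n) * s \<and> real (Suc n) * s < real k"
      by (simp add: field_simps)
    also have "\<dots> \<longleftrightarrow> \<lfloor>real (Suc n) * s\<rfloor> = int k - 1"
      unfolding floor_eq_iff by auto
    also have "\<dots> \<longleftrightarrow> k = k0"
      unfolding k0_def using that assms by (auto simp: nat_eq_iff2 of_nat_diff)
    finally show ?thesis by (simp add: indicator_def)
  qed
  have "occ_fun q g n s = (\<Sum>k\<in>{1..<Suc n * Suc n}. if k = k0 then occ_step q g n k else 0)"
    unfolding occ_fun_def
  proof (rule sum.cong[OF refl])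
    fix k assume "k \<in> {1..<Suc n * Suc n}"
    then have k: "1 \<le> k" by simp
    show "indicat_real {(real k - 1) * h n..<real k * h n} s * occ_step q g n k = (if k = k0 then occ_step q g n k else 0)"
      unfolding ind[OF k] by simp
  qed
  also have "\<dots> = (if k0 \<in> {1..<Suc n * Suc n} then occ_step q g n k0 else 0)"
    by (simp add: sum.delta')
  also have "\<dots> = of_bool (k0 < Suc n * Suc n) * occ_step q g n k0" by (simp add: k0_def)
  finally show ?thesis by (simp only: k0_def)
qed

lemma occ_fun_neg: "s < 0 \<Longrightarrow> occ_fun q g n s = 0"
proof -
  assume s: "s < 0"
  have "indicat_real {(real k - 1) * h n..<real k * h n} s = 0" if "1 \<le> k" for k
  proof -
    have "0 \<le> (real k - 1) * h n" using that by simp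
    then show ?thesis using s by (simp add: indicator_def)
  qed
  then show ?thesis unfolding occ_fun_def by (intro sum.neutral ballI) simp
qed

lemma grid_index:
  assumes "0 \<le> s"
  shows "real (nat \<lfloor>real (Suc n) * s\<rfloor> + 1) * h n = (of_int \<lfloor>real (Suc n) * s\<rfloor> + 1) / real (Suc n)"
proof -
  have "real (nat z + 1) = of_int z + 1" if "0 \<le> z" for z using that by simp
  moreover have "0 \<le> \<lfloor>real (Suc n) * s\<rfloor>" using assms by simp
  ultimately show ?thesis by (simp only: times_divide_eq_right mult_1_right)
qed

text \<open>Before \<open>\<tau>\<close> no grid point up to the sampled one exceeds
  \<open>a\<close>; after \<open>\<tau>\<close> some earlier grid point eventually does. Only
  \<open>s = \<tau>\<close> is ambiguous.\<close>

lemma occ_fun_tendsto: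
  assumes g: "continuous_on UNIV g" and s: "0 \<le> s" "\<not> crosses \<or> s \<noteq> \<tau>"
  shows "(\<lambda>n. occ_fun q g n s) \<longlonglongrightarrow> exp (- q * s) * (of_bool (live s) * g (u s))"
proof -
  define k where "k n = nat \<lfloor>real (Suc n) * s\<rfloor> + 1" for n
  define c where "c n = real (k n) * h n" for n
  have c_eq: "c n = (of_int \<lfloor>real (Suc n) * s\<rfloor> + 1) / real (Suc n)" for n
    unfolding c_def k_def by (rule grid_index[OF s(1)])
  have c_lim: "c \<longlonglongrightarrow> s" unfolding c_eq by (rule floor_grid_tendsto_right)
  have c_gt: "s < c n" for n unfolding c_eq by (rule floor_grid_gt)
  have "(\<lambda>n. u (c n)) \<longlonglongrightarrow> u s"
    by (rule cadlag_seq_right[OF cadlag s(1) c_lim less_imp_le[OF c_gt]])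
  then have gu: "(\<lambda>n. g (u (c n))) \<longlonglongrightarrow> g (u s)" using continuous_on_tendsto_compose[OF g] by simp
  have alive: "\<forall>\<^sub>F n in sequentially. grid_alive a u (h n) (k n) = live s"
  proof (cases "\<not> crosses \<or> s < \<tau>")
    case True
    have "\<forall>\<^sub>F n in sequentially. \<not> crosses \<or> c n < \<tau>"
    proof (cases crosses)
      case True
      then show ?thesis using order_tendstoD(2)[OF c_lim, of \<tau>] \<open>\<not> crosses \<or> s < \<tau>\<close> by simp
    qed simp
    then show ?thesis
    proof eventually_elim
      case (elim n)
      have "u (real j * h n) \<le> a" if "j \<le> k n" for j
      proof (rule ccontr)
        assume *: "\<not> u (real j * h n) \<le> a"
        then have "0 < j" using start by (cases j) auto
        then have "0 < real j * h n" "a < u (real j * h n)" using * by auto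
        then have "crosses" "\<tau> \<le> real j * h n" using crossing_le by auto
        moreover have "real j * h n \<le> c n" unfolding c_def using that by (intro mult_right_mono) auto
        ultimately show False using elim by auto
      qed
      then have "grid_alive a u (h n) (k n)" unfolding grid_alive_def by blast
      then show ?case using live_before[OF s(1) True] by simp
    qed
  next
    case False
    then have cr: crosses and lt: "\<tau> < s" using s(2) by auto
    have "\<forall>\<^sub>F n in sequentially. \<exists>j. a < u (real j * h n) \<and> real j * h n < \<tau> + (s - \<tau>)"
      by (rule crosses_grid[OF cr]) (use lt in simp)
    then show ?thesis
    proof eventually_elim
      case (elim n)
      then obtain j where j: "a < u (real j * h n)" "real j * h n < s" by auto
      have "real j * h n < real (k n) * h n" using j(2) c_gt[of n] unfolding c_def by linarith
      then have "real j < real (k n)" by (rule mult_right_less_imp_less) simp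
      then have "j \<in> {..k n}" by simp
      then have "\<not> grid_alive a u (h n) (k n)" unfolding grid_alive_def using j(1) by force
      then show ?case using not_live_after[OF cr lt] by simp
    qed
  qed
  have "\<forall>\<^sub>F n in sequentially. s + 1 < real (Suc n)" by (rule eventually_less_Suc)
  then have ind: "\<forall>\<^sub>F n in sequentially. k n < Suc n * Suc n"
  proof eventually_elim
    case (elim n)
    have "c n < real (Suc n)" using floor_grid_le[of n s] elim unfolding c_eq[symmetric]
      by (smt (verit) divide_le_eq_1 of_nat_0_le_iff of_nat_Suc)
    then have "real (k n) < real (Suc n) * real (Suc n)" unfolding c_def by (simp add: field_simps del: of_nat_Suc)
    then show ?case by (simp only: of_nat_mult[symmetric] of_nat_less_iff)
  qed
  have "(\<lambda>n. exp (- q * c n) * (of_bool (live s) * g (u (c n)))) \<longlonglongrightarrow> exp (- q * s) * (of_bool (live s) * g (u s))"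
    by (intro tendsto_intros c_lim gu)
  moreover have "\<forall>\<^sub>F n in sequentially. exp (- q * c n) * (of_bool (live s) * g (u (c n))) = occ_fun q g n s"
    using alive ind
  proof eventually_elim
    case (elim n)
    have "occ_fun q g n s = of_bool (k n < Suc n * Suc n) * occ_step q g n (k n)"
      unfolding k_def by (rule occ_fun_eq[OF s(1)])
    then show ?case using elim unfolding occ_step_def c_def by (simp del: of_nat_Suc)
  qed
  ultimately show ?thesis by (rule Lim_transform_eventually)
qed

text \<open>Sampling at a time later than \<open>s\<close> discounts more than
  \<open>exp (- q * s)\<close>, which provides an integrable majorant independent of the
  mesh.\<close>

lemma occ_fun_bounded:
  assumes g: "\<And>y. y \<le> a \<Longrightarrow> \<bar>g y\<bar> \<le> C" and q: "0 < q"
  shows "\<bar>occ_fun q g n s\<bar> \<le> C * (indicator {0..} s * exp (- q * s))"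
proof (cases "0 \<le> s")
  case False
  then show ?thesis using occ_fun_neg[of s] by simp
next
  case True
  define k where "k = nat \<lfloor>real (Suc n) * s\<rfloor> + 1"
  have C0: "0 \<le> C" using g[OF start] by linarith
  have gt: "s < real k * h n" unfolding k_def grid_index[OF True] by (rule floor_grid_gt)
  have "\<bar>occ_fun q g n s\<bar> \<le> \<bar>occ_step q g n k\<bar>" unfolding occ_fun_eq[OF True] k_def[symmetric] by simp
  also have "\<dots> = exp (- q * (real k * h n)) * \<bar>of_bool (grid_alive a u (h n) k) * g (u (real k * h n))\<bar>"
    unfolding occ_step_def by (simp only: abs_mult abs_exp_cancel)
  also have "\<dots> \<le> exp (- q * s) * C"
  proof (intro mult_mono)
    show "exp (- q * (real k * h n)) \<le> exp (- q * s)" using gt q by (simp del: of_nat_Suc times_divide_eq_right)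
    show "\<bar>of_bool (grid_alive a u (h n) k) * g (u (real k * h n))\<bar> \<le> C"
    proof (cases "grid_alive a u (h n) k")
      case True
      then have "u (real k * h n) \<le> a" unfolding grid_alive_def by blast
      then show ?thesis using g True by simp
    qed (use C0 in simp)
  qed (use C0 in auto)
  finally show ?thesis using True by (simp add: mult.commute)
qed

lemma occ_fun_integral:
  "integrable lborel (occ_fun q g n)"
  "(LINT s|lborel. occ_fun q g n s) = (\<Sum>k\<in>{1..<Suc n * Suc n}. h n * occ_step q g n k)"
proof -
  have le: "(real k - 1) * h n \<le> real k * h n" for k by (intro mult_right_mono) auto
  have ind: "integrable lborel (indicat_real {(real k - 1) * h n..<real k * h n})" for k
    using emeasure_lborel_Ico[OF le] by (intro integrable_real_indicator) auto
  show "integrable lborel (occ_fun q g n)"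
    unfolding occ_fun_def by (intro Bochner_Integration.integrable_sum integrable_mult_left ind)
  have len: "(LINT s|lborel. indicat_real {(real k - 1) * h n..<real k * h n} s) = h n" for k
  proof -
    have "(LINT s|lborel. indicat_real {(real k - 1) * h n..<real k * h n} s) = real k * h n - (real k - 1) * h n"
      using measure_lborel_Ico[OF le] by simp
    also have "\<dots> = h n"
    proof -
      have "(real k - 1) * h n = real k * h n - h n" by (simp only: left_diff_distrib mult_1_left)
      then show ?thesis by linarith
    qed
    finally show ?thesis .
  qed
  show "(LINT s|lborel. occ_fun q g n s) = (\<Sum>k\<in>{1..<Suc n * Suc n}. h n * occ_step q g n k)"
  proof -
    have "(LINT s|lborel. occ_fun q g n s) =
      (\<Sum>k\<in>{1..<Suc n * Suc n}. LINT s|lborel. indicat_real {(real k - 1) * h n..<real k * h n} s * occ_step q g n k)"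
      unfolding occ_fun_def by (rule Bochner_Integration.integral_sum) (rule integrable_mult_left[OF ind])
    also have "\<dots> = (\<Sum>k\<in>{1..<Suc n * Suc n}. h n * occ_step q g n k)"
      by (rule sum.cong[OF refl]) (simp only: integral_mult_left_zero len)
    finally show ?thesis .
  qed
qed

text \<open>The Riemann sums are integrals of \<open>occ_fun\<close>, which converges except at the
  single time \<open>\<tau>\<close>, a Lebesgue null set.\<close>

lemma occ_sum_tendsto:
  assumes g: "continuous_on UNIV g" "\<And>y. y \<le> a \<Longrightarrow> \<bar>g y\<bar> \<le> C" and q: "0 < q"
  shows "(\<lambda>n. \<Sum>k\<in>{1..<Suc n * Suc n}. h n * occ_step q g n k) \<longlonglongrightarrow>
    (LINT s|lborel. indicator {0..} s * (exp (- q * s) * (of_bool (live s) * g (u s))))"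
proof -
  have int: "integrable lborel (\<lambda>s. C * (indicat_real {0..} s * exp (- q * s)))"
    by (rule integrable_mult_right[OF exponential_integral(1)[OF q]])
  have "AE s in lborel. s \<noteq> \<tau>" by (rule AE_lborel_singleton)
  then have lim: "AE s in lborel. (\<lambda>n. occ_fun q g n s) \<longlonglongrightarrow> indicator {0..} s * (exp (- q * s) * (of_bool (live s) * g (u s)))"
  proof eventually_elim
    case (elim s)
    show ?case
    proof (cases "0 \<le> s")
      case True
      then show ?thesis using occ_fun_tendsto[OF g(1) True, of q] elim by simp
    qed (simp add: occ_fun_neg)
  qed
  have meas: "(\<lambda>s. indicator {0..} s * (exp (- q * s) * (of_bool (live s) * g (u s)))) \<in> borel_measurable lborel"
  proof -
    define w where "w s = indicator {0..} s * u s" for s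
    have w: "w \<in> borel_measurable borel"
      unfolding w_def using cadlag by (intro right_continuous_borel_measurable) (auto simp: cadlag_def)
    have [measurable]: "g \<in> borel_measurable borel" using g(1) by (rule borel_measurable_continuous_onI)
    \<comment> \<open>Having exceeded \<open>a\<close> at a rational time before \<open>s\<close>
      means that \<open>s\<close> lies in a countable union of half-lines.\<close>
    define R where "R = {r \<in> \<rat>. 0 < r \<and> a < u r}"
    have R: "countable R" unfolding R_def by (rule countable_subset[OF _ countable_rat]) auto
    have eq: "indicator {0..} s * (exp (- q * s) * (of_bool (live s) * g (u s))) =
      indicator {0..} s * (exp (- q * s) * (indicator ({s. w s \<le> a} - (\<Union>r\<in>R. {r<..})) s * g (w s)))" for s
    proof (cases "0 \<le> s")
      case True
      have "live s \<longleftrightarrow> s \<in> {s. w s \<le> a} - (\<Union>r\<in>R. {r<..})"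
        using True unfolding live_def R_def w_def by (fastforce simp: not_le)
      then show ?thesis using True by (simp add: indicator_def w_def)
    qed simp
    have [measurable]: "{s. w s \<le> a} - (\<Union>r\<in>R. {r<..}) \<in> sets borel"
      using R w by (intro sets.Diff sets.countable_UN') auto
    show ?thesis unfolding eq using w by measurable
  qed
  have "(\<lambda>n. LINT s|lborel. occ_fun q g n s) \<longlonglongrightarrow>
    (LINT s|lborel. indicator {0..} s * (exp (- q * s) * (of_bool (live s) * g (u s))))"
    by (rule integral_dominated_convergence[OF meas _ int lim])
       (use occ_fun_integral(1) occ_fun_bounded[OF g(2) q] in auto)
  then show ?thesis unfolding occ_fun_integral(2) .
qed

lemma occ_sum_bounded:
  assumes g: "\<And>y. y \<le> a \<Longrightarrow> \<bar>g y\<bar> \<le> C" and q: "0 < q"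
  shows "\<bar>\<Sum>k\<in>{1..<Suc n * Suc n}. h n * occ_step q g n k\<bar> \<le> C / q"
proof -
  have int: "integrable lborel (\<lambda>s. C * (indicat_real {0..} s * exp (- q * s)))"
    by (rule integrable_mult_right[OF exponential_integral(1)[OF q]])
  have "\<bar>LINT s|lborel. occ_fun q g n s\<bar> \<le> (LINT s|lborel. \<bar>occ_fun q g n s\<bar>)" by (rule integral_abs_bound)
  also have "\<dots> \<le> (LINT s|lborel. C * (indicat_real {0..} s * exp (- q * s)))"
    by (rule integral_mono_AE) (use occ_fun_integral(1) int occ_fun_bounded[OF g q] in auto)
  also have "\<dots> = C / q"
    using exponential_integral(2)[OF q] by (simp add: divide_inverse)
  finally show ?thesis unfolding occ_fun_integral(2) .
qed

end

lemma cadlag_const: "cadlag (\<lambda>_. c)"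
  unfolding cadlag_def by (intro conjI allI impI exI[of _ c]) (auto intro: continuous_const tendsto_const)

text \<open>An instance of \<open>occ_sum_bounded\<close> for the constant path 0, which never
  crosses the level 0; the term at time 0 accounts for the additional 1.\<close>

lemma discount_sum_bounded:
  assumes q: "0 < (q::real)"
  shows "(\<Sum>k<Suc n * Suc n. 1 / real (Suc n) * exp (- q * (real k * (1 / real (Suc n))))) \<le> 1 + 1 / q"
proof -
  interpret cadlag_path "\<lambda>_. 0" 0 by unfold_locales (auto intro: cadlag_const)
  have "occ_step q (\<lambda>_. 1) n k = exp (- q * (real k * (1 / real (Suc n))))" for k
    unfolding occ_step_def grid_alive_def by simp
  then have "(\<Sum>k\<in>{1..<Suc n * Suc n}. 1 / real (Suc n) * exp (- q * (real k * (1 / real (Suc n))))) \<le> 1 / q"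
    using occ_sum_bounded[of "\<lambda>_. 1" 1 q n] q by (simp only: abs_le_iff) simp
  moreover have "{..<Suc n * Suc n} = insert 0 {1..<Suc n * Suc n}" by auto
  then have "(\<Sum>k<Suc n * Suc n. 1 / real (Suc n) * exp (- q * (real k * (1 / real (Suc n))))) =
    1 / real (Suc n) * exp (- q * (real 0 * (1 / real (Suc n)))) +
    (\<Sum>k\<in>{1..<Suc n * Suc n}. 1 / real (Suc n) * exp (- q * (real k * (1 / real (Suc n)))))"
    by (simp only:) (subst sum.insert; simp)
  moreover have "1 / real (Suc n) * exp (- q * (real 0 * (1 / real (Suc n)))) \<le> 1" by simp
  ultimately show ?thesis by linarith
qed

section \<open>Dynkin's formula\<close>

context resetting
begin

abbreviation "step n \<equiv> 1 / real (Suc n)"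

abbreviation (input) upath :: "'a \<Rightarrow> real \<Rightarrow> real" where "upath \<omega> \<equiv> (\<lambda>t. U t \<omega>)"

definition alive :: "nat \<Rightarrow> nat \<Rightarrow> 'a set" where
  "alive n k = {\<omega> \<in> space P. \<forall>j\<in>{..k}. U (real j * step n) \<omega> \<le> a}"

definition exit_sum :: "(real \<Rightarrow> real) \<Rightarrow> nat \<Rightarrow> 'a \<Rightarrow> real" where
  "exit_sum f n \<omega> = (\<Sum>k<Suc n * Suc n. exp (- q * (real (Suc k) * step n)) *
     ((indicator (alive n k) \<omega> - indicator (alive n (Suc k)) \<omega>) * f (U (real (Suc k) * step n) \<omega>)))"

definition occ_sum :: "(real \<Rightarrow> real) \<Rightarrow> nat \<Rightarrow> 'a \<Rightarrow> real" where
  "occ_sum g n \<omega> = (\<Sum>k\<in>{1..<Suc n * Suc n}. step n * (exp (- q * (real k * step n)) *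
     (indicator (alive n k) \<omega> * g (U (real k * step n) \<omega>))))"

definition crossed :: "'a \<Rightarrow> bool" where
  "crossed \<omega> \<longleftrightarrow> {t. 0 < t \<and> a < U t \<omega>} \<noteq> {}"

definition exit_value :: "(real \<Rightarrow> real) \<Rightarrow> 'a \<Rightarrow> real" where
  "exit_value f \<omega> = of_bool (crossed \<omega>) * (exp (- q * crossing_time a (upath \<omega>)) * f (U (crossing_time a (upath \<omega>)) \<omega>))"

text \<open>Quantifying over rational times makes the event measurable; it differs from not having crossed before
  \<open>s\<close> for at most one \<open>s\<close>.\<close>

definition living :: "real \<Rightarrow> 'a \<Rightarrow> bool" where
  "living s \<omega> \<longleftrightarrow> U s \<omega> \<le> a \<and> (\<forall>r\<in>\<rat>. 0 < r \<and> r < s \<longrightarrow> U r \<omega> \<le> a)"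

definition occ_value :: "(real \<Rightarrow> real) \<Rightarrow> 'a \<Rightarrow> real" where
  "occ_value g \<omega> = (LINT s|lborel. indicator {0..} s * (exp (- q * s) * (of_bool (living s \<omega>) * g (U s \<omega>))))"

lemma cadlag_path_U: "\<omega> \<in> space P \<Longrightarrow> cadlag_path (upath \<omega>) a"
  using cadlag_U start x_le_a by unfold_locales auto

lemma alive_indicator: "\<omega> \<in> space P \<Longrightarrow> indicator (alive n k) \<omega> = of_bool (grid_alive a (upath \<omega>) (step n) k)"
  by (simp add: alive_def grid_alive_def indicator_def)

lemma alive_filt: "alive n k \<in> sets (filt (real k * step n))"
proof -
  have "{\<omega> \<in> space (filt (real k * step n)). \<forall>j\<in>{..k}. U (real j * step n) \<omega> \<le> a} \<in> sets (filt (real k * step n))"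
  proof (intro sets.sets_Collect_finite_All)
    fix j assume "j \<in> {..k}"
    then have "real j * step n \<le> real k * step n" by (intro mult_right_mono) auto
    moreover have "0 \<le> real j * step n" by simp
    ultimately have "U (real j * step n) \<in> borel_measurable (filt (real k * step n))"
      using measurable_filt_mono[OF adapted] by blast
    then show "{\<omega> \<in> space (filt (real k * step n)). U (real j * step n) \<omega> \<le> a} \<in> sets (filt (real k * step n))"
      by measurable
  qed simp
  then show ?thesis by (simp only: alive_def space_filt)
qed

lemma alive_sets [measurable]: "alive n k \<in> sets P"
  using alive_filt sets_filt_events by blast

lemma alive_le: "\<omega> \<in> alive n k \<Longrightarrow> U (real k * step n) \<omega> \<le> a"
  unfolding alive_def by blast

lemma U_step_measurable [measurable]: "U (real k * step n) \<in> borel_measurable P"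
  by (rule U_measurable) simp

lemma exit_sum_eq:
  assumes \<omega>: "\<omega> \<in> space P"
  shows "exit_sum f n \<omega> = (\<Sum>k<Suc n * Suc n. cadlag_path.exit_term (upath \<omega>) a q f n k)"
proof -
  interpret cadlag_path "upath \<omega>" a by (rule cadlag_path_U[OF \<omega>])
  have "indicat_real (alive n k) \<omega> - indicator (alive n (Suc k)) \<omega> =
    of_bool (grid_alive a (upath \<omega>) (step n) k \<and> \<not> grid_alive a (upath \<omega>) (step n) (Suc k))" for k
  proof -
    have "grid_alive a (upath \<omega>) (step n) (Suc k) \<Longrightarrow> grid_alive a (upath \<omega>) (step n) k"
      unfolding grid_alive_def by simp
    then show ?thesis unfolding alive_indicator[OF \<omega>] by auto
  qed
  then show ?thesis unfolding exit_sum_def exit_term_def by (simp only:)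
qed

lemma occ_sum_eq:
  assumes \<omega>: "\<omega> \<in> space P"
  shows "occ_sum g n \<omega> = (\<Sum>k\<in>{1..<Suc n * Suc n}. step n * cadlag_path.occ_step (upath \<omega>) a q g n k)"
proof -
  interpret cadlag_path "upath \<omega>" a by (rule cadlag_path_U[OF \<omega>])
  show ?thesis unfolding occ_sum_def occ_step_def alive_indicator[OF \<omega>] ..
qed

lemma exit_sum_measurable [measurable]:
  "f \<in> borel_measurable borel \<Longrightarrow> exit_sum f n \<in> borel_measurable P"
proof -
  assume [measurable]: "f \<in> borel_measurable borel"
  show ?thesis unfolding exit_sum_def by measurable
qed

lemma occ_sum_measurable [measurable]:
  "g \<in> borel_measurable borel \<Longrightarrow> occ_sum g n \<in> borel_measurable P"
proof -
  assume [measurable]: "g \<in> borel_measurable borel"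
  show ?thesis unfolding occ_sum_def by measurable
qed

lemma exit_sum_tendsto:
  assumes f: "continuous_on UNIV f" and \<omega>: "\<omega> \<in> space P"
  shows "(\<lambda>n. exit_sum f n \<omega>) \<longlonglongrightarrow> exit_value f \<omega>"
proof -
  interpret cadlag_path "upath \<omega>" a by (rule cadlag_path_U[OF \<omega>])
  show ?thesis
    using exit_sum_tendsto[OF f q] unfolding exit_sum_eq[OF \<omega>] exit_value_def crossed_def .
qed

lemma exit_sum_bounded:
  assumes f: "\<And>y. \<bar>f y\<bar> \<le> K" and \<omega>: "\<omega> \<in> space P"
  shows "\<bar>exit_sum f n \<omega>\<bar> \<le> K"
proof -
  interpret cadlag_path "upath \<omega>" a by (rule cadlag_path_U[OF \<omega>])
  show ?thesis unfolding exit_sum_eq[OF \<omega>] by (rule exit_sum_bounded[OF f q])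
qed

lemma occ_sum_tendsto:
  assumes g: "continuous_on UNIV g" "\<And>y. y \<le> a \<Longrightarrow> \<bar>g y\<bar> \<le> C" and \<omega>: "\<omega> \<in> space P"
  shows "(\<lambda>n. occ_sum g n \<omega>) \<longlonglongrightarrow> occ_value g \<omega>"
proof -
  interpret cadlag_path "upath \<omega>" a by (rule cadlag_path_U[OF \<omega>])
  have "live s = living s \<omega>" for s unfolding live_def living_def ..
  then show ?thesis
    using occ_sum_tendsto[OF g q] unfolding occ_sum_eq[OF \<omega>] occ_value_def by simp
qed

lemma occ_sum_bounded:
  assumes g: "\<And>y. y \<le> a \<Longrightarrow> \<bar>g y\<bar> \<le> C" and \<omega>: "\<omega> \<in> space P"
  shows "\<bar>occ_sum g n \<omega>\<bar> \<le> C / q"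
proof -
  interpret cadlag_path "upath \<omega>" a by (rule cadlag_path_U[OF \<omega>])
  show ?thesis unfolding occ_sum_eq[OF \<omega>] by (rule occ_sum_bounded[OF g q])
qed

lemma exit_value_measurable:
  assumes "continuous_on UNIV f"
  shows "exit_value f \<in> borel_measurable P"
proof (rule borel_measurable_LIMSEQ_real)
  show "(\<lambda>n. exit_sum f n \<omega>) \<longlonglongrightarrow> exit_value f \<omega>" if "\<omega> \<in> space P" for \<omega>
    by (rule exit_sum_tendsto[OF assms that])
  show "exit_sum f n \<in> borel_measurable P" for n
    by (rule exit_sum_measurable[OF borel_measurable_continuous_onI[OF assms]])
qed

lemma occ_value_measurable:
  assumes "continuous_on UNIV g" "\<And>y. y \<le> a \<Longrightarrow> \<bar>g y\<bar> \<le> C"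
  shows "occ_value g \<in> borel_measurable P"
proof (rule borel_measurable_LIMSEQ_real)
  show "(\<lambda>n. occ_sum g n \<omega>) \<longlonglongrightarrow> occ_value g \<omega>" if "\<omega> \<in> space P" for \<omega>
    by (rule occ_sum_tendsto[OF assms that])
  show "occ_sum g n \<in> borel_measurable P" for n
    by (rule occ_sum_measurable[OF borel_measurable_continuous_onI[OF assms(1)]])
qed

lemma expectation_exit_sum_tendsto:
  assumes f: "continuous_on UNIV f" "\<And>y. \<bar>f y\<bar> \<le> K"
  shows "(\<lambda>n. LINT \<omega>|P. exit_sum f n \<omega>) \<longlonglongrightarrow> (LINT \<omega>|P. exit_value f \<omega>)"
proof (rule integral_dominated_convergence[where w = "\<lambda>_. K"])
  show "exit_value f \<in> borel_measurable P" by (rule exit_value_measurable[OF f(1)])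
  show "exit_sum f n \<in> borel_measurable P" for n
    by (rule exit_sum_measurable[OF borel_measurable_continuous_onI[OF f(1)]])
  show "AE \<omega> in P. (\<lambda>n. exit_sum f n \<omega>) \<longlonglongrightarrow> exit_value f \<omega>"
    by (rule AE_I2, rule exit_sum_tendsto[OF f(1)])
  show "AE \<omega> in P. norm (exit_sum f n \<omega>) \<le> K" for n
    by (rule AE_I2) (simp add: exit_sum_bounded[OF f(2)])
qed simp

lemma expectation_occ_sum_tendsto:
  assumes g: "continuous_on UNIV g" "\<And>y. y \<le> a \<Longrightarrow> \<bar>g y\<bar> \<le> C"
  shows "(\<lambda>n. LINT \<omega>|P. occ_sum g n \<omega>) \<longlonglongrightarrow> (LINT \<omega>|P. occ_value g \<omega>)"
proof (rule integral_dominated_convergence[where w = "\<lambda>_. C / q"])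
  show "occ_value g \<in> borel_measurable P" by (rule occ_value_measurable[OF g])
  show "occ_sum g n \<in> borel_measurable P" for n
    by (rule occ_sum_measurable[OF borel_measurable_continuous_onI[OF g(1)]])
  show "AE \<omega> in P. (\<lambda>n. occ_sum g n \<omega>) \<longlonglongrightarrow> occ_value g \<omega>"
    by (rule AE_I2, rule occ_sum_tendsto[OF g])
  show "AE \<omega> in P. norm (occ_sum g n \<omega>) \<le> C / q" for n
    by (rule AE_I2) (simp add: occ_sum_bounded[OF g(2)])
qed simp

lemma alive_expectation_integrable:
  fixes g :: "real \<Rightarrow> real" and C :: real
  assumes g [measurable]: "g \<in> borel_measurable borel" and C: "\<And>y. y \<le> a \<Longrightarrow> \<bar>g y\<bar> \<le> C"
  shows "integrable P (\<lambda>\<omega>. indicator (alive n k) \<omega> * g (U (real k * step n) \<omega>))"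
proof (rule X.integrable_const_bound[where B = C])
  have C0: "0 \<le> C" using C[of a] by linarith
  have "\<bar>indicator (alive n k) \<omega> * g (U (real k * step n) \<omega>)\<bar> \<le> C" for \<omega>
    using C[OF alive_le[of \<omega> n k]] C0 by (cases "\<omega> \<in> alive n k") auto
  then show "AE \<omega> in P. norm (indicator (alive n k) \<omega> * g (U (real k * step n) \<omega>)) \<le> C" by simp
qed measurable

text \<open>At time 0 the process sits at \<open>x \<le> a\<close>, so the term with index 0 is the
  deterministic \<open>step n * g x\<close>, which vanishes with the mesh.\<close>

lemma expectation_occ_sum:
  fixes g :: "real \<Rightarrow> real" and C :: real
  assumes g: "g \<in> borel_measurable borel" and C: "\<And>y. y \<le> a \<Longrightarrow> \<bar>g y\<bar> \<le> C"
  shows "(\<Sum>k<Suc n * Suc n. step n * (exp (- q * (real k * step n)) *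
     (LINT \<omega>|P. indicator (alive n k) \<omega> * g (U (real k * step n) \<omega>)))) =
    step n * g x + (LINT \<omega>|P. occ_sum g n \<omega>)"
proof -
  note int = alive_expectation_integrable[OF g C]
  have "(LINT \<omega>|P. occ_sum g n \<omega>) = (\<Sum>k\<in>{1..<Suc n * Suc n}. LINT \<omega>|P. step n * (exp (- q * (real k * step n)) *
     (indicator (alive n k) \<omega> * g (U (real k * step n) \<omega>))))"
    unfolding occ_sum_def by (rule Bochner_Integration.integral_sum) (intro integrable_mult_right int)
  also have "\<dots> = (\<Sum>k\<in>{1..<Suc n * Suc n}. step n * (exp (- q * (real k * step n)) *
     (LINT \<omega>|P. indicator (alive n k) \<omega> * g (U (real k * step n) \<omega>))))"
    by (rule sum.cong[OF refl]) (simp only: integral_mult_right_zero)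
  finally have *: "(LINT \<omega>|P. occ_sum g n \<omega>) = \<dots>" .
  have "(LINT \<omega>|P. indicator (alive n 0) \<omega> * g (U (real 0 * step n) \<omega>)) = (LINT \<omega>|P. g x)"
    by (rule Bochner_Integration.integral_cong[OF refl]) (use start x_le_a in \<open>auto simp: alive_def\<close>)
  then have 0: "(LINT \<omega>|P. indicator (alive n 0) \<omega> * g (U (real 0 * step n) \<omega>)) = g x" by (simp add: X.prob_space)
  have "{..<Suc n * Suc n} = insert 0 {1..<Suc n * Suc n}" by auto
  then have "(\<Sum>k<Suc n * Suc n. step n * (exp (- q * (real k * step n)) *
     (LINT \<omega>|P. indicator (alive n k) \<omega> * g (U (real k * step n) \<omega>)))) =
     step n * (exp (- q * (real 0 * step n)) * (LINT \<omega>|P. indicator (alive n 0) \<omega> * g (U (real 0 * step n) \<omega>))) +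
     (LINT \<omega>|P. occ_sum g n \<omega>)"
    unfolding * by (simp only:) (rule sum.insert; simp)
  then show ?thesis unfolding 0 by simp
qed

text \<open>Leaving in step \<open>k\<close> means being alive at \<open>k\<close> but not at
  \<open>Suc k\<close>, so each exit term is a difference of discounted expectations. Summation
  telescopes \<open>A\<close>, leaving the initial value, the value at the horizon and the one-step
  changes.\<close>

lemma expectation_exit_sum:
  fixes f :: "real \<Rightarrow> real" and K :: real
  assumes f [measurable]: "f \<in> borel_measurable borel" and K: "\<And>y. \<bar>f y\<bar> \<le> K"
  defines "A \<equiv> \<lambda>n k. exp (- q * (real k * step n)) * (LINT \<omega>|P. indicator (alive n k) \<omega> * f (U (real k * step n) \<omega>))"
  shows "(LINT \<omega>|P. exit_sum f n \<omega>) = f x - A n (Suc n * Suc n) +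
     (\<Sum>k<Suc n * Suc n. exp (- q * (real (Suc k) * step n)) *
        (LINT \<omega>|P. indicator (alive n k) \<omega> * f (U (real (Suc k) * step n) \<omega>)) - A n k)"
proof -
  have K0: "0 \<le> K" using K[of 0] by linarith
  have int: "integrable P (\<lambda>\<omega>. indicator (alive n j) \<omega> * f (U (real k * step n) \<omega>))" for j k
  proof (rule X.integrable_const_bound[where B = K])
    have "\<bar>indicator (alive n j) \<omega> * f (U (real k * step n) \<omega>)\<bar> \<le> K" for \<omega>
      using K[of "U (real k * step n) \<omega>"] K0 by (cases "\<omega> \<in> alive n j") simp_all
    then show "AE \<omega> in P. norm (indicator (alive n j) \<omega> * f (U (real k * step n) \<omega>)) \<le> K" by simp
  qed measurable
  define F where "F k = exp (- q * (real (Suc k) * step n)) *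
        (LINT \<omega>|P. indicator (alive n k) \<omega> * f (U (real (Suc k) * step n) \<omega>))" for k
  have term_eq: "(LINT \<omega>|P. exp (- q * (real (Suc k) * step n)) *
     ((indicator (alive n k) \<omega> - indicator (alive n (Suc k)) \<omega>) * f (U (real (Suc k) * step n) \<omega>))) = F k - A n (Suc k)" for k
    unfolding left_diff_distrib integral_mult_right_zero
    by (subst Bochner_Integration.integral_diff[OF int int]) (simp only: F_def A_def right_diff_distrib)
  have "(LINT \<omega>|P. exit_sum f n \<omega>) = (\<Sum>k<Suc n * Suc n. LINT \<omega>|P. exp (- q * (real (Suc k) * step n)) *
     ((indicator (alive n k) \<omega> - indicator (alive n (Suc k)) \<omega>) * f (U (real (Suc k) * step n) \<omega>)))"
    unfolding exit_sum_def
    by (rule Bochner_Integration.integral_sum, rule integrable_mult_right)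
       (unfold left_diff_distrib, rule Bochner_Integration.integrable_diff[OF int int])
  also have "\<dots> = (\<Sum>k<Suc n * Suc n. F k - A n (Suc k))" by (simp only: term_eq)
  also have "\<dots> = (\<Sum>k<Suc n * Suc n. (F k - A n k) - (A n (Suc k) - A n k))" by simp
  also have "\<dots> = (\<Sum>k<Suc n * Suc n. F k - A n k) - (A n (Suc n * Suc n) - A n 0)"
    by (subst sum_subtractf) (simp only: sum_lessThan_telescope)
  also have "A n 0 = f x"
  proof -
    have "(LINT \<omega>|P. indicator (alive n 0) \<omega> * f (U (real 0 * step n) \<omega>)) = (LINT \<omega>|P. f x)"
      by (rule Bochner_Integration.integral_cong[OF refl]) (use start x_le_a in \<open>auto simp: alive_def\<close>)
    then show ?thesis by (simp add: A_def X.prob_space)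
  qed
  finally show ?thesis by (simp add: F_def)
qed

text \<open>Each one-step change in \<open>expectation_exit_sum\<close> is replaced by the
  approximation of \<open>one_step\<close>; the resulting sums are Riemann sums for the occupation
  integrals. Since \<open>f\<close> is exponential just above \<open>a\<close>, the continuous
  motion only sees the multiple \<open>\<alpha>\<close>, and other values of \<open>f\<close> enter
  through the resets.\<close>

theorem dynkin_formula:
  fixes f :: "real \<Rightarrow> real" and \<alpha> \<theta> \<delta> B K :: real
  assumes \<theta>: "0 \<le> \<theta>" and \<delta>: "0 < \<delta>" and f: "continuous_on UNIV f"
    and K: "\<And>u. \<bar>f u\<bar> \<le> K" and B: "\<And>u v. \<bar>f u - f v\<bar> \<le> B * \<bar>u - v\<bar>"
    and f_exp: "\<And>u. u \<le> a + \<delta> \<Longrightarrow> f u = \<alpha> * exp (\<theta> * u)"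
  shows "(LINT \<omega>|P. exit_value f \<omega>) = f x +
    \<alpha> * (X.\<psi> \<theta> - lam - q) * (LINT \<omega>|P. occ_value (\<lambda>y. exp (\<theta> * y)) \<omega>) +
    lam * (LINT \<omega>|P. occ_value (\<lambda>y. f (p * y)) \<omega>)"
proof -
  have f_exp': "\<forall>u. u \<le> a + \<delta> \<longrightarrow> f u = \<alpha> * exp (\<theta> * u)" using f_exp by blast
  define \<gamma> where "\<gamma> = X.\<psi> \<theta> - lam - q"
  define g1 where "g1 y = exp (\<theta> * y)" for y :: real
  define g2 where "g2 y = f (p * y)" for y :: real
  have g1: "continuous_on UNIV g1" "\<And>y. y \<le> a \<Longrightarrow> \<bar>g1 y\<bar> \<le> exp (\<theta> * a)"
    unfolding g1_def using \<theta> by (auto intro!: continuous_intros mult_left_mono)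
  have g2: "continuous_on UNIV g2" "\<And>y. y \<le> a \<Longrightarrow> \<bar>g2 y\<bar> \<le> K"
    unfolding g2_def using K by (auto intro!: continuous_on_compose2[OF f] continuous_intros)
  have f_meas: "f \<in> borel_measurable borel" by (rule borel_measurable_continuous_onI[OF f])
  have K0: "0 \<le> K" using K[of 0] by linarith
  define A where "A n k = exp (- q * (real k * step n)) * (LINT \<omega>|P. indicator (alive n k) \<omega> * f (U (real k * step n) \<omega>))" for n k
  define b where "b n k = exp (- q * (real k * step n)) * (LINT \<omega>|P. indicator (alive n k) \<omega> * g1 (U (real k * step n) \<omega>))" for n k
  define c where "c n k = exp (- q * (real k * step n)) * (LINT \<omega>|P. indicator (alive n k) \<omega> * g2 (U (real k * step n) \<omega>))" for n k
  define F where "F n k = exp (- q * (real (Suc k) * step n)) *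
        (LINT \<omega>|P. indicator (alive n k) \<omega> * f (U (real (Suc k) * step n) \<omega>))" for n k
  \<comment> \<open>The telescoped sum after the one-step approximation, already grouped into a
    difference quotient times the occupation sum of the exponential plus the reset term.\<close>
  define main where "main n = f x - A n (Suc n * Suc n) +
      \<alpha> * ((exp (\<gamma> * step n) - 1) / step n) * (step n * g1 x + (LINT \<omega>|P. occ_sum g1 n \<omega>)) +
      lam * exp (- (q + lam) * step n) * (step n * g2 x + (LINT \<omega>|P. occ_sum g2 n \<omega>))" for n
  have A_b: "A n k = \<alpha> * b n k" for n k
  proof -
    have eq: "indicator (alive n k) \<omega> * f (U (real k * step n) \<omega>) = \<alpha> * (indicator (alive n k) \<omega> * g1 (U (real k * step n) \<omega>))" for \<omega>
      using f_exp[of "U (real k * step n) \<omega>"] alive_le[of \<omega> n k] \<delta>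
      by (cases "\<omega> \<in> alive n k") (auto simp: g1_def)
    show ?thesis unfolding A_def b_def eq integral_mult_right_zero by (simp only: mult.left_commute)
  qed
  have main_eq: "main n = f x - A n (Suc n * Suc n) +
     (\<Sum>k<Suc n * Suc n. exp (- q * step n) * (\<alpha> * exp ((X.\<psi> \<theta> - lam) * step n) * b n k + lam * step n * exp (- lam * step n) * c n k) - A n k)" for n
  proof -
    have s: "step n \<noteq> 0" by simp
    have "exp (- q * step n) * (\<alpha> * exp ((X.\<psi> \<theta> - lam) * step n) * b n k + lam * step n * exp (- lam * step n) * c n k) - A n k
      = \<alpha> * ((exp (\<gamma> * step n) - 1) / step n) * (step n * b n k) + lam * exp (- (q + lam) * step n) * (step n * c n k)" for k
    proof -
      have e1: "exp (\<gamma> * step n) = exp (- q * step n) * exp ((X.\<psi> \<theta> - lam) * step n)"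
        unfolding exp_add[symmetric] \<gamma>_def by (rule arg_cong[where f = exp]) (simp only: left_diff_distrib mult_minus_left; linarith)
      have e2: "exp (- (q + lam) * step n) = exp (- q * step n) * exp (- lam * step n)"
        unfolding exp_add[symmetric] by (rule arg_cong[where f = exp]) (simp only: distrib_right mult_minus_left; linarith)
      have "((exp (\<gamma> * step n) - 1) / step n) * (step n * b n k) = (exp (\<gamma> * step n) - 1) * b n k"
        using s by simp
      then have "\<alpha> * ((exp (\<gamma> * step n) - 1) / step n) * (step n * b n k) = \<alpha> * ((exp (\<gamma> * step n) - 1) * b n k)"
        by (simp only: mult.assoc)
      then show ?thesis unfolding A_b e1 e2 by (simp only: algebra_simps)
    qed
    then have "(\<Sum>k<Suc n * Suc n. exp (- q * step n) * (\<alpha> * exp ((X.\<psi> \<theta> - lam) * step n) * b n k + lam * step n * exp (- lam * step n) * c n k) - A n k)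
      = \<alpha> * ((exp (\<gamma> * step n) - 1) / step n) * (\<Sum>k<Suc n * Suc n. step n * b n k) +
        lam * exp (- (q + lam) * step n) * (\<Sum>k<Suc n * Suc n. step n * c n k)"
      by (simp only: sum.distrib sum_distrib_left)
    moreover have "(\<Sum>k<Suc n * Suc n. step n * b n k) = step n * g1 x + (LINT \<omega>|P. occ_sum g1 n \<omega>)"
      unfolding b_def by (rule expectation_occ_sum[OF borel_measurable_continuous_onI[OF g1(1)] g1(2)])
    moreover have "(\<Sum>k<Suc n * Suc n. step n * c n k) = step n * g2 x + (LINT \<omega>|P. occ_sum g2 n \<omega>)"
      unfolding c_def by (rule expectation_occ_sum[OF borel_measurable_continuous_onI[OF g2(1)] g2(2)])
    ultimately show ?thesis unfolding main_def by (simp only: add.assoc)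
  qed
  have exit_eq: "(LINT \<omega>|P. exit_sum f n \<omega>) = f x - A n (Suc n * Suc n) + (\<Sum>k<Suc n * Suc n. F n k - A n k)" for n
    unfolding A_def F_def by (rule expectation_exit_sum[OF f_meas K])
  have "(\<lambda>n. (LINT \<omega>|P. exit_sum f n \<omega>) - main n) \<longlonglongrightarrow> 0"
  proof (rule LIMSEQ_I)
    fix r :: real assume r: "0 < r"
    \<comment> \<open>The discounted number of steps times the mesh is at most
      \<open>1 + 1 / q\<close>, so the accumulated error is at most \<open>r / 2\<close>.\<close>
    define e where "e = r / (2 * (1 + 1 / q))"
    have q1: "0 < 1 + 1 / q" using q by (simp add: add_pos_pos)
    have e: "0 < e" using r q1 by (simp add: e_def)
    have "\<forall>\<^sub>F n in sequentially. \<bar>(LINT \<omega>|P. exit_sum f n \<omega>) - main n\<bar> < r"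
      using one_step[OF \<theta> \<delta> f_meas K B f_exp' e]
    proof eventually_elim
      case (elim n)
      have err: "\<bar>F n k - exp (- q * step n) * (\<alpha> * exp ((X.\<psi> \<theta> - lam) * step n) * b n k + lam * step n * exp (- lam * step n) * c n k)\<bar>
        \<le> e * (step n * exp (- q * (real k * step n)))" for k
      proof -
        define I where "I = (LINT \<omega>|P. indicator (alive n k) \<omega> * f (U (real (Suc k) * step n) \<omega>))"
        define I1 where "I1 = (LINT \<omega>|P. indicator (alive n k) \<omega> * g1 (U (real k * step n) \<omega>))"
        define I2 where "I2 = (LINT \<omega>|P. indicator (alive n k) \<omega> * g2 (U (real k * step n) \<omega>))"
        define J where "J = \<alpha> * exp ((X.\<psi> \<theta> - lam) * step n) * I1 + lam * step n * exp (- lam * step n) * I2"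
        define w where "w = exp (- q * (real k * step n))"
        have bound: "\<bar>I - J\<bar> \<le> e * step n"
          unfolding I_def J_def I1_def I2_def g1_def g2_def
          by (rule elim[rule_format, OF alive_filt alive_le])
        have "real (Suc k) * step n = real k * step n + step n" by (simp only: of_nat_Suc distrib_right mult_1_left add.commute)
        then have "exp (- q * (real (Suc k) * step n)) = w * exp (- q * step n)"
          unfolding w_def exp_add[symmetric] by (simp only: distrib_left)
        then have "F n k - exp (- q * step n) * (\<alpha> * exp ((X.\<psi> \<theta> - lam) * step n) * b n k + lam * step n * exp (- lam * step n) * c n k)
          = (w * exp (- q * step n)) * (I - J)"
          unfolding F_def b_def c_def I_def[symmetric] I1_def[symmetric] I2_def[symmetric] w_def[symmetric] J_def
          by (simp only: right_diff_distrib distrib_left mult_ac)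
        also have "\<bar>\<dots>\<bar> = (w * exp (- q * step n)) * \<bar>I - J\<bar>" by (simp add: abs_mult w_def)
        also have "\<dots> \<le> (w * 1) * (e * step n)"
          using bound q by (intro mult_mono mult_left_mono) (auto simp: w_def)
        finally show ?thesis unfolding w_def by (simp only: mult_ac mult_1_left mult_1_right)
      qed
      have diff_eq: "(LINT \<omega>|P. exit_sum f n \<omega>) - main n = (\<Sum>k<Suc n * Suc n. F n k -
         exp (- q * step n) * (\<alpha> * exp ((X.\<psi> \<theta> - lam) * step n) * b n k + lam * step n * exp (- lam * step n) * c n k))"
        unfolding exit_eq main_eq by (simp only: sum_subtractf; linarith)
      have "\<bar>(LINT \<omega>|P. exit_sum f n \<omega>) - main n\<bar> \<le> (\<Sum>k<Suc n * Suc n. \<bar>F n k -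
         exp (- q * step n) * (\<alpha> * exp ((X.\<psi> \<theta> - lam) * step n) * b n k + lam * step n * exp (- lam * step n) * c n k)\<bar>)"
        unfolding diff_eq by (rule sum_abs)
      also have "\<dots> \<le> (\<Sum>k<Suc n * Suc n. e * (step n * exp (- q * (real k * step n))))"
        by (intro sum_mono err)
      also have "\<dots> = e * (\<Sum>k<Suc n * Suc n. step n * exp (- q * (real k * step n)))"
        by (rule sum_distrib_left[symmetric])
      also have "\<dots> \<le> e * (1 + 1 / q)"
        by (rule mult_left_mono[OF discount_sum_bounded[OF q]]) (use e in simp)
      also have "\<dots> = r / 2"
      proof -
        define z where "z = 1 + 1 / q"
        have "z \<noteq> 0" using q1 by (simp add: z_def)
        then show ?thesis unfolding e_def z_def[symmetric] by simp
      qed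
      also have "\<dots> < r" using r by simp
      finally show ?case .
    qed
    then show "\<exists>no. \<forall>n\<ge>no. norm ((LINT \<omega>|P. exit_sum f n \<omega>) - main n - 0) < r"
      unfolding eventually_sequentially by simp
  qed
  moreover have "main \<longlonglongrightarrow> f x - 0 + \<alpha> * \<gamma> * (0 * g1 x + (LINT \<omega>|P. occ_value g1 \<omega>)) +
      lam * exp (- (q + lam) * 0) * (0 * g2 x + (LINT \<omega>|P. occ_value g2 \<omega>))"
  proof -
    have step0: "(\<lambda>n. step n) \<longlonglongrightarrow> 0" by (rule LIMSEQ_Suc[OF lim_1_over_n])
    \<comment> \<open>The horizon term is discounted by \<open>exp (- q * Suc n)\<close> while
      \<open>f\<close> is bounded.\<close>
    have "(\<lambda>n. A n (Suc n * Suc n)) \<longlonglongrightarrow> 0"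
    proof (rule tendsto_rabs_zero_cancel, rule tendsto_sandwich)
      show "\<forall>\<^sub>F n in sequentially. 0 \<le> \<bar>A n (Suc n * Suc n)\<bar>" by simp
      show "\<forall>\<^sub>F n in sequentially. \<bar>A n (Suc n * Suc n)\<bar> \<le> exp (- q * real (Suc n)) * K"
      proof (rule always_eventually, rule allI)
        fix n
        let ?m = "Suc n * Suc n"
        have int: "integrable P (\<lambda>\<omega>. indicator (alive n ?m) \<omega> * f (U (real ?m * step n) \<omega>))"
          by (rule alive_expectation_integrable[OF f_meas K])
        have "\<bar>LINT \<omega>|P. indicator (alive n ?m) \<omega> * f (U (real ?m * step n) \<omega>)\<bar> \<le>
          (LINT \<omega>|P. \<bar>indicator (alive n ?m) \<omega> * f (U (real ?m * step n) \<omega>)\<bar>)" by (rule integral_abs_bound)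
        also have "\<dots> \<le> (LINT \<omega>|P. K)"
        proof (rule integral_mono)
          show "integrable P (\<lambda>\<omega>. \<bar>indicator (alive n ?m) \<omega> * f (U (real ?m * step n) \<omega>)\<bar>)"
            using int by (rule integrable_abs)
          show "\<bar>indicator (alive n ?m) \<omega> * f (U (real ?m * step n) \<omega>)\<bar> \<le> K" for \<omega>
            using K[of "U (real ?m * step n) \<omega>"] K0 by (cases "\<omega> \<in> alive n ?m") simp_all
        qed simp
        also have "\<dots> = K" by (simp add: X.prob_space)
        finally have le: "\<bar>LINT \<omega>|P. indicator (alive n ?m) \<omega> * f (U (real ?m * step n) \<omega>)\<bar> \<le> K" .
        have "real ?m * step n = real (Suc n)" by (simp only: of_nat_mult; simp)
        then have "\<bar>A n ?m\<bar> = exp (- q * real (Suc n)) * \<bar>LINT \<omega>|P. indicator (alive n ?m) \<omega> * f (U (real ?m * step n) \<omega>)\<bar>"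
          unfolding A_def by (simp only: abs_mult abs_exp_cancel)
        also have "\<dots> \<le> exp (- q * real (Suc n)) * K" using le by (intro mult_left_mono) auto
        finally show "\<bar>A n ?m\<bar> \<le> exp (- q * real (Suc n)) * K" .
      qed
      have "(\<lambda>n. exp (- q * real n)) \<longlonglongrightarrow> 0" using q by real_asymp
      then have "(\<lambda>n. exp (- q * real (Suc n)) * K) \<longlonglongrightarrow> 0 * K"
        by (intro tendsto_mult tendsto_const) (rule LIMSEQ_Suc)
      then show "(\<lambda>n. exp (- q * real (Suc n)) * K) \<longlonglongrightarrow> 0" by simp
    qed simp
    \<comment> \<open>The generator applied to the exponential appears as the derivative of
      \<open>exp (\<gamma> * z)\<close> at 0.\<close>
    moreover have "(\<lambda>n. (exp (\<gamma> * step n) - 1) / step n) \<longlonglongrightarrow> \<gamma>"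
    proof -
      have "((\<lambda>z. exp (\<gamma> * z)) has_real_derivative \<gamma>) (at 0)"
        by (auto intro!: derivative_eq_intros)
      then have "((\<lambda>z. (exp (\<gamma> * z) - 1) / z) \<longlongrightarrow> \<gamma>) (at 0)"
        unfolding has_field_derivative_iff by simp
      moreover have "filterlim (\<lambda>n. step n) (at 0) sequentially"
        unfolding filterlim_at using step0 by simp
      ultimately show ?thesis by (rule filterlim_compose)
    qed
    ultimately show ?thesis
      unfolding main_def
      by (intro tendsto_add tendsto_diff tendsto_mult tendsto_exp tendsto_const step0
          expectation_occ_sum_tendsto[OF g1] expectation_occ_sum_tendsto[OF g2])
  qed
  ultimately have "(\<lambda>n. ((LINT \<omega>|P. exit_sum f n \<omega>) - main n) + main n) \<longlonglongrightarrow> 0 + (f x - 0 + \<alpha> * \<gamma> * (0 * g1 x + (LINT \<omega>|P. occ_value g1 \<omega>)) +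
      lam * exp (- (q + lam) * 0) * (0 * g2 x + (LINT \<omega>|P. occ_value g2 \<omega>)))"
    by (rule tendsto_add)
  then have "(\<lambda>n. LINT \<omega>|P. exit_sum f n \<omega>) \<longlonglongrightarrow> f x + \<alpha> * \<gamma> * (LINT \<omega>|P. occ_value g1 \<omega>) + lam * (LINT \<omega>|P. occ_value g2 \<omega>)"
    by simp
  with expectation_exit_sum_tendsto[OF f K]
  have "(LINT \<omega>|P. exit_value f \<omega>) = f x + \<alpha> * \<gamma> * (LINT \<omega>|P. occ_value g1 \<omega>) + lam * (LINT \<omega>|P. occ_value g2 \<omega>)"
    by (rule LIMSEQ_unique)
  then show ?thesis by (simp only: \<gamma>_def g1_def[abs_def] g2_def[abs_def])
qed

end

section \<open>The occupation measure\<close>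

lemma exp_lipschitz:
  fixes s t M :: real
  assumes "s \<le> M" "t \<le> M"
  shows "\<bar>exp s - exp t\<bar> \<le> exp M * \<bar>s - t\<bar>"
proof -
  have *: "\<bar>exp s - exp t\<bar> \<le> exp M * \<bar>s - t\<bar>" if "s \<le> t" "t \<le> M" for s t :: real
  proof -
    have "exp t - exp s = exp t * (1 - exp (s - t))" by (simp add: right_diff_distrib exp_diff)
    also have "\<dots> \<le> exp t * (t - s)"
    proof (rule mult_left_mono)
      show "1 - exp (s - t) \<le> t - s" using exp_ge_add_one_self[of "s - t"] by linarith
    qed simp
    also have "\<dots> \<le> exp M * (t - s)" using that by (intro mult_right_mono) auto
    finally show ?thesis using that by (simp add: abs_if)
  qed
  show ?thesis
  proof (cases "s \<le> t")
    case True
    then show ?thesis using *[of s t] assms by simp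
  next
    case False
    then show ?thesis using *[of t s] assms by (simp add: abs_minus_commute)
  qed
qed

text \<open>Dynkin's formula needs bounded Lipschitz functions that are multiples of one exponential below a level
  slightly above \<open>a\<close>. As \<open>\<delta>\<close> tends to 0, these two approximate \<open>e\<^sup>\<theta>\<^sup>y\<close> on \<open>(-\<infinity>, a]\<close> and the
  indicator of \<open>(a, \<infinity>)\<close>.\<close>

definition cut_exp :: "real \<Rightarrow> real \<Rightarrow> real \<Rightarrow> real \<Rightarrow> real" where
  "cut_exp \<theta> a \<delta> u =
     (let c1 = exp (\<theta> * (a + \<delta>)); c2 = exp (\<theta> * (a + 2 * \<delta>)); y = exp (\<theta> * min u (a + 2 * \<delta>))
      in min y (c1 / (c2 - c1) * (c2 - y)))"

definition ramp :: "real \<Rightarrow> real \<Rightarrow> real \<Rightarrow> real" where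
  "ramp a \<delta> u = max 0 (min 1 ((u - a - \<delta>) / \<delta>))"

text \<open>As a function of \<open>y = exp (\<theta> * u)\<close> this is the minimum of the
  identity and the line falling from height \<open>c1\<close> at \<open>y = c1\<close> to 0 at
  \<open>y = c2\<close>. It is Lipschitz in \<open>y\<close>, and \<open>y\<close> is Lipschitz in
  \<open>u\<close> because \<open>u\<close> is capped at \<open>a + 2 * \<delta>\<close>.\<close>

lemma cut_exp_props:
  assumes \<theta>: "0 < \<theta>" and \<delta>: "0 < \<delta>"
  shows "continuous_on UNIV (cut_exp \<theta> a \<delta>)"
    and "\<And>u. u \<le> a + \<delta> \<Longrightarrow> cut_exp \<theta> a \<delta> u = exp (\<theta> * u)"
    and "\<And>u. a + 2 * \<delta> \<le> u \<Longrightarrow> cut_exp \<theta> a \<delta> u = 0"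
    and "\<And>u. \<bar>cut_exp \<theta> a \<delta> u\<bar> \<le> exp (\<theta> * (a + 2 * \<delta>))"
    and "\<exists>B. \<forall>u v. \<bar>cut_exp \<theta> a \<delta> u - cut_exp \<theta> a \<delta> v\<bar> \<le> B * \<bar>u - v\<bar>"
proof -
  define c1 where "c1 = exp (\<theta> * (a + \<delta>))"
  define c2 where "c2 = exp (\<theta> * (a + 2 * \<delta>))"
  define y where "y u = exp (\<theta> * min u (a + 2 * \<delta>))" for u
  define \<kappa> where "\<kappa> = c1 / (c2 - c1)"
  have c: "0 < c1" "c1 < c2" using \<theta> \<delta> by (auto simp: c1_def c2_def)
  have \<kappa>: "0 < \<kappa>" "\<kappa> * (c2 - c1) = c1" using c by (auto simp: \<kappa>_def)
  have eq: "cut_exp \<theta> a \<delta> u = min (y u) (\<kappa> * (c2 - y u))" for u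
    by (simp add: cut_exp_def Let_def c1_def c2_def y_def \<kappa>_def)
  have y: "0 < y u" "y u \<le> c2" for u using \<theta> by (auto simp: y_def c2_def)
  have "continuous_on UNIV y" unfolding y_def by (intro continuous_intros)
  then show "continuous_on UNIV (cut_exp \<theta> a \<delta>)" unfolding eq[abs_def] by (intro continuous_intros)
  show "cut_exp \<theta> a \<delta> u = exp (\<theta> * u)" if "u \<le> a + \<delta>" for u
  proof -
    have yu: "y u = exp (\<theta> * u)" using that \<delta> by (simp add: y_def min_absorb1)
    have "y u \<le> c1" unfolding yu c1_def using that \<theta> by simp
    then have "\<kappa> * (c2 - c1) \<le> \<kappa> * (c2 - y u)" using \<kappa> by (intro mult_left_mono) auto
    then have "y u \<le> \<kappa> * (c2 - y u)" using \<kappa>(2) \<open>y u \<le> c1\<close> by linarith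
    then show ?thesis unfolding eq yu[symmetric] by (rule min_absorb1)
  qed
  show "cut_exp \<theta> a \<delta> u = 0" if "a + 2 * \<delta> \<le> u" for u
  proof -
    have "y u = c2" using that by (simp add: y_def c2_def min_absorb2)
    then show ?thesis unfolding eq using c by (simp add: min_absorb2)
  qed
  show "\<bar>cut_exp \<theta> a \<delta> u\<bar> \<le> exp (\<theta> * (a + 2 * \<delta>))" for u
  proof -
    have "0 \<le> \<kappa> * (c2 - y u)" using \<kappa> y(2)[of u] by simp
    then show ?thesis unfolding eq c2_def[symmetric] using y[of u] by (simp add: abs_if min_def)
  qed
  show "\<exists>B. \<forall>u v. \<bar>cut_exp \<theta> a \<delta> u - cut_exp \<theta> a \<delta> v\<bar> \<le> B * \<bar>u - v\<bar>"
  proof (intro exI allI)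
    fix u v :: real
    have yl: "\<bar>y u - y v\<bar> \<le> c2 * \<theta> * \<bar>u - v\<bar>"
    proof -
      have "\<bar>y u - y v\<bar> \<le> c2 * \<bar>\<theta> * min u (a + 2 * \<delta>) - \<theta> * min v (a + 2 * \<delta>)\<bar>"
        unfolding y_def c2_def using \<theta> by (intro exp_lipschitz mult_left_mono) auto
      also have "\<bar>\<theta> * min u (a + 2 * \<delta>) - \<theta> * min v (a + 2 * \<delta>)\<bar> = \<theta> * \<bar>min u (a + 2 * \<delta>) - min v (a + 2 * \<delta>)\<bar>"
        using \<theta> by (simp add: right_diff_distrib[symmetric] abs_mult)
      also have "\<dots> \<le> \<theta> * \<bar>u - v\<bar>" using \<theta> by (intro mult_left_mono) (auto simp: min_def)
      finally show ?thesis using c by (simp add: mult_left_mono mult.assoc)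
    qed
    have min_lip: "\<bar>min A1 B1 - min A2 B2\<bar> \<le> \<bar>A1 - A2\<bar> + \<bar>B1 - B2\<bar>" for A1 B1 A2 B2 :: real
      by (simp add: min_def abs_if)
    have "\<bar>cut_exp \<theta> a \<delta> u - cut_exp \<theta> a \<delta> v\<bar> \<le> \<bar>y u - y v\<bar> + \<bar>\<kappa> * (c2 - y u) - \<kappa> * (c2 - y v)\<bar>"
      unfolding eq by (rule min_lip)
    also have "\<kappa> * (c2 - y u) - \<kappa> * (c2 - y v) = \<kappa> * (y v - y u)" by (simp add: algebra_simps)
    also have "\<bar>\<kappa> * (y v - y u)\<bar> = \<kappa> * \<bar>y u - y v\<bar>" using \<kappa> by (simp add: abs_mult abs_minus_commute)
    also have "\<bar>y u - y v\<bar> + \<kappa> * \<bar>y u - y v\<bar> = (1 + \<kappa>) * \<bar>y u - y v\<bar>" by (simp add: distrib_right)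
    also have "\<dots> \<le> (1 + \<kappa>) * (c2 * \<theta> * \<bar>u - v\<bar>)" using yl \<kappa> by (intro mult_left_mono) auto
    finally show "\<bar>cut_exp \<theta> a \<delta> u - cut_exp \<theta> a \<delta> v\<bar> \<le> ((1 + \<kappa>) * (c2 * \<theta>)) * \<bar>u - v\<bar>" by (simp add: mult.assoc)
  qed
qed

lemma ramp_props:
  assumes \<delta>: "0 < \<delta>"
  shows "continuous_on UNIV (ramp a \<delta>)"
    and "\<And>u. u \<le> a + \<delta> \<Longrightarrow> ramp a \<delta> u = 0"
    and "\<And>u. a + 2 * \<delta> \<le> u \<Longrightarrow> ramp a \<delta> u = 1"
    and "\<And>u. \<bar>ramp a \<delta> u\<bar> \<le> 1"
    and "\<And>u v. \<bar>ramp a \<delta> u - ramp a \<delta> v\<bar> \<le> (1 / \<delta>) * \<bar>u - v\<bar>"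
proof -
  show "continuous_on UNIV (ramp a \<delta>)" unfolding ramp_def[abs_def] using \<delta> by (intro continuous_intros) auto
  show "ramp a \<delta> u = 0" if "u \<le> a + \<delta>" for u
  proof -
    have "(u - a - \<delta>) / \<delta> \<le> 0" using that \<delta> by (intro divide_nonpos_pos) auto
    then show ?thesis by (simp add: ramp_def)
  qed
  show "ramp a \<delta> u = 1" if "a + 2 * \<delta> \<le> u" for u
  proof -
    have "1 \<le> (u - a - \<delta>) / \<delta>" using that \<delta> by (simp add: field_simps)
    then show ?thesis by (simp add: ramp_def)
  qed
  show "\<bar>ramp a \<delta> u\<bar> \<le> 1" for u by (auto simp: ramp_def)
  show "\<bar>ramp a \<delta> u - ramp a \<delta> v\<bar> \<le> (1 / \<delta>) * \<bar>u - v\<bar>" for u v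
  proof -
    have lip: "\<bar>max 0 (min 1 s) - max 0 (min 1 t)\<bar> \<le> \<bar>s - t\<bar>" for s t :: real by (simp add: max_def min_def abs_if)
    have "\<bar>ramp a \<delta> u - ramp a \<delta> v\<bar> \<le> \<bar>(u - a - \<delta>) / \<delta> - (v - a - \<delta>) / \<delta>\<bar>"
      unfolding ramp_def by (rule lip)
    also have "(u - a - \<delta>) / \<delta> - (v - a - \<delta>) / \<delta> = (1 / \<delta>) * (u - v)" by (simp add: diff_divide_distrib)
    also have "\<bar>\<dots>\<bar> = (1 / \<delta>) * \<bar>u - v\<bar>" using \<delta> by (simp add: abs_mult)
    finally show ?thesis .
  qed
qed

context resetting
begin

text \<open>The process as one function of time and outcome, made 0 at negative times, where
  \<open>U\<close> is meaningless.\<close>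

definition joint :: "real \<times> 'a \<Rightarrow> real" where
  "joint z = indicator {0..} (fst z) * U (fst z) (snd z)"

definition alive_set :: "(real \<times> 'a) set" where
  "alive_set = {z \<in> space (lborel \<Otimes>\<^sub>M P). 0 \<le> fst z \<and> joint z \<le> a \<and>
     (\<forall>r\<in>{r \<in> \<rat>. 0 < r}. r < fst z \<longrightarrow> U r (snd z) \<le> a)}"

definition occ_density :: "real \<times> 'a \<Rightarrow> real" where
  "occ_density z = indicator alive_set z * exp (- q * fst z)"

text \<open>The measure \<open>L\<close> of the overview: the image under the process of
  \<open>exp (- q * s) ds\<close> times \<open>P\<close>, restricted to the pairs at which the
  process is still alive.\<close>

definition occ_meas :: "real measure" where
  "occ_meas = distr (density (lborel \<Otimes>\<^sub>M P) (\<lambda>z. ennreal (occ_density z))) borel joint"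

lemma joint_measurable [measurable]: "joint \<in> borel_measurable (lborel \<Otimes>\<^sub>M P)"
proof (rule borel_measurable_LIMSEQ_real)
  fix n :: nat
  have f: "(\<lambda>z. U (real (Suc i) * step n) (snd z)) \<in> borel_measurable (lborel \<Otimes>\<^sub>M P)" for i :: nat
    by (rule measurable_compose[OF measurable_snd U_step_measurable])
  have g: "(\<lambda>z. nat \<lfloor>real (Suc n) * fst z\<rfloor>) \<in> (lborel \<Otimes>\<^sub>M P) \<rightarrow>\<^sub>M count_space UNIV"
    by measurable
  have "(\<lambda>z. U (real (Suc (nat \<lfloor>real (Suc n) * fst z\<rfloor>)) * step n) (snd z)) \<in> borel_measurable (lborel \<Otimes>\<^sub>M P)"
    by (rule measurable_compose_countable[OF f g])
  then show "(\<lambda>z. indicator {0..} (fst z) * U (real (Suc (nat \<lfloor>real (Suc n) * fst z\<rfloor>)) * step n) (snd z)) \<in> borel_measurable (lborel \<Otimes>\<^sub>M P)"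
    by measurable
next
  fix z :: "real \<times> 'a" assume "z \<in> space (lborel \<Otimes>\<^sub>M P)"
  then have \<omega>: "snd z \<in> space P" by (auto simp: space_pair_measure)
  interpret cadlag_path "\<lambda>t. U t (snd z)" a by (rule cadlag_path_U[OF \<omega>])
  show "(\<lambda>n. indicator {0..} (fst z) * U (real (Suc (nat \<lfloor>real (Suc n) * fst z\<rfloor>)) * step n) (snd z)) \<longlonglongrightarrow> joint z"
  proof (cases "0 \<le> fst z")
    case True
    have eq: "real (Suc (nat \<lfloor>real (Suc n) * fst z\<rfloor>)) * step n = (of_int \<lfloor>real (Suc n) * fst z\<rfloor> + 1) / real (Suc n)" for n
      using grid_index[OF True, of n] by (simp only: Suc_eq_plus1)
    have "(\<lambda>n. U ((of_int \<lfloor>real (Suc n) * fst z\<rfloor> + 1) / real (Suc n)) (snd z)) \<longlonglongrightarrow> U (fst z) (snd z)"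
      by (rule cadlag_seq_right[OF cadlag True floor_grid_tendsto_right less_imp_le[OF floor_grid_gt]])
    then show ?thesis unfolding joint_def eq by (intro tendsto_mult tendsto_const)
  next
    case False
    then show ?thesis by (simp add: joint_def)
  qed
qed

lemma alive_set_measurable [measurable]: "alive_set \<in> sets (lborel \<Otimes>\<^sub>M P)"
proof -
  have count: "countable {r \<in> \<rat>. 0 < (r::real)}"
    by (rule countable_subset[OF _ countable_rat]) auto
  have "{z \<in> space (lborel \<Otimes>\<^sub>M P). \<forall>r\<in>{r \<in> \<rat>. 0 < r}. r < fst z \<longrightarrow> U r (snd z) \<le> a} \<in> sets (lborel \<Otimes>\<^sub>M P)"
  proof (rule sets.sets_Collect_countable_All'[OF _ count])
    fix r :: real assume "r \<in> {r \<in> \<rat>. 0 < r}"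
    then have [measurable]: "U r \<in> borel_measurable P" by (intro U_measurable) auto
    show "{z \<in> space (lborel \<Otimes>\<^sub>M P). r < fst z \<longrightarrow> U r (snd z) \<le> a} \<in> sets (lborel \<Otimes>\<^sub>M P)"
      by measurable
  qed
  moreover have "{z \<in> space (lborel \<Otimes>\<^sub>M P). 0 \<le> fst z \<and> joint z \<le> a} \<in> sets (lborel \<Otimes>\<^sub>M P)"
    by measurable
  moreover have "alive_set = {z \<in> space (lborel \<Otimes>\<^sub>M P). 0 \<le> fst z \<and> joint z \<le> a} \<inter>
    {z \<in> space (lborel \<Otimes>\<^sub>M P). \<forall>r\<in>{r \<in> \<rat>. 0 < r}. r < fst z \<longrightarrow> U r (snd z) \<le> a}"
    unfolding alive_set_def by auto
  ultimately show ?thesis by simp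
qed

lemma alive_set_iff: "\<omega> \<in> space P \<Longrightarrow> (s, \<omega>) \<in> alive_set \<longleftrightarrow> 0 \<le> s \<and> living s \<omega>"
  unfolding alive_set_def living_def joint_def by (auto simp: space_pair_measure)

lemma occ_density_measurable [measurable]: "occ_density \<in> borel_measurable (lborel \<Otimes>\<^sub>M P)"
  unfolding occ_density_def by measurable

lemma sets_occ_meas [simp, measurable_cong]: "sets occ_meas = sets borel"
  by (simp add: occ_meas_def)

lemma emeasure_occ_meas_le: "emeasure occ_meas (space occ_meas) \<le> ennreal (1 / q)"
proof -
  have "emeasure occ_meas (space occ_meas) = (\<integral>\<^sup>+z. ennreal (occ_density z) \<partial>(lborel \<Otimes>\<^sub>M P))"
    unfolding occ_meas_def
    by (subst emeasure_distr) (auto simp: emeasure_density space_pair_measure intro!: nn_integral_cong)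
  also have "\<dots> \<le> (\<integral>\<^sup>+z. ennreal (indicator {0..} (fst z) * exp (- q * fst z)) \<partial>(lborel \<Otimes>\<^sub>M P))"
    by (rule nn_integral_mono) (auto simp: occ_density_def alive_set_def indicator_def)
  also have "\<dots> = (\<integral>\<^sup>+s. \<integral>\<^sup>+\<omega>. ennreal (indicator {0..} s * exp (- q * s)) \<partial>P \<partial>lborel)"
    by (subst X.nn_integral_fst[symmetric]) simp_all
  also have "\<dots> = (\<integral>\<^sup>+s. ennreal (indicator {0..} s * exp (- q * s)) \<partial>lborel)"
    by (simp add: X.emeasure_space_1)
  also have "\<dots> = ennreal (1 / q)"
    using exponential_integral[OF q] by (subst nn_integral_eq_integral) auto
  finally show ?thesis .
qed

lemma finite_occ_meas: "finite_measure occ_meas"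
  using emeasure_occ_meas_le by (intro finite_measureI) (auto simp: top_unique)

lemma AE_occ_meas_le: "AE y in occ_meas. y \<le> a"
proof -
  have "AE z in lborel \<Otimes>\<^sub>M P. 0 < ennreal (occ_density z) \<longrightarrow> joint z \<le> a"
    by (rule AE_I2) (auto simp: occ_density_def alive_set_def indicator_def split: if_splits)
  then have "AE z in density (lborel \<Otimes>\<^sub>M P) (\<lambda>z. ennreal (occ_density z)). joint z \<le> a"
    by (subst AE_density) auto
  then show ?thesis unfolding occ_meas_def by (subst AE_distr_iff) auto
qed

lemma occ_integrable:
  fixes g :: "real \<Rightarrow> real"
  assumes [measurable]: "g \<in> borel_measurable borel" and C: "\<And>y. y \<le> a \<Longrightarrow> \<bar>g y\<bar> \<le> C"
  shows "integrable occ_meas g"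
proof -
  interpret L: finite_measure occ_meas by (rule finite_occ_meas)
  show ?thesis
  proof (rule L.integrable_const_bound)
    show "AE y in occ_meas. norm (g y) \<le> C"
      using AE_occ_meas_le by eventually_elim (simp add: C)
  qed measurable
qed

text \<open>Fubini, after unfolding the image measure and its density; from here on expectations of
  time integrals become integrals over the line.\<close>

lemma occ_value_eq:
  fixes g :: "real \<Rightarrow> real"
  assumes g [measurable]: "g \<in> borel_measurable borel" and C: "\<And>y. y \<le> a \<Longrightarrow> \<bar>g y\<bar> \<le> C"
  shows "(LINT \<omega>|P. occ_value g \<omega>) = (LINT y|occ_meas. g y)"
proof -
  interpret pair_sigma_finite lborel P
    by (intro pair_sigma_finite.intro lborel.sigma_finite_measure_axioms X.sigma_finite_measure_axioms)
  have d0: "0 \<le> occ_density z" for z by (simp add: occ_density_def)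
  have gj [measurable]: "(\<lambda>z. g (joint z)) \<in> borel_measurable (lborel \<Otimes>\<^sub>M P)" by measurable
  have "integrable (density (lborel \<Otimes>\<^sub>M P) (\<lambda>z. ennreal (occ_density z))) (\<lambda>z. g (joint z))"
  proof -
    have "integrable occ_meas g" by (rule occ_integrable[OF g]) (rule C)
    then show ?thesis unfolding occ_meas_def by (subst (asm) integrable_distr_eq) auto
  qed
  then have int: "integrable (lborel \<Otimes>\<^sub>M P) (\<lambda>z. occ_density z *\<^sub>R g (joint z))"
    by (subst (asm) integrable_density) (auto simp: d0)
  have "(LINT y|occ_meas. g y) = (LINT z|density (lborel \<Otimes>\<^sub>M P) (\<lambda>z. ennreal (occ_density z)). g (joint z))"
    unfolding occ_meas_def by (subst integral_distr) auto
  also have "\<dots> = (LINT z|(lborel \<Otimes>\<^sub>M P). occ_density z *\<^sub>R g (joint z))"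
    by (subst integral_density) (auto simp: d0)
  also have "\<dots> = (LINT \<omega>|P. LINT s|lborel. occ_density (s, \<omega>) *\<^sub>R g (joint (s, \<omega>)))"
    using integral_snd[of "\<lambda>s \<omega>. occ_density (s, \<omega>) *\<^sub>R g (joint (s, \<omega>))"] int by (simp add: case_prod_beta')
  also have "\<dots> = (LINT \<omega>|P. occ_value g \<omega>)"
  proof (rule Bochner_Integration.integral_cong[OF refl])
    fix \<omega> assume \<omega>: "\<omega> \<in> space P"
    show "(LINT s|lborel. occ_density (s, \<omega>) *\<^sub>R g (joint (s, \<omega>))) = occ_value g \<omega>"
      unfolding occ_value_def
      by (rule Bochner_Integration.integral_cong[OF refl])
         (auto simp: occ_density_def joint_def indicator_def alive_set_iff[OF \<omega>])
  qed
  finally show ?thesis by simp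
qed

text \<open>The constant \<open>c\<close> of the overview: the discounted probability that the
  process is exactly at \<open>a\<close> at the crossing time.\<close>

definition creep :: real where
  "creep = (LINT \<omega>|P. exit_value (\<lambda>u. of_bool (u = a)) \<omega>)"

lemma exit_value_ge: "\<omega> \<in> space P \<Longrightarrow> crossed \<omega> \<Longrightarrow> a \<le> U (crossing_time a (upath \<omega>)) \<omega>"
  using cadlag_path.crossing_value_ge[OF cadlag_path_U] unfolding crossed_def by blast

lemma crossing_time_nonneg: "\<omega> \<in> space P \<Longrightarrow> crossed \<omega> \<Longrightarrow> 0 \<le> crossing_time a (upath \<omega>)"
  using cadlag_path.crossing_nonneg[OF cadlag_path_U] unfolding crossed_def by blast

lemma exit_value_bounded:
  assumes "\<And>u. \<bar>f u\<bar> \<le> K" "\<omega> \<in> space P"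
  shows "\<bar>exit_value f \<omega>\<bar> \<le> K"
proof (cases "crossed \<omega>")
  case True
  have "\<bar>exit_value f \<omega>\<bar> = exp (- q * crossing_time a (upath \<omega>)) * \<bar>f (U (crossing_time a (upath \<omega>)) \<omega>)\<bar>"
    using True by (simp add: exit_value_def abs_mult)
  also have "\<dots> \<le> 1 * K"
    using crossing_time_nonneg[OF assms(2) True] q assms(1) by (intro mult_mono) auto
  finally show ?thesis by simp
next
  case False
  have "0 \<le> K" using assms(1)[of 0] by linarith
  then show ?thesis using False by (simp add: exit_value_def)
qed

lemma delta_tendsto_0: "(\<lambda>m. 2 * step m) \<longlonglongrightarrow> 0"
  using tendsto_mult[OF tendsto_const LIMSEQ_Suc[OF lim_1_over_n], of "2::real"] by simp

lemma step_le: "a + 2 * step m \<le> a + 2"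
proof -
  have "step m \<le> 1" by simp
  then show ?thesis by linarith
qed

lemma cut_exp_tendsto:
  assumes "0 < \<theta>"
  shows "(\<lambda>m. cut_exp \<theta> a (step m) u) \<longlonglongrightarrow> of_bool (u \<le> a) * exp (\<theta> * u)"
proof (cases "u \<le> a")
  case True
  have "cut_exp \<theta> a (step m) u = exp (\<theta> * u)" for m
    using True by (intro cut_exp_props(2)[OF assms]) (auto intro: add_increasing2)
  then show ?thesis using True by simp
next
  case False
  have "\<forall>\<^sub>F m in sequentially. 2 * step m < u - a"
    by (rule order_tendstoD(2)[OF delta_tendsto_0]) (use False in simp)
  then have "\<forall>\<^sub>F m in sequentially. cut_exp \<theta> a (step m) u = 0"
    by eventually_elim (rule cut_exp_props(3)[OF assms]; linarith?; simp)
  then show ?thesis using False by (simp add: tendsto_eventually)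
qed

lemma ramp_tendsto: "(\<lambda>m. ramp a (step m) u) \<longlonglongrightarrow> of_bool (a < u)"
proof (cases "u \<le> a")
  case True
  have "ramp a (step m) u = 0" for m
    using True by (intro ramp_props(2)) (auto intro: add_increasing2)
  then show ?thesis using True by simp
next
  case False
  have "\<forall>\<^sub>F m in sequentially. 2 * step m < u - a"
    by (rule order_tendstoD(2)[OF delta_tendsto_0]) (use False in simp)
  then have "\<forall>\<^sub>F m in sequentially. ramp a (step m) u = 1"
    by eventually_elim (rule ramp_props(3); linarith?; simp)
  then show ?thesis using False by (simp add: tendsto_eventually)
qed

lemma exit_value_tendsto:
  assumes "\<And>u. (\<lambda>m. F m u) \<longlonglongrightarrow> f u"
  shows "(\<lambda>m. exit_value (F m) \<omega>) \<longlonglongrightarrow> exit_value f \<omega>"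
  unfolding exit_value_def by (intro tendsto_mult tendsto_const assms)

text \<open>Exit functionals are first available for continuous functions; bounded pointwise limits
  supply measurability and convergence of means for the discontinuous ones needed below.\<close>

lemma exit_value_limit:
  fixes F :: "nat \<Rightarrow> real \<Rightarrow> real"
  assumes F: "\<And>m. continuous_on UNIV (F m)" "\<And>m u. \<bar>F m u\<bar> \<le> K"
    and lim: "\<And>u. (\<lambda>m. F m u) \<longlonglongrightarrow> f u"
  shows "exit_value f \<in> borel_measurable P" "integrable P (exit_value f)"
    "(\<lambda>m. LINT \<omega>|P. exit_value (F m) \<omega>) \<longlonglongrightarrow> (LINT \<omega>|P. exit_value f \<omega>)"
proof -
  show meas: "exit_value f \<in> borel_measurable P"
  proof (rule borel_measurable_LIMSEQ_real)
    show "(\<lambda>m. exit_value (F m) \<omega>) \<longlonglongrightarrow> exit_value f \<omega>" for \<omega> by (rule exit_value_tendsto[OF lim])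
    show "exit_value (F m) \<in> borel_measurable P" for m by (rule exit_value_measurable[OF F(1)])
  qed
  have fK: "\<bar>f u\<bar> \<le> K" for u
    by (rule LIMSEQ_le_const2[OF tendsto_rabs[OF lim]]) (use F(2) in blast)
  show "integrable P (exit_value f)"
    by (rule X.integrable_const_bound[where B = K, OF _ meas])
       (rule AE_I2, simp add: exit_value_bounded[OF fK])
  show "(\<lambda>m. LINT \<omega>|P. exit_value (F m) \<omega>) \<longlonglongrightarrow> (LINT \<omega>|P. exit_value f \<omega>)"
  proof (rule integral_dominated_convergence[where w = "\<lambda>_. K", OF meas])
    show "exit_value (F m) \<in> borel_measurable P" for m by (rule exit_value_measurable[OF F(1)])
    show "AE \<omega> in P. (\<lambda>m. exit_value (F m) \<omega>) \<longlonglongrightarrow> exit_value f \<omega>"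
      by (rule AE_I2, rule exit_value_tendsto[OF lim])
    show "AE \<omega> in P. norm (exit_value (F m) \<omega>) \<le> K" for m
      by (rule AE_I2) (simp add: exit_value_bounded[OF F(2)])
  qed simp
qed

lemma occ_limit:
  fixes F :: "nat \<Rightarrow> real \<Rightarrow> real"
  assumes F: "\<And>m. continuous_on UNIV (F m)" "\<And>m u. \<bar>F m u\<bar> \<le> K"
    and lim: "\<And>u. (\<lambda>m. F m u) \<longlonglongrightarrow> f u"
  shows "(\<lambda>m. LINT \<omega>|P. occ_value (\<lambda>y. F m (p * y)) \<omega>) \<longlonglongrightarrow> (LINT y|occ_meas. f (p * y))"
proof -
  interpret L: finite_measure occ_meas by (rule finite_occ_meas)
  have F_meas [measurable]: "F m \<in> borel_measurable borel" for m by (rule borel_measurable_continuous_onI[OF F(1)])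
  have f_meas [measurable]: "f \<in> borel_measurable borel"
    by (rule borel_measurable_LIMSEQ_real[OF lim F_meas])
  have "(\<lambda>m. LINT y|occ_meas. F m (p * y)) \<longlonglongrightarrow> (LINT y|occ_meas. f (p * y))"
    by (rule integral_dominated_convergence[where w = "\<lambda>_. K"]) (auto simp: F(2) lim)
  moreover have "(LINT \<omega>|P. occ_value (\<lambda>y. F m (p * y)) \<omega>) = (LINT y|occ_meas. F m (p * y))" for m
    by (rule occ_value_eq[where C = K]) (auto simp: F(2))
  ultimately show ?thesis by simp
qed

text \<open>In the limit of the cut exponentials Dynkin's formula holds for
  \<open>exp (\<theta> * u)\<close> restricted to \<open>u \<le> a\<close>. At the crossing time the
  process is at or above \<open>a\<close>, so this function sees only passages exactly at
  \<open>a\<close>.\<close>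

theorem creep_identity:
  assumes \<theta>: "0 < \<theta>"
  shows "creep * exp (\<theta> * a) = exp (\<theta> * x) + (X.\<psi> \<theta> - lam - q) * (LINT y|occ_meas. exp (\<theta> * y)) +
    lam * (LINT y|occ_meas. of_bool (p * y \<le> a) * exp (\<theta> * (p * y)))"
proof -
  define F where "F m = cut_exp \<theta> a (step m)" for m
  define f where "f u = of_bool (u \<le> a) * exp (\<theta> * u)" for u
  define K where "K = exp (\<theta> * (a + 2))"
  have step: "0 < step m" "step m \<le> 1" for m by auto
  have F: "continuous_on UNIV (F m)" "\<bar>F m u\<bar> \<le> K" "u \<le> a + step m \<Longrightarrow> F m u = 1 * exp (\<theta> * u)" for m u
  proof -
    show "continuous_on UNIV (F m)" unfolding F_def by (rule cut_exp_props(1)[OF \<theta> step(1)])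
    have "\<bar>F m u\<bar> \<le> exp (\<theta> * (a + 2 * step m))" unfolding F_def by (rule cut_exp_props(4)[OF \<theta> step(1)])
    also have "\<dots> \<le> K"
      unfolding K_def exp_le_cancel_iff using step_le[of m] \<theta> by (intro mult_left_mono) auto
    finally show "\<bar>F m u\<bar> \<le> K" .
    show "F m u = 1 * exp (\<theta> * u)" if "u \<le> a + step m"
      using cut_exp_props(2)[OF \<theta> step(1) that] by (simp add: F_def)
  qed
  have lim: "(\<lambda>m. F m u) \<longlonglongrightarrow> f u" for u unfolding F_def f_def by (rule cut_exp_tendsto[OF \<theta>])
  have "(LINT \<omega>|P. exit_value (F m) \<omega>) = F m x +
      1 * (X.\<psi> \<theta> - lam - q) * (LINT \<omega>|P. occ_value (\<lambda>y. exp (\<theta> * y)) \<omega>) + lam * (LINT \<omega>|P. occ_value (\<lambda>y. F m (p * y)) \<omega>)" for m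
  proof -
    obtain B where B: "\<forall>u v. \<bar>F m u - F m v\<bar> \<le> B * \<bar>u - v\<bar>"
      using cut_exp_props(5)[OF \<theta> step(1)] unfolding F_def by blast
    show ?thesis
      by (rule dynkin_formula[OF less_imp_le[OF \<theta>] step(1)[of m] F(1) F(2) B[rule_format]]) (rule F(3))
  qed
  moreover have "(LINT \<omega>|P. occ_value (\<lambda>y. exp (\<theta> * y)) \<omega>) = (LINT y|occ_meas. exp (\<theta> * y))"
    by (rule occ_value_eq[where C = "exp (\<theta> * a)"]) (use \<theta> in auto)
  ultimately have eq: "(LINT \<omega>|P. exit_value (F m) \<omega>) = F m x +
      (X.\<psi> \<theta> - lam - q) * (LINT y|occ_meas. exp (\<theta> * y)) + lam * (LINT \<omega>|P. occ_value (\<lambda>y. F m (p * y)) \<omega>)" for m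
    by simp
  have "(\<lambda>m. LINT \<omega>|P. exit_value (F m) \<omega>) \<longlonglongrightarrow> f x +
      (X.\<psi> \<theta> - lam - q) * (LINT y|occ_meas. exp (\<theta> * y)) + lam * (LINT y|occ_meas. f (p * y))"
    unfolding eq by (intro tendsto_add tendsto_mult tendsto_const lim occ_limit[OF F(1,2) lim])
  with exit_value_limit(3)[OF F(1,2) lim]
  have "(LINT \<omega>|P. exit_value f \<omega>) = f x +
      (X.\<psi> \<theta> - lam - q) * (LINT y|occ_meas. exp (\<theta> * y)) + lam * (LINT y|occ_meas. f (p * y))"
    by (rule LIMSEQ_unique)
  moreover have "(LINT \<omega>|P. exit_value f \<omega>) = (LINT \<omega>|P. exit_value (\<lambda>u. of_bool (u = a)) \<omega> * exp (\<theta> * a))"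
  proof (rule Bochner_Integration.integral_cong[OF refl])
    fix \<omega> assume "\<omega> \<in> space P"
    then show "exit_value f \<omega> = exit_value (\<lambda>u. of_bool (u = a)) \<omega> * exp (\<theta> * a)"
      using exit_value_ge[of \<omega>] by (auto simp: exit_value_def f_def)
  qed
  moreover have "f x = exp (\<theta> * x)" using x_le_a by (simp add: f_def)
  ultimately show ?thesis by (simp add: creep_def f_def)
qed

text \<open>For the ramp, which vanishes just above \<open>a\<close>, Dynkin's formula loses its
  initial and exponential terms and leaves only resets beyond \<open>a\<close>. Every passage ends
  either at \<open>a\<close> or strictly above it, and the ramps converge to the indicator of the
  latter.\<close>

theorem exit_transform:
  shows "exit_value (\<lambda>_. 1) \<in> borel_measurable P"
    "(LINT \<omega>|P. exit_value (\<lambda>_. 1) \<omega>) = creep + lam * (LINT y|occ_meas. of_bool (a < p * y))"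
proof -
  define F where "F m = ramp a (step m)" for m
  define f where "f u = (of_bool (a < u) :: real)" for u
  have step: "0 < step m" for m by auto
  have F: "continuous_on UNIV (F m)" "\<bar>F m u\<bar> \<le> 1" "u \<le> a + step m \<Longrightarrow> F m u = 0 * exp (0 * u)" for m u
    unfolding F_def using ramp_props(1,2,4)[OF step] by auto
  have lim: "(\<lambda>m. F m u) \<longlonglongrightarrow> f u" for u unfolding F_def f_def by (rule ramp_tendsto)
  have eq: "(LINT \<omega>|P. exit_value (F m) \<omega>) = lam * (LINT \<omega>|P. occ_value (\<lambda>y. F m (p * y)) \<omega>)" for m
  proof -
    \<comment> \<open>Here \<open>\<alpha> = 0\<close>; the choice \<open>\<theta> = 0\<close> is a
      placeholder.\<close>
    have "(LINT \<omega>|P. exit_value (F m) \<omega>) = F m x +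
      0 * (X.\<psi> 0 - lam - q) * (LINT \<omega>|P. occ_value (\<lambda>y. exp (0 * y)) \<omega>) + lam * (LINT \<omega>|P. occ_value (\<lambda>y. F m (p * y)) \<omega>)"
      by (rule dynkin_formula[OF order_refl step[of m] F(1) F(2)], unfold F_def, rule ramp_props(5)[OF step])
         (rule F(3)[unfolded F_def])
    moreover have "x \<le> a + step m" using x_le_a by (rule add_increasing2[rotated]) simp
    then have "F m x = 0" using F(3) by simp
    ultimately show ?thesis by simp
  qed
  have "(\<lambda>m. LINT \<omega>|P. exit_value (F m) \<omega>) \<longlonglongrightarrow> lam * (LINT y|occ_meas. f (p * y))"
    unfolding eq by (intro tendsto_mult tendsto_const occ_limit[OF F(1,2) lim])
  with exit_value_limit(3)[OF F(1,2) lim]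
  have jump: "(LINT \<omega>|P. exit_value f \<omega>) = lam * (LINT y|occ_meas. f (p * y))"
    by (rule LIMSEQ_unique)
  have int_f: "integrable P (exit_value f)" by (rule exit_value_limit(2)[OF F(1,2) lim])
  \<comment> \<open>The indicator of \<open>u = a\<close> is reached through the cut exponentials
    with \<open>\<theta> = 1\<close>: at the crossing time their limit is \<open>exp a\<close> if
    the value is \<open>a\<close> and 0 otherwise.\<close>
  define G where "G m u = cut_exp 1 a (step m) u" for m u
  define g where "g u = of_bool (u \<le> a) * exp (1 * u)" for u
  have G: "continuous_on UNIV (G m)" "\<bar>G m u\<bar> \<le> exp (1 * (a + 2))" for m u
  proof -
    show "continuous_on UNIV (G m)" unfolding G_def[abs_def] by (rule cut_exp_props(1)[OF _ step]) simp
    have "\<bar>G m u\<bar> \<le> exp (1 * (a + 2 * step m))" unfolding G_def by (rule cut_exp_props(4)[OF _ step]) simp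
    also have "\<dots> \<le> exp (1 * (a + 2))"
      unfolding exp_le_cancel_iff using step_le[of m] by (intro mult_left_mono) auto
    finally show "\<bar>G m u\<bar> \<le> exp (1 * (a + 2))" .
  qed
  have "(\<lambda>m. G m u) \<longlonglongrightarrow> g u" for u unfolding G_def g_def by (rule cut_exp_tendsto) simp
  then have int_g: "integrable P (exit_value g)" by (rule exit_value_limit(2)[OF G])
  have creep_eq: "exit_value (\<lambda>u. of_bool (u = a)) \<omega> = exit_value g \<omega> * exp (- a)" if "\<omega> \<in> space P" for \<omega>
    using exit_value_ge[OF that] by (auto simp: exit_value_def g_def exp_minus)
  have int_c: "integrable P (exit_value (\<lambda>u. of_bool (u = a)))"
    using integrable_mult_left[OF int_g, of "exp (- a)"] creep_eq
    by (simp cong: Bochner_Integration.integrable_cong)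
  have sum: "exit_value (\<lambda>_. 1) \<omega> = exit_value (\<lambda>u. of_bool (u = a)) \<omega> + exit_value f \<omega>" if "\<omega> \<in> space P" for \<omega>
    using exit_value_ge[OF that] by (auto simp: exit_value_def f_def)
  show "exit_value (\<lambda>_. 1) \<in> borel_measurable P" by (rule exit_value_measurable) simp
  have "(LINT \<omega>|P. exit_value (\<lambda>_. 1) \<omega>) = (LINT \<omega>|P. exit_value (\<lambda>u. of_bool (u = a)) \<omega> + exit_value f \<omega>)"
    by (rule Bochner_Integration.integral_cong[OF refl sum])
  also have "\<dots> = creep + (LINT \<omega>|P. exit_value f \<omega>)"
    unfolding creep_def by (rule Bochner_Integration.integral_add[OF int_c int_f])
  finally show "(LINT \<omega>|P. exit_value (\<lambda>_. 1) \<omega>) = creep + lam * (LINT y|occ_meas. of_bool (a < p * y))"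
    unfolding jump by (simp add: f_def)
qed

end

section \<open>Uniqueness of Laplace transforms\<close>

text \<open>The substitution \<open>z = exp (y - a)\<close> maps the half-line below
  \<open>a\<close> into the unit interval and turns the transforms at \<open>\<theta> + n\<close>
  into moments of \<open>z\<close> with the weight \<open>exp (\<theta> * y)\<close>. Weierstrass
  approximation extends equality from polynomials to \<open>\<phi>\<close>. The minima keep all
  functions bounded on the whole line and change nothing almost everywhere.\<close>

lemma laplace_weighted_integral_eq:
  fixes M N :: "real measure" and \<phi> :: "real \<Rightarrow> real"
  assumes M: "finite_measure M" "sets M = sets borel" "AE y in M. y \<le> a"
    and N: "finite_measure N" "sets N = sets borel" "AE y in N. y \<le> a"
    and \<theta>: "0 < \<theta>" and eq: "\<And>n::nat. (LINT y|M. exp ((\<theta> + real n) * y)) = (LINT y|N. exp ((\<theta> + real n) * y))"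
    and \<phi>: "continuous_on {0..1} \<phi>"
  shows "(LINT y|M. \<phi> (exp (min (y - a) 0)) * exp (\<theta> * min y a)) = (LINT y|N. \<phi> (exp (min (y - a) 0)) * exp (\<theta> * min y a))"
proof -
  define z where "z y = exp (min (y - a) 0)" for y
  define w where "w y = exp (\<theta> * min y a)" for y
  have z: "z y \<in> {0..1}" for y by (simp add: z_def)
  have zw [measurable]: "z \<in> borel_measurable borel" "w \<in> borel_measurable borel" unfolding z_def w_def by measurable
  have w: "0 \<le> w y" "w y \<le> exp (\<theta> * a)" for y using \<theta> by (auto simp: w_def)
  have \<phi>_meas: "(\<lambda>y. \<phi> (z y)) \<in> borel_measurable borel"
  proof -
    have "continuous_on UNIV z" unfolding z_def by (intro continuous_intros)
    then have "continuous_on UNIV (\<lambda>y. \<phi> (z y))"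
      by (rule continuous_on_compose2[OF \<phi>]) (use z in auto)
    then show ?thesis by (rule borel_measurable_continuous_onI)
  qed
  have "\<exists>B. \<forall>s\<in>{0..1}. \<bar>\<phi> s\<bar> \<le> B"
    using compact_imp_bounded[OF compact_continuous_image[OF \<phi>]] by (simp add: bounded_iff)
  then obtain B where "\<forall>s\<in>{0..1}. \<bar>\<phi> s\<bar> \<le> B" ..
  then have B: "\<bar>\<phi> s\<bar> \<le> B" if "s \<in> {0..1}" for s using that by blast
  have B0: "0 \<le> B" using B[of 0] by auto
  have int: "integrable Q (\<lambda>y. g (z y) * w y)"
    if "finite_measure Q" "sets Q = sets borel" "(\<lambda>y. g (z y)) \<in> borel_measurable borel" "\<And>s. s \<in> {0..1} \<Longrightarrow> \<bar>g s\<bar> \<le> C" for Q g C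
  proof -
    interpret Q: finite_measure Q by fact
    have "0 \<le> C" using that(4)[of 0] by auto
    have "\<bar>g (z y) * w y\<bar> \<le> C * exp (\<theta> * a)" for y
      unfolding abs_mult using that(4)[OF z[of y]] w[of y] \<open>0 \<le> C\<close> by (intro mult_mono) auto
    moreover have "(\<lambda>y. g (z y) * w y) \<in> borel_measurable Q"
      using that(2,3) zw(2) by (simp cong: measurable_cong_sets)
    ultimately show ?thesis by (intro Q.integrable_const_bound[where B = "C * exp (\<theta> * a)"]) auto
  qed
  have pow: "(LINT y|M. z y ^ n * w y) = (LINT y|N. z y ^ n * w y)" for n :: nat
  proof -
    \<comment> \<open>The shift by \<open>a\<close> in \<open>z\<close> costs the constant factor
      \<open>exp (- (real n * a))\<close>, the same for both measures.\<close>
    have *: "(LINT y|Q. z y ^ n * w y) = exp (- (real n * a)) * (LINT y|Q. exp ((\<theta> + real n) * y))"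
      if "sets Q = sets borel" "AE y in Q. y \<le> a" for Q
    proof -
      have "(LINT y|Q. z y ^ n * w y) = (LINT y|Q. exp (- (real n * a)) * exp ((\<theta> + real n) * y))"
      proof (rule integral_cong_AE)
        show "AE y in Q. z y ^ n * w y = exp (- (real n * a)) * exp ((\<theta> + real n) * y)"
          using that(2)
        proof eventually_elim
          case (elim y)
          then have "z y = exp (y - a)" "w y = exp (\<theta> * y)" by (auto simp: z_def w_def min_absorb1)
          then show ?case by (simp add: exp_of_nat_mult[symmetric] exp_add[symmetric] algebra_simps)
        qed
      qed (use that(1) in \<open>simp_all cong: measurable_cong_sets\<close>)
      then show ?thesis by simp
    qed
    show ?thesis using *[OF M(2,3)] *[OF N(2,3)] eq[of n] by simp
  qed
  have poly: "(LINT y|M. g (z y) * w y) = (LINT y|N. g (z y) * w y)" if g: "real_polynomial_function g" for g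
  proof -
    obtain c n where g_eq: "g = (\<lambda>s. \<Sum>i\<le>n. c i * s ^ i)" using g unfolding real_polynomial_function_iff_sum by auto
    have pint: "integrable Q (\<lambda>y. z y ^ i * w y)" if "finite_measure Q" "sets Q = sets borel" for Q i
    proof (rule int[OF that, where g = "\<lambda>s. s ^ i" and C = 1])
      show "\<bar>s ^ i\<bar> \<le> 1" if "s \<in> {0..1}" for s :: real using that by (simp add: power_le_one)
    qed measurable
    have "(LINT y|Q. g (z y) * w y) = (\<Sum>i\<le>n. c i * (LINT y|Q. z y ^ i * w y))"
      if "finite_measure Q" "sets Q = sets borel" for Q
    proof -
      have "(LINT y|Q. g (z y) * w y) = (LINT y|Q. (\<Sum>i\<le>n. c i * (z y ^ i * w y)))"
        unfolding g_eq sum_distrib_right by (simp only: mult.assoc)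
      also have "\<dots> = (\<Sum>i\<le>n. LINT y|Q. c i * (z y ^ i * w y))"
        by (rule Bochner_Integration.integral_sum) (intro integrable_mult_right pint that)
      finally show ?thesis by simp
    qed
    then show ?thesis using M N pow by simp
  qed
  have "\<bar>(LINT y|M. \<phi> (z y) * w y) - (LINT y|N. \<phi> (z y) * w y)\<bar> \<le> e * (exp (\<theta> * a) * (measure M (space M) + measure N (space N)))"
    if e: "0 < e" for e
  proof -
    obtain g where g: "real_polynomial_function g" "\<And>s. s \<in> {0..1} \<Longrightarrow> \<bar>\<phi> s - g s\<bar> < e"
      using Stone_Weierstrass_real_polynomial_function[OF _ \<phi> e] by auto
    have g_cont: "continuous_on UNIV g"
      using continuous_real_polymonial_function[OF g(1)] by (auto simp: continuous_on_eq_continuous_within)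
    then have gz: "(\<lambda>y. g (z y)) \<in> borel_measurable borel"
      by (intro measurable_compose[OF zw(1)] borel_measurable_continuous_onI)
    have gB: "\<bar>g s\<bar> \<le> B + e" if "s \<in> {0..1}" for s using g(2)[OF that] B[OF that] by linarith
    have close: "\<bar>(LINT y|Q. \<phi> (z y) * w y) - (LINT y|Q. g (z y) * w y)\<bar> \<le> e * (exp (\<theta> * a) * measure Q (space Q))"
      if Q: "finite_measure Q" "sets Q = sets borel" for Q
    proof -
      interpret Q: finite_measure Q by fact
      have i1: "integrable Q (\<lambda>y. \<phi> (z y) * w y)" by (rule int[OF Q \<phi>_meas B])
      have i2: "integrable Q (\<lambda>y. g (z y) * w y)" by (rule int[OF Q gz gB])
      have "\<bar>(LINT y|Q. \<phi> (z y) * w y) - (LINT y|Q. g (z y) * w y)\<bar> = \<bar>LINT y|Q. \<phi> (z y) * w y - g (z y) * w y\<bar>"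
        using i1 i2 by simp
      also have "\<dots> \<le> (LINT y|Q. \<bar>\<phi> (z y) * w y - g (z y) * w y\<bar>)" by (rule integral_abs_bound)
      also have "\<dots> \<le> (LINT y|Q. e * exp (\<theta> * a))"
      proof (rule integral_mono)
        show "integrable Q (\<lambda>y. \<bar>\<phi> (z y) * w y - g (z y) * w y\<bar>)" using i1 i2 by auto
        fix y
        have "\<bar>\<phi> (z y) * w y - g (z y) * w y\<bar> = \<bar>\<phi> (z y) - g (z y)\<bar> * w y"
          using w(1)[of y] by (simp add: left_diff_distrib[symmetric] abs_mult)
        also have "\<dots> \<le> e * exp (\<theta> * a)" using g(2)[OF z[of y]] w[of y] e by (intro mult_mono) auto
        finally show "\<bar>\<phi> (z y) * w y - g (z y) * w y\<bar> \<le> e * exp (\<theta> * a)" .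
      qed simp
      also have "\<dots> = e * (exp (\<theta> * a) * measure Q (space Q))" by simp
      finally show ?thesis .
    qed
    show ?thesis using close[OF M(1,2)] close[OF N(1,2)] poly[OF g(1)] by (simp add: distrib_left)
  qed
  then have le: "\<bar>(LINT y|M. \<phi> (z y) * w y) - (LINT y|N. \<phi> (z y) * w y)\<bar> \<le> e * D"
    if "0 < e" "D = exp (\<theta> * a) * (measure M (space M) + measure N (space N)) + 1" for e D
    using that by (smt (verit, ccfv_SIG) mult_left_mono)
  define D where "D = exp (\<theta> * a) * (measure M (space M) + measure N (space N)) + 1"
  have D: "0 < D" unfolding D_def by (intro add_nonneg_pos mult_nonneg_nonneg) auto
  have "\<bar>(LINT y|M. \<phi> (z y) * w y) - (LINT y|N. \<phi> (z y) * w y)\<bar> \<le> 0"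
  proof (rule field_le_epsilon)
    fix e :: real assume "0 < e"
    then show "\<bar>(LINT y|M. \<phi> (z y) * w y) - (LINT y|N. \<phi> (z y) * w y)\<bar> \<le> 0 + e"
      using le[of "e / D" D] D by (simp add: D_def)
  qed
  then show ?thesis unfolding z_def w_def by simp
qed

text \<open>Half-lines \<open>{t<..}\<close> determine a finite measure, and their indicators are
  bounded limits of functions covered by \<open>laplace_weighted_integral_eq\<close>.\<close>

lemma laplace_transform_unique:
  fixes M N :: "real measure"
  assumes M: "finite_measure M" "sets M = sets borel" "AE y in M. y \<le> a"
    and N: "finite_measure N" "sets N = sets borel" "AE y in N. y \<le> a"
    and eq: "\<And>\<theta>. \<theta>0 < \<theta> \<Longrightarrow> (\<integral>\<^sup>+y. ennreal (exp (\<theta> * y)) \<partial>M) = (\<integral>\<^sup>+y. ennreal (exp (\<theta> * y)) \<partial>N)"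
  shows "M = N"
proof (rule measure_eqI_lessThan)
  interpret M: finite_measure M by fact
  interpret N: finite_measure N by fact
  show "sets M = sets borel" "sets N = sets borel" by fact+
  fix t :: real
  show "emeasure M {t<..} < \<infinity>" by (simp add: less_top[symmetric])
  define \<theta> where "\<theta> = max \<theta>0 0 + 1"
  have \<theta>: "0 < \<theta>" "\<theta>0 < \<theta>" by (auto simp: \<theta>_def)
  have eq': "(LINT y|M. exp ((\<theta> + real n) * y)) = (LINT y|N. exp ((\<theta> + real n) * y))" for n :: nat
  proof -
    have "(LINT y|Q. exp ((\<theta> + real n) * y)) = enn2real (\<integral>\<^sup>+y. ennreal (exp ((\<theta> + real n) * y)) \<partial>Q)"
      if "sets Q = sets borel" for Q :: "real measure"
      using that by (intro integral_eq_nn_integral) (simp_all cong: measurable_cong_sets)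
    then show ?thesis using M(2) N(2) eq[of "\<theta> + real n"] \<theta>(2) by simp
  qed
  define c where "c = exp (t - a)"
  have c: "0 < c" by (simp add: c_def)
  \<comment> \<open>The first factor rises to the indicator of \<open>s > c\<close>, that is of
    \<open>y > t\<close>. The second cancels the weight, since \<open>a + ln s\<close> is
    \<open>y\<close>; the maximum with \<open>c\<close> avoids the logarithm near 0, where the first
    factor vanishes anyway.\<close>
  define \<phi> where "\<phi> k s = max 0 (min 1 (real k * (s - c))) * exp (- \<theta> * (a + ln (max s c)))" for k :: nat and s
  have \<phi>: "continuous_on {0..1} (\<phi> k)" for k
    unfolding \<phi>_def using c by (intro continuous_intros) (auto simp: max_def)
  define F where "F k y = \<phi> k (exp (min (y - a) 0)) * exp (\<theta> * min y a)" for k y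
  have F_eq: "(LINT y|M. F k y) = (LINT y|N. F k y)" for k
    unfolding F_def by (rule laplace_weighted_integral_eq[OF M N \<theta>(1) eq' \<phi>])
  have lim: "(\<lambda>k. LINT y|Q. F k y) \<longlonglongrightarrow> measure Q {t<..}"
    if Q: "finite_measure Q" "sets Q = sets borel" "AE y in Q. y \<le> a" for Q
  proof -
    interpret Q: finite_measure Q by fact
    have "(\<lambda>k. LINT y|Q. F k y) \<longlonglongrightarrow> (LINT y|Q. indicator {t<..} y)"
    proof (rule integral_dominated_convergence[where w = "\<lambda>_. 1"])
      have "F k \<in> borel_measurable borel" for k unfolding F_def \<phi>_def by measurable
      then show "F k \<in> borel_measurable Q" for k using Q(2) by (simp cong: measurable_cong_sets)
      show "(\<lambda>y. indicator {t<..} y :: real) \<in> borel_measurable Q" using Q(2) by (simp cong: measurable_cong_sets)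
      have F_a: "F k y = max 0 (min 1 (real k * (exp (y - a) - c))) * exp (\<theta> * (y - (a + ln (max (exp (y - a)) c))))"
        if "y \<le> a" for k y
        using that by (simp add: F_def \<phi>_def min_absorb1 exp_add[symmetric] algebra_simps)
      show "AE y in Q. norm (F k y) \<le> 1" for k
        using Q(3)
      proof eventually_elim
        case (elim y)
        have "y - a = ln (exp (y - a))" by simp
        also have "\<dots> \<le> ln (max (exp (y - a)) c)" using c by (subst ln_le_cancel_iff) auto
        finally have "exp (\<theta> * (y - (a + ln (max (exp (y - a)) c)))) \<le> 1" using \<theta>(1) by (simp add: mult_nonneg_nonpos)
        then have "max 0 (min 1 (real k * (exp (y - a) - c))) * exp (\<theta> * (y - (a + ln (max (exp (y - a)) c)))) \<le> 1 * 1"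
          by (intro mult_mono) auto
        then show ?case unfolding F_a[OF elim] by (simp add: abs_mult)
      qed
      show "AE y in Q. (\<lambda>k. F k y) \<longlonglongrightarrow> indicator {t<..} y"
        using Q(3)
      proof eventually_elim
        case (elim y)
        show ?case
        proof (cases "t < y")
          case True
          then have gt: "c < exp (y - a)" by (simp add: c_def)
          have "\<exists>K. 1 / (exp (y - a) - c) < real K" by (rule reals_Archimedean2)
          then obtain K where K: "1 / (exp (y - a) - c) < real K" ..
          have "F k y = 1" if "K \<le> k" for k
          proof -
            have "1 / (exp (y - a) - c) < real k" using K that by linarith
            then have "1 \<le> real k * (exp (y - a) - c)" using gt by (simp add: field_simps)
            then have "max 0 (min 1 (real k * (exp (y - a) - c))) = 1" by simp
            moreover have "max (exp (y - a)) c = exp (y - a)" using gt by simp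
            ultimately show ?thesis unfolding F_a[OF elim] by (simp only: ln_exp) simp
          qed
          then have "\<forall>\<^sub>F k in sequentially. F k y = 1" unfolding eventually_sequentially by blast
          then show ?thesis using True by (simp add: tendsto_eventually)
        next
          case False
          then have "exp (y - a) \<le> c" by (simp add: c_def)
          then have "real k * (exp (y - a) - c) \<le> 0" for k by (simp add: mult_nonneg_nonpos)
          then have "F k y = 0" for k unfolding F_a[OF elim] by (simp add: max_absorb1 min.coboundedI2)
          then show ?thesis using False by simp
        qed
      qed
    qed simp
    moreover have "{t<..} \<in> sets Q" "space Q = UNIV" using Q(2) sets_eq_imp_space_eq[OF Q(2)] by auto
    ultimately show ?thesis by simp
  qed
  have "measure M {t<..} = measure N {t<..}"
    using LIMSEQ_unique[OF lim[OF M] lim[OF N, folded F_eq]] .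
  then show "emeasure M {t<..} = emeasure N {t<..}"
    by (simp add: M.emeasure_eq_measure N.emeasure_eq_measure)
qed

section \<open>The resolvent series\<close>

text \<open>The series argument abstracted from the process: a kernel of mass at most
  \<open>m\<close> on starting points below \<open>a\<close>, a finite measure solving the renewal
  equation, and \<open>lam * m < 1\<close> for convergence.\<close>

locale resolvent_kernel =
  fixes r :: "real \<Rightarrow> real \<Rightarrow> real" and p a lam m :: real and x :: real and L :: "real measure"
  assumes r_measurable: "case_prod r \<in> borel_measurable (borel \<Otimes>\<^sub>M borel)"
    and r_nonneg: "\<And>z. z \<le> a \<Longrightarrow> AE y in lborel. 0 \<le> r z y"
    and r_mass: "\<And>z. z \<le> a \<Longrightarrow> (\<integral>\<^sup>+y. ennreal (r z y) \<partial>lborel) \<le> ennreal m"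
    and p: "0 < p" and x: "x \<le> a" and lam: "0 \<le> lam" and m: "0 \<le> m" "lam * m < 1"
    and L_finite: "finite_measure L" and L_sets: "sets L = sets borel" and L_le: "AE y in L. y \<le> a"
    and L_eq: "\<And>g. g \<in> borel_measurable borel \<Longrightarrow> (\<integral>\<^sup>+y. g y \<partial>L) = (\<integral>\<^sup>+y. ennreal (r x y) * g y \<partial>lborel) +
      ennreal lam * (\<integral>\<^sup>+z. of_bool (p * z \<le> a) * (\<integral>\<^sup>+y. ennreal (r (p * z) y) * g y \<partial>lborel) \<partial>L)"
begin

definition kernel :: "(real \<Rightarrow> ennreal) \<Rightarrow> real \<Rightarrow> ennreal" where
  "kernel g z = (\<integral>\<^sup>+y. ennreal (r z y) * g y \<partial>lborel)"

definition inside :: "real \<Rightarrow> ennreal" where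
  "inside z = of_bool (z \<le> min a (a / p))"

definition reset_kernel :: "(real \<Rightarrow> ennreal) \<Rightarrow> real \<Rightarrow> ennreal" where
  "reset_kernel g z = inside z * kernel g (p * z)"

text \<open>The kernel \<open>r\<close> is nonnegative only almost everywhere, so the Lebesgue integrals defining \<open>V_iter\<close> can have
  junk values; these nonnegative integrals always make sense and agree with \<open>V_iter\<close> almost everywhere.\<close>

fun iterate :: "nat \<Rightarrow> real \<Rightarrow> real \<Rightarrow> ennreal" where
  "iterate 0 z y = ennreal (r z y)"
| "iterate (Suc k) z y = (\<integral>\<^sup>+w. ennreal (r z w) * (inside w * iterate k (p * w) y) \<partial>lborel)"

lemma inside_iff: "z \<le> min a (a / p) \<longleftrightarrow> z \<le> a \<and> p * z \<le> a"
  using p by (auto simp: field_simps)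

lemma r_pair [measurable]: "(\<lambda>z. r (fst z) (snd z)) \<in> borel_measurable (borel \<Otimes>\<^sub>M borel)"
  using r_measurable by (simp add: case_prod_beta')

lemma r_compose [measurable (raw)]:
  assumes "f \<in> borel_measurable Q" "g \<in> borel_measurable Q"
  shows "(\<lambda>w. r (f w) (g w)) \<in> borel_measurable Q"
  using measurable_compose[OF measurable_Pair[OF assms] r_pair] by simp

lemma inside_measurable [measurable]: "inside \<in> borel_measurable borel"
  unfolding inside_def by measurable

lemma kernel_measurable [measurable]:
  assumes [measurable]: "g \<in> borel_measurable borel"
  shows "kernel g \<in> borel_measurable borel"
  unfolding kernel_def by measurable

lemma reset_kernel_measurable [measurable]:
  assumes [measurable]: "g \<in> borel_measurable borel"
  shows "reset_kernel g \<in> borel_measurable borel"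
proof -
  have [measurable]: "kernel g \<in> borel_measurable borel" by (rule kernel_measurable) fact
  show ?thesis unfolding reset_kernel_def by measurable
qed

lemma reset_kernel_pow_measurable: "g \<in> borel_measurable borel \<Longrightarrow> (reset_kernel ^^ k) g \<in> borel_measurable borel"
  by (induction k) (auto intro: reset_kernel_measurable)

lemma iterate_pair: "(\<lambda>z. iterate k (fst z) (snd z)) \<in> borel_measurable (borel \<Otimes>\<^sub>M borel)"
proof (induction k)
  case 0
  show ?case by simp
next
  case (Suc k)
  have [measurable]: "(\<lambda>w. iterate k (f w) (g w)) \<in> borel_measurable Q"
    if "f \<in> borel_measurable Q" "g \<in> borel_measurable Q" for f g and Q :: "'b measure"
    using measurable_compose[OF measurable_Pair[OF that] Suc.IH] by simp
  have "(\<lambda>t. ennreal (r (fst (fst t)) (snd t)) * (inside (snd t) * iterate k (p * snd t) (snd (fst t))))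
    \<in> borel_measurable ((borel \<Otimes>\<^sub>M borel) \<Otimes>\<^sub>M lborel)"
    by measurable
  then show ?case
    using lborel.borel_measurable_nn_integral[of "\<lambda>z w. ennreal (r (fst z) w) * (inside w * iterate k (p * w) (snd z))" "borel \<Otimes>\<^sub>M borel"]
    by (simp add: case_prod_beta')
qed

lemma iterate_compose [measurable (raw)]:
  assumes "f \<in> borel_measurable Q" "g \<in> borel_measurable Q"
  shows "(\<lambda>w. iterate k (f w) (g w)) \<in> borel_measurable Q"
  using measurable_compose[OF measurable_Pair[OF assms] iterate_pair] by simp

text \<open>The recursion of \<open>iterate\<close> peels off the first kernel; Tonelli moves the
  integral over \<open>y\<close> inside, where the remaining kernels act on \<open>g\<close> as
  powers of \<open>reset_kernel\<close>.\<close>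

lemma nn_integral_iterate:
  assumes g [measurable]: "g \<in> borel_measurable borel"
  shows "(\<integral>\<^sup>+y. iterate k z y * g y \<partial>lborel) = kernel ((reset_kernel ^^ k) g) z"
proof (induction k arbitrary: z)
  case 0
  show ?case by (simp add: kernel_def)
next
  case (Suc k)
  have "(\<integral>\<^sup>+y. iterate (Suc k) z y * g y \<partial>lborel) =
    (\<integral>\<^sup>+y. \<integral>\<^sup>+w. ennreal (r z w) * (inside w * iterate k (p * w) y) * g y \<partial>lborel \<partial>lborel)"
    by (simp add: nn_integral_multc)
  also have "\<dots> = (\<integral>\<^sup>+w. \<integral>\<^sup>+y. ennreal (r z w) * (inside w * iterate k (p * w) y) * g y \<partial>lborel \<partial>lborel)"
    by (rule lborel_pair.Fubini') measurable
  also have "\<dots> = (\<integral>\<^sup>+w. ennreal (r z w) * (inside w * (\<integral>\<^sup>+y. iterate k (p * w) y * g y \<partial>lborel)) \<partial>lborel)"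
    by (intro nn_integral_cong) (simp add: mult.assoc nn_integral_cmult)
  also have "\<dots> = kernel ((reset_kernel ^^ Suc k) g) z"
    unfolding Suc.IH by (simp add: kernel_def reset_kernel_def)
  finally show ?case .
qed

lemma reset_kernel_pow_bound:
  assumes g: "g \<in> borel_measurable borel" and b: "\<And>y. g y \<le> ennreal b" and b0: "0 \<le> b"
  shows "(reset_kernel ^^ k) g z \<le> ennreal (b * m ^ k)"
proof (induction k arbitrary: z)
  case 0
  then show ?case using b by simp
next
  case (Suc k)
  have "(reset_kernel ^^ Suc k) g z = inside z * kernel ((reset_kernel ^^ k) g) (p * z)" by (simp add: reset_kernel_def)
  also have "\<dots> \<le> ennreal (b * m ^ Suc k)"
  proof (cases "z \<le> min a (a / p)")
    case True
    then have pz: "p * z \<le> a" using inside_iff by simp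
    have "kernel ((reset_kernel ^^ k) g) (p * z) \<le> (\<integral>\<^sup>+y. ennreal (r (p * z) y) * ennreal (b * m ^ k) \<partial>lborel)"
      unfolding kernel_def by (intro nn_integral_mono mult_left_mono Suc.IH) auto
    also have "\<dots> = (\<integral>\<^sup>+y. ennreal (r (p * z) y) \<partial>lborel) * ennreal (b * m ^ k)"
      by (rule nn_integral_multc) measurable
    also have "\<dots> \<le> ennreal m * ennreal (b * m ^ k)" by (intro mult_right_mono r_mass[OF pz]) auto
    also have "\<dots> = ennreal (b * m ^ Suc k)" using m(1) b0 by (simp add: ennreal_mult[symmetric] mult_ac)
    finally show ?thesis using True by (simp add: inside_def)
  next
    case False
    then have "inside z = 0" unfolding inside_def of_bool_def by (rule if_not_P)
    then show ?thesis by simp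
  qed
  finally show ?case .
qed

text \<open>The equation for \<open>L\<close> is applied to the remainder again and again; the
  remainder is kept explicitly so that no subtraction in \<open>ennreal\<close> occurs.\<close>

lemma L_expansion:
  assumes g: "g \<in> borel_measurable borel"
  shows "(\<integral>\<^sup>+y. g y \<partial>L) = (\<Sum>k<n. ennreal lam ^ k * kernel ((reset_kernel ^^ k) g) x) + ennreal lam ^ n * (\<integral>\<^sup>+y. (reset_kernel ^^ n) g y \<partial>L)"
proof (induction n)
  case 0
  show ?case by simp
next
  case (Suc n)
  have L_step: "(\<integral>\<^sup>+y. h y \<partial>L) = kernel h x + ennreal lam * (\<integral>\<^sup>+z. reset_kernel h z \<partial>L)" if "h \<in> borel_measurable borel" for h
  proof -
    \<comment> \<open>As \<open>L\<close> lives below \<open>a\<close>, the condition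
      \<open>p * z \<le> a\<close> is the same as \<open>inside z\<close>, the integration range of
      \<open>V_iter\<close>.\<close>
    have "(\<integral>\<^sup>+z. of_bool (p * z \<le> a) * kernel h (p * z) \<partial>L) = (\<integral>\<^sup>+z. reset_kernel h z \<partial>L)"
    proof (rule nn_integral_cong_AE)
      show "AE z in L. of_bool (p * z \<le> a) * kernel h (p * z) = reset_kernel h z"
        using L_le
      proof eventually_elim
        case (elim z)
        then show ?case unfolding reset_kernel_def inside_def inside_iff by simp
      qed
    qed
    then show ?thesis using L_eq[OF that] by (simp add: kernel_def)
  qed
  show ?case
    unfolding Suc.IH L_step[OF reset_kernel_pow_measurable[OF g, of n]]
    by (simp add: distrib_left mult.assoc mult.left_commute[of "ennreal lam"] add.assoc)
qed

text \<open>Each application of \<open>reset_kernel\<close> costs at most the factor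
  \<open>m\<close>, so the remainder is at most the bound of \<open>g\<close> times the mass of
  \<open>L\<close> times \<open>(lam * m) ^ n\<close>.\<close>

lemma L_series:
  assumes g: "g \<in> borel_measurable borel" and b: "\<And>y. g y \<le> ennreal b" and b0: "0 \<le> b"
  shows "(\<integral>\<^sup>+y. g y \<partial>L) = (\<Sum>k. ennreal lam ^ k * kernel ((reset_kernel ^^ k) g) x)"
proof -
  interpret L: finite_measure L by (rule L_finite)
  define M where "M = b * measure L (space L)"
  have M0: "0 \<le> M" using b0 by (simp add: M_def)
  have rem: "ennreal lam ^ n * (\<integral>\<^sup>+y. (reset_kernel ^^ n) g y \<partial>L) \<le> ennreal (M * (lam * m) ^ n)" for n
  proof -
    have "(\<integral>\<^sup>+y. (reset_kernel ^^ n) g y \<partial>L) \<le> (\<integral>\<^sup>+y. ennreal (b * m ^ n) \<partial>L)"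
      by (intro nn_integral_mono reset_kernel_pow_bound[OF g b b0])
    also have "\<dots> = ennreal (M * m ^ n)"
      using b0 m(1) by (simp add: L.emeasure_eq_measure ennreal_mult[symmetric] M_def mult_ac)
    finally have "ennreal lam ^ n * (\<integral>\<^sup>+y. (reset_kernel ^^ n) g y \<partial>L) \<le> ennreal lam ^ n * ennreal (M * m ^ n)"
      by (rule mult_left_mono) simp
    also have "\<dots> = ennreal (M * (lam * m) ^ n)"
      using lam m(1) M0 by (simp add: ennreal_power ennreal_mult[symmetric] power_mult_distrib mult_ac)
    finally show ?thesis .
  qed
  have "(\<lambda>n. M * (lam * m) ^ n) \<longlonglongrightarrow> M * 0"
    by (intro tendsto_mult tendsto_const LIMSEQ_realpow_zero) (use lam m in auto)
  then have rem0: "(\<lambda>n. ennreal (M * (lam * m) ^ n)) \<longlonglongrightarrow> 0"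
    using tendsto_ennrealI by fastforce
  have rem_lim: "(\<lambda>n. ennreal lam ^ n * (\<integral>\<^sup>+y. (reset_kernel ^^ n) g y \<partial>L)) \<longlonglongrightarrow> 0"
    by (rule tendsto_sandwich[OF _ _ tendsto_const rem0]) (simp_all add: rem)
  have "(\<lambda>n. \<Sum>k<n. ennreal lam ^ k * kernel ((reset_kernel ^^ k) g) x) \<longlonglongrightarrow> (\<Sum>k. ennreal lam ^ k * kernel ((reset_kernel ^^ k) g) x)"
    by (rule summable_LIMSEQ) simp
  from tendsto_add[OF this rem_lim]
  have "(\<lambda>n. \<integral>\<^sup>+y. g y \<partial>L) \<longlonglongrightarrow> (\<Sum>k. ennreal lam ^ k * kernel ((reset_kernel ^^ k) g) x) + 0"
    unfolding L_expansion[OF g, symmetric] .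
  then show ?thesis by (simp add: LIMSEQ_const_iff)
qed

text \<open>The exponent \<open>Suc k\<close> follows \<open>V_bar\<close>; the extra factor makes
  this the density of \<open>lam\<close> times \<open>L\<close>.\<close>

definition series :: "real \<Rightarrow> ennreal" where
  "series y = (\<Sum>k. ennreal lam ^ Suc k * iterate k x y)"

lemma series_measurable [measurable]: "series \<in> borel_measurable borel"
  unfolding series_def by measurable

lemma nn_integral_series:
  assumes g [measurable]: "g \<in> borel_measurable borel" and b: "\<And>y. g y \<le> ennreal b" and b0: "0 \<le> b"
  shows "(\<integral>\<^sup>+y. series y * g y \<partial>lborel) = ennreal lam * (\<integral>\<^sup>+y. g y \<partial>L)"
proof -
  have "(\<integral>\<^sup>+y. series y * g y \<partial>lborel) = (\<integral>\<^sup>+y. (\<Sum>k. ennreal lam ^ Suc k * (iterate k x y * g y)) \<partial>lborel)"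
    unfolding series_def by (simp add: ennreal_suminf_multc[symmetric] mult.assoc)
  also have "\<dots> = (\<Sum>k. \<integral>\<^sup>+y. ennreal lam ^ Suc k * (iterate k x y * g y) \<partial>lborel)"
    by (rule nn_integral_suminf) measurable
  also have "\<dots> = (\<Sum>k. ennreal lam * (ennreal lam ^ k * kernel ((reset_kernel ^^ k) g) x))"
    by (simp add: nn_integral_cmult nn_integral_iterate[OF g] mult.assoc)
  also have "\<dots> = ennreal lam * (\<integral>\<^sup>+y. g y \<partial>L)"
    unfolding L_series[OF assms] by (rule ennreal_suminf_cmult)
  finally show ?thesis .
qed

lemma AE_iterate_finite:
  assumes "z \<le> a"
  shows "AE y in lborel. iterate k z y \<noteq> \<infinity>"
proof (rule nn_integral_PInf_AE)
  show "iterate k z \<in> borel_measurable lborel" by measurable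
  have "(\<integral>\<^sup>+y. iterate k z y * 1 \<partial>lborel) = kernel ((reset_kernel ^^ k) (\<lambda>_. 1)) z" by (rule nn_integral_iterate) simp
  also have "\<dots> \<le> (\<integral>\<^sup>+y. ennreal (r z y) * ennreal (1 * m ^ k) \<partial>lborel)"
    unfolding kernel_def by (intro nn_integral_mono mult_left_mono reset_kernel_pow_bound) auto
  also have "\<dots> = (\<integral>\<^sup>+y. ennreal (r z y) \<partial>lborel) * ennreal (1 * m ^ k)"
    by (rule nn_integral_multc) measurable
  also have "\<dots> \<le> ennreal m * ennreal (1 * m ^ k)" by (intro mult_right_mono r_mass assms) auto
  also have "\<dots> < \<infinity>" by (simp add: ennreal_mult_less_top)
  finally show "(\<integral>\<^sup>+y. iterate k z y \<partial>lborel) \<noteq> \<infinity>" by simp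
qed

lemma V_iter_pair: "(\<lambda>z. V_iter p a (Suc k) r (fst z) (snd z)) \<in> borel_measurable (borel \<Otimes>\<^sub>M borel)"
proof (induction k)
  case 0
  show ?case by simp
next
  case (Suc k)
  have [measurable]: "(\<lambda>w. V_iter p a (Suc k) r (f w) (g w)) \<in> borel_measurable Q"
    if "f \<in> borel_measurable Q" "g \<in> borel_measurable Q" for f g and Q :: "'b measure"
    using measurable_compose[OF measurable_Pair[OF that] Suc.IH] by simp
  have "(\<lambda>t. indicator {..min a (a / p)} (snd t) *\<^sub>R (r (fst (fst t)) (snd t) * V_iter p a (Suc k) r (p * snd t) (snd (fst t))))
    \<in> borel_measurable ((borel \<Otimes>\<^sub>M borel) \<Otimes>\<^sub>M lborel)"
    by measurable
  then show ?case
    using lborel.borel_measurable_lebesgue_integral[of "\<lambda>z w. indicator {..min a (a / p)} w *\<^sub>R (r (fst z) w * V_iter p a (Suc k) r (p * w) (snd z))" "borel \<Otimes>\<^sub>M borel"]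
    by (simp add: case_prod_beta' set_lebesgue_integral_def)
qed

lemma V_iter_compose [measurable (raw)]:
  assumes "f \<in> borel_measurable Q" "g \<in> borel_measurable Q"
  shows "(\<lambda>w. V_iter p a (Suc k) r (f w) (g w)) \<in> borel_measurable Q"
  using measurable_compose[OF measurable_Pair[OF assms] V_iter_pair] by simp

text \<open>The induction hypothesis gives, for each \<open>w\<close>, equality for almost every
  \<open>y\<close>; the integral over \<open>w\<close> needs it for almost every \<open>w\<close> at
  fixed \<open>y\<close>, so the quantifiers are exchanged by Fubini. At almost every
  \<open>y\<close> the nonnegative integral is finite and the Bochner integral coincides with
  it.\<close>

lemma AE_V_iter:
  assumes "z \<le> a"
  shows "AE y in lborel. V_iter p a (Suc k) r z y = enn2real (iterate k z y)"
  using assms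
proof (induction k arbitrary: z)
  case 0
  from r_nonneg[OF this] show ?case by eventually_elim simp
next
  case (Suc k)
  define good where "good w y \<longleftrightarrow> (w \<le> min a (a / p) \<longrightarrow> V_iter p a (Suc k) r (p * w) y = enn2real (iterate k (p * w) y))" for w y
  have "AE w in lborel. AE y in lborel. good w y"
  proof (rule AE_I2)
    fix w
    show "AE y in lborel. good w y"
    proof (cases "w \<le> min a (a / p)")
      case True
      then have "p * w \<le> a" using inside_iff by simp
      from Suc.IH[OF this] show ?thesis by eventually_elim (simp add: good_def)
    next
      case False
      then have "good w = (\<lambda>_. True)" unfolding good_def by (intro ext) (rule eqTrueI, rule impI, erule notE)
      then show ?thesis by simp
    qed
  qed
  moreover have "{t \<in> space (lborel \<Otimes>\<^sub>M lborel). good (fst t) (snd t)} \<in> sets (lborel \<Otimes>\<^sub>M lborel)"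
    unfolding good_def by measurable
  \<comment> \<open>Joint measurability of the good set permits the exchange.\<close>
  ultimately have good: "AE y in lborel. AE w in lborel. good w y"
    by (subst (asm) lborel_pair.AE_commute) auto
  show ?case using good AE_iterate_finite[OF Suc.prems, of "Suc k"]
  proof eventually_elim
    case (elim y)
    define F where "F w = indicator {..min a (a / p)} w *\<^sub>R (r z w * V_iter p a (Suc k) r (p * w) y)" for w
    define G where "G w = ennreal (r z w) * (inside w * iterate k (p * w) y)" for w
    have [measurable]: "F \<in> borel_measurable lborel" "G \<in> borel_measurable lborel"
      unfolding F_def G_def by measurable
    have "(\<integral>\<^sup>+w. G w \<partial>lborel) \<noteq> \<infinity>" using elim(2) by (simp add: G_def)
    then have "AE w in lborel. G w \<noteq> \<infinity>" by (intro nn_integral_PInf_AE) auto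
    then have FG: "AE w in lborel. 0 \<le> F w \<and> ennreal (F w) = G w"
      using elim(1) r_nonneg[OF Suc.prems]
    proof eventually_elim
      case (elim w)
      show ?case
      proof (cases "w \<le> min a (a / p)")
        case True
        then have V: "V_iter p a (Suc k) r (p * w) y = enn2real (iterate k (p * w) y)" using elim(2) by (simp add: good_def)
        have F: "F w = r z w * enn2real (iterate k (p * w) y)" using True V by (simp add: F_def)
        have G: "G w = ennreal (r z w) * iterate k (p * w) y" using True by (simp add: G_def inside_def)
        have "ennreal (r z w * enn2real (iterate k (p * w) y)) = ennreal (r z w) * iterate k (p * w) y"
        \<comment> \<open>Where the kernel vanishes the iterate may be infinite, but both products
          are 0; elsewhere finiteness of the product makes the iterate finite.\<close>
        proof (cases "r z w = 0")
          case False
          then have "iterate k (p * w) y \<noteq> \<infinity>" using elim(1,3) unfolding G by (auto simp: ennreal_mult_eq_top_iff)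
          then have "ennreal (enn2real (iterate k (p * w) y)) = iterate k (p * w) y" by (simp add: less_top)
          then show ?thesis using elim(3) by (simp add: ennreal_mult)
        qed simp
        then show ?thesis unfolding F G using elim(3) by simp
      qed (auto simp: F_def G_def inside_def)
    qed
    have "V_iter p a (Suc (Suc k)) r z y = (LINT w|lborel. F w)"
      by (simp add: F_def set_lebesgue_integral_def)
    also have "\<dots> = enn2real (\<integral>\<^sup>+w. ennreal (F w) \<partial>lborel)"
      by (rule integral_eq_nn_integral) (use FG in auto)
    also have "(\<integral>\<^sup>+w. ennreal (F w) \<partial>lborel) = (\<integral>\<^sup>+w. G w \<partial>lborel)"
      by (rule nn_integral_cong_AE) (use FG in auto)
    finally show ?case by (simp add: G_def)
  qed
qed

text \<open>The series has finite total mass, so it is finite almost everywhere; there the real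
  series is summable and its sum is the intended value.\<close>

lemma AE_V_bar: "AE y in lborel. 0 \<le> V_bar p a lam r x y \<and> ennreal (V_bar p a lam r x y) = series y"
proof -
  interpret L: finite_measure L by (rule L_finite)
  have "AE y in lborel. \<forall>k. V_iter p a (Suc k) r x y = enn2real (iterate k x y) \<and> iterate k x y \<noteq> \<infinity>"
    unfolding AE_all_countable by (intro allI AE_conjI AE_V_iter AE_iterate_finite x)
  moreover have "AE y in lborel. series y \<noteq> \<infinity>"
  proof (rule nn_integral_PInf_AE)
    have "(\<integral>\<^sup>+y. series y * 1 \<partial>lborel) = ennreal lam * (\<integral>\<^sup>+y. 1 \<partial>L)"
      by (rule nn_integral_series[where b = 1]) auto
    also have "\<dots> < \<infinity>" by (simp add: L.emeasure_eq_measure ennreal_mult_less_top)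
    finally show "(\<integral>\<^sup>+y. series y \<partial>lborel) \<noteq> \<infinity>" by simp
  qed simp
  ultimately show ?thesis
  proof eventually_elim
    case (elim y)
    define f where "f k = lam ^ Suc k * V_iter p a (Suc k) r x y" for k
    have f: "0 \<le> f k" "ennreal (f k) = ennreal lam ^ Suc k * iterate k x y" for k
    proof -
      have eq: "f k = lam ^ Suc k * enn2real (iterate k x y)" using elim(1) by (simp only: f_def)
      show "0 \<le> f k" unfolding eq using lam by simp
      have "ennreal (enn2real (iterate k x y)) = iterate k x y" using elim(1) by (simp add: less_top)
      then show "ennreal (f k) = ennreal lam ^ Suc k * iterate k x y"
        unfolding eq using lam by (simp add: ennreal_mult ennreal_power del: power_Suc)
    qed
    have S_eq: "series y = (\<Sum>k. ennreal (f k))" unfolding series_def f(2) ..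
    have "summable f"
      by (rule summable_suminf_not_top[OF f(1)]) (use elim(2) in \<open>simp add: S_eq\<close>)
    then have "(\<Sum>k. ennreal (f k)) = ennreal (\<Sum>k. f k)" by (rule suminf_ennreal2[OF f(1)])
    moreover have "V_bar p a lam r x y = (\<Sum>k. f k)" unfolding V_bar_def f_def ..
    moreover have "0 \<le> (\<Sum>k. f k)" using \<open>summable f\<close> f(1) by (rule suminf_nonneg)
    ultimately show ?case by (simp add: S_eq)
  qed
qed

lemma V_bar_measurable [measurable]: "V_bar p a lam r x \<in> borel_measurable borel"
  unfolding V_bar_def by measurable

text \<open>Identifies \<open>V_bar\<close> as the density of \<open>lam\<close> times
  \<open>L\<close>; this is how integrals against \<open>L\<close> turn into the integrals of the
  final formula.\<close>

theorem V_bar_integral: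
  fixes g :: "real \<Rightarrow> real"
  assumes g [measurable]: "g \<in> borel_measurable borel" and b: "\<And>y. 0 \<le> g y" "\<And>y. g y \<le> b"
  shows "(LINT y|lborel. V_bar p a lam r x y * g y) = lam * (LINT y|L. g y)"
proof -
  interpret L: finite_measure L by (rule L_finite)
  have b0: "0 \<le> b" using b order_trans by blast
  have gL [measurable]: "g \<in> borel_measurable L" using L_sets by (simp cong: measurable_cong_sets)
  have "(LINT y|lborel. V_bar p a lam r x y * g y) = enn2real (\<integral>\<^sup>+y. ennreal (V_bar p a lam r x y * g y) \<partial>lborel)"
    by (rule integral_eq_nn_integral) (use AE_V_bar b in auto)
  also have "(\<integral>\<^sup>+y. ennreal (V_bar p a lam r x y * g y) \<partial>lborel) = (\<integral>\<^sup>+y. series y * ennreal (g y) \<partial>lborel)"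
  proof (rule nn_integral_cong_AE)
    show "AE y in lborel. ennreal (V_bar p a lam r x y * g y) = series y * ennreal (g y)"
      using AE_V_bar by eventually_elim (use b in \<open>simp add: ennreal_mult\<close>)
  qed
  also have "\<dots> = ennreal lam * (\<integral>\<^sup>+y. ennreal (g y) \<partial>L)"
    by (rule nn_integral_series[where b = b]) (use b b0 in \<open>auto intro: ennreal_leI\<close>)
  also have "(\<integral>\<^sup>+y. ennreal (g y) \<partial>L) = ennreal (LINT y|L. g y)"
  proof (rule nn_integral_eq_integral)
    show "integrable L g" by (rule L.integrable_const_bound[where B = b]) (use b in auto)
  qed (use b in auto)
  also have "enn2real (ennreal lam * ennreal (LINT y|L. g y)) = lam * (LINT y|L. g y)"
    using lam b by (simp add: ennreal_mult[symmetric] integral_nonneg_AE)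
  finally show ?thesis .
qed

end

section \<open>Occupation densities\<close>

text \<open>The sign of \<open>r_bar\<close> is not known in advance, so uniqueness of Laplace transforms is applied after moving
  its negative part to the other side, where it is added to the occupation measure.\<close>

definition borel_sum :: "real measure \<Rightarrow> real measure \<Rightarrow> real measure" where
  "borel_sum M N = measure_of UNIV (sets borel) (\<lambda>A. emeasure M A + emeasure N A)"

lemma sets_borel_sum [measurable_cong, simp]: "sets (borel_sum M N) = sets borel"
  unfolding borel_sum_def using sets.sigma_sets_eq[of "borel :: real measure"] by simp

lemma emeasure_borel_sum:
  assumes M: "sets M = sets borel" and N: "sets N = sets borel" and A: "A \<in> sets borel"
  shows "emeasure (borel_sum M N) A = emeasure M A + emeasure N A"
  unfolding borel_sum_def
proof (rule emeasure_measure_of_sigma[OF _ _ _ A])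
  show "sigma_algebra UNIV (sets (borel :: real measure))"
    using sets.sigma_algebra_axioms[of "borel :: real measure"] by simp
  show "positive (sets borel) (\<lambda>A. emeasure M A + emeasure N A)"
    by (simp add: positive_def)
  show "countably_additive (sets borel) (\<lambda>A. emeasure M A + emeasure N A)"
  proof (rule countably_additiveI)
    fix A :: "nat \<Rightarrow> real set"
    assume A: "range A \<subseteq> sets borel" "disjoint_family A"
    show "(\<Sum>i. emeasure M (A i) + emeasure N (A i)) = emeasure M (\<Union> (range A)) + emeasure N (\<Union> (range A))"
      using A M N by (simp add: suminf_add[symmetric] suminf_emeasure)
  qed
qed

lemma nn_integral_borel_sum:
  fixes f :: "real \<Rightarrow> ennreal"
  assumes M: "sets M = sets borel" and N: "sets N = sets borel" and f: "f \<in> borel_measurable borel"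
  shows "(\<integral>\<^sup>+y. f y \<partial>borel_sum M N) = (\<integral>\<^sup>+y. f y \<partial>M) + (\<integral>\<^sup>+y. f y \<partial>N)"
proof -
  note cong = measurable_cong_sets[OF M refl] measurable_cong_sets[OF N refl]
    measurable_cong_sets[OF sets_borel_sum[of M N] refl]
  from f show ?thesis
  proof (induction rule: borel_measurable_induct)
    case (cong f g)
    then have "f = g" by (intro ext) simp
    with cong(4) show ?case by simp
  next
    case (set A)
    then show ?case by (simp add: emeasure_borel_sum[OF M N] M N)
  next
    case (mult u c)
    then show ?case by (simp add: nn_integral_cmult cong distrib_left)
  next
    case (add u v)
    then show ?case by (simp add: nn_integral_add cong add_ac)
  next
    case (seq F)
    have inc: "incseq (\<lambda>i. \<integral>\<^sup>+y. F i y \<partial>Q)" for Q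
      using seq(3) by (intro monoI nn_integral_mono) (auto simp: mono_def le_fun_def)
    have SUP: "(\<integral>\<^sup>+y. (SUP i. F i) y \<partial>Q) = (SUP i. \<integral>\<^sup>+y. F i y \<partial>Q)" if "sets Q = sets borel" for Q
      unfolding SUP_apply
      by (rule nn_integral_monotone_convergence_SUP[OF seq(3)]) (use seq(1) measurable_cong_sets[OF that refl] in auto)
    show ?case
      unfolding SUP[OF M] SUP[OF N] SUP[OF sets_borel_sum] seq.IH by (rule ennreal_SUP_add[OF inc inc])
  qed
qed

text \<open>Densities such as \<open>W (a - y)\<close> may have infinite mass near minus infinity.
  Tilting by an exponential with exponent above \<open>\<theta>0\<close> makes both measures finite
  and can be undone afterwards.\<close>

lemma laplace_transform_unique_tilted:
  fixes M N :: "real measure"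
  assumes M: "sets M = sets borel" "AE y in M. y \<le> a"
    and N: "sets N = sets borel" "AE y in N. y \<le> a"
    and finite: "\<And>\<theta>. \<theta>0 < \<theta> \<Longrightarrow> (\<integral>\<^sup>+y. ennreal (exp (\<theta> * y)) \<partial>M) \<noteq> \<infinity>"
    and eq: "\<And>\<theta>. \<theta>0 < \<theta> \<Longrightarrow> (\<integral>\<^sup>+y. ennreal (exp (\<theta> * y)) \<partial>M) = (\<integral>\<^sup>+y. ennreal (exp (\<theta> * y)) \<partial>N)"
  shows "M = N"
proof -
  define \<theta>1 where "\<theta>1 = \<theta>0 + 1"
  define tilt where "tilt Q = density Q (\<lambda>y. ennreal (exp (\<theta>1 * y)))" for Q :: "real measure"
  have meas: "h \<in> borel_measurable Q" if "sets Q = sets borel" "h \<in> borel_measurable borel"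
    for Q :: "real measure" and h :: "real \<Rightarrow> ennreal"
    using that by (simp cong: measurable_cong_sets)
  have tilt_integral: "(\<integral>\<^sup>+y. ennreal (exp (\<theta> * y)) \<partial>tilt Q) = (\<integral>\<^sup>+y. ennreal (exp ((\<theta>1 + \<theta>) * y)) \<partial>Q)"
    if "sets Q = sets borel" for Q \<theta>
  proof -
    have "(\<integral>\<^sup>+y. ennreal (exp (\<theta> * y)) \<partial>tilt Q) = (\<integral>\<^sup>+y. ennreal (exp (\<theta>1 * y)) * ennreal (exp (\<theta> * y)) \<partial>Q)"
      unfolding tilt_def by (rule nn_integral_density; rule meas[OF that]; measurable)
    then show ?thesis by (simp add: ennreal_mult[symmetric] exp_add[symmetric] distrib_right)
  qed
  have tilt_finite: "finite_measure (tilt Q)"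
    if "sets Q = sets borel" "(\<integral>\<^sup>+y. ennreal (exp (\<theta>1 * y)) \<partial>Q) \<noteq> \<infinity>" for Q
  proof (rule finite_measureI)
    have "emeasure (tilt Q) (space (tilt Q)) = (\<integral>\<^sup>+y. ennreal (exp (0 * y)) \<partial>tilt Q)" by simp
    also have "\<dots> \<noteq> \<infinity>" unfolding tilt_integral[OF that(1)] using that(2) by simp
    finally show "emeasure (tilt Q) (space (tilt Q)) \<noteq> \<infinity>" .
  qed
  have tilt_AE: "AE y in tilt Q. y \<le> a" if "sets Q = sets borel" "AE y in Q. y \<le> a" for Q
    unfolding tilt_def using that by (subst AE_density) (auto intro: meas)
  have untilt: "Q = density (tilt Q) (\<lambda>y. ennreal (exp (- (\<theta>1 * y))))" if "sets Q = sets borel" for Q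
  proof -
    have "density (tilt Q) (\<lambda>y. ennreal (exp (- (\<theta>1 * y)))) =
      density Q (\<lambda>y. ennreal (exp (\<theta>1 * y)) * ennreal (exp (- (\<theta>1 * y))))"
      unfolding tilt_def by (rule density_density_eq; rule meas[OF that]; measurable)
    also have "(\<lambda>y. ennreal (exp (\<theta>1 * y)) * ennreal (exp (- (\<theta>1 * y)))) = (\<lambda>_. 1)"
      by (simp add: ennreal_mult[symmetric] exp_add[symmetric])
    finally show ?thesis by (simp add: density_1)
  qed
  have fin1: "(\<integral>\<^sup>+y. ennreal (exp (\<theta>1 * y)) \<partial>M) \<noteq> \<infinity>" by (rule finite) (simp add: \<theta>1_def)
  have "tilt M = tilt N"
  proof (rule laplace_transform_unique)
    show "finite_measure (tilt M)" by (rule tilt_finite[OF M(1) fin1])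
    have "(\<integral>\<^sup>+y. ennreal (exp (\<theta>1 * y)) \<partial>N) \<noteq> \<infinity>" using fin1 eq[of \<theta>1] by (simp add: \<theta>1_def)
    then show "finite_measure (tilt N)" by (rule tilt_finite[OF N(1)])
    show "sets (tilt M) = sets borel" "sets (tilt N) = sets borel" using M N by (simp_all add: tilt_def)
    show "AE y in tilt M. y \<le> a" "AE y in tilt N. y \<le> a" by (rule tilt_AE; fact)+
    fix \<theta> :: real assume "0 < \<theta>"
    then show "(\<integral>\<^sup>+y. ennreal (exp (\<theta> * y)) \<partial>tilt M) = (\<integral>\<^sup>+y. ennreal (exp (\<theta> * y)) \<partial>tilt N)"
      unfolding tilt_integral[OF M(1)] tilt_integral[OF N(1)] by (intro eq) (simp add: \<theta>1_def)
  qed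
  then show ?thesis using untilt[OF M(1)] untilt[OF N(1)] by simp
qed

locale scale_function =
  fixes \<psi> :: "real \<Rightarrow> real" and q \<Phi> :: real and W :: "real \<Rightarrow> real"
  assumes scale: "is_scale_function \<psi> q W"
    and Phi_def: "\<Phi> = right_inverse \<psi> q" and Phi_pos: "0 < \<Phi>" and psi_Phi: "\<psi> \<Phi> = q"
    and psi_neq: "\<And>\<theta>. \<Phi> < \<theta> \<Longrightarrow> \<psi> \<theta> \<noteq> q"
begin

lemma W_nonneg: "0 \<le> W u"
  and W_neg: "u < 0 \<Longrightarrow> W u = 0"
  and W_right: "0 \<le> u \<Longrightarrow> continuous (at_right u) W"
  using scale unfolding is_scale_function_def by blast+

lemma W_measurable [measurable]: "W \<in> borel_measurable borel"
proof -
  have "(\<lambda>s. indicator {0..} s * W s) \<in> borel_measurable borel"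
    by (rule right_continuous_borel_measurable) (rule W_right)
  moreover have "(\<lambda>s. indicator {0..} s * W s) = W"
  proof
    fix s show "indicator {0..} s * W s = W s" using W_neg[of s] by (cases "0 \<le> s") auto
  qed
  ultimately show ?thesis by simp
qed

text \<open>The transform of the nonnegative \<open>W\<close> is
  \<open>1 / (\<psi> \<theta> - q)\<close>, so the difference is not negative, and it is nonzero
  beyond the largest root.\<close>

lemma psi_gt:
  assumes "\<Phi> < \<theta>" shows "0 < \<psi> \<theta> - q"
proof -
  have "0 \<le> (LBINT u:{0..}. exp (- \<theta> * u) * W u)"
    unfolding set_lebesgue_integral_def using W_nonneg by (intro integral_nonneg_AE) auto
  also have "\<dots> = 1 / (\<psi> \<theta> - q)"
    using scale assms unfolding is_scale_function_def Phi_def by blast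
  finally show ?thesis using psi_neq[OF assms] by (simp add: zero_le_divide_iff)
qed

lemma W_transform:
  assumes \<theta>: "\<Phi> < \<theta>"
  shows "(\<integral>\<^sup>+y. ennreal (exp (\<theta> * y) * W (c - y)) \<partial>lborel) = ennreal (exp (\<theta> * c) / (\<psi> \<theta> - q))"
proof -
  have int: "set_integrable lborel {0..} (\<lambda>u. exp (- \<theta> * u) * W u)"
    and val: "(LBINT u:{0..}. exp (- \<theta> * u) * W u) = 1 / (\<psi> \<theta> - q)"
    using scale \<theta> unfolding is_scale_function_def Phi_def by blast+
  have ind: "indicator {0..} u *\<^sub>R (exp (- \<theta> * u) * W u) = exp (- \<theta> * u) * W u" for u
    using W_neg[of u] by (auto simp: indicator_def)
  have "(\<integral>\<^sup>+y. ennreal (exp (\<theta> * y) * W (c - y)) \<partial>lborel) =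
    (\<integral>\<^sup>+u. ennreal (exp (\<theta> * (c + (-1) * u)) * W (c - (c + (-1) * u))) \<partial>lborel)"
    using nn_integral_real_affine[of "\<lambda>y. ennreal (exp (\<theta> * y) * W (c - y))" "-1" c] by simp
  also have "\<dots> = (\<integral>\<^sup>+u. ennreal (exp (\<theta> * c)) * ennreal (exp (- \<theta> * u) * W u) \<partial>lborel)"
    using W_nonneg by (intro nn_integral_cong) (simp add: ennreal_mult[symmetric] exp_diff exp_minus right_diff_distrib field_simps)
  also have "\<dots> = ennreal (exp (\<theta> * c)) * (\<integral>\<^sup>+u. ennreal (exp (- \<theta> * u) * W u) \<partial>lborel)"
    by (rule nn_integral_cmult) measurable
  also have "(\<integral>\<^sup>+u. ennreal (exp (- \<theta> * u) * W u) \<partial>lborel) = ennreal (1 / (\<psi> \<theta> - q))"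
    using nn_integral_eq_integral[OF int[unfolded set_integrable_def]] W_nonneg val
    unfolding set_lebesgue_integral_def ind by simp
  also have "ennreal (exp (\<theta> * c)) * \<dots> = ennreal (exp (\<theta> * c) / (\<psi> \<theta> - q))"
    using psi_gt[OF \<theta>] by (simp add: ennreal_mult[symmetric])
  finally show ?thesis .
qed

lemma r_bar_above: "x \<le> a \<Longrightarrow> a < y \<Longrightarrow> r_bar \<Phi> W a x y = 0"
  by (simp add: r_bar_def W_neg)

lemma r_bar_measurable: "case_prod (r_bar \<Phi> W a) \<in> borel_measurable (borel \<Otimes>\<^sub>M borel)"
  unfolding r_bar_def by measurable

text \<open>Solving the identity for the transform of \<open>K\<close> gives a difference of two
  scale function transforms. Written as a sum, it says that \<open>K\<close> plus the density
  \<open>f1\<close> equals the density \<open>f2\<close>; positivity of \<open>K\<close> then forces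
  \<open>f2 - f1\<close>, which is \<open>r_bar\<close>, to be nonnegative almost
  everywhere.\<close>

lemma killed_occupation_density:
  assumes K: "finite_measure K" "sets K = sets borel" "AE y in K. y \<le> a" and x: "x \<le> a"
    and identity: "\<And>\<theta>. 0 < \<theta> \<Longrightarrow> c * exp (\<theta> * a) = exp (\<theta> * x) + (\<psi> \<theta> - q) * (LINT y|K. exp (\<theta> * y))"
  shows "AE y in lborel. 0 \<le> r_bar \<Phi> W a x y" "K = density lborel (\<lambda>y. ennreal (r_bar \<Phi> W a x y))"
    "\<And>\<theta>. \<Phi> < \<theta> \<Longrightarrow> (\<integral>\<^sup>+y. ennreal (r_bar \<Phi> W a x y) * ennreal (exp (\<theta> * y)) \<partial>lborel) =
       ennreal ((exp (- \<Phi> * (a - x)) * exp (\<theta> * a) - exp (\<theta> * x)) / (\<psi> \<theta> - q))"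
    "\<And>\<theta>. \<Phi> < \<theta> \<Longrightarrow> 0 \<le> exp (- \<Phi> * (a - x)) * exp (\<theta> * a) - exp (\<theta> * x)"
proof -
  interpret K: finite_measure K by fact
  have Kmeas: "h \<in> borel_measurable K" if "h \<in> borel_measurable borel" for h :: "real \<Rightarrow> 'b::topological_space"
    using that K(2) by (simp cong: measurable_cong_sets)
  \<comment> \<open>At \<open>\<theta> = \<Phi>\<close> the factor
    \<open>\<psi> \<theta> - q\<close> vanishes and only the unknown constant remains.\<close>
  have "c * exp (\<Phi> * a) = exp (\<Phi> * x)" using identity[OF Phi_pos] psi_Phi by simp
  then have c: "c = exp (- \<Phi> * (a - x))"
    by (simp add: exp_diff exp_minus right_diff_distrib field_simps)
  have K_transform: "(\<integral>\<^sup>+y. ennreal (exp (\<theta> * y)) \<partial>K) = ennreal ((c * exp (\<theta> * a) - exp (\<theta> * x)) / (\<psi> \<theta> - q))"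
    and K_nonneg: "0 \<le> c * exp (\<theta> * a) - exp (\<theta> * x)" if \<theta>: "\<Phi> < \<theta>" for \<theta>
  proof -
    have pos: "0 < \<theta>" using \<theta> Phi_pos by simp
    have "integrable K (\<lambda>y. exp (\<theta> * y))"
    proof (rule K.integrable_const_bound[where B = "exp (\<theta> * a)"])
      show "AE y in K. norm (exp (\<theta> * y)) \<le> exp (\<theta> * a)" using K(3) by eventually_elim (use pos in simp)
    qed (rule Kmeas, measurable)
    then have "(\<integral>\<^sup>+y. ennreal (exp (\<theta> * y)) \<partial>K) = ennreal (LINT y|K. exp (\<theta> * y))"
      by (rule nn_integral_eq_integral) simp
    moreover have diff: "(\<psi> \<theta> - q) * (LINT y|K. exp (\<theta> * y)) = c * exp (\<theta> * a) - exp (\<theta> * x)"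
      using identity[OF pos] by simp
    ultimately show "(\<integral>\<^sup>+y. ennreal (exp (\<theta> * y)) \<partial>K) = ennreal ((c * exp (\<theta> * a) - exp (\<theta> * x)) / (\<psi> \<theta> - q))"
      using psi_gt[OF \<theta>] by (metis nonzero_mult_div_cancel_left less_irrefl)
    show "0 \<le> c * exp (\<theta> * a) - exp (\<theta> * x)"
      unfolding diff[symmetric] using psi_gt[OF \<theta>] by (intro mult_nonneg_nonneg integral_nonneg_AE) auto
  qed
  have c0: "0 \<le> c" by (simp add: c)
  define f1 where "f1 y = W (x - y)" for y
  define f2 where "f2 y = c * W (a - y)" for y
  have [measurable]: "f1 \<in> borel_measurable borel" "f2 \<in> borel_measurable borel"
    unfolding f1_def f2_def by measurable
  have f_nonneg: "0 \<le> f1 y" "0 \<le> f2 y" for y using W_nonneg c0 by (simp_all add: f1_def f2_def)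
  have f1_transform: "(\<integral>\<^sup>+y. ennreal (f1 y) * ennreal (exp (\<theta> * y)) \<partial>lborel) = ennreal (exp (\<theta> * x) / (\<psi> \<theta> - q))"
    if \<theta>: "\<Phi> < \<theta>" for \<theta>
    using W_transform[OF \<theta>, of x] W_nonneg by (simp add: f1_def ennreal_mult[symmetric] mult.commute)
  have f2_transform: "(\<integral>\<^sup>+y. ennreal (f2 y) * ennreal (exp (\<theta> * y)) \<partial>lborel) = ennreal (c * (exp (\<theta> * a) / (\<psi> \<theta> - q)))"
    if \<theta>: "\<Phi> < \<theta>" for \<theta>
  proof -
    have "(\<integral>\<^sup>+y. ennreal (f2 y) * ennreal (exp (\<theta> * y)) \<partial>lborel) = (\<integral>\<^sup>+y. ennreal c * ennreal (exp (\<theta> * y) * W (a - y)) \<partial>lborel)"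
      using W_nonneg c0 by (intro nn_integral_cong) (simp add: f2_def ennreal_mult[symmetric] mult_ac)
    also have "\<dots> = ennreal c * (\<integral>\<^sup>+y. ennreal (exp (\<theta> * y) * W (a - y)) \<partial>lborel)"
      by (rule nn_integral_cmult) measurable
    also have "\<dots> = ennreal (c * (exp (\<theta> * a) / (\<psi> \<theta> - q)))"
      unfolding W_transform[OF \<theta>] using c0 psi_gt[OF \<theta>] by (simp add: ennreal_mult[symmetric])
    finally show ?thesis .
  qed
  \<comment> \<open>No sign of the difference is needed in this additive form, so uniqueness applies
    to genuine measures.\<close>
  have sum_eq: "borel_sum K (density lborel (\<lambda>y. ennreal (f1 y))) = density lborel (\<lambda>y. ennreal (f2 y))"
    (is "?M = ?N")
  proof (rule laplace_transform_unique_tilted)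
    show "sets ?M = sets borel" "sets ?N = sets borel" by simp_all
    show "AE y in ?N. y \<le> a"
      by (subst AE_density) (auto simp: f2_def W_neg intro!: AE_I2 leI)
    have null: "emeasure ?M {a<..} = 0"
    proof -
      have "emeasure K {a<..} = 0"
        using K(3) K(2) by (subst AE_iff_measurable[symmetric, where P = "\<lambda>y. y \<le> a"]) (auto simp: sets_eq_imp_space_eq[OF K(2)])
      moreover have "emeasure (density lborel (\<lambda>y. ennreal (f1 y))) {a<..} = (\<integral>\<^sup>+y. 0 \<partial>(lborel :: real measure))"
        by (subst emeasure_density) (use x in \<open>auto simp: f1_def W_neg split: split_indicator intro!: nn_integral_cong simp del: nn_integral_0_iff_AE nn_integral_const\<close>)
      ultimately show ?thesis using K(2) by (subst emeasure_borel_sum) auto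
    qed
    show "AE y in ?M. y \<le> a"
      by (rule AE_I[OF _ null]) (auto simp: not_le)
    fix \<theta> :: real assume \<theta>: "\<Phi> < \<theta>"
    have "(\<integral>\<^sup>+y. ennreal (exp (\<theta> * y)) \<partial>?M) = ennreal ((c * exp (\<theta> * a) - exp (\<theta> * x)) / (\<psi> \<theta> - q)) + ennreal (exp (\<theta> * x) / (\<psi> \<theta> - q))"
      using K(2) by (simp add: nn_integral_borel_sum K_transform[OF \<theta>] nn_integral_density f1_transform[OF \<theta>])
    also have "\<dots> = ennreal (c * (exp (\<theta> * a) / (\<psi> \<theta> - q)))"
      using K_nonneg[OF \<theta>] psi_gt[OF \<theta>] by (simp add: ennreal_plus[symmetric] add_divide_distrib[symmetric] del: ennreal_plus)
    finally have M: "(\<integral>\<^sup>+y. ennreal (exp (\<theta> * y)) \<partial>?M) = ennreal (c * (exp (\<theta> * a) / (\<psi> \<theta> - q)))" .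
    then show "(\<integral>\<^sup>+y. ennreal (exp (\<theta> * y)) \<partial>?M) \<noteq> \<infinity>" by simp
    show "(\<integral>\<^sup>+y. ennreal (exp (\<theta> * y)) \<partial>?M) = (\<integral>\<^sup>+y. ennreal (exp (\<theta> * y)) \<partial>?N)"
      unfolding M by (simp add: nn_integral_density f2_transform[OF \<theta>])
  qed
  have sum_integral: "(\<integral>\<^sup>+y. g y \<partial>K) + (\<integral>\<^sup>+y. ennreal (f1 y) * g y \<partial>lborel) = (\<integral>\<^sup>+y. ennreal (f2 y) * g y \<partial>lborel)"
    if [measurable]: "g \<in> borel_measurable borel" for g
    using nn_integral_borel_sum[OF K(2), of "density lborel (\<lambda>y. ennreal (f1 y))" g]
    by (simp add: sum_eq nn_integral_density)
  define \<theta>1 where "\<theta>1 = \<Phi> + 1"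
  have \<theta>1: "\<Phi> < \<theta>1" by (simp add: \<theta>1_def)
  define e where "e y = ennreal (exp (\<theta>1 * y))" for y
  have [measurable]: "e \<in> borel_measurable borel" unfolding e_def by measurable
  have f1_finite: "(\<integral>\<^sup>+y. ennreal (f1 y) * (e y * indicator B y) \<partial>lborel) \<noteq> \<infinity>" for B
  proof -
    have "(\<integral>\<^sup>+y. ennreal (f1 y) * (e y * indicator B y) \<partial>lborel) \<le> (\<integral>\<^sup>+y. ennreal (f1 y) * e y \<partial>lborel)"
      by (intro nn_integral_mono) (auto simp: indicator_def)
    also have "\<dots> < \<infinity>" using f1_transform[OF \<theta>1] by (simp add: e_def)
    finally show ?thesis by simp
  qed
  have r: "r_bar \<Phi> W a x y = f2 y - f1 y" for y by (simp add: r_bar_def f1_def f2_def c)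
  show nonneg: "AE y in lborel. 0 \<le> r_bar \<Phi> W a x y"
  proof -
    \<comment> \<open>On the set where the difference is negative, \<open>K \<ge> 0\<close> gives
      the opposite inequality of integrals. The weight \<open>e\<close> makes them finite, so
      subtracting is legitimate and the excess has integral 0.\<close>
    define B where "B = {y. f2 y < f1 y}"
    have [measurable]: "B \<in> sets borel" unfolding B_def by measurable
    define g where "g y = e y * indicator B y" for y
    have [measurable]: "g \<in> borel_measurable borel" unfolding g_def by measurable
    have le: "(\<integral>\<^sup>+y. ennreal (f1 y) * g y \<partial>lborel) \<le> (\<integral>\<^sup>+y. ennreal (f2 y) * g y \<partial>lborel)"
      using sum_integral[of g] by (metis add.commute le_iff_add \<open>g \<in> borel_measurable borel\<close>)
    have split: "ennreal (f1 y) * g y = ennreal (f2 y) * g y + ennreal (f1 y - f2 y) * g y" for y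
      using f_nonneg[of y] by (auto simp: g_def B_def indicator_def distrib_right[symmetric] ennreal_plus[symmetric] simp del: ennreal_plus)
    have "(\<integral>\<^sup>+y. ennreal (f2 y) * g y \<partial>lborel) + (\<integral>\<^sup>+y. ennreal (f1 y - f2 y) * g y \<partial>lborel) = (\<integral>\<^sup>+y. ennreal (f1 y) * g y \<partial>lborel)"
      unfolding split by (rule nn_integral_add[symmetric]) measurable
    moreover have "(\<integral>\<^sup>+y. ennreal (f2 y) * g y \<partial>lborel) \<noteq> \<infinity>"
    proof -
      have "(\<integral>\<^sup>+y. ennreal (f2 y) * g y \<partial>lborel) \<le> (\<integral>\<^sup>+y. ennreal (f1 y) * g y \<partial>lborel)"
        unfolding split by (intro nn_integral_mono) simp
      then show ?thesis using f1_finite[of B] unfolding g_def by (auto simp: top_unique)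
    qed
    ultimately have "(\<integral>\<^sup>+y. ennreal (f1 y - f2 y) * g y \<partial>lborel) = 0"
      using le ennreal_add_left_cancel_le[of "\<integral>\<^sup>+y. ennreal (f2 y) * g y \<partial>lborel" "\<integral>\<^sup>+y. ennreal (f1 y - f2 y) * g y \<partial>lborel" 0]
      by simp
    then have "AE y in lborel. ennreal (f1 y - f2 y) * g y = 0"
      by (subst (asm) nn_integral_0_iff_AE) measurable
    then show ?thesis
      by eventually_elim (auto simp: r g_def e_def B_def indicator_def not_less ennreal_eq_0_iff split: if_splits)
  qed
  have r_meas [measurable]: "r_bar \<Phi> W a x \<in> borel_measurable borel"
    unfolding r_bar_def by measurable
  \<comment> \<open>With the sign settled, \<open>f2\<close> splits into \<open>r_bar\<close> and
    \<open>f1\<close>, and the finite transform of \<open>f1\<close> cancels from the additive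
    identity.\<close>
  show K_density: "K = density lborel (\<lambda>y. ennreal (r_bar \<Phi> W a x y))" (is "K = ?R")
  proof (rule laplace_transform_unique_tilted)
    show "sets K = sets borel" "AE y in K. y \<le> a" by fact+
    show "sets ?R = sets borel" by simp
    show "AE y in ?R. y \<le> a"
      by (subst AE_density) (auto simp: r_bar_above[OF x] intro!: AE_I2 leI)
    fix \<theta> assume \<theta>: "\<Phi> < \<theta>"
    show "(\<integral>\<^sup>+y. ennreal (exp (\<theta> * y)) \<partial>K) \<noteq> \<infinity>" by (simp add: K_transform[OF \<theta>])
    let ?e = "\<lambda>y. ennreal (exp (\<theta> * y))"
    have "(\<integral>\<^sup>+y. ?e y \<partial>K) + (\<integral>\<^sup>+y. ennreal (f1 y) * ?e y \<partial>lborel) = (\<integral>\<^sup>+y. ennreal (f2 y) * ?e y \<partial>lborel)"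
      by (rule sum_integral) measurable
    also have "\<dots> = (\<integral>\<^sup>+y. ennreal (r_bar \<Phi> W a x y) * ?e y + ennreal (f1 y) * ?e y \<partial>lborel)"
    proof (rule nn_integral_cong_AE)
      show "AE y in lborel. ennreal (f2 y) * ?e y = ennreal (r_bar \<Phi> W a x y) * ?e y + ennreal (f1 y) * ?e y"
        using nonneg
      proof eventually_elim
        case (elim y)
        have "ennreal (f2 y) = ennreal (r_bar \<Phi> W a x y) + ennreal (f1 y)"
          using elim f_nonneg[of y] by (simp add: r ennreal_plus[symmetric] del: ennreal_plus)
        then show ?case by (simp add: distrib_right)
      qed
    qed
    also have "\<dots> = (\<integral>\<^sup>+y. ennreal (r_bar \<Phi> W a x y) * ?e y \<partial>lborel) + (\<integral>\<^sup>+y. ennreal (f1 y) * ?e y \<partial>lborel)"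
      by (rule nn_integral_add) measurable
    finally have "(\<integral>\<^sup>+y. ?e y \<partial>K) = (\<integral>\<^sup>+y. ennreal (r_bar \<Phi> W a x y) * ?e y \<partial>lborel)"
      unfolding f1_transform[OF \<theta>] by simp
    then show "(\<integral>\<^sup>+y. ?e y \<partial>K) = (\<integral>\<^sup>+y. ?e y \<partial>?R)" by (simp add: nn_integral_density)
  qed
  fix \<theta> assume \<theta>: "\<Phi> < \<theta>"
  have "(\<integral>\<^sup>+y. ennreal (r_bar \<Phi> W a x y) * ennreal (exp (\<theta> * y)) \<partial>lborel) = (\<integral>\<^sup>+y. ennreal (exp (\<theta> * y)) \<partial>K)"
    unfolding K_density by (simp add: nn_integral_density)
  then show "(\<integral>\<^sup>+y. ennreal (r_bar \<Phi> W a x y) * ennreal (exp (\<theta> * y)) \<partial>lborel) =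
       ennreal ((exp (- \<Phi> * (a - x)) * exp (\<theta> * a) - exp (\<theta> * x)) / (\<psi> \<theta> - q))"
    unfolding K_transform[OF \<theta>] c .
  show "0 \<le> exp (- \<Phi> * (a - x)) * exp (\<theta> * a) - exp (\<theta> * x)" using K_nonneg[OF \<theta>] unfolding c .
qed

text \<open>The constant is found at \<open>\<theta> = \<Phi>\<close> as before. Substituted back,
  and after division by \<open>\<psi> \<theta> - q\<close>, the transform of \<open>L\<close>
  becomes that of \<open>r_bar\<close> started at \<open>x\<close> plus \<open>lam\<close> times the
  mixture of those started at the reset positions \<open>p * z\<close>.\<close>

lemma occupation_equation:
  assumes L: "finite_measure L" "sets L = sets borel" "AE y in L. y \<le> a"
    and x: "x \<le> a" and p: "0 < p" and lam: "0 \<le> lam"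
    and transform: "\<And>z \<theta>. z \<le> a \<Longrightarrow> \<Phi> < \<theta> \<Longrightarrow>
      (\<integral>\<^sup>+y. ennreal (r_bar \<Phi> W a z y) * ennreal (exp (\<theta> * y)) \<partial>lborel) =
       ennreal ((exp (- \<Phi> * (a - z)) * exp (\<theta> * a) - exp (\<theta> * z)) / (\<psi> \<theta> - q))"
    and numerator: "\<And>z \<theta>. z \<le> a \<Longrightarrow> \<Phi> < \<theta> \<Longrightarrow> 0 \<le> exp (- \<Phi> * (a - z)) * exp (\<theta> * a) - exp (\<theta> * z)"
    and identity: "\<And>\<theta>. 0 < \<theta> \<Longrightarrow> c * exp (\<theta> * a) = exp (\<theta> * x) + (\<psi> \<theta> - q) * (LINT y|L. exp (\<theta> * y)) +
      lam * (LINT y|L. of_bool (p * y \<le> a) * exp (\<theta> * (p * y)))"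
  shows "c = exp (- \<Phi> * (a - x)) + lam * (LINT y|L. of_bool (p * y \<le> a) * exp (- \<Phi> * (a - p * y)))"
    and "\<And>g. g \<in> borel_measurable borel \<Longrightarrow> (\<integral>\<^sup>+y. g y \<partial>L) = (\<integral>\<^sup>+y. ennreal (r_bar \<Phi> W a x y) * g y \<partial>lborel) +
      ennreal lam * (\<integral>\<^sup>+z. of_bool (p * z \<le> a) * (\<integral>\<^sup>+y. ennreal (r_bar \<Phi> W a (p * z) y) * g y \<partial>lborel) \<partial>L)"
proof -
  interpret L: finite_measure L by fact
  have Lmeas: "h \<in> borel_measurable L" if "h \<in> borel_measurable borel" for h :: "real \<Rightarrow> 'b::topological_space"
    using that L(2) by (simp cong: measurable_cong_sets)
  have bound: "integrable L (\<lambda>y. of_bool (p * y \<le> a) * exp (\<theta> * (p * y)))" if "0 < \<theta>" for \<theta>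
  proof (rule L.integrable_const_bound[where B = "exp (\<theta> * a)"])
    show "AE y in L. norm (of_bool (p * y \<le> a) * exp (\<theta> * (p * y))) \<le> exp (\<theta> * a)"
      using that by (auto simp: of_bool_def)
  qed (rule Lmeas, measurable)
  have exp_eq: "exp (- \<Phi> * (a - z)) = exp (\<Phi> * z) * exp (- (\<Phi> * a))" for z
    by (simp add: exp_add[symmetric] algebra_simps)
  show c: "c = exp (- \<Phi> * (a - x)) + lam * (LINT y|L. of_bool (p * y \<le> a) * exp (- \<Phi> * (a - p * y)))"
  proof -
    have "c * exp (\<Phi> * a) = exp (\<Phi> * x) + lam * (LINT y|L. of_bool (p * y \<le> a) * exp (\<Phi> * (p * y)))"
      using identity[OF Phi_pos] psi_Phi by simp
    then have "c * (exp (\<Phi> * a) * exp (- (\<Phi> * a))) =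
      (exp (\<Phi> * x) + lam * (LINT y|L. of_bool (p * y \<le> a) * exp (\<Phi> * (p * y)))) * exp (- (\<Phi> * a))"
      by (simp add: mult.assoc[symmetric])
    also have "exp (\<Phi> * a) * exp (- (\<Phi> * a)) = 1" by (simp add: exp_minus)
    also have "(LINT y|L. of_bool (p * y \<le> a) * exp (- \<Phi> * (a - p * y))) =
      (LINT y|L. of_bool (p * y \<le> a) * exp (\<Phi> * (p * y))) * exp (- (\<Phi> * a))"
      unfolding exp_eq by (simp add: mult.assoc[symmetric])
    ultimately show ?thesis unfolding exp_eq[of x] by (simp add: distrib_right mult.assoc)
  qed
  \<comment> \<open>The candidate density of \<open>L\<close>: the path before any reset, and the
    restarts from all reset positions not above \<open>a\<close>.\<close>
  define k where "k y = ennreal (r_bar \<Phi> W a x y) + ennreal lam * (\<integral>\<^sup>+z. of_bool (p * z \<le> a) * ennreal (r_bar \<Phi> W a (p * z) y) \<partial>L)" for y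
  have [measurable_cong]: "sets L = sets borel" by fact
  have r_meas: "(\<lambda>w. r_bar \<Phi> W a (f w) (g w)) \<in> borel_measurable Q"
    if "f \<in> borel_measurable Q" "g \<in> borel_measurable Q" for f g and Q :: "'b measure"
    using measurable_compose[OF measurable_Pair[OF that] r_bar_measurable] by simp
  note [measurable] = r_meas
  have inner: "(\<lambda>y. \<integral>\<^sup>+z. of_bool (p * z \<le> a) * ennreal (r_bar \<Phi> W a (p * z) y) \<partial>L) \<in> borel_measurable borel"
    by measurable
  then have k_meas [measurable]: "k \<in> borel_measurable borel" unfolding k_def by measurable
  have k_integral: "(\<integral>\<^sup>+y. k y * g y \<partial>lborel) = (\<integral>\<^sup>+y. ennreal (r_bar \<Phi> W a x y) * g y \<partial>lborel) +
      ennreal lam * (\<integral>\<^sup>+z. of_bool (p * z \<le> a) * (\<integral>\<^sup>+y. ennreal (r_bar \<Phi> W a (p * z) y) * g y \<partial>lborel) \<partial>L)"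
    if g [measurable]: "g \<in> borel_measurable borel" for g
  proof -
    interpret pair_sigma_finite L lborel
      unfolding pair_sigma_finite_def using L.sigma_finite_measure_axioms lborel.sigma_finite_measure_axioms by blast
    note [measurable] = inner
    have "(\<integral>\<^sup>+y. k y * g y \<partial>lborel) = (\<integral>\<^sup>+y. ennreal (r_bar \<Phi> W a x y) * g y +
      ennreal lam * (\<integral>\<^sup>+z. of_bool (p * z \<le> a) * ennreal (r_bar \<Phi> W a (p * z) y) * g y \<partial>L) \<partial>lborel)"
      by (intro nn_integral_cong) (simp add: k_def distrib_right nn_integral_multc mult.assoc[of "ennreal lam"])
    also have "\<dots> = (\<integral>\<^sup>+y. ennreal (r_bar \<Phi> W a x y) * g y \<partial>lborel) +
      ennreal lam * (\<integral>\<^sup>+y. \<integral>\<^sup>+z. of_bool (p * z \<le> a) * ennreal (r_bar \<Phi> W a (p * z) y) * g y \<partial>L \<partial>lborel)"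
      by (subst nn_integral_add, measurable) (subst nn_integral_cmult, measurable)
    also have "(\<integral>\<^sup>+y. \<integral>\<^sup>+z. of_bool (p * z \<le> a) * ennreal (r_bar \<Phi> W a (p * z) y) * g y \<partial>L \<partial>lborel) =
      (\<integral>\<^sup>+z. \<integral>\<^sup>+y. of_bool (p * z \<le> a) * ennreal (r_bar \<Phi> W a (p * z) y) * g y \<partial>lborel \<partial>L)"
      by (rule Fubini') measurable
    also have "\<dots> = (\<integral>\<^sup>+z. of_bool (p * z \<le> a) * (\<integral>\<^sup>+y. ennreal (r_bar \<Phi> W a (p * z) y) * g y \<partial>lborel) \<partial>L)"
      by (intro nn_integral_cong) (simp add: nn_integral_cmult mult.assoc)
    finally show ?thesis .
  qed
  have "L = density lborel k"
  proof (rule laplace_transform_unique_tilted)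
    show "sets L = sets borel" "AE y in L. y \<le> a" by fact+
    show "sets (density lborel k) = sets borel" by simp
    have "k y = 0" if "a < y" for y
    proof -
      have zero: "(\<lambda>z. of_bool (p * z \<le> a) * ennreal (r_bar \<Phi> W a (p * z) y)) = (\<lambda>_. 0)"
      proof
        fix z show "of_bool (p * z \<le> a) * ennreal (r_bar \<Phi> W a (p * z) y) = 0"
          using r_bar_above[of "p * z" a y] that by (cases "p * z \<le> a") auto
      qed
      show ?thesis unfolding k_def zero using r_bar_above[OF x that] by simp
    qed
    then show "AE y in density lborel k. y \<le> a"
      by (subst AE_density) (auto intro!: AE_I2 leI)
    fix \<theta> assume \<theta>: "\<Phi> < \<theta>"
    then have pos: "0 < \<theta>" using Phi_pos by simp
    note gt = psi_gt[OF \<theta>]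
    \<comment> \<open>The numerator of the transform of \<open>r_bar\<close> started at
      \<open>z\<close>; inserting the formula for \<open>c\<close> makes the identity linear in
      these numerators.\<close>
    let ?N = "\<lambda>z. exp (- \<Phi> * (a - z)) * exp (\<theta> * a) - exp (\<theta> * z)"
    have int: "integrable L (\<lambda>y. exp (\<theta> * y))"
    proof (rule L.integrable_const_bound[where B = "exp (\<theta> * a)"])
      show "AE y in L. norm (exp (\<theta> * y)) \<le> exp (\<theta> * a)" using L(3) by eventually_elim (use pos in simp)
    qed (rule Lmeas, measurable)
    then have L_transform: "(\<integral>\<^sup>+y. ennreal (exp (\<theta> * y)) \<partial>L) = ennreal (LINT y|L. exp (\<theta> * y))"
      by (rule nn_integral_eq_integral) simp
    then show "(\<integral>\<^sup>+y. ennreal (exp (\<theta> * y)) \<partial>L) \<noteq> \<infinity>" by simp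
    have b1: "integrable L (\<lambda>y. of_bool (p * y \<le> a) * exp (\<theta> * (p * y)))" by (rule bound[OF pos])
    have b2: "integrable L (\<lambda>y. of_bool (p * y \<le> a) * exp (- \<Phi> * (a - p * y)))"
      using integrable_mult_left[OF bound[OF Phi_pos], of "exp (- (\<Phi> * a))"]
      unfolding exp_eq by (simp add: mult.assoc)
    have N_eq: "of_bool (p * y \<le> a) * ?N (p * y) =
      (of_bool (p * y \<le> a) * exp (- \<Phi> * (a - p * y))) * exp (\<theta> * a) - of_bool (p * y \<le> a) * exp (\<theta> * (p * y))" for y
      by (simp add: algebra_simps)
    have N_int: "integrable L (\<lambda>y. of_bool (p * y \<le> a) * ?N (p * y))"
      unfolding N_eq using b1 b2 by (intro Bochner_Integration.integrable_diff integrable_mult_left)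
    have N_val: "(LINT y|L. of_bool (p * y \<le> a) * ?N (p * y)) =
      (LINT y|L. of_bool (p * y \<le> a) * exp (- \<Phi> * (a - p * y))) * exp (\<theta> * a) - (LINT y|L. of_bool (p * y \<le> a) * exp (\<theta> * (p * y)))"
      unfolding N_eq using b1 b2 by (subst Bochner_Integration.integral_diff) auto
    have N_nonneg: "0 \<le> of_bool (p * y \<le> a) * ?N (p * y)" for y
      using numerator[OF _ \<theta>, of "p * y"] by (cases "p * y \<le> a") auto
    have solve: "A * I = n + l * J \<Longrightarrow> I = n / A + l * (J / A)" if "0 < A" for A I n l J :: real
      using that by (simp add: field_simps)
    have "(\<psi> \<theta> - q) * (LINT y|L. exp (\<theta> * y)) = ?N x + lam * (LINT y|L. of_bool (p * y \<le> a) * ?N (p * y))"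
      unfolding N_val using identity[OF pos] unfolding c by (simp add: algebra_simps)
    then have val: "(LINT y|L. exp (\<theta> * y)) = ?N x / (\<psi> \<theta> - q) + lam * ((LINT y|L. of_bool (p * y \<le> a) * ?N (p * y)) / (\<psi> \<theta> - q))"
      by (rule solve[OF gt])
    have J: "(\<integral>\<^sup>+z. of_bool (p * z \<le> a) * (\<integral>\<^sup>+y. ennreal (r_bar \<Phi> W a (p * z) y) * ennreal (exp (\<theta> * y)) \<partial>lborel) \<partial>L) =
      ennreal ((LINT y|L. of_bool (p * y \<le> a) * ?N (p * y)) / (\<psi> \<theta> - q))"
    proof -
      have "of_bool (p * z \<le> a) * (\<integral>\<^sup>+y. ennreal (r_bar \<Phi> W a (p * z) y) * ennreal (exp (\<theta> * y)) \<partial>lborel) =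
        ennreal (of_bool (p * z \<le> a) * ?N (p * z) / (\<psi> \<theta> - q))" for z
        using transform[OF _ \<theta>, of "p * z"] by (cases "p * z \<le> a") auto
      then have "(\<integral>\<^sup>+z. of_bool (p * z \<le> a) * (\<integral>\<^sup>+y. ennreal (r_bar \<Phi> W a (p * z) y) * ennreal (exp (\<theta> * y)) \<partial>lborel) \<partial>L) =
        (\<integral>\<^sup>+z. ennreal (of_bool (p * z \<le> a) * ?N (p * z) / (\<psi> \<theta> - q)) \<partial>L)" by (rule nn_integral_cong)
      also have "\<dots> = ennreal (LINT z|L. of_bool (p * z \<le> a) * ?N (p * z) / (\<psi> \<theta> - q))"
        using N_int gt by (intro nn_integral_eq_integral AE_I2 divide_nonneg_pos N_nonneg) auto
      finally show ?thesis by simp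
    qed
    have N0: "0 \<le> (LINT y|L. of_bool (p * y \<le> a) * ?N (p * y))"
      by (rule integral_nonneg_AE) (use N_nonneg in blast)
    have "(\<integral>\<^sup>+y. ennreal (exp (\<theta> * y)) \<partial>density lborel k) = (\<integral>\<^sup>+y. k y * ennreal (exp (\<theta> * y)) \<partial>lborel)"
      by (rule nn_integral_density) measurable
    also have "\<dots> = ennreal (?N x / (\<psi> \<theta> - q)) + ennreal lam * ennreal ((LINT y|L. of_bool (p * y \<le> a) * ?N (p * y)) / (\<psi> \<theta> - q))"
      by (subst k_integral) (simp_all only: transform[OF x \<theta>] J borel_measurable_exp measurable_const, measurable)
    also have "\<dots> = ennreal (?N x / (\<psi> \<theta> - q) + lam * ((LINT y|L. of_bool (p * y \<le> a) * ?N (p * y)) / (\<psi> \<theta> - q)))"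
    proof (subst ennreal_plus)
      show "0 \<le> ?N x / (\<psi> \<theta> - q)" using numerator[OF x \<theta>] gt by (intro divide_nonneg_pos)
      show "0 \<le> lam * ((LINT y|L. of_bool (p * y \<le> a) * ?N (p * y)) / (\<psi> \<theta> - q))"
        using N0 gt lam by (intro mult_nonneg_nonneg divide_nonneg_pos)
    qed (use lam N0 gt in \<open>subst ennreal_mult; simp\<close>)
    also have "\<dots> = ennreal (LINT y|L. exp (\<theta> * y))" by (simp only: val)
    also have "\<dots> = (\<integral>\<^sup>+y. ennreal (exp (\<theta> * y)) \<partial>L)" by (rule L_transform[symmetric])
    finally show "(\<integral>\<^sup>+y. ennreal (exp (\<theta> * y)) \<partial>L) = (\<integral>\<^sup>+y. ennreal (exp (\<theta> * y)) \<partial>density lborel k)"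
      by (rule sym)
  qed
  moreover have "(\<integral>\<^sup>+y. g y \<partial>density lborel k) = (\<integral>\<^sup>+y. k y * g y \<partial>lborel)" if "g \<in> borel_measurable borel" for g
    by (rule nn_integral_density) (use that in measurable)
  ultimately show "(\<integral>\<^sup>+y. g y \<partial>L) = (\<integral>\<^sup>+y. ennreal (r_bar \<Phi> W a x y) * g y \<partial>lborel) +
      ennreal lam * (\<integral>\<^sup>+z. of_bool (p * z \<le> a) * (\<integral>\<^sup>+y. ennreal (r_bar \<Phi> W a (p * z) y) * g y \<partial>lborel) \<partial>L)"
    if "g \<in> borel_measurable borel" for g
    using k_integral[OF that] that by (simp only:)
qed

end

section \<open>The process without resetting\<close>

context independent_levy_poisson
begin

lemma X_adapted:
  assumes "0 \<le> t"
  shows "X t \<in> borel_measurable (filt t)"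
proof (rule measurableI)
  fix A :: "real set" assume "A \<in> sets borel"
  then have "X t -` A \<inter> space P \<in> {X s -` A \<inter> space P |s A. 0 \<le> s \<and> s \<le> t \<and> A \<in> sets borel}"
    unfolding mem_Collect_eq by (intro exI[of _ t] exI[of _ A] conjI refl assms order_refl)
  then show "X t -` A \<inter> space (filt t) \<in> sets (filt t)"
    unfolding space_filt unfolding filt_def by (intro in_measure_of[OF filt_gen_space] UnI1)
qed simp

lemma null_sets_filt: "Z \<in> null_sets P \<Longrightarrow> Z \<in> sets (filt t)"
  unfolding filt_def by (intro in_measure_of[OF filt_gen_space] UnI2)

text \<open>The filtration contains all null sets from time 0 on, so replacing exceptional paths by
  constants preserves adaptedness.\<close>

lemma modification_adapted:
  fixes f :: "'a \<Rightarrow> real"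
  assumes "Z \<in> null_sets P" and f: "f \<in> borel_measurable (filt t)"
  shows "(\<lambda>\<omega>. if \<omega> \<in> Z then c else f \<omega>) \<in> borel_measurable (filt t)"
proof (rule measurable_If_set)
  have "Z \<subseteq> space P" using assms(1) by (auto dest: sets.sets_into_space null_setsD2)
  then show "Z \<inter> space (filt t) \<in> sets (filt t)"
    using null_sets_filt[OF assms(1)] by (simp add: Int_absorb2)
qed (use f in auto)

text \<open>Makes the unreset process an instance of the general one, with the zero process as a
  Poisson process of intensity 0; independence is inherited by composing the second path with a
  constant map.\<close>

lemma independent_levy_zero: "independent_levy_poisson P X 0 (\<lambda>_ _. 0)"
proof -
  have "poisson_process P 0 (\<lambda>_ _. 0)"
  proof unfold_locales
    fix n :: nat and t :: "nat \<Rightarrow> real"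
    assume t: "mono t" "t 0 \<ge> 0"
    from X.independent_increments[OF this, of n]
    show "X.indep_vars (\<lambda>_. borel) (\<lambda>i \<omega>. 0 - 0 :: real) {..<n}"
      by (rule X.indep_vars_compose2[where Y = "\<lambda>_ _. 0 - 0 :: real"]) simp
  next
    fix t :: real and k :: nat
    show "prob {\<omega> \<in> space P. 0 = real k} = (0 * t) ^ k / fact k * exp (- (0 * t))"
      \<comment> \<open>For \<open>k = 0\<close> the convention \<open>0 ^ 0 = 1\<close> gives the
        weight 1.\<close>
      by (cases k) (auto simp: X.prob_space)
  qed (auto intro: cadlag_const)
  moreover have "independent_processes P X (\<lambda>_ _. 0)"
  proof -
    have "X.indep_var (Pi\<^sub>M {0..} (\<lambda>_. borel)) ((\<lambda>f. f) \<circ> (\<lambda>\<omega>. \<lambda>t\<in>{0..}. X t \<omega>))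
       (Pi\<^sub>M {0..} (\<lambda>_. borel)) ((\<lambda>_. \<lambda>t\<in>{0..}. 0 :: real) \<circ> (\<lambda>\<omega>. \<lambda>t\<in>{0..}. N t \<omega>))"
      using indep unfolding independent_processes_def
      by (rule X.indep_var_compose) (auto intro!: measurable_const simp: space_PiM)
    then show ?thesis unfolding independent_processes_def by (simp add: comp_def)
  qed
  ultimately show ?thesis
    by (intro independent_levy_poisson.intro independent_levy_poisson_axioms.intro X.spectrally_negative_levy_process_axioms)
qed

lemma predictable_integral_zero:
  assumes "0 \<le> t" shows "predictable_integral u (\<lambda>_. 0) t = 0"
proof -
  interpret counting_path "\<lambda>_. 0" by unfold_locales auto
  have "{0<..t} \<in> null_sets (interval_measure (\<lambda>s. 0))"
    using emeasure_Ioc[of 0 t] assms by (auto simp: null_sets_def)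
  then have "AE s in interval_measure (\<lambda>s. 0). indicator {0<..t} s *\<^sub>R left_lim u s = 0"
    by (rule AE_mp[OF AE_not_in]) (auto intro!: AE_I2)
  then show ?thesis
    unfolding predictable_integral_def set_lebesgue_integral_def by (rule integral_eq_zero_AE)
qed

text \<open>The solution is \<open>x + X\<close>, since the integral against the zero process
  vanishes; on a null set it is replaced by the constant path \<open>x\<close> to remove exceptional
  paths.\<close>

lemma killed_process:
  assumes "0 < p" "p < 1" "0 < q" "x \<le> a"
  obtains V where "resetting P X 0 (\<lambda>_ _. 0) V p q x a"
proof -
  interpret Z: independent_levy_poisson P X 0 "\<lambda>_ _. 0" by (rule independent_levy_zero)
  have "AE \<omega> in P. cadlag (\<lambda>t. X t \<omega>) \<and> X 0 \<omega> = 0"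
    using X.cadlag_paths X.start by eventually_elim simp
  then obtain B where B: "{\<omega> \<in> space P. \<not> (cadlag (\<lambda>t. X t \<omega>) \<and> X 0 \<omega> = 0)} \<subseteq> B" "emeasure P B = 0" "B \<in> sets P"
    by (rule AE_E)
  then have null: "B \<in> null_sets P" by auto
  have good: "cadlag (\<lambda>t. X t \<omega>)" "X 0 \<omega> = 0" if "\<omega> \<in> space P" "\<omega> \<notin> B" for \<omega>
    using that B(1) by blast+
  define V where "V t \<omega> = (if \<omega> \<in> B then x else x + X t \<omega>)" for t \<omega>
  have "resetting P X 0 (\<lambda>_ _. 0) V p q x a"
  proof unfold_locales
    fix t :: real assume "0 \<le> t"
    then have [measurable]: "X t \<in> borel_measurable (Z.filt t)" by (rule Z.X_adapted)
    have "(\<lambda>\<omega>. x + X t \<omega>) \<in> borel_measurable (Z.filt t)" by measurable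
    then show "V t \<in> borel_measurable (Z.filt t)" unfolding V_def by (rule Z.modification_adapted[OF null])
  next
    fix \<omega> assume \<omega>: "\<omega> \<in> space P"
    show "V 0 \<omega> = x" using good[OF \<omega>] by (auto simp: V_def)
    show "cadlag (\<lambda>t. V t \<omega>)"
    proof (cases "\<omega> \<in> B")
      case True
      then show ?thesis by (simp add: V_def cadlag_const)
    next
      case False
      from good(1)[OF \<omega> False] have "cadlag (\<lambda>t. x + X t \<omega>)"
        unfolding cadlag_def
      proof (elim conjE, intro conjI allI impI)
        fix t :: real assume "\<forall>t\<ge>0. continuous (at_right t) (\<lambda>t. X t \<omega>)" "0 \<le> t"
        then show "continuous (at_right t) (\<lambda>t. x + X t \<omega>)" by (intro continuous_add continuous_const) simp
      next
        fix t :: real assume "\<forall>t>0. \<exists>l. ((\<lambda>t. X t \<omega>) \<longlongrightarrow> l) (at_left t)" "0 < t"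
        then obtain l where "((\<lambda>t. X t \<omega>) \<longlongrightarrow> l) (at_left t)" by blast
        from tendsto_add[OF tendsto_const this] show "\<exists>l. ((\<lambda>t. x + X t \<omega>) \<longlongrightarrow> l) (at_left t)" by (rule exI)
      qed
      then show ?thesis using False by (simp add: V_def)
    qed
  next
    show "AE \<omega> in P. \<forall>t\<ge>0. V t \<omega> = x + X t \<omega> - (1 - p) * predictable_integral (\<lambda>s. V s \<omega>) (\<lambda>s. 0) t"
      using AE_not_in[OF null] by eventually_elim (simp add: V_def predictable_integral_zero)
  qed (use assms in auto)
  then show thesis by (rule that)
qed

end

section \<open>The exit transform as a series\<close>

context resetting
begin

text \<open>Dynkin's formula and the series are joined here: the unreset process with discount
  \<open>q + lam\<close> supplies the kernel properties, the reset process supplies the equation for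
  its occupation measure, and \<open>V_bar_integral\<close> translates the two terms of the exit
  transform.\<close>

theorem exit_transform_series:
  fixes W :: "real \<Rightarrow> real" and \<Phi> :: real
  assumes W: "is_scale_function X.\<psi> (q + lam) W" and \<Phi>: "\<Phi> = right_inverse X.\<psi> (q + lam)"
  shows "(LINT \<omega>|P. exit_value (\<lambda>_. 1) \<omega>) = exp (- \<Phi> * (a - x))
      + (LBINT y:{..min a (a / p)}. V_bar p a lam (r_bar \<Phi> W a) x y * exp (- \<Phi> * (a - p * y)))
      + indicator {..0} a * (LBINT y:{a / p..a}. V_bar p a lam (r_bar \<Phi> W a) x y)"
proof -
  have lam: "0 \<le> lam" by (rule N.intensity_nonneg)
  have Q: "0 < q + lam" using q lam by simp
  interpret S: scale_function X.\<psi> "q + lam" \<Phi> W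
    using W \<Phi> X.right_inverse_laplace_exponent[OF Q] by unfold_locales auto
  let ?r = "r_bar \<Phi> W a"
  \<comment> \<open>All starting points \<open>z \<le> a\<close> are treated, because the kernel is
    later evaluated at every reset position. Resets absorb rate \<open>lam\<close>, hence the
    discount \<open>q + lam\<close>.\<close>
  have killed: "(AE y in lborel. 0 \<le> ?r z y) \<and> (\<integral>\<^sup>+y. ennreal (?r z y) \<partial>lborel) \<le> ennreal (1 / (q + lam)) \<and>
    (\<forall>\<theta>>\<Phi>. (\<integral>\<^sup>+y. ennreal (?r z y) * ennreal (exp (\<theta> * y)) \<partial>lborel) =
       ennreal ((exp (- \<Phi> * (a - z)) * exp (\<theta> * a) - exp (\<theta> * z)) / (X.\<psi> \<theta> - (q + lam))) \<and>
      0 \<le> exp (- \<Phi> * (a - z)) * exp (\<theta> * a) - exp (\<theta> * z))" if z: "z \<le> a" for z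
  proof -
    obtain V where "resetting P X 0 (\<lambda>_ _. 0) V p (q + lam) z a" by (rule killed_process[OF p Q z])
    then interpret V: resetting P X 0 "\<lambda>_ _. 0" V p "q + lam" z a .
    have identity: "V.creep * exp (\<theta> * a) = exp (\<theta> * z) + (X.\<psi> \<theta> - (q + lam)) * (LINT y|V.occ_meas. exp (\<theta> * y))"
      if "0 < \<theta>" for \<theta>
      using V.creep_identity[OF that] by simp
    have density: "AE y in lborel. 0 \<le> ?r z y" "V.occ_meas = density lborel (\<lambda>y. ennreal (?r z y))"
      "(\<integral>\<^sup>+y. ennreal (?r z y) * ennreal (exp (\<theta> * y)) \<partial>lborel) =
         ennreal ((exp (- \<Phi> * (a - z)) * exp (\<theta> * a) - exp (\<theta> * z)) / (X.\<psi> \<theta> - (q + lam)))"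
      "0 \<le> exp (- \<Phi> * (a - z)) * exp (\<theta> * a) - exp (\<theta> * z)" if "\<Phi> < \<theta>" for \<theta>
      by (rule S.killed_occupation_density[OF V.finite_occ_meas V.sets_occ_meas V.AE_occ_meas_le z]; fact identity that)+
    have [measurable]: "?r z \<in> borel_measurable borel"
      unfolding r_bar_def by measurable
    have "(\<integral>\<^sup>+y. ennreal (?r z y) \<partial>lborel) = emeasure (density lborel (\<lambda>y. ennreal (?r z y))) UNIV"
      by (subst emeasure_density) auto
    also have "\<dots> = emeasure V.occ_meas (space V.occ_meas)"
      using density(2)[of "\<Phi> + 1"] sets_eq_imp_space_eq[OF V.sets_occ_meas] by simp
    also have "\<dots> \<le> ennreal (1 / (q + lam))" by (rule V.emeasure_occ_meas_le)
    finally have "(\<integral>\<^sup>+y. ennreal (?r z y) \<partial>lborel) \<le> ennreal (1 / (q + lam))" .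
    then show ?thesis using density[of "\<Phi> + 1"] density(3,4) by simp
  qed
  have identity: "creep * exp (\<theta> * a) = exp (\<theta> * x) + (X.\<psi> \<theta> - (q + lam)) * (LINT y|occ_meas. exp (\<theta> * y)) +
      lam * (LINT y|occ_meas. of_bool (p * y \<le> a) * exp (\<theta> * (p * y)))" if "0 < \<theta>" for \<theta>
    using creep_identity[OF that] by (simp add: algebra_simps)
  have r_nonneg: "AE y in lborel. 0 \<le> ?r z y" if "z \<le> a" for z
    by (rule killed[OF that, THEN conjunct1])
  have r_mass: "(\<integral>\<^sup>+y. ennreal (?r z y) \<partial>lborel) \<le> ennreal (1 / (q + lam))" if "z \<le> a" for z
    by (rule killed[OF that, THEN conjunct2, THEN conjunct1])
  have transform: "(\<integral>\<^sup>+y. ennreal (?r z y) * ennreal (exp (\<theta> * y)) \<partial>lborel) =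
       ennreal ((exp (- \<Phi> * (a - z)) * exp (\<theta> * a) - exp (\<theta> * z)) / (X.\<psi> \<theta> - (q + lam))) \<and>
    0 \<le> exp (- \<Phi> * (a - z)) * exp (\<theta> * a) - exp (\<theta> * z)" if "z \<le> a" "\<Phi> < \<theta>" for z \<theta>
    by (rule killed[OF that(1), THEN conjunct2, THEN conjunct2, THEN spec, THEN mp]) (rule that(2))
  note r_transform = conjunct1[OF transform] and r_numerator = conjunct2[OF transform]
  have creep: "creep = exp (- \<Phi> * (a - x)) + lam * (LINT y|occ_meas. of_bool (p * y \<le> a) * exp (- \<Phi> * (a - p * y)))"
    by (rule S.occupation_equation(1)[OF finite_occ_meas sets_occ_meas AE_occ_meas_le x_le_a p(1) lam];
      fact r_transform r_numerator identity)
  have occ: "(\<integral>\<^sup>+y. g y \<partial>occ_meas) = (\<integral>\<^sup>+y. ennreal (?r x y) * g y \<partial>lborel) +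
      ennreal lam * (\<integral>\<^sup>+z. of_bool (p * z \<le> a) * (\<integral>\<^sup>+y. ennreal (?r (p * z) y) * g y \<partial>lborel) \<partial>occ_meas)"
    if "g \<in> borel_measurable borel" for g
    by (rule S.occupation_equation(2)[OF finite_occ_meas sets_occ_meas AE_occ_meas_le x_le_a p(1) lam];
      fact r_transform r_numerator identity that)
  interpret R: resolvent_kernel ?r p a lam "1 / (q + lam)" x occ_meas
  proof (rule resolvent_kernel.intro)
    show "0 < p" "x \<le> a" "0 \<le> lam" by (fact p(1) x_le_a lam)+
    \<comment> \<open>The mass bound is the total discounted lifetime; strict contraction comes from
      \<open>q > 0\<close>.\<close>
    show "0 \<le> 1 / (q + lam)" "lam * (1 / (q + lam)) < 1" using q lam by simp_all
    show "finite_measure occ_meas" by (rule finite_occ_meas)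
    show "sets occ_meas = sets borel" by (rule sets_occ_meas)
    show "AE y in occ_meas. y \<le> a" by (rule AE_occ_meas_le)
    show "case_prod ?r \<in> borel_measurable (borel \<Otimes>\<^sub>M borel)" by (rule S.r_bar_measurable)
    show "AE y in lborel. 0 \<le> ?r z y" if "z \<le> a" for z by (rule r_nonneg[OF that])
    show "(\<integral>\<^sup>+y. ennreal (?r z y) \<partial>lborel) \<le> ennreal (1 / (q + lam))" if "z \<le> a" for z by (rule r_mass[OF that])
    show "(\<integral>\<^sup>+y. g y \<partial>occ_meas) = (\<integral>\<^sup>+y. ennreal (?r x y) * g y \<partial>lborel) +
      ennreal lam * (\<integral>\<^sup>+z. of_bool (p * z \<le> a) * (\<integral>\<^sup>+y. ennreal (?r (p * z) y) * g y \<partial>lborel) \<partial>occ_meas)"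
      if "g \<in> borel_measurable borel" for g by (rule occ[OF that])
  qed
  define g1 where "g1 y = of_bool (y \<le> min a (a / p)) * exp (- \<Phi> * (a - p * y))" for y
  define g2 where "g2 y = (of_bool (y \<le> a \<and> a < p * y) :: real)" for y
  have [measurable]: "g1 \<in> borel_measurable borel" "g2 \<in> borel_measurable borel"
    unfolding g1_def g2_def by measurable
  have g1: "0 \<le> g1 y" "g1 y \<le> 1" for y
    using S.Phi_pos R.inside_iff[of y] by (auto simp: g1_def)
  have V1: "(LBINT y:{..min a (a / p)}. V_bar p a lam ?r x y * exp (- \<Phi> * (a - p * y))) =
    lam * (LINT y|occ_meas. of_bool (p * y \<le> a) * exp (- \<Phi> * (a - p * y)))"
  proof -
    have "(LBINT y:{..min a (a / p)}. V_bar p a lam ?r x y * exp (- \<Phi> * (a - p * y))) =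
      (LINT y|lborel. V_bar p a lam ?r x y * g1 y)"
      unfolding set_lebesgue_integral_def
      by (intro Bochner_Integration.integral_cong refl) (simp add: g1_def indicator_def)
    also have "\<dots> = lam * (LINT y|occ_meas. g1 y)" by (rule R.V_bar_integral) (use g1 in auto)
    also have "(LINT y|occ_meas. g1 y) = (LINT y|occ_meas. of_bool (p * y \<le> a) * exp (- \<Phi> * (a - p * y)))"
    proof (rule integral_cong_AE)
      show "AE y in occ_meas. g1 y = of_bool (p * y \<le> a) * exp (- \<Phi> * (a - p * y))"
        using AE_occ_meas_le
      proof eventually_elim
        case (elim y)
        then show ?case unfolding g1_def R.inside_iff by simp
      qed
    qed measurable
    finally show ?thesis .
  qed
  have V2: "indicator {..0} a * (LBINT y:{a / p..a}. V_bar p a lam ?r x y) = lam * (LINT y|occ_meas. of_bool (a < p * y))"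
  proof -
    have "(LINT y|lborel. V_bar p a lam ?r x y * g2 y) = indicator {..0} a * (LBINT y:{a / p..a}. V_bar p a lam ?r x y)"
    proof (cases "a \<le> 0")
      case True
      have "(LINT y|lborel. V_bar p a lam ?r x y * g2 y) = (LBINT y:{a / p..a}. V_bar p a lam ?r x y)"
        unfolding set_lebesgue_integral_def
      proof (rule integral_cong_AE)
        \<comment> \<open>A reset from \<open>y\<close> passes above \<open>a\<close> exactly if
          \<open>y > a / p\<close>; the closed interval of the formula has the additional endpoint
          \<open>a / p\<close>, a null set. For \<open>a = 0\<close> both sets are
          negligible.\<close>
        show "AE y in lborel. V_bar p a lam ?r x y * g2 y = indicator {a / p..a} y *\<^sub>R V_bar p a lam ?r x y"
          using AE_lborel_singleton[of "a / p"]
        proof eventually_elim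
          case (elim y)
          have "a < p * y \<longleftrightarrow> a / p \<le> y" using elim p by (auto simp: field_simps)
          then show ?case by (auto simp: g2_def indicator_def)
        qed
      qed measurable
      then show ?thesis using True by simp
    next
      case False
      have "g2 y = 0" for y
      proof -
        have "p * y \<le> a" if "y \<le> a"
        proof -
          have "p * y \<le> p * a" using that p by (intro mult_left_mono) auto
          also have "\<dots> \<le> 1 * a" using False p by (intro mult_right_mono) auto
          finally show ?thesis by simp
        qed
        then show ?thesis by (auto simp: g2_def)
      qed
      then show ?thesis using False by simp
    qed
    then have "indicator {..0} a * (LBINT y:{a / p..a}. V_bar p a lam ?r x y) = (LINT y|lborel. V_bar p a lam ?r x y * g2 y)"
      by (rule sym)
    also have "\<dots> = lam * (LINT y|occ_meas. g2 y)"
      by (rule R.V_bar_integral[where b = 1]) (auto simp: g2_def)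
    also have "(LINT y|occ_meas. g2 y) = (LINT y|occ_meas. of_bool (a < p * y))"
    proof (rule integral_cong_AE)
      show "AE y in occ_meas. g2 y = of_bool (a < p * y)"
        using AE_occ_meas_le by eventually_elim (simp add: g2_def)
    qed measurable
    finally show ?thesis .
  qed
  show ?thesis using exit_transform(2) unfolding V1 V2 creep by (simp only:)
qed

end

section \<open>From almost sure solutions to exception-free paths\<close>

lemma first_passage_crossing_time:
  assumes "{t. 0 < t \<and> a < f t} \<noteq> {}"
  shows "first_passage a f = ereal (crossing_time a f)"
proof -
  have "bdd_below {t. 0 < t \<and> a < f t}" by (rule bdd_belowI[of _ 0]) auto
  from ereal_Inf'[OF this assms] show ?thesis
    unfolding first_passage_def crossing_time_def by simp
qed

lemma first_passage_infinite: "{t. 0 < t \<and> a < f t} = {} \<Longrightarrow> first_passage a f = \<infinity>"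
  unfolding first_passage_def by (simp only: image_empty Inf_empty top_ereal_def)

text \<open>The integrand of the theorem agrees with a measurable functional only off a null set;
  completeness makes it measurable nevertheless.\<close>

lemma borel_measurable_completion_AE_eq:
  fixes f g :: "'a \<Rightarrow> real"
  assumes g: "g \<in> borel_measurable (completion M)" and eq: "AE \<omega> in completion M. f \<omega> = g \<omega>"
  shows "f \<in> borel_measurable (completion M)"
proof (rule measurableI)
  obtain Z where Z: "{\<omega> \<in> space (completion M). f \<omega> \<noteq> g \<omega>} \<subseteq> Z" "emeasure (completion M) Z = 0" "Z \<in> sets (completion M)"
    using eq by (rule AE_E)
  then have null: "Z \<in> null_sets (completion M)" by auto
  fix A :: "real set" assume A: "A \<in> sets borel"
  have "f -` A \<inter> Z \<inter> space (completion M) \<in> sets (completion M)"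
    by (rule completion.complete[OF _ null]) auto
  moreover have "g -` A \<inter> space (completion M) - Z \<in> sets (completion M)"
    using measurable_sets[OF g A] Z(3) by (rule sets.Diff)
  moreover have "f -` A \<inter> space (completion M) = (f -` A \<inter> Z \<inter> space (completion M)) \<union> (g -` A \<inter> space (completion M) - Z)"
    using Z(1) by auto
  ultimately show "f -` A \<inter> space (completion M) \<in> sets (completion M)" by (simp only: sets.Un)
qed simp

theorem proposition13:
  fixes M :: "'a measure" and X N U :: "real \<Rightarrow> 'a \<Rightarrow> real"
    and W :: "real \<Rightarrow> real" and a p q lam x \<Phi> :: real
    and r :: "real \<Rightarrow> real \<Rightarrow> real"
  assumes "spectrally_negative_levy_process M X"
    and "poisson_process M lam N"
    and "independent_processes M X N"
    and "resetting_solution M X N p x U"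
    and "0 < p" and "p < 1" and "0 < q" and "0 \<le> lam" and "x \<le> a"
    and "is_scale_function (laplace_exponent M X) (q + lam) W"
  defines "\<Phi> \<equiv> right_inverse (laplace_exponent M X) (q + lam)"
  defines "r \<equiv> r_bar \<Phi> W a"
  shows "(LINT \<omega>|completion M.
            exp (- q * real_of_ereal (first_passage a (\<lambda>t. U t \<omega>))) *
            indicator {\<omega>. first_passage a (\<lambda>t. U t \<omega>) < \<infinity>} \<omega>)
    = exp (- \<Phi> * (a - x))
      + (LBINT y:{..min a (a / p)}. V_bar p a lam r x y * exp (- \<Phi> * (a - p * y)))
      + indicator {..0} a * (LBINT y:{a / p..a}. V_bar p a lam r x y)"
proof -
  interpret X0: spectrally_negative_levy_process M X by fact
  let ?P = "completion M"
  interpret I: independent_levy_poisson ?P X lam N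
    by (intro independent_levy_poisson.intro independent_levy_poisson_axioms.intro
      spectrally_negative_levy_process_completion poisson_process_completion
      independent_processes_completion X0.prob_space_axioms assms)
  have \<psi>: "laplace_exponent ?P X = laplace_exponent M X"
    by (rule laplace_exponent_completion) (rule X0.levy_process_axioms)
  have filt: "completed_filtration M X N t = I.filt t" for t
    unfolding completed_filtration_def I.filt_def by simp
  have adapted: "U t \<in> borel_measurable (I.filt t)" if "0 \<le> t" for t
    using assms(4) that unfolding resetting_solution_def filt by blast
  have cadlag: "AE \<omega> in ?P. cadlag (\<lambda>t. U t \<omega>)"
    and sde: "AE \<omega> in ?P. \<forall>t\<ge>0. U t \<omega> = x + X t \<omega> - (1 - p) * predictable_integral (\<lambda>s. U s \<omega>) (\<lambda>s. N s \<omega>) t"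
    using assms(4) unfolding resetting_solution_def by (blast intro: AE_completion)+
  \<comment> \<open>At time 0 the integral runs over the empty interval and \<open>X 0 = 0\<close>
    almost surely, so the equation itself yields the initial value.\<close>
  have "AE \<omega> in ?P. cadlag (\<lambda>t. U t \<omega>) \<and> U 0 \<omega> = x"
    using cadlag sde I.X.start
  proof eventually_elim
    case (elim \<omega>)
    then show ?case by (simp add: predictable_integral_def set_lebesgue_integral_def)
  qed
  then obtain B where B: "{\<omega> \<in> space ?P. \<not> (cadlag (\<lambda>t. U t \<omega>) \<and> U 0 \<omega> = x)} \<subseteq> B" "emeasure ?P B = 0" "B \<in> sets ?P"
    by (rule AE_E)
  then have null: "B \<in> null_sets ?P" by auto
  have good: "cadlag (\<lambda>t. U t \<omega>)" "U 0 \<omega> = x" if "\<omega> \<in> space ?P" "\<omega> \<notin> B" for \<omega>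
    using that B(1) by blast+
  \<comment> \<open>On the exceptional null set the path is replaced by the constant
    \<open>x\<close>, which is cadlag and starts at \<open>x\<close>; the expectation does not
    change.\<close>
  define V where "V t \<omega> = (if \<omega> \<in> B then x else U t \<omega>)" for t \<omega>
  interpret R: resetting ?P X lam N V p q x a
  proof
    fix t :: real assume "0 \<le> t"
    from adapted[OF this] show "V t \<in> borel_measurable (I.filt t)"
      unfolding V_def by (rule I.modification_adapted[OF null])
  next
    fix \<omega> assume \<omega>: "\<omega> \<in> space ?P"
    show "V 0 \<omega> = x" using good[OF \<omega>] by (auto simp: V_def)
    show "cadlag (\<lambda>t. V t \<omega>)"
      using good[OF \<omega>] by (cases "\<omega> \<in> B") (simp_all add: V_def cadlag_const)
  next
    show "AE \<omega> in ?P. \<forall>t\<ge>0. V t \<omega> = x + X t \<omega> - (1 - p) * predictable_integral (\<lambda>s. V s \<omega>) (\<lambda>s. N s \<omega>) t"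
      using AE_not_in[OF null] sde
    proof eventually_elim
      case (elim \<omega>)
      have "(\<lambda>t. V t \<omega>) = (\<lambda>t. U t \<omega>)" using elim(1) by (simp add: V_def)
      from this[THEN fun_cong] this elim(2) show ?case by simp
    qed
  qed (use assms in auto)
  let ?F = "\<lambda>\<omega>. exp (- q * real_of_ereal (first_passage a (\<lambda>t. U t \<omega>))) *
            indicator {\<omega>. first_passage a (\<lambda>t. U t \<omega>) < \<infinity>} \<omega>"
  have eq: "AE \<omega> in ?P. ?F \<omega> = R.exit_value (\<lambda>_. 1) \<omega>"
    using AE_not_in[OF null]
  proof eventually_elim
    case (elim \<omega>)
    then have V: "V t \<omega> = U t \<omega>" for t by (simp add: V_def)
    show ?case
    proof (cases "{t. 0 < t \<and> a < U t \<omega>} = {}")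
      case True
      then show ?thesis
        using first_passage_infinite[OF True] by (simp add: R.exit_value_def R.crossed_def V)
    next
      case False
      then show ?thesis
        using first_passage_crossing_time[OF False] by (simp add: R.exit_value_def R.crossed_def V)
    qed
  qed
  have "(LINT \<omega>|?P. ?F \<omega>) = (LINT \<omega>|?P. R.exit_value (\<lambda>_. 1) \<omega>)"
    by (rule integral_cong_AE[OF borel_measurable_completion_AE_eq[OF R.exit_transform(1) eq] R.exit_transform(1) eq])
  also have "\<dots> = exp (- \<Phi> * (a - x))
      + (LBINT y:{..min a (a / p)}. V_bar p a lam r x y * exp (- \<Phi> * (a - p * y)))
      + indicator {..0} a * (LBINT y:{a / p..a}. V_bar p a lam r x y)"
    unfolding r_def by (rule R.exit_transform_series) (use assms in \<open>simp_all add: \<psi>\<close>)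
  finally show ?thesis .
qed

end
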